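(* Let $\mathcal A$ be a unital C$^*$-algebra generated by self-adjoint elements $x_1,\ldots,x_n$. The following are equivalent: (1) $\mathcal A$ is an MF algebra. (2) $\mathcal A$ has the approximation property. (3) There are positive integers $m_k$ and self-adjoint matrices $A_1^{(k)},\ldots,A_n^{(k)}\in\mathcal M_{m_k}(\mathbb C)$, $k=1,2,\ldots$, such that $\lim_{k\to\infty}\|P(A_1^{(k)},\ldots,A_n^{(k)})\|=\|P(x_1,\ldots,x_n)\|$ for every noncommutative polynomial $P\in\mathbb C\langle X_1,\ldots,X_n\rangle$. (4) For every faithful $*$-representation $\pi:\mathcal A\to B(\mathcal H)$ on an infinite dimensional separable complex Hilbert space $\mathcal H$, there are positive integers $m_k$, self-adjoint matrices $A_1^{(k)},\ldots,A_n^{(k)}\in\mathcal M_{m_k}(\mathbb C)$ and unitary operators $U_k:\mathcal H\to(\mathbb C^{m_k})^\infty$, $k=1,2,\ldots$, such that (a) $\lim_{k\to\infty}\|P(A_1^{(k)},\ldots,A_n^{(k)})\|=\|P(x_1,\ldots,x_n)\|$ for every $P\in\mathbb C\langle X_1,\ldots,X_n\rangle$, and (b) $U_k^*(A_i^{(k)})^\infty U_k\to\pi(x_i)$ in the $*$-strong operator topology as $k\to\infty$, for $1\le i\le n$.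
   Context: MF algebra: a unital C$^*$-algebra $\mathcal A$ is MF if there exist positive integers $n_k$ and a unital injective $*$-homomorphism from $\mathcal A$ into $\prod_k\mathcal M_{n_k}(\mathbb C)/\bigoplus_k\mathcal M_{n_k}(\mathbb C)$ (bounded sequences modulo sequences tending to $0$ in norm). Approximation property: with $\{P_r\}_{r\ge1}$ an enumeration of all noncommutative polynomials in $X_1,\dots,X_n$ with coefficients having rational real and imaginary parts, and $\Gamma_R^{(top)}(x_1,\dots,x_n;k,\epsilon,P_1,\dots,P_r)$ the set of $n$-tuples of self-adjoint $k\times k$ matrices $(A_i)$ with $\max_i\|A_i\|\le R$ and $|\|P_j(A)\|-\|P_j(x)\||\le\epsilon$ for $1\le j\le r$, $\mathcal A$ has the approximation property if for every $R>\max_i\|x_i\|$, $r\in\mathbb N$, $\epsilon>0$ there are infinitely many $k$ with $\Gamma_R^{(top)}(x_1,\dots,x_n;k,\epsilon,P_1,\dots,P_r)\neq\emptyset$. Notation: $(\mathbb C^m)^\infty=\mathbb C^m\oplus\mathbb C^m\oplus\cdots$ and for a matrix $A\in\mathcal M_m(\mathbb C)$, $A^\infty=A\oplus A\oplus\cdots$ acting on $(\mathbb C^m)^\infty$. $T_k\to T$ in the $*$-strong operator topology means $T_k\to T$ and $T_k^*\to T^*$ strongly. *)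

theory Defs
  imports "HOL-Analysis.Analysis" "HOL-Library.Countable" "Jordan_Normal_Form.Schur_Decomposition"
begin

class cvec = real_vector +
  fixes scaleC :: "complex \<Rightarrow> 'a \<Rightarrow> 'a" (infixr "*\<^sub>C" 75)
  assumes scaleC_add_right: "a *\<^sub>C (x + y) = a *\<^sub>C x + a *\<^sub>C y"
    and scaleC_add_left: "(a + b) *\<^sub>C x = a *\<^sub>C x + b *\<^sub>C x"
    and scaleC_scaleC: "a *\<^sub>C (b *\<^sub>C x) = (a * b) *\<^sub>C x"
    and scaleC_one: "1 *\<^sub>C x = x"
    and scaleR_scaleC: "r *\<^sub>R x = complex_of_real r *\<^sub>C x"

text \<open>Unital C*-algebra (nonzero, since \<open>real_normed_algebra_1\<close> has \<open>0 \<noteq> 1\<close>).\<close>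
class unital_cstar_algebra = cvec + real_normed_algebra_1 + banach +
  fixes cstar :: "'a \<Rightarrow> 'a"
  assumes norm_scaleC: "norm (a *\<^sub>C x) = cmod a * norm x"
    and scaleC_mult_left: "(a *\<^sub>C x) * y = a *\<^sub>C (x * y)"
    and scaleC_mult_right: "x * (a *\<^sub>C y) = a *\<^sub>C (x * y)"
    and cstar_cstar: "cstar (cstar x) = x"
    and cstar_add: "cstar (x + y) = cstar x + cstar y"
    and cstar_scaleC: "cstar (a *\<^sub>C x) = cnj a *\<^sub>C cstar x"
    and cstar_mult: "cstar (x * y) = cstar y * cstar x"
    and cstar_identity: "norm (cstar x * x) = (norm x)\<^sup>2"

class chilbert = cvec + real_normed_vector + banach +
  fixes cinner :: "'a \<Rightarrow> 'a \<Rightarrow> complex"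
  assumes cinner_add_left: "cinner (x + y) z = cinner x z + cinner y z"
    and cinner_scaleC_left: "cinner (a *\<^sub>C x) y = cnj a * cinner x y"
    and cinner_commute: "cinner y x = cnj (cinner x y)"
    and cinner_self_norm: "cinner x x = complex_of_real ((norm x)\<^sup>2)"

definition hilbert_separable :: "'h::metric_space itself \<Rightarrow> bool" where
  "hilbert_separable _ \<longleftrightarrow> (\<exists>D::'h set. countable D \<and> closure D = UNIV)"

definition infinite_dimensional :: "'h::cvec itself \<Rightarrow> bool" where
  "infinite_dimensional _ \<longleftrightarrow>
     \<not> (\<exists>S::'h set. finite S \<and> (\<forall>h. \<exists>c. h = (\<Sum>s\<in>S. c s *\<^sub>C s)))"

definition clinear_map :: "('a::cvec \<Rightarrow> 'b::cvec) \<Rightarrow> bool" where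
  "clinear_map T \<longleftrightarrow> (\<forall>x y. T (x + y) = T x + T y) \<and> (\<forall>c x. T (c *\<^sub>C x) = c *\<^sub>C T x)"

definition bounded_op :: "('h::chilbert \<Rightarrow> 'h) \<Rightarrow> bool" where
  "bounded_op T \<longleftrightarrow> clinear_map T \<and> (\<exists>K. \<forall>h. norm (T h) \<le> K * norm h)"

definition cadj :: "('h::chilbert \<Rightarrow> 'h) \<Rightarrow> ('h \<Rightarrow> 'h)" where
  "cadj T = (THE S. \<forall>u v. cinner (S u) v = cinner u (T v))"

definition star_strong_conv :: "(nat \<Rightarrow> 'h::chilbert \<Rightarrow> 'h) \<Rightarrow> ('h \<Rightarrow> 'h) \<Rightarrow> bool" where
  "star_strong_conv T S \<longleftrightarrow>
     (\<forall>h. (\<lambda>k. T k h) \<longlonglongrightarrow> S h) \<and> (\<forall>h. (\<lambda>k. cadj (T k) h) \<longlonglongrightarrow> cadj S h)"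

definition faithful_rep :: "('a::unital_cstar_algebra \<Rightarrow> 'h::chilbert \<Rightarrow> 'h) \<Rightarrow> bool" where
  "faithful_rep \<pi> \<longleftrightarrow>
     (\<forall>a. bounded_op (\<pi> a)) \<and>
     (\<forall>a b. \<pi> (a + b) = (\<lambda>h. \<pi> a h + \<pi> b h)) \<and>
     (\<forall>c a. \<pi> (c *\<^sub>C a) = (\<lambda>h. c *\<^sub>C \<pi> a h)) \<and>
     (\<forall>a b. \<pi> (a * b) = \<pi> a \<circ> \<pi> b) \<and>
     \<pi> 1 = id \<and>
     (\<forall>a. \<pi> (cstar a) = cadj (\<pi> a)) \<and>
     inj \<pi>"

definition vnorm :: "complex vec \<Rightarrow> real" where
  "vnorm v = sqrt (\<Sum>i<dim_vec v. (cmod (v $ i))\<^sup>2)"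

definition mnorm :: "complex mat \<Rightarrow> real" where
  "mnorm A = Sup {vnorm (A *\<^sub>v v) | v. v \<in> carrier_vec (dim_col A) \<and> vnorm v \<le> 1}"

definition selfadjoint_mat :: "nat \<Rightarrow> complex mat \<Rightarrow> bool" where
  "selfadjoint_mat m A \<longleftrightarrow> A \<in> carrier_mat m m \<and> mat_adjoint A = A"

text \<open>Noncommutative polynomial expressions; variable \<open>NVar i\<close> stands for \<open>X_(i+1)\<close>.\<close>
datatype 'c ncpoly = NVar nat | NConst 'c | NAdd "'c ncpoly" "'c ncpoly" | NMul "'c ncpoly" "'c ncpoly"

instance ncpoly :: (countable) countable
  by countable_datatype

fun ncvars :: "'c ncpoly \<Rightarrow> nat set" where
  "ncvars (NVar i) = {i}"
| "ncvars (NConst c) = {}"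
| "ncvars (NAdd p q) = ncvars p \<union> ncvars q"
| "ncvars (NMul p q) = ncvars p \<union> ncvars q"

definition ncpolys :: "nat \<Rightarrow> complex ncpoly set" where
  "ncpolys n = {P. ncvars P \<subseteq> {..<n}}"

fun ev_alg :: "(nat \<Rightarrow> 'a::unital_cstar_algebra) \<Rightarrow> complex ncpoly \<Rightarrow> 'a" where
  "ev_alg x (NVar i) = x i"
| "ev_alg x (NConst c) = c *\<^sub>C 1"
| "ev_alg x (NAdd p q) = ev_alg x p + ev_alg x q"
| "ev_alg x (NMul p q) = ev_alg x p * ev_alg x q"

fun ev_mat :: "nat \<Rightarrow> (nat \<Rightarrow> complex mat) \<Rightarrow> complex ncpoly \<Rightarrow> complex mat" where
  "ev_mat m A (NVar i) = A i"
| "ev_mat m A (NConst c) = c \<cdot>\<^sub>m 1\<^sub>m m"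
| "ev_mat m A (NAdd p q) = ev_mat m A p + ev_mat m A q"
| "ev_mat m A (NMul p q) = ev_mat m A p * ev_mat m A q"

text \<open>Polynomials with coefficients having rational real and imaginary parts, and
  an enumeration \<open>P_1, P_2, ...\<close> of them (\<open>enum_poly n r\<close> is \<open>P_r\<close>, \<open>r \<ge> 1\<close>).\<close>
definition gauss_rat :: "rat \<times> rat \<Rightarrow> complex" where
  "gauss_rat q = Complex (of_rat (fst q)) (of_rat (snd q))"

definition ratpolys :: "nat \<Rightarrow> (rat \<times> rat) ncpoly set" where
  "ratpolys n = {P. ncvars P \<subseteq> {..<n}}"

definition enum_poly :: "nat \<Rightarrow> nat \<Rightarrow> complex ncpoly" where
  "enum_poly n r = map_ncpoly gauss_rat (from_nat_into (ratpolys n) (r - 1))"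

definition bounded_seq :: "(nat \<Rightarrow> nat) \<Rightarrow> (nat \<Rightarrow> complex mat) \<Rightarrow> bool" where
  "bounded_seq nk s \<longleftrightarrow> (\<forall>k. s k \<in> carrier_mat (nk k) (nk k)) \<and> bdd_above (range (\<lambda>k. mnorm (s k)))"

definition null_seq :: "(nat \<Rightarrow> nat) \<Rightarrow> (nat \<Rightarrow> complex mat) \<Rightarrow> bool" where
  "null_seq nk s \<longleftrightarrow> (\<forall>k. s k \<in> carrier_mat (nk k) (nk k)) \<and> (\<lambda>k. mnorm (s k)) \<longlonglongrightarrow> 0"

text \<open>Class of a bounded sequence in \<open>\<Prod>_k M_{n_k} / \<Oplus>_k M_{n_k}\<close>.\<close>
definition qcls :: "(nat \<Rightarrow> nat) \<Rightarrow> (nat \<Rightarrow> complex mat) \<Rightarrow> (nat \<Rightarrow> complex mat) set" where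
  "qcls nk s = {t. bounded_seq nk t \<and> null_seq nk (\<lambda>k. s k - t k)}"

definition quot_alg :: "(nat \<Rightarrow> nat) \<Rightarrow> (nat \<Rightarrow> complex mat) set set" where
  "quot_alg nk = {qcls nk s | s. bounded_seq nk s}"

definition qlift1 :: "(nat \<Rightarrow> nat) \<Rightarrow> (complex mat \<Rightarrow> complex mat) \<Rightarrow>
    (nat \<Rightarrow> complex mat) set \<Rightarrow> (nat \<Rightarrow> complex mat) set" where
  "qlift1 nk f X = {u. \<exists>s\<in>X. u \<in> qcls nk (\<lambda>k. f (s k))}"

definition qlift2 :: "(nat \<Rightarrow> nat) \<Rightarrow> (complex mat \<Rightarrow> complex mat \<Rightarrow> complex mat) \<Rightarrow>
    (nat \<Rightarrow> complex mat) set \<Rightarrow> (nat \<Rightarrow> complex mat) set \<Rightarrow> (nat \<Rightarrow> complex mat) set" where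
  "qlift2 nk f X Y = {u. \<exists>s\<in>X. \<exists>t\<in>Y. u \<in> qcls nk (\<lambda>k. f (s k) (t k))}"

definition unital_inj_star_hom_quot ::
    "(nat \<Rightarrow> nat) \<Rightarrow> ('a::unital_cstar_algebra \<Rightarrow> (nat \<Rightarrow> complex mat) set) \<Rightarrow> bool" where
  "unital_inj_star_hom_quot nk \<phi> \<longleftrightarrow>
     (\<forall>a. \<phi> a \<in> quot_alg nk) \<and>
     (\<forall>a b. \<phi> (a + b) = qlift2 nk (+) (\<phi> a) (\<phi> b)) \<and>
     (\<forall>c a. \<phi> (c *\<^sub>C a) = qlift1 nk (\<lambda>M. c \<cdot>\<^sub>m M) (\<phi> a)) \<and>
     (\<forall>a b. \<phi> (a * b) = qlift2 nk (*) (\<phi> a) (\<phi> b)) \<and>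
     (\<forall>a. \<phi> (cstar a) = qlift1 nk mat_adjoint (\<phi> a)) \<and>
     \<phi> 1 = qcls nk (\<lambda>k. 1\<^sub>m (nk k)) \<and>
     inj \<phi>"

definition MF_algebra :: "'a::unital_cstar_algebra itself \<Rightarrow> bool" where
  "MF_algebra _ \<longleftrightarrow> (\<exists>nk. (\<forall>k. 0 < nk k) \<and>
      (\<exists>\<phi>::'a \<Rightarrow> (nat \<Rightarrow> complex mat) set. unital_inj_star_hom_quot nk \<phi>))"

text \<open>\<open>x_1..x_n\<close> (here \<open>x 0 .. x (n-1)\<close>) generate the unital C*-algebra: the unital
  *-subalgebra generated by the self-adjoint \<open>x_i\<close> (= polynomials in them) is dense.\<close>
definition generates :: "nat \<Rightarrow> (nat \<Rightarrow> 'a::unital_cstar_algebra) \<Rightarrow> bool" where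
  "generates n x \<longleftrightarrow> closure (ev_alg x ` ncpolys n) = UNIV"

definition Gamma_top ::
    "nat \<Rightarrow> (nat \<Rightarrow> 'a::unital_cstar_algebra) \<Rightarrow> real \<Rightarrow> nat \<Rightarrow> real \<Rightarrow> nat \<Rightarrow> (nat \<Rightarrow> complex mat) set" where
  "Gamma_top n x R k \<epsilon> r = {A. (\<forall>i. A i = (if i < n then A i else 0\<^sub>m k k)) \<and>
      (\<forall>i<n. selfadjoint_mat k (A i) \<and> mnorm (A i) \<le> R) \<and>
      (\<forall>j\<in>{1..r}. \<bar>mnorm (ev_mat k A (enum_poly n j)) - norm (ev_alg x (enum_poly n j))\<bar> \<le> \<epsilon>)}"

definition approximation_property :: "nat \<Rightarrow> (nat \<Rightarrow> 'a::unital_cstar_algebra) \<Rightarrow> bool" where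
  "approximation_property n x \<longleftrightarrow>
     (\<forall>R. (\<forall>i<n. norm (x i) < R) \<longrightarrow> (\<forall>r. \<forall>\<epsilon>>0. infinite {k. Gamma_top n x R k \<epsilon> r \<noteq> {}}))"

definition ell2_m :: "nat \<Rightarrow> (nat \<Rightarrow> complex vec) set" where
  "ell2_m m = {f. (\<forall>j. f j \<in> carrier_vec m) \<and> summable (\<lambda>j. (vnorm (f j))\<^sup>2)}"

definition unitary_to_ell2 :: "nat \<Rightarrow> ('h::chilbert \<Rightarrow> (nat \<Rightarrow> complex vec)) \<Rightarrow> bool" where
  "unitary_to_ell2 m U \<longleftrightarrow> bij_betw U UNIV (ell2_m m) \<and>
     (\<forall>x y. U (x + y) = (\<lambda>j. U x j + U y j)) \<and>
     (\<forall>c x. U (c *\<^sub>C x) = (\<lambda>j. c \<cdot>\<^sub>v U x j)) \<and>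
     (\<forall>x. (\<Sum>j. (vnorm (U x j))\<^sup>2) = (norm x)\<^sup>2)"

definition conj_amp :: "('h \<Rightarrow> (nat \<Rightarrow> complex vec)) \<Rightarrow> complex mat \<Rightarrow> 'h \<Rightarrow> 'h" where
  "conj_amp U A = (\<lambda>h. inv_into UNIV U (\<lambda>j. A *\<^sub>v U h j))"

end

theory Submission
  imports Defs
begin

text \<open>
  (1) to (2): an injective *-homomorphism into the quotient is isometric, so the lifts of \<open>x\<close> satisfy
  \<open>limsup \<parallel>P(A\<^sup>k)\<parallel> = \<parallel>P(x)\<parallel>\<close>; a direct sum of finitely many sufficiently late blocks turns the
  limes superior into an approximation for finitely many \<open>P\<close> at once, in arbitrarily large size.
  (2) to (3) is a diagonal argument over polynomials with rational coefficients, and (3) to (1) extends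
  \<open>P(x) \<mapsto> (P(A\<^sup>k))\<^sub>k\<close> by continuity.

  (3) to (4): a vector state of \<open>\<pi>\<close> is a limit of states of the matrix algebras, since otherwise a
  separating functional would bound the top of the spectrum of a self-adjoint polynomial away from its
  limit. States of \<open>M\<^sub>m\<close> are vector states of the infinite amplification. Applied to the cyclic
  vectors \<open>\<xi>\<^sub>l\<close> of a decomposition of \<open>\<pi>\<close>, with different \<open>l\<close> in orthogonal copies, this yields vectors
  whose Gram matrix converges to that of the total family \<open>\<pi>(Q(x))\<xi>\<^sub>l\<close>, and convergence of Gram matrices
  is implemented by unitaries. This replaces Voiculescu's theorem.

  (4) to (3) only needs some faithful representation on the given space. It is obtained by
  the GNS construction from a faithful state, all of whose ingredients (square roots, positivity of
  \<open>a*a\<close>, norming functionals) are elementary.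
\<close>

section \<open>Positivity in unital C*-algebras\<close>

text \<open>Spectra and functional calculus are avoided, which explains this form of positivity: for
  self-adjoint \<open>a\<close> the inequality \<open>norm (t *\<^sub>R 1 - a) \<le> t\<close>
  places the spectrum in \<open>[0, 2t]\<close>, is preserved by sums through the triangle
  inequality, and can be tested directly by contractive functionals. Factorizations such as
  \<open>\<parallel>a\<parallel>^2 - a*a = b*b\<close> then replace the functional calculus, also in
  the proof that an injective *-homomorphism is isometric.

  Two obstacles shape the passage to operators. The functional separating a vector state from the
  states of a matrix algebra varies with the matrix algebra, whereas norm convergence speaks about
  one fixed polynomial; bounded coefficients and a convergent subsequence bridge this. Moreover the
  matrices act on spaces unrelated to the representation space, so only numbers can be compared, and
  Gram matrices are the numbers that determine vectors up to a unitary. Matching vectors controls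
  the operators because the family \<open>Q(x)\<xi>\<close> is carried into itself by each
  \<open>x_i\<close>, with the same change of index on the matrix side.\<close>

definition cpos :: "'a::unital_cstar_algebra \<Rightarrow> bool" where
  "cpos a \<longleftrightarrow> cstar a = a \<and> (\<exists>t\<ge>0. norm (t *\<^sub>R 1 - a) \<le> t)"

section \<open>Scalar multiples and the involution\<close>

lemma scaleC_zero_left [simp]: "0 *\<^sub>C x = (0::'a::cvec)"
  using scaleC_add_left[of 0 0 x] by simp

lemma scaleC_zero_right [simp]: "c *\<^sub>C 0 = (0::'a::cvec)"
  using scaleC_add_right[of c 0 0] by simp

lemma scaleC_minus_left: "(- c) *\<^sub>C x = - (c *\<^sub>C (x::'a::cvec))"
  using scaleC_add_left[of c "-c" x] by (simp add: eq_neg_iff_add_eq_0 add.commute)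

lemma scaleC_minus_right: "c *\<^sub>C (- x) = - (c *\<^sub>C (x::'a::cvec))"
  using scaleC_add_right[of c x "-x"] by (simp add: eq_neg_iff_add_eq_0 add.commute)

lemma scaleC_diff_right: "c *\<^sub>C (x - y) = c *\<^sub>C x - c *\<^sub>C (y::'a::cvec)"
  using scaleC_add_right[of c x "-y"] by (simp add: scaleC_minus_right)

lemma scaleC_minus_one: "(-1) *\<^sub>C x = - (x::'a::cvec)"
  by (simp add: scaleC_minus_left scaleC_one)

lemma scaleC_scaleR: "c *\<^sub>C (r *\<^sub>R x) = r *\<^sub>R (c *\<^sub>C (x::'a::cvec))"
  by (simp add: scaleR_scaleC scaleC_scaleC mult.commute)

lemma cstar_scaleR: "cstar (r *\<^sub>R x) = r *\<^sub>R cstar (x::'a::unital_cstar_algebra)"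
  by (simp add: scaleR_scaleC cstar_scaleC)

lemma cstar_zero [simp]: "cstar 0 = (0::'a::unital_cstar_algebra)"
  using cstar_add[of 0 "0::'a"] by simp

lemma cstar_minus: "cstar (- x) = - cstar (x::'a::unital_cstar_algebra)"
  using cstar_add[of x "-x"] by (simp add: eq_neg_iff_add_eq_0 add.commute)

lemma cstar_diff: "cstar (x - y) = cstar x - cstar (y::'a::unital_cstar_algebra)"
  using cstar_add[of x "-y"] by (simp add: cstar_minus)

lemma cstar_one [simp]: "cstar 1 = (1::'a::unital_cstar_algebra)"
  by (metis cstar_cstar cstar_mult mult_1 mult_1_right)

lemma norm_cstar: "norm (cstar x) = norm (x::'a::unital_cstar_algebra)"
proof -
  have le: "norm y \<le> norm (cstar y)" for y :: 'a
  proof (cases "y = 0")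
    case False
    have "norm y * norm y \<le> norm (cstar y) * norm y"
      by (metis cstar_identity norm_mult_ineq power2_eq_square)
    then show ?thesis using False by simp
  qed simp
  show ?thesis using le[of x] le[of "cstar x"] by (simp add: cstar_cstar)
qed

lemma bounded_linear_cstar: "bounded_linear (cstar :: 'a::unital_cstar_algebra \<Rightarrow> 'a)"
  by (rule bounded_linear_intro[of _ 1]) (auto simp: cstar_add cstar_scaleR norm_cstar)

lemma cstar_mult_eq_0: "cstar x * x = 0 \<longleftrightarrow> x = (0::'a::unital_cstar_algebra)"
proof
  assume "cstar x * x = 0"
  then have "(norm x)\<^sup>2 = 0" using cstar_identity[of x] by simp
  then show "x = 0" by simp
qed simp

lemma selfadj_sq_eq_0: "cstar x = x \<Longrightarrow> x * x = 0 \<Longrightarrow> x = (0::'a::unital_cstar_algebra)"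
  using cstar_mult_eq_0[of x] by simp

text \<open>For commuting self-adjoint \<open>h, k\<close> the element \<open>u = h + \<i>k\<close> satisfies \<open>u*u = h\<^sup>2 + k\<^sup>2\<close>,
  and \<open>h\<close> is the real part of \<open>u\<close>.\<close>

lemma selfadj_sum_squares:
  fixes h k :: "'a::unital_cstar_algebra"
  assumes "cstar h = h" "cstar k = k" "h * k = k * h"
  shows "(norm h)\<^sup>2 \<le> norm (h * h + k * k)"
proof -
  define u where "u = h + \<i> *\<^sub>C k"
  have us: "cstar u = h - \<i> *\<^sub>C k"
    using assms by (simp add: u_def cstar_add cstar_scaleC scaleC_minus_left)
  have "cstar u * u = h * h + k * k"
    using assms unfolding us unfolding u_def
    by (simp add: algebra_simps scaleC_mult_left scaleC_mult_right scaleC_scaleC scaleC_minus_one scaleC_diff_right)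
  then have nu: "(norm u)\<^sup>2 = norm (h * h + k * k)" using cstar_identity[of u] by simp
  have "2 *\<^sub>R h = u + cstar u" unfolding us unfolding u_def by (simp add: scaleR_2)
  then have "2 * norm h \<le> norm u + norm (cstar u)"
    by (metis norm_scaleR abs_numeral norm_triangle_ineq)
  then have "norm h \<le> norm u" by (simp add: norm_cstar)
  then show ?thesis using nu by (metis norm_ge_zero power_mono)
qed

section \<open>Square roots near the unit by iteration\<close>

primrec sqrt_iter :: "'a::real_normed_algebra_1 \<Rightarrow> nat \<Rightarrow> 'a" where
  "sqrt_iter y 0 = 0"
| "sqrt_iter y (Suc n) = (1/2) *\<^sub>R (y + sqrt_iter y n * sqrt_iter y n)"

lemma sqrt_iter_real: "0 \<le> sqrt_iter (1::real) n" "sqrt_iter (1::real) n \<le> 1"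
proof -
  show a: "0 \<le> sqrt_iter (1::real) n" for n by (induction n) auto
  show "sqrt_iter (1::real) n \<le> 1"
  proof (induction n)
    case (Suc n)
    have "sqrt_iter (1::real) n * sqrt_iter 1 n \<le> 1 * 1" using Suc a[of n] by (intro mult_mono) auto
    then show ?case by simp
  qed simp
qed

text \<open>The iterates and their successive differences are polynomials in \<open>y\<close> with
  nonnegative coefficients, so their norms are bounded by the values of the same polynomials at
  \<open>1\<close>. The bounded increasing scalar sequence then forces convergence in the
  algebra.\<close>

lemma sqrt_iter_norm:
  fixes y :: "'a::real_normed_algebra_1"
  assumes "norm y \<le> 1"
  shows "norm (sqrt_iter y n) \<le> sqrt_iter 1 n"
    and "norm (sqrt_iter y (Suc n) - sqrt_iter y n) \<le> sqrt_iter 1 (Suc n) - sqrt_iter 1 n"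
proof -
  show A: "norm (sqrt_iter y n) \<le> sqrt_iter 1 n" for n
  proof (induction n)
    case (Suc n)
    have "norm (sqrt_iter y n * sqrt_iter y n) \<le> sqrt_iter 1 n * sqrt_iter 1 n"
      using Suc by (meson mult_mono norm_ge_zero norm_mult_ineq order_trans)
    then have "norm (y + sqrt_iter y n * sqrt_iter y n) \<le> 1 + sqrt_iter 1 n * sqrt_iter 1 n"
      using assms norm_triangle_ineq[of y "sqrt_iter y n * sqrt_iter y n"] by linarith
    then show ?case by simp
  qed simp
  show "norm (sqrt_iter y (Suc n) - sqrt_iter y n) \<le> sqrt_iter 1 (Suc n) - sqrt_iter 1 n"
  proof (induction n)
    case 0
    then show ?case using assms by simp
  next
    case (Suc n)
    define c d where "c = sqrt_iter y n" and "d = sqrt_iter y (Suc n)"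
    define r s where "r = sqrt_iter (1::real) n" and "s = sqrt_iter (1::real) (Suc n)"
    have e: "sqrt_iter y (Suc (Suc n)) - sqrt_iter y (Suc n) = (1/2) *\<^sub>R ((d - c) * d + c * (d - c))"
    proof -
      have "sqrt_iter y (Suc (Suc n)) - sqrt_iter y (Suc n) = (1/2) *\<^sub>R (y + d * d) - (1/2) *\<^sub>R (y + c * c)"
        by (simp add: c_def d_def)
      also have "\<dots> = (1/2) *\<^sub>R ((d - c) * d + c * (d - c))" by (simp add: algebra_simps)
      finally show ?thesis .
    qed
    have f: "sqrt_iter 1 (Suc (Suc n)) - sqrt_iter 1 (Suc n) = (1/2) * ((s - r) * s + r * (s - r))"
    proof -
      have "sqrt_iter 1 (Suc (Suc n)) - sqrt_iter 1 (Suc n) = (1/2) *\<^sub>R (1 + s * s) - (1/2) *\<^sub>R (1 + r * r)"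
        by (simp add: r_def s_def)
      also have "\<dots> = (1/2) * ((s - r) * s + r * (s - r))" by (simp add: field_simps)
      finally show ?thesis .
    qed
    have b: "norm d \<le> s" "norm c \<le> r" "norm (d - c) \<le> s - r"
      using A[of n] A[of "Suc n"] Suc unfolding c_def d_def r_def s_def by simp_all
    have "norm ((d - c) * d) \<le> (s - r) * s" "norm (c * (d - c)) \<le> r * (s - r)"
      using b by (meson mult_mono norm_ge_zero norm_mult_ineq order_trans)+
    then have "norm ((d - c) * d + c * (d - c)) \<le> (s - r) * s + r * (s - r)"
      by (meson add_mono norm_triangle_ineq order_trans)
    then show ?case unfolding e f by simp
  qed
qed

lemma sqrt_iter_LIMSEQ:
  fixes y :: "'a::unital_cstar_algebra"
  assumes "norm y \<le> 1"
  obtains c where "sqrt_iter y \<longlonglongrightarrow> c" "norm c \<le> 1"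
proof -
  let ?r = "sqrt_iter (1::real)"
  have inc: "?r n \<le> ?r (Suc n)" for n
    using sqrt_iter_norm(2)[OF assms, of n] norm_ge_zero order_trans by (metis diff_ge_0_iff_ge)
  have "incseq ?r" using inc by (rule incseq_SucI)
  moreover have "\<forall>n. ?r n \<le> 1" using sqrt_iter_real by blast
  ultimately have "Cauchy ?r" by (meson convergent_Cauchy convergentI incseq_convergent)
  have d: "norm (sqrt_iter y (n + k) - sqrt_iter y n) \<le> ?r (n + k) - ?r n" for n k
  proof (induction k)
    case (Suc k)
    have "norm (sqrt_iter y (n + Suc k) - sqrt_iter y n)
        \<le> norm (sqrt_iter y (Suc (n + k)) - sqrt_iter y (n + k)) + norm (sqrt_iter y (n + k) - sqrt_iter y n)"
      using norm_triangle_ineq[of "sqrt_iter y (Suc (n + k)) - sqrt_iter y (n + k)" "sqrt_iter y (n + k) - sqrt_iter y n"] by simp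
    then show ?case using Suc sqrt_iter_norm(2)[OF assms, of "n + k"] by simp
  qed simp
  have "Cauchy (sqrt_iter y)"
  proof (rule CauchyI)
    fix e :: real assume "e > 0"
    with \<open>Cauchy ?r\<close> obtain M where M: "\<And>m n. m \<ge> M \<Longrightarrow> n \<ge> M \<Longrightarrow> norm (?r m - ?r n) < e"
      unfolding Cauchy_iff by blast
    have "norm (sqrt_iter y m - sqrt_iter y n) < e" if "m \<ge> n" "n \<ge> M" for m n
      using d[of n "m - n"] M[of m n] that by auto
    then show "\<exists>M. \<forall>m\<ge>M. \<forall>n\<ge>M. norm (sqrt_iter y m - sqrt_iter y n) < e"
      by (metis linorder_le_cases norm_minus_commute)
  qed
  then obtain c where c: "sqrt_iter y \<longlonglongrightarrow> c" using Cauchy_convergent_iff convergent_def by blast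
  have "norm (sqrt_iter y n) \<le> 1" for n using sqrt_iter_norm(1)[OF assms, of n] sqrt_iter_real(2)[of n] by simp
  then have "norm c \<le> 1" using LIMSEQ_le_const2[OF tendsto_norm[OF c]] by blast
  with c show ?thesis using that by blast
qed

lemma sqrt_iter_intertwine:
  fixes w a b :: "'a::real_normed_algebra_1"
  assumes "w * a = b * w"
  shows "w * sqrt_iter a n = sqrt_iter b n * w"
proof (induction n)
  case (Suc n)
  have "w * (sqrt_iter a n * sqrt_iter a n) = (sqrt_iter b n * sqrt_iter b n) * w"
    by (metis Suc mult.assoc)
  then show ?case using assms by (simp add: algebra_simps)
qed simp

lemma cstar_sqrt_iter: "cstar y = y \<Longrightarrow> cstar (sqrt_iter y n) = sqrt_iter y n"
  by (induction n) (auto simp: cstar_scaleR cstar_add cstar_mult)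

text \<open>The limit \<open>c\<close> of the recursion solves \<open>2 c = y + c * c\<close>. With
  \<open>y = 1 - a\<close> this says \<open>(1 - c) * (1 - c) = a\<close>, and for self-adjoint
  \<open>a\<close> the root \<open>1 - c\<close> is positive because
  \<open>norm c \<le> 1\<close>.\<close>

definition unit_sqrt :: "'a::unital_cstar_algebra \<Rightarrow> 'a" where
  "unit_sqrt a = 1 - lim (sqrt_iter (1 - a))"

lemma unit_sqrt:
  fixes a :: "'a::unital_cstar_algebra"
  assumes "norm (1 - a) \<le> 1"
  shows "unit_sqrt a * unit_sqrt a = a" "norm (1 - unit_sqrt a) \<le> 1"
    and "cstar a = a \<Longrightarrow> cstar (unit_sqrt a) = unit_sqrt a"
    and "norm (1 - b) \<le> 1 \<Longrightarrow> w * a = b * w \<Longrightarrow> w * unit_sqrt a = unit_sqrt b * w"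
proof -
  let ?c = "\<lambda>a::'a. lim (sqrt_iter (1 - a))"
  have L: "sqrt_iter (1 - a) \<longlonglongrightarrow> ?c a \<and> norm (?c a) \<le> 1" if "norm (1 - a) \<le> 1" for a :: 'a
    using sqrt_iter_LIMSEQ[OF that] by (metis limI)
  note c = conjunct1[OF L[OF assms]] conjunct2[OF L[OF assms]]
  have "(\<lambda>n. sqrt_iter (1 - a) (Suc n)) \<longlonglongrightarrow> (1/2) *\<^sub>R (1 - a + ?c a * ?c a)"
    unfolding sqrt_iter.simps by (intro tendsto_intros c)
  then have "?c a = (1/2) *\<^sub>R (1 - a + ?c a * ?c a)" using LIMSEQ_Suc[OF c(1)] LIMSEQ_unique by blast
  then have "2 *\<^sub>R ?c a = 2 *\<^sub>R ((1/2) *\<^sub>R (1 - a + ?c a * ?c a))" by simp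
  then have "?c a + ?c a = 1 - a + ?c a * ?c a" by (simp add: scaleR_2)
  then show "unit_sqrt a * unit_sqrt a = a" by (simp add: unit_sqrt_def algebra_simps)
  show "norm (1 - unit_sqrt a) \<le> 1" using c by (simp add: unit_sqrt_def)
  show "cstar (unit_sqrt a) = unit_sqrt a" if "cstar a = a"
  proof -
    have "(\<lambda>n. cstar (sqrt_iter (1 - a) n)) \<longlonglongrightarrow> cstar (?c a)"
      by (rule bounded_linear.tendsto[OF bounded_linear_cstar c(1)])
    then have "sqrt_iter (1 - a) \<longlonglongrightarrow> cstar (?c a)" using that by (simp add: cstar_sqrt_iter cstar_diff)
    then show ?thesis using c(1) LIMSEQ_unique by (auto simp: unit_sqrt_def cstar_diff)
  qed
  show "w * unit_sqrt a = unit_sqrt b * w" if "norm (1 - b) \<le> 1" "w * a = b * w"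
  proof -
    have "(\<lambda>n. w * sqrt_iter (1 - a) n) \<longlonglongrightarrow> w * ?c a" by (intro tendsto_intros c)
    moreover have "(\<lambda>n. sqrt_iter (1 - b) n * w) \<longlonglongrightarrow> ?c b * w"
      using L[OF that(1)] by (intro tendsto_intros) auto
    moreover have "w * sqrt_iter (1 - a) n = sqrt_iter (1 - b) n * w" for n
      by (rule sqrt_iter_intertwine) (use that in \<open>simp add: algebra_simps\<close>)
    ultimately have "w * ?c a = ?c b * w" using LIMSEQ_unique by simp
    then show ?thesis by (simp add: unit_sqrt_def algebra_simps)
  qed
qed

section \<open>The positive cone and its square roots\<close>

lemma cpos_selfadj: "cpos a \<Longrightarrow> cstar a = a" by (simp add: cpos_def)

text \<open>Passing from \<open>t\<close> to a larger \<open>s\<close> adds a multiple of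
  \<open>1\<close> of norm \<open>s - t\<close>. This permits one common bound for two positive
  elements.\<close>

lemma cpos_bound:
  assumes "cpos a"
  obtains t where "t > 0" "\<And>s. s \<ge> t \<Longrightarrow> norm (s *\<^sub>R 1 - a) \<le> s"
proof -
  obtain t where t: "t \<ge> 0" "norm (t *\<^sub>R 1 - a) \<le> t" using assms by (auto simp: cpos_def)
  have "norm (s *\<^sub>R 1 - a) \<le> s" if "s \<ge> t" for s
  proof -
    have "s *\<^sub>R 1 - a = (s - t) *\<^sub>R 1 + (t *\<^sub>R 1 - a)" by (simp add: algebra_simps)
    then have "norm (s *\<^sub>R 1 - a) \<le> norm ((s - t) *\<^sub>R (1::'a)) + norm (t *\<^sub>R 1 - a)"
      by (metis norm_triangle_ineq)
    then show ?thesis using t that by simp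
  qed
  then show ?thesis using that[of "t + 1"] t by auto
qed

lemma cpos_scaleR: "cpos a \<Longrightarrow> r \<ge> 0 \<Longrightarrow> cpos (r *\<^sub>R a)"
proof -
  assume a: "cpos a" "r \<ge> 0"
  then obtain t where t: "t \<ge> 0" "norm (t *\<^sub>R 1 - a) \<le> t" by (auto simp: cpos_def)
  have "norm ((r * t) *\<^sub>R 1 - r *\<^sub>R a) = r * norm (t *\<^sub>R 1 - a)"
    using a by (simp add: scaleR_right_diff_distrib[symmetric] scaleR_scaleR[symmetric] del: scaleR_scaleR)
  then show ?thesis using a t unfolding cpos_def
    by (intro conjI exI[of _ "r * t"]) (auto simp: cstar_scaleR mult_left_mono)
qed

lemma cpos_add: "cpos a \<Longrightarrow> cpos b \<Longrightarrow> cpos (a + b)"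
proof -
  assume a: "cpos a" "cpos b"
  then obtain t s where t: "t \<ge> 0" "norm (t *\<^sub>R 1 - a) \<le> t" "s \<ge> 0" "norm (s *\<^sub>R 1 - b) \<le> s" by (auto simp: cpos_def)
  have "(t + s) *\<^sub>R 1 - (a + b) = (t *\<^sub>R 1 - a) + (s *\<^sub>R 1 - b)" by (simp add: algebra_simps)
  then have "norm ((t + s) *\<^sub>R 1 - (a + b)) \<le> norm (t *\<^sub>R 1 - a) + norm (s *\<^sub>R 1 - b)"
    by (metis norm_triangle_ineq)
  then have "norm ((t + s) *\<^sub>R 1 - (a + b)) \<le> t + s" using t by linarith
  then show ?thesis using a t by (auto simp: cpos_def cstar_add intro!: exI[of _ "t + s"])
qed

lemma cpos_norm_diff: "cstar a = a \<Longrightarrow> norm a \<le> r \<Longrightarrow> cpos (r *\<^sub>R 1 - a)"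
  unfolding cpos_def using order_trans[OF norm_ge_zero, of a r]
  by (intro conjI exI[of _ r]) (auto simp: cstar_diff cstar_scaleR)

text \<open>Both roots are taken after division by one common \<open>t\<close>. With different
  scalings, an element intertwining \<open>a\<close> and \<open>b\<close> would no longer intertwine
  the rescaled elements.\<close>

lemma cpos_sqrt_exists:
  fixes a b :: "'a::unital_cstar_algebra"
  assumes "cpos a" "cpos b"
  obtains h k where "cpos h" "h * h = a" "cpos k" "k * k = b"
    "\<And>w. w * a = b * w \<Longrightarrow> w * h = k * w" "\<And>w. w * a = a * w \<Longrightarrow> w * h = h * w"
    "\<And>w. w * b = b * w \<Longrightarrow> w * k = k * w"
proof -
  obtain t1 where t1: "t1 > 0" "\<And>s. s \<ge> t1 \<Longrightarrow> norm (s *\<^sub>R 1 - a) \<le> s" using cpos_bound[OF assms(1)] by blast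
  obtain t2 where t2: "t2 > 0" "\<And>s. s \<ge> t2 \<Longrightarrow> norm (s *\<^sub>R 1 - b) \<le> s" using cpos_bound[OF assms(2)] by blast
  define t where "t = max t1 t2"
  have t: "t > 0" using t1 t2 by (simp add: t_def)
  have n: "norm (1 - (1/t) *\<^sub>R c) \<le> 1" if "norm (t *\<^sub>R 1 - c) \<le> t" for c :: 'a
  proof -
    have "1 - (1/t) *\<^sub>R c = (1/t) *\<^sub>R (t *\<^sub>R 1 - c)" using t by (simp add: algebra_simps)
    then show ?thesis using t that by (simp add: divide_simps)
  qed
  have na: "norm (1 - (1/t) *\<^sub>R a) \<le> 1" and nb: "norm (1 - (1/t) *\<^sub>R b) \<le> 1"
    using n t1(2)[of t] t2(2)[of t] by (auto simp: t_def)
  let ?s = "\<lambda>c::'a. sqrt t *\<^sub>R unit_sqrt ((1/t) *\<^sub>R c)"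
  have sq: "?s c * ?s c = c" if "norm (1 - (1/t) *\<^sub>R c) \<le> 1" for c
    using unit_sqrt(1)[OF that] t by simp
  have ps: "cpos (?s c)" if "norm (1 - (1/t) *\<^sub>R c) \<le> 1" "cstar c = c" for c
  proof (rule cpos_scaleR)
    have "cstar (unit_sqrt ((1/t) *\<^sub>R c)) = unit_sqrt ((1/t) *\<^sub>R c)"
      by (rule unit_sqrt(3)[OF that(1)]) (simp add: cstar_scaleR that)
    then show "cpos (unit_sqrt ((1/t) *\<^sub>R c))"
      using unit_sqrt(2)[OF that(1)] unfolding cpos_def by (metis scaleR_one zero_le_one)
  qed (use t in simp)
  have int: "w * ?s c = ?s d * w"
    if "norm (1 - (1/t) *\<^sub>R c) \<le> 1" "norm (1 - (1/t) *\<^sub>R d) \<le> 1" "w * c = d * w" for c d w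
    using unit_sqrt(4)[OF that(1,2), of w] that(3) by simp
  show ?thesis
    using that[of "?s a" "?s b"] sq[OF na] sq[OF nb] ps[OF na] ps[OF nb] int[OF na nb] int[OF na na] int[OF nb nb]
      cpos_selfadj assms by blast
qed

text \<open>For \<open>g\<close> of norm one, \<open>1 - g * g\<close> is within distance one of
  \<open>1\<close> and so has a root \<open>b\<close>, which commutes with \<open>g\<close>. Since
  \<open>b * b + g * g = 1\<close>, the estimate for sums of squares gives
  \<open>norm (b * b) \<le> 1\<close>, which is positivity of \<open>g * g\<close> with
  \<open>t = 1\<close>.\<close>

lemma cpos_square:
  fixes h :: "'a::unital_cstar_algebra"
  assumes "cstar h = h"
  shows "cpos (h * h)"
proof (cases "h = 0")
  case True
  then show ?thesis by (auto simp: cpos_def intro!: exI[of _ 0])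
next
  case False
  define g where "g = (1 / norm h) *\<^sub>R h"
  have g: "cstar g = g" "norm g = 1" using assms False by (auto simp: g_def cstar_scaleR)
  have ng: "norm (g * g) = 1" using cstar_identity[of g] g by simp
  define b where "b = unit_sqrt (1 - g * g)"
  have b: "b * b = 1 - g * g" "cstar b = b" "g * b = b * g"
    using unit_sqrt[of "1 - g * g"] unit_sqrt(4)[of "1 - g * g" "1 - g * g" g] ng g
    by (auto simp: b_def cstar_diff cstar_mult algebra_simps)
  have "(norm b)\<^sup>2 \<le> norm (b * b + g * g)" by (rule selfadj_sum_squares) (use b g in auto)
  then have "norm (b * b) \<le> 1" using b cstar_identity[of b] by simp
  then have "cpos (g * g)" using b g unfolding cpos_def by (intro conjI exI[of _ 1]) (auto simp: cstar_mult)
  then have "cpos ((norm h)\<^sup>2 *\<^sub>R (g * g))" by (rule cpos_scaleR) simp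
  moreover have "(norm h)\<^sup>2 *\<^sub>R (g * g) = h * h" using False by (simp add: g_def power2_eq_square)
  ultimately show ?thesis by simp
qed

text \<open>The elements \<open>a\<close> and \<open>r *\<^sub>R 1 - a\<close> commute, hence so do
  their roots \<open>h\<close> and \<open>k\<close>. The squares of the roots add up to
  \<open>r *\<^sub>R 1\<close>, so the estimate for commuting sums of squares bounds
  \<open>h\<close> and with it \<open>a\<close>.\<close>

lemma cpos_le_norm:
  fixes a :: "'a::unital_cstar_algebra"
  assumes "cpos a" "cpos (r *\<^sub>R 1 - a)"
  shows "norm a \<le> \<bar>r\<bar>"
proof -
  obtain h k where hk: "cpos h" "h * h = a" "cpos k" "k * k = r *\<^sub>R 1 - a"
    "\<And>w. w * a = a * w \<Longrightarrow> w * h = h * w"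
    "\<And>w. w * (r *\<^sub>R 1 - a) = (r *\<^sub>R 1 - a) * w \<Longrightarrow> w * k = k * w"
    using cpos_sqrt_exists[OF assms] by metis
  have "a * k = k * a" by (rule hk(6)) (simp add: algebra_simps)
  then have "k * h = h * k" by (metis hk(5))
  then have "(norm h)\<^sup>2 \<le> norm (h * h + k * k)"
    by (rule selfadj_sum_squares[OF cpos_selfadj[OF hk(1)] cpos_selfadj[OF hk(3)] sym])
  then have "(norm h)\<^sup>2 \<le> \<bar>r\<bar>" by (simp add: hk(2,4))
  then show ?thesis using hk(2) cstar_identity[of h] cpos_selfadj[OF hk(1)] by simp
qed

lemma cpos_antisym:
  fixes a :: "'a::unital_cstar_algebra"
  assumes "cpos a" "cpos (- a)"
  shows "a = 0"
  using cpos_le_norm[of a 0] assms by simp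

text \<open>The roots of \<open>p\<close> and \<open>q\<close> commute with \<open>e\<close>, so
  \<open>e * p * e\<close> and \<open>e * q * e\<close> are squares of self-adjoint elements. Each
  is the negative of the other, and antisymmetry of the order makes both vanish.\<close>

lemma commuting_positive_sum_zero:
  fixes e p q :: "'a::unital_cstar_algebra"
  assumes "cpos p" "cpos q" "cstar e = e" "e * p = p * e" "e * q = q * e" "e * (p + q) * e = 0"
  shows "e * p = 0" "e * q = 0"
proof -
  obtain h k where hk: "cpos h" "h * h = p" "cpos k" "k * k = q"
    "\<And>w. w * p = p * w \<Longrightarrow> w * h = h * w" "\<And>w. w * q = q * w \<Longrightarrow> w * k = k * w"
    using cpos_sqrt_exists[OF assms(1,2)] by metis
  have sa: "cstar h = h" "cstar k = k" by (rule cpos_selfadj[OF hk(1)], rule cpos_selfadj[OF hk(3)])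
  have c: "e * h = h * e" "e * k = k * e" by (rule hk(5)[OF assms(4)], rule hk(6)[OF assms(5)])
  have "(e * h) * (e * h) = e * p * e" "(e * k) * (e * k) = e * q * e" using c hk by (metis mult.assoc)+
  moreover have "cstar (e * h) = e * h" "cstar (e * k) = e * k" using c sa assms by (simp_all add: cstar_mult)
  moreover have eq: "e * p * e = - (e * q * e)" using assms(6) by (simp add: algebra_simps eq_neg_iff_add_eq_0)
  ultimately have "cpos (e * p * e)" "cpos (e * q * e)" using cpos_square by metis+
  then have "e * p * e = 0" "e * q * e = 0" using eq cpos_antisym[of "e * p * e"] cpos_antisym[of "e * q * e"] by auto
  then have "e * h = 0" "e * k = 0"
    using \<open>(e * h) * (e * h) = _\<close> \<open>(e * k) * (e * k) = _\<close> \<open>cstar (e * h) = _\<close> \<open>cstar (e * k) = _\<close> selfadj_sq_eq_0 by metis+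
  then show "e * p = 0" "e * q = 0" using hk by (metis mult.assoc mult_zero_left)+
qed

text \<open>With \<open>e = p - q\<close>, the difference \<open>p * p - q * q\<close> factors as
  \<open>e * (p + q)\<close>. Multiplying by \<open>e\<close> from the right brings it into the form
  where commuting positive summands vanish separately, and then
  \<open>e * e = e * p - e * q = 0\<close>.\<close>

lemma cpos_sqrt_unique:
  fixes p q :: "'a::unital_cstar_algebra"
  assumes "cpos p" "cpos q" "p * p = q * q" "p * q = q * p"
  shows "p = q"
proof -
  define e where "e = p - q"
  have e: "cstar e = e" using cpos_selfadj[OF assms(1)] cpos_selfadj[OF assms(2)] by (simp add: e_def cstar_diff)
  have c: "e * p = p * e" "e * q = q * e" using assms by (auto simp: e_def algebra_simps)
  have "e * (p + q) = p * p + p * q - (q * p + q * q)" by (simp add: e_def algebra_simps)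
  then have "e * (p + q) = 0" using assms by simp
  then have "e * (p + q) * e = 0" by simp
  then have "e * p = 0" "e * q = 0" using commuting_positive_sum_zero[OF assms(1,2) e c] by auto
  then have "e * e = 0" by (metis e_def diff_self right_diff_distrib)
  then show ?thesis using selfadj_sq_eq_0[OF e] by (simp add: e_def)
qed

text \<open>The Kelley--Vaught argument. If \<open>- x*x\<close> is positive then so is \<open>xx*\<close>, and intertwining the
  square roots of \<open>(xx*)\<^sup>2\<close> and \<open>(x*x)\<^sup>2\<close> by \<open>x*\<close> gives \<open>x*(xx*) = - (x*x)x*\<close>.\<close>

lemma neg_cstar_mult_cpos_zero:
  fixes x :: "'a::unital_cstar_algebra"
  assumes "cpos (- (cstar x * x))"
  shows "x = 0"
proof -
  define b d where "b = cstar x * x" and "d = x * cstar x"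
  \<comment> \<open>These are the real and imaginary parts of \<open>x\<close>. Expanding gives
    \<open>b + d = 2 h^2 + 2 k^2\<close>, so \<open>d\<close> is positive as the sum of
    \<open>b + d\<close> and \<open>- b\<close>.\<close>
  define h k where "h = (1/2) *\<^sub>R (x + cstar x)" and "k = (1/2) *\<^sub>R (\<i> *\<^sub>C (cstar x - x))"
  have "cstar h = h" by (simp add: h_def cstar_scaleR cstar_add cstar_cstar add.commute)
  moreover have "cstar k = k"
    by (simp add: k_def cstar_scaleR cstar_scaleC cstar_diff cstar_cstar scaleC_minus_left)
       (simp add: scaleC_diff_right algebra_simps)
  ultimately have p: "cpos (2 *\<^sub>R (h * h) + 2 *\<^sub>R (k * k))" by (simp add: cpos_add cpos_scaleR cpos_square)
  have "2 *\<^sub>R (h * h) = (1/2) *\<^sub>R ((x + cstar x) * (x + cstar x))" by (simp add: h_def)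
  moreover have "2 *\<^sub>R (k * k) = - ((1/2) *\<^sub>R ((cstar x - x) * (cstar x - x)))"
    by (simp add: k_def scaleC_mult_left scaleC_mult_right scaleC_scaleC scaleC_minus_one scaleC_scaleR)
  ultimately have "2 *\<^sub>R (h * h) + 2 *\<^sub>R (k * k)
      = (1/2) *\<^sub>R ((x + cstar x) * (x + cstar x) - (cstar x - x) * (cstar x - x))"
    by (simp add: scaleR_right_diff_distrib)
  also have "(x + cstar x) * (x + cstar x) - (cstar x - x) * (cstar x - x) = 2 *\<^sub>R (b + d)"
    by (simp add: b_def d_def algebra_simps scaleR_2)
  finally have "cpos (b + d)" using p by simp
  then have pd: "cpos d" using cpos_add[of "b + d" "- b"] assms by (simp add: b_def)
  have pb: "cpos (- b)" using assms by (simp add: b_def)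
  have sab: "cstar b = b" "cstar d = d" by (simp_all add: b_def d_def cstar_mult cstar_cstar)
  \<comment> \<open>By uniqueness of positive roots these will be \<open>d\<close> and
    \<open>- b\<close>; the sign in the second comes from positivity of \<open>- b\<close>.\<close>
  obtain p q where pq: "cpos p" "p * p = d * d" "cpos q" "q * q = b * b"
    "\<And>w. w * (d * d) = (b * b) * w \<Longrightarrow> w * p = q * w"
    "\<And>w. w * (d * d) = (d * d) * w \<Longrightarrow> w * p = p * w"
    "\<And>w. w * (b * b) = (b * b) * w \<Longrightarrow> w * q = q * w"
    by (rule cpos_sqrt_exists[OF cpos_square[OF sab(2)] cpos_square[OF sab(1)]]) (rule that; assumption)
  have "d * p = p * d" by (rule pq(6)) (simp add: mult.assoc)
  then have "p = d" using cpos_sqrt_unique[OF pq(1) pd pq(2)] by simp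
  moreover have "b * q = q * b" by (rule pq(7)) (simp add: mult.assoc)
  then have "q = - b" using cpos_sqrt_unique[OF pq(3) pb] pq(4) by simp
  moreover have "cstar x * p = q * cstar x" by (rule pq(5)) (simp add: b_def d_def mult.assoc)
  ultimately have "cstar x * d = - (b * cstar x)" by simp
  moreover have "cstar x * d = b * cstar x" by (simp add: b_def d_def mult.assoc)
  ultimately have "2 *\<^sub>R (b * cstar x) = 0" by (simp add: scaleR_2 eq_neg_iff_add_eq_0)
  then have "b * cstar x = 0" by simp
  then have "b * b = 0" by (metis b_def mult.assoc mult_zero_left)
  then have "b = 0" using selfadj_sq_eq_0 sab by blast
  then show ?thesis by (simp add: b_def cstar_mult_eq_0)
qed

section \<open>Absolute values and positivity of \<open>cstar x * x\<close>\<close>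

lemma cabs_exists:
  fixes b :: "'a::unital_cstar_algebra"
  assumes "cstar b = b"
  obtains c where "cpos c" "c * c = b * b" "b * c = c * b"
proof -
  obtain c where "cpos c" "c * c = b * b" "\<And>w. w * (b * b) = (b * b) * w \<Longrightarrow> w * c = c * w"
    using cpos_sqrt_exists[OF cpos_square[OF assms] cpos_square[OF assms]] by metis
  then show ?thesis using that by (metis mult.assoc)
qed

text \<open>Let \<open>c = |b|\<close> and \<open>n = c - b\<close>, twice the negative part of
  \<open>b\<close>. From \<open>b * n = - (c * n)\<close> it follows that
  \<open>cstar (x * n) * (x * n)\<close> is minus a square, so \<open>x * n = 0\<close> by
  \<open>neg_cstar_mult_cpos_zero\<close>. This gives \<open>c * n = 0\<close>, and
  \<open>n * n = 2 c n\<close> then shows \<open>b = c\<close>.\<close>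

theorem cpos_cstar_mult: "cpos (cstar x * x)" for x :: "'a::unital_cstar_algebra"
proof -
  define b where "b = cstar x * x"
  have sb: "cstar b = b" by (simp add: b_def cstar_mult cstar_cstar)
  then obtain c where c: "cpos c" "c * c = b * b" "b * c = c * b" using cabs_exists by blast
  obtain r where r: "cpos r" "r * r = c" "\<And>w. w * c = c * w \<Longrightarrow> w * r = r * w"
    using cpos_sqrt_exists[OF c(1) c(1)] by metis
  define n where "n = c - b"
  have sn: "cstar n = n" using c sb cpos_selfadj by (auto simp: n_def cstar_diff)
  have "n * c = c * n" using c by (simp add: n_def algebra_simps)
  then have nr: "n * r = r * n" by (rule r(3))
  have nb: "b * n = - (c * n)" using c by (simp add: n_def algebra_simps)
  have sr: "cstar (r * n) = r * n" using sn r nr cpos_selfadj by (metis cstar_mult)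
  have "cstar (x * n) * (x * n) = n * (b * n)" by (simp add: cstar_mult sn b_def mult.assoc)
  also have "\<dots> = - ((r * n) * (r * n))" unfolding nb using nr r by (metis minus_mult_right mult.assoc)
  finally have eq: "cstar (x * n) * (x * n) = - ((r * n) * (r * n))" .
  then have "x * n = 0" using neg_cstar_mult_cpos_zero[of "x * n"] cpos_square[OF sr] by simp
  then have "r * n = 0" using eq selfadj_sq_eq_0[OF sr] by simp
  then have "c * n = 0" using r by (metis mult.assoc mult_zero_right)
  moreover have "n * n = c * n + c * n" using c by (simp add: n_def algebra_simps)
  ultimately have "n = 0" using selfadj_sq_eq_0[OF sn] by simp
  then show ?thesis using c by (simp add: n_def b_def)
qed

text \<open>A contractive functional attaining \<open>norm (1 + b)\<close> must attain the norms of
  \<open>1\<close> and \<open>b\<close> separately; this turns norming functionals into states. The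
  lower bound comes from \<open>0 \<le> b \<le> norm (1 + b) - 1\<close>.\<close>

lemma norm_one_plus_cpos:
  fixes b :: "'a::unital_cstar_algebra"
  assumes "cpos b"
  shows "norm (1 + b) = 1 + norm b"
proof (rule antisym)
  show "norm (1 + b) \<le> 1 + norm b" using norm_triangle_ineq[of 1 b] by simp
  have "cpos (norm (1 + b) *\<^sub>R 1 - (1 + b))"
    by (rule cpos_norm_diff) (use assms cpos_selfadj in \<open>auto simp: cstar_add\<close>)
  then have c: "cpos ((norm (1 + b) - 1) *\<^sub>R 1 - b)" by (simp add: algebra_simps)
  have "cpos ((norm (1 + b) - 1) *\<^sub>R (1::'a))" using cpos_add[OF c assms] by simp
  then obtain t where "t \<ge> 0" "norm (t *\<^sub>R 1 - (norm (1 + b) - 1) *\<^sub>R (1::'a)) \<le> t"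
    unfolding cpos_def by blast
  then have "\<bar>t - (norm (1 + b) - 1)\<bar> \<le> t"
    by (metis mult_1_right norm_one norm_scaleR scaleR_left_diff_distrib)
  then have "norm (1 + b) - 1 \<ge> 0" by linarith
  then show "1 + norm b \<le> norm (1 + b)" using cpos_le_norm[OF assms c] by linarith
qed

section \<open>Norming functionals\<close>

definition sublinear :: "('b::real_vector \<Rightarrow> real) \<Rightarrow> bool" where
  "sublinear q \<longleftrightarrow> (\<forall>x y. q (x + y) \<le> q x + q y) \<and> (\<forall>r>0. \<forall>x. q (r *\<^sub>R x) \<le> r * q x)"

text \<open>The auxiliary functional in the minimality proof of the Hahn--Banach theorem. It is
  sublinear and below \<open>q\<close>, and the choice \<open>t = 1\<close> shows that its value at
  \<open>- y\<close> is at most \<open>- q y\<close>.\<close>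

definition sublinear_shift :: "('b::real_vector \<Rightarrow> real) \<Rightarrow> 'b \<Rightarrow> 'b \<Rightarrow> real" where
  "sublinear_shift q y x = (INF t\<in>{0..}. q (x + t *\<^sub>R y) - t * q y)"

lemma sublinear_zero: "sublinear q \<Longrightarrow> q 0 = 0"
proof -
  assume "sublinear q"
  then have "q (r *\<^sub>R 0) \<le> r * q 0" if "r > 0" for r using that unfolding sublinear_def by blast
  from this[of 2] this[of "1/2"] show ?thesis by simp
qed

lemma sublinear_scale:
  assumes "sublinear q" "r \<ge> 0"
  shows "q (r *\<^sub>R x) = r * q x"
proof (cases "r = 0")
  case False
  then have r: "r > 0" using assms by simp
  then have "q (r *\<^sub>R x) \<le> r * q x" "q ((1/r) *\<^sub>R (r *\<^sub>R x)) \<le> (1/r) * q (r *\<^sub>R x)"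
    using assms unfolding sublinear_def by (blast, metis zero_less_divide_1_iff)
  then show ?thesis using r by (simp add: field_simps)
qed (simp add: sublinear_zero[OF assms(1)])

lemma sublinear_lower: "sublinear q \<Longrightarrow> - q (- x) \<le> q x"
proof -
  assume s: "sublinear q"
  then have "q (x + - x) \<le> q x + q (- x)" unfolding sublinear_def by blast
  then show ?thesis using sublinear_zero[OF s] by simp
qed

lemma sublinear_shift:
  assumes q: "sublinear q"
  shows "sublinear (sublinear_shift q y)" and "t \<ge> 0 \<Longrightarrow> sublinear_shift q y x \<le> q (x + t *\<^sub>R y) - t * q y"
proof -
  have sub: "q (a + b) \<le> q a + q b" for a b using q unfolding sublinear_def by blast
  \<comment> \<open>The left-hand side is independent of \<open>t\<close>, so the infimum is taken
    over a set that is bounded below.\<close>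
  have "- q (- x) \<le> q (x + t *\<^sub>R y) - t * q y" if "t \<ge> 0" for x t
    using sub[of "x + t *\<^sub>R y" "- x"] sublinear_scale[OF q that, of y] by simp
  then have bdd: "bdd_below ((\<lambda>t. q (x + t *\<^sub>R y) - t * q y) ` {0..})" for x by (auto intro!: bdd_belowI2)
  show le: "sublinear_shift q y x \<le> q (x + t *\<^sub>R y) - t * q y" if "t \<ge> 0" for x t
    unfolding sublinear_shift_def by (rule cINF_lower[OF bdd]) (use that in auto)
  have "sublinear_shift q y (a + b) \<le> sublinear_shift q y a + sublinear_shift q y b" for a b
  proof -
    have k: "sublinear_shift q y (a + b) \<le> (q (a + s *\<^sub>R y) - s * q y) + (q (b + t *\<^sub>R y) - t * q y)"
      if "s \<ge> 0" "t \<ge> 0" for s t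
    proof -
      have "a + b + (s + t) *\<^sub>R y = (a + s *\<^sub>R y) + (b + t *\<^sub>R y)" by (simp add: algebra_simps)
      then have "q (a + b + (s + t) *\<^sub>R y) \<le> q (a + s *\<^sub>R y) + q (b + t *\<^sub>R y)" using sub by metis
      then show ?thesis using le[of "s + t" "a + b"] that by (simp add: algebra_simps)
    qed
    have "sublinear_shift q y (a + b) - (q (a + s *\<^sub>R y) - s * q y) \<le> sublinear_shift q y b" if "s \<ge> 0" for s
      unfolding sublinear_shift_def[of q y b] by (rule cINF_greatest) (use k[OF that] in \<open>auto simp: algebra_simps\<close>)
    then have "sublinear_shift q y (a + b) - sublinear_shift q y b \<le> sublinear_shift q y a"
      unfolding sublinear_shift_def[of q y a] by (intro cINF_greatest) (auto simp: algebra_simps)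
    then show ?thesis by simp
  qed
  moreover have "sublinear_shift q y (r *\<^sub>R x) \<le> r * sublinear_shift q y x" if "r > 0" for r x
  proof -
    have "sublinear_shift q y (r *\<^sub>R x) / r \<le> q (x + t *\<^sub>R y) - t * q y" if "t \<ge> 0" for t
    proof -
      have "q (r *\<^sub>R x + (r * t) *\<^sub>R y) = r * q (x + t *\<^sub>R y)"
        using sublinear_scale[OF q, of r "x + t *\<^sub>R y"] \<open>r > 0\<close> by (simp add: algebra_simps)
      then show ?thesis using le[of "r * t" "r *\<^sub>R x"] that \<open>r > 0\<close> by (simp add: field_simps)
    qed
    then have "sublinear_shift q y (r *\<^sub>R x) / r \<le> sublinear_shift q y x"
      unfolding sublinear_shift_def[of q y x] by (intro cINF_greatest) auto
    then show ?thesis using that by (simp add: field_simps)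
  qed
  ultimately show "sublinear (sublinear_shift q y)" unfolding sublinear_def by blast
qed

text \<open>The lower bound \<open>- p (- x)\<close>, common to the whole chain, keeps the infimum
  finite. Subadditivity uses comparability: the smaller of two members estimates both
  summands.\<close>

lemma sublinear_chain_INF:
  assumes ne: "C \<noteq> {}" and C: "\<And>q. q \<in> C \<Longrightarrow> sublinear q \<and> q \<le> p"
    and ch: "\<And>q r. q \<in> C \<Longrightarrow> r \<in> C \<Longrightarrow> q \<le> r \<or> r \<le> q"
  shows "sublinear (\<lambda>x. INF q\<in>C. q x)" "q \<in> C \<Longrightarrow> (INF q\<in>C. q x) \<le> q x"
proof -
  let ?u = "\<lambda>x. INF q\<in>C. q x"
  have "- p (- x) \<le> q x" if "q \<in> C" for q x
    using sublinear_lower[of q x] C[OF that] by (smt (verit) le_funD)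
  then have bdd: "bdd_below ((\<lambda>q. q x) ` C)" for x by (auto intro!: bdd_belowI2)
  show le: "?u x \<le> q x" if "q \<in> C" for q x using cINF_lower[OF bdd that] .
  have "?u (a + b) \<le> ?u a + ?u b" for a b
  proof -
    have k: "?u (a + b) \<le> q a + r b" if qr: "q \<in> C" "r \<in> C" for q r
    proof -
      obtain w where w: "w \<in> C" "w \<le> q" "w \<le> r" using ch[OF qr] qr by blast
      then have "?u (a + b) \<le> w a + w b" using le[OF w(1), of "a + b"] C[OF w(1)] unfolding sublinear_def by (metis order_trans)
      then show ?thesis using w le_funD by (smt (verit))
    qed
    have "?u (a + b) - q a \<le> ?u b" if "q \<in> C" for q
      by (rule cINF_greatest[OF ne]) (use k[OF that] in \<open>auto simp: algebra_simps\<close>)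
    then have "?u (a + b) - ?u b \<le> ?u a" by (intro cINF_greatest[OF ne]) (auto simp: algebra_simps)
    then show ?thesis by simp
  qed
  moreover have "?u (r *\<^sub>R x) \<le> r * ?u x" if "r > 0" for r x
  proof -
    have "?u (r *\<^sub>R x) / r \<le> q x" if "q \<in> C" for q
      using le[OF that, of "r *\<^sub>R x"] sublinear_scale[of q r x] C[OF that] \<open>r > 0\<close> by (simp add: field_simps)
    then have "?u (r *\<^sub>R x) / r \<le> ?u x" by (intro cINF_greatest[OF ne]) auto
    then show ?thesis using that by (simp add: field_simps)
  qed
  ultimately show "sublinear ?u" unfolding sublinear_def by blast
qed

text \<open>A minimal sublinear functional is linear, since its shifts cannot be smaller.\<close>

lemma linear_below_sublinear:
  fixes p :: "'b::real_vector \<Rightarrow> real"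
  assumes p: "sublinear p"
  obtains g where "linear g" "\<And>x. g x \<le> p x"
proof -
  define A where "A = {q. sublinear q \<and> q \<le> p}"
  have pA: "p \<in> A" using p by (simp add: A_def)
  \<comment> \<open>\<open>P\<close> reverses the pointwise order, so the maximal element given by
    Zorn's lemma is a minimal functional.\<close>
  define P where "P = (\<lambda>q r :: 'b \<Rightarrow> real. r \<le> q)"
  have "\<exists>m\<in>A. \<forall>a\<in>A. P m a \<longrightarrow> a = m"
  proof (rule predicate_Zorn)
    show "partial_order_on A (relation_of P A)"
      by (rule partial_order_on_relation_ofI) (auto simp: P_def)
    show "\<exists>u\<in>A. \<forall>a\<in>C. P a u" if "C \<in> Chains (relation_of P A)" for C
    proof (cases "C = {}")
      case True
      then show ?thesis using pA by blast
    next
      case False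
      have C: "\<And>q. q \<in> C \<Longrightarrow> sublinear q \<and> q \<le> p" and ch: "\<And>q r. q \<in> C \<Longrightarrow> r \<in> C \<Longrightarrow> q \<le> r \<or> r \<le> q"
        using that unfolding Chains_def relation_of_def A_def P_def by blast+
      have u1: "sublinear (\<lambda>x. INF q\<in>C. q x)"
        by (rule sublinear_chain_INF(1)[OF False, of p]) (use C ch in blast)+
      have u2: "(INF q\<in>C. q x) \<le> r x" if "r \<in> C" for r x
        by (rule sublinear_chain_INF(2)[OF False, of p]) (use C ch that in blast)+
      obtain q0 where "q0 \<in> C" using False by blast
      then have "(\<lambda>x. INF q\<in>C. q x) \<in> A" using u1 u2[of q0] C[of q0] unfolding A_def le_fun_def
        by (auto intro: order_trans)
      then show ?thesis using u2 unfolding P_def le_fun_def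
        by (intro bexI[of _ "\<lambda>x. INF q\<in>C. q x"]) auto
    qed
  qed
  then obtain m where m: "m \<in> A" "\<And>a. a \<in> A \<Longrightarrow> a \<le> m \<Longrightarrow> a = m" unfolding P_def by blast
  have ms: "sublinear m" and mp: "m \<le> p" using m(1) by (auto simp: A_def)
  have "sublinear_shift m y = m" for y
  proof -
    have "sublinear_shift m y x \<le> m x" for x using sublinear_shift(2)[OF ms, of 0 y x] by simp
    then have le: "sublinear_shift m y \<le> m" by (rule le_funI)
    then show ?thesis using m(2) sublinear_shift(1)[OF ms] mp order_trans unfolding A_def by blast
  qed
  then have "m x + m y \<le> m (x + y)" for x y using sublinear_shift(2)[OF ms, of 1 y x] by simp
  moreover have "m (x + y) \<le> m x + m y" for x y using ms unfolding sublinear_def by blast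
  ultimately have add: "m (x + y) = m x + m y" for x y by (meson antisym)
  have neg: "m (- x) = - m x" for x using add[of x "-x"] sublinear_zero[OF ms] by simp
  have "m (r *\<^sub>R x) = r * m x" for r x
  proof (cases "r \<ge> 0")
    case False
    then show ?thesis using sublinear_scale[OF ms, of "-r" x] neg[of "r *\<^sub>R x"] by simp
  qed (rule sublinear_scale[OF ms])
  then have "linear m" using add by (intro linearI) auto
  then show ?thesis using that mp by (meson le_funD)
qed

text \<open>Domination by the shift of the norm at \<open>z\<close> takes the place of an extension
  from the line through \<open>z\<close>: it forces \<open>g (- z) \<le> - norm z\<close>, hence
  equality.\<close>

theorem norming_functional:
  fixes z :: "'b::real_normed_vector"
  obtains g where "linear g" "\<And>x. \<bar>g x\<bar> \<le> norm x" "g z = norm z"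
proof -
  have s: "sublinear (norm :: 'b \<Rightarrow> real)" unfolding sublinear_def by (auto simp: norm_triangle_ineq)
  obtain g where g: "linear g" "\<And>x. g x \<le> sublinear_shift norm z x"
    using linear_below_sublinear[OF sublinear_shift(1)[OF s]] by blast
  have le: "g x \<le> norm x" for x using g(2)[of x] sublinear_shift(2)[OF s, of 0 z x] by simp
  have n: "g (- x) = - g x" for x using g(1) by (rule linear_neg)
  have "g (- z) \<le> - norm z" using g(2)[of "-z"] sublinear_shift(2)[OF s, of 1 z "-z"] by simp
  then have "g z = norm z" using n[of z] le[of z] by simp
  moreover have "\<bar>g x\<bar> \<le> norm x" for x using le[of x] le[of "-x"] n[of x] by simp
  ultimately show ?thesis using that g(1) by blast
qed

lemma mult_cnj_cmod: "z * cnj z = complex_of_real ((cmod z)\<^sup>2)"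
  by (simp only: complex_norm_square)

section \<open>Semi-inner products and Hilbert spaces\<close>

text \<open>Degenerate forms on incomplete spaces are allowed, so that one Gram--Schmidt process
  serves both Hilbert spaces and the forms that states induce on the algebra.\<close>

locale semi_inner =
  fixes B :: "'v::cvec \<Rightarrow> 'v \<Rightarrow> complex"
  assumes add_right: "B x (y + z) = B x y + B x z"
    and scale_right: "B x (c *\<^sub>C y) = c * B x y"
    and herm: "B y x = cnj (B x y)"
    and nonneg: "0 \<le> Re (B x x)"
begin

definition q :: "'v \<Rightarrow> real" where "q x = Re (B x x)"

lemma q_ge_0: "0 \<le> q x" by (simp add: q_def nonneg)

lemma B_self: "B x x = complex_of_real (q x)"
  using herm[of x x] by (simp add: q_def complex_eq_iff)

lemma add_left: "B (x + y) z = B x z + B y z"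
  by (metis add_right herm complex_cnj_add)

lemma scale_left: "B (c *\<^sub>C x) y = cnj c * B x y"
  by (metis scale_right herm complex_cnj_mult)

lemma zero_right [simp]: "B x 0 = 0" using scale_right[of x 0 0] by simp
lemma zero_left [simp]: "B 0 x = 0" using scale_left[of 0 0 x] by simp
lemma minus_right: "B x (- y) = - B x y" using scale_right[of x "-1" y] by (simp add: scaleC_minus_one)
lemma minus_left: "B (- x) y = - B x y" using scale_left[of "-1" x y] by (simp add: scaleC_minus_one)
lemma diff_right: "B x (y - z) = B x y - B x z" using add_right[of x y "-z"] by (simp add: minus_right)
lemma diff_left: "B (x - y) z = B x z - B y z" using add_left[of x "-y" z] by (simp add: minus_left)
lemma sum_right: "B x (sum f A) = (\<Sum>a\<in>A. B x (f a))"
  by (induction A rule: infinite_finite_induct) (auto simp: add_right)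
lemma sum_left: "B (sum f A) x = (\<Sum>a\<in>A. B (f a) x)"
  by (induction A rule: infinite_finite_induct) (auto simp: add_left)

lemma q_zero [simp]: "q 0 = 0" by (simp add: q_def)

lemma q_add: "q (x + y) = q x + 2 * Re (B x y) + q y"
  using herm[of x y] by (simp add: q_def add_left add_right)

lemma q_diff: "q (x - y) = q x - 2 * Re (B x y) + q y"
  using herm[of x y] by (simp add: q_def diff_left diff_right)

lemma q_scale: "q (c *\<^sub>C x) = (cmod c)\<^sup>2 * q x"
proof -
  have "B (c *\<^sub>C x) (c *\<^sub>C x) = (c * cnj c) * B x x" by (simp add: scale_left scale_right)
  then have "B (c *\<^sub>C x) (c *\<^sub>C x) = complex_of_real ((cmod c)\<^sup>2 * q x)"
    by (simp add: B_self mult_cnj_cmod)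
  then show ?thesis unfolding q_def[of "c *\<^sub>C x"] by simp
qed

lemma cauchy_schwarz: "(cmod (B x y))\<^sup>2 \<le> q x * q y"
proof (cases "B x y = 0")
  case True
  then show ?thesis by (simp add: q_ge_0)
next
  case False
  define b where "b = (cmod (B x y))\<^sup>2"
  have b: "b > 0" using False by (simp add: b_def)
  have main: "0 \<le> q x + 2 * t * b + t\<^sup>2 * b * q y" for t :: real
  proof -
    \<comment> \<open>The factor \<open>cnj (B x y)\<close> makes the cross term real; it becomes
      \<open>2 t |B x y|^2\<close>.\<close>
    let ?c = "complex_of_real t * cnj (B x y)"
    have "B x (?c *\<^sub>C y) = complex_of_real t * (B x y * cnj (B x y))" by (simp add: scale_right)
    then have "Re (B x (?c *\<^sub>C y)) = t * b" by (simp add: mult_cnj_cmod b_def)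
    moreover have "q (?c *\<^sub>C y) = t\<^sup>2 * b * q y" by (simp add: q_scale norm_mult power_mult_distrib b_def)
    ultimately show ?thesis using q_add[of x "?c *\<^sub>C y"] q_ge_0[of "x + ?c *\<^sub>C y"] by simp
  qed
  show ?thesis
  proof (cases "q y = 0")
    case True
    \<comment> \<open>Without a quadratic term the bound is affine in \<open>t\<close>, and this
      \<open>t\<close> makes its value \<open>- 1\<close>.\<close>
    have "0 \<le> q x + 2 * (- (q x + 1) / (2 * b)) * b" using main[of "- (q x + 1) / (2 * b)"] True by simp
    then show ?thesis using b by (simp add: field_simps)
  next
    case False
    then have y: "q y > 0" using q_ge_0[of y] by simp
    have "0 \<le> q x + 2 * (- 1 / q y) * b + (- 1 / q y)\<^sup>2 * b * q y" by (rule main)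
    also have "\<dots> = q x - b / q y" using y by (simp add: field_simps power2_eq_square)
    finally show ?thesis using y by (simp add: field_simps b_def)
  qed
qed

lemma cauchy_schwarz_sqrt: "cmod (B x y) \<le> sqrt (q x) * sqrt (q y)"
  using cauchy_schwarz[of x y] by (metis real_le_rsqrt real_sqrt_mult)

lemma sqrt_q_triangle: "sqrt (q (x + y)) \<le> sqrt (q x) + sqrt (q y)"
proof (rule real_le_lsqrt)
  have "Re (B x y) \<le> sqrt (q x) * sqrt (q y)"
    using cauchy_schwarz_sqrt[of x y] complex_Re_le_cmod[of "B x y"] by linarith
  then show "q (x + y) \<le> (sqrt (q x) + sqrt (q y))\<^sup>2"
    by (simp add: q_add power2_sum q_ge_0)
qed (simp add: q_ge_0)

lemma polarization:
  "4 * B x y = of_real (q (x + y)) - of_real (q (x - y))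
     - \<i> * (of_real (q (x + \<i> *\<^sub>C y)) - of_real (q (x - \<i> *\<^sub>C y)))"
  by (simp add: q_add q_diff q_scale scale_right complex_eq_iff)

text \<open>Zero entries are permitted, so that Gram--Schmidt keeps the numbering of a linearly
  dependent sequence.\<close>

definition orthsys :: "(nat \<Rightarrow> 'v) \<Rightarrow> bool" where
  "orthsys e \<longleftrightarrow> (\<forall>i j. i \<noteq> j \<longrightarrow> B (e i) (e j) = 0) \<and> (\<forall>i. e i = 0 \<or> B (e i) (e i) = 1)"

definition normalize_vec :: "'v \<Rightarrow> 'v" where
  "normalize_vec u = (if q u = 0 then 0 else complex_of_real (1 / sqrt (q u)) *\<^sub>C u)"

fun gram_schmidt :: "(nat \<Rightarrow> 'v) \<Rightarrow> nat \<Rightarrow> 'v" where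
  "gram_schmidt v k = normalize_vec (v k - (\<Sum>j<k. B (gram_schmidt v j) (v k) *\<^sub>C gram_schmidt v j))"

declare gram_schmidt.simps [simp del]

definition resid :: "(nat \<Rightarrow> 'v) \<Rightarrow> nat \<Rightarrow> 'v \<Rightarrow> 'v" where
  "resid e N x = x - (\<Sum>j<N. B (e j) x *\<^sub>C e j)"

lemma gram_schmidt_resid: "gram_schmidt v k = normalize_vec (resid (gram_schmidt v) k (v k))"
  by (subst gram_schmidt.simps) (simp add: resid_def)

lemma normalize_vec_cases: "normalize_vec u = 0 \<or> B (normalize_vec u) (normalize_vec u) = 1"
proof (cases "q u = 0")
  case False
  then have "q u > 0" using q_ge_0[of u] by simp
  then have "q (normalize_vec u) = 1" using False
    by (simp add: normalize_vec_def q_scale norm_divide power_divide)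
  then show ?thesis by (simp add: B_self)
qed (simp add: normalize_vec_def)

lemma resid_orth:
  assumes "i < N" "\<And>i j. i < N \<Longrightarrow> j < N \<Longrightarrow> i \<noteq> j \<Longrightarrow> B (e i) (e j) = 0"
    "\<And>i. i < N \<Longrightarrow> e i = 0 \<or> B (e i) (e i) = 1"
  shows "B (e i) (resid e N x) = 0"
proof -
  have "(\<Sum>j<N. B (e j) x * B (e i) (e j)) = (\<Sum>j<N. if j = i then B (e i) x else 0)"
    using assms by (intro sum.cong refl) (auto, metis zero_left mult_zero_left mult_1_right)
  then show ?thesis using assms(1) by (simp add: resid_def diff_right sum_right scale_right)
qed

lemma orthsys_gram_schmidt: "orthsys (gram_schmidt v)"
proof -
  let ?e = "gram_schmidt v"
  have n: "?e i = 0 \<or> B (?e i) (?e i) = 1" for i using normalize_vec_cases gram_schmidt_resid by metis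
  have o: "\<forall>i<N. \<forall>j<N. i \<noteq> j \<longrightarrow> B (?e i) (?e j) = 0" for N
  proof (induction N)
    case (Suc N)
    have z: "B (?e i) (?e N) = 0" if "i < N" for i
    proof -
      have "B (?e i) (resid ?e N (v N)) = 0" by (rule resid_orth) (use that Suc n in auto)
      then show ?thesis unfolding gram_schmidt_resid[of v N] normalize_vec_def by (simp add: scale_right)
    qed
    have "B (?e N) (?e i) = 0" if "i < N" for i using z[OF that] herm by (metis complex_cnj_zero)
    then show ?case using z Suc by (auto simp: less_Suc_eq)
  qed simp
  have "B (?e i) (?e j) = 0" if "i \<noteq> j" for i j
    using o[of "Suc (max i j)"] that by (simp add: less_Suc_eq_le)
  then show ?thesis using n unfolding orthsys_def by blast
qed

lemma resid_Suc: "resid e (Suc N) x = resid e N x - B (e N) x *\<^sub>C e N"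
  by (simp add: resid_def)

lemma orthsys_B_resid:
  assumes "orthsys e"
  shows "B (e N) (resid e N x) = B (e N) x"
proof -
  have "(\<Sum>j<N. B (e j) x * B (e N) (e j)) = 0"
    using assms by (intro sum.neutral) (auto simp: orthsys_def)
  then show ?thesis by (simp add: resid_def diff_right sum_right scale_right)
qed

lemma bessel_identity:
  assumes "orthsys e"
  shows "q (resid e N x) = q x - (\<Sum>j<N. (cmod (B (e j) x))\<^sup>2)"
proof (induction N)
  case 0
  then show ?case by (simp add: resid_def)
next
  case (Suc N)
  define b where "b = B (e N) x"
  have "q (resid e N x - b *\<^sub>C e N) = q (resid e N x) - (cmod b)\<^sup>2"
  proof (cases "e N = 0")
    case True
    then show ?thesis by (simp add: b_def)
  next
    case False
    then have "q (e N) = 1" using assms by (metis q_def orthsys_def one_complex.sel(1))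
    moreover have "B (resid e N x) (e N) = cnj b" using orthsys_B_resid[OF assms, of N x] herm by (metis b_def)
    then have "Re (B (resid e N x) (b *\<^sub>C e N)) = (cmod b)\<^sup>2"
      by (simp add: scale_right mult_cnj_cmod flip: of_real_power)
    ultimately show ?thesis by (simp add: q_diff q_scale)
  qed
  then show ?case using Suc by (simp add: resid_Suc b_def)
qed

lemma bessel: "orthsys e \<Longrightarrow> (\<Sum>j<N. (cmod (B (e j) x))\<^sup>2) \<le> q x"
  using bessel_identity[of e N x] q_ge_0[of "resid e N x"] by simp

lemma bessel_summable: "orthsys e \<Longrightarrow> summable (\<lambda>j. (cmod (B (e j) x))\<^sup>2)"
  by (rule summableI_nonneg_bounded[of _ "q x"]) (auto simp: bessel)

lemma resid_mono: "orthsys e \<Longrightarrow> M \<le> N \<Longrightarrow> q (resid e N x) \<le> q (resid e M x)"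
  by (simp add: bessel_identity) (rule sum_mono2, auto)

text \<open>In a degenerate form a vector lies in the span of its Gram--Schmidt system only up to a
  null vector. If the residual at step \<open>k\<close> is null, the new system vector is
  \<open>0\<close>; otherwise subtracting its component removes the residual completely.\<close>

lemma gram_schmidt_resid_null: "q (resid (gram_schmidt v) (Suc k) (v k)) = 0"
proof -
  let ?e = "gram_schmidt v" let ?u = "resid ?e k (v k)"
  have e: "?e k = normalize_vec ?u" by (rule gram_schmidt_resid)
  show ?thesis
  proof (cases "q ?u = 0")
    case True
    then have "?e k = 0" by (simp add: e normalize_vec_def)
    then show ?thesis using True by (simp add: resid_Suc)
  next
    case False
    then have pos: "q ?u > 0" using q_ge_0[of ?u] by simp
    have "B (?e k) (v k) = B (?e k) ?u" using orthsys_B_resid[OF orthsys_gram_schmidt] by simp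
    also have "\<dots> = complex_of_real (1 / sqrt (q ?u)) * complex_of_real (q ?u)"
      using False by (simp add: e normalize_vec_def scale_left B_self)
    finally have "B (?e k) (v k) *\<^sub>C ?e k = ?u" using False pos
      by (simp add: e normalize_vec_def scaleC_scaleC scaleC_one flip: of_real_mult)
    then show ?thesis by (simp add: resid_Suc)
  qed
qed

lemma resid_diff: "resid e N (x - y) = resid e N x - resid e N y"
proof -
  have "(\<Sum>j<N. B (e j) (x - y) *\<^sub>C e j) = (\<Sum>j<N. B (e j) x *\<^sub>C e j) - (\<Sum>j<N. B (e j) y *\<^sub>C e j)"
    unfolding sum_subtractf[symmetric]
    by (intro sum.cong refl) (metis diff_right scaleC_add_left diff_add_cancel add_diff_cancel_right')
  then show ?thesis by (simp add: resid_def)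
qed

text \<open>By Bessel's identity the defect of the partial sums is \<open>q\<close> of the residual.
  The residual of \<open>v k\<close> is null after stage \<open>k\<close>, and taking residuals does
  not increase \<open>q\<close>; hence the defect at \<open>x\<close> is eventually at most
  \<open>q (x - v k)\<close>.\<close>

lemma parseval:
  assumes dense: "\<And>x r. r > 0 \<Longrightarrow> \<exists>k. q (x - v k) < r"
  shows "(\<lambda>j. (cmod (B (gram_schmidt v j) x))\<^sup>2) sums q x"
proof -
  let ?e = "gram_schmidt v"
  have o: "orthsys ?e" by (rule orthsys_gram_schmidt)
  have "\<bar>(\<Sum>j<N. (cmod (B (?e j) x))\<^sup>2) - q x\<bar> = q (resid ?e N x)" for N
    using bessel_identity[OF o, of N x] q_ge_0[of "resid ?e N x"] by simp
  moreover have "\<exists>M. \<forall>N\<ge>M. q (resid ?e N x) < r" if "r > 0" for r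
  proof -
    obtain k where k: "q (x - v k) < r" using dense[OF \<open>r > 0\<close>] by blast
    have "q (resid ?e N x) < r" if "N \<ge> Suc k" for N
    proof -
      have "q (resid ?e N (v k)) = 0"
        using resid_mono[OF o that, of "v k"] gram_schmidt_resid_null[of v k] q_ge_0[of "resid ?e N (v k)"] by simp
      then have "sqrt (q (resid ?e N x)) \<le> sqrt (q (resid ?e N (x - v k)))"
        using sqrt_q_triangle[of "resid ?e N (x - v k)" "resid ?e N (v k)"] by (simp add: resid_diff)
      moreover have "q (resid ?e N (x - v k)) \<le> q (x - v k)"
        using resid_mono[OF o, of 0 N "x - v k"] by (simp add: resid_def)
      ultimately show ?thesis using k by simp
    qed
    then show ?thesis by blast
  qed
  ultimately show ?thesis unfolding sums_def LIMSEQ_iff real_norm_def by metis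
qed

end

interpretation hil: semi_inner "cinner :: 'h::chilbert \<Rightarrow> 'h \<Rightarrow> complex"
proof
  fix x y z :: 'h and c
  show "cinner y x = cnj (cinner x y)" by (rule cinner_commute)
  show "cinner x (y + z) = cinner x y + cinner x z"
    by (metis cinner_add_left cinner_commute complex_cnj_add)
  show "cinner x (c *\<^sub>C y) = c * cinner x y"
    by (metis cinner_scaleC_left cinner_commute complex_cnj_mult complex_cnj_cnj)
  show "0 \<le> Re (cinner x x)" by (simp add: cinner_self_norm)
qed

lemma hil_q: "hil.q x = (norm x)\<^sup>2"
  by (simp add: hil.q_def cinner_self_norm)

lemma cinner_eq_0: "cinner x x = 0 \<longleftrightarrow> x = (0::'h::chilbert)"
  by (simp add: cinner_self_norm)

lemma norm_cinner_le: "cmod (cinner x y) \<le> norm x * norm (y::'h::chilbert)"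
  using hil.cauchy_schwarz_sqrt[of x y] by (simp add: hil_q)

lemma chilbert_norm_scaleC: "norm (c *\<^sub>C x) = cmod c * norm (x::'h::chilbert)"
proof -
  have "(norm (c *\<^sub>C x))\<^sup>2 = (cmod c * norm x)\<^sup>2"
    using hil.q_scale[of c x] by (simp add: hil_q power_mult_distrib)
  then show ?thesis by (simp add: power2_eq_iff_nonneg)
qed

lemma bounded_bilinear_cinner: "bounded_bilinear (cinner :: 'h::chilbert \<Rightarrow> 'h \<Rightarrow> complex)"
proof (rule bounded_bilinear.intro)
  show "\<exists>K. \<forall>a b::'h. norm (cinner a b) \<le> norm a * norm b * K"
    by (rule exI[of _ 1]) (simp add: norm_cinner_le)
qed (auto simp: hil.add_left hil.add_right scaleR_scaleC hil.scale_left hil.scale_right scaleR_conv_of_real)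

lemmas tendsto_cinner = bounded_bilinear.tendsto[OF bounded_bilinear_cinner]
lemmas bounded_linear_cinner_right = bounded_bilinear.bounded_linear_right[OF bounded_bilinear_cinner]

lemma tendsto_scaleC: "(f \<longlongrightarrow> (l::'h::chilbert)) F \<Longrightarrow> ((\<lambda>n. c *\<^sub>C f n) \<longlongrightarrow> c *\<^sub>C l) F"
proof -
  have "bounded_linear (\<lambda>x::'h. c *\<^sub>C x)"
    by (rule bounded_linear_intro[of _ "cmod c"])
       (auto simp: scaleC_add_right scaleC_scaleR chilbert_norm_scaleC mult.commute)
  then show "(f \<longlongrightarrow> l) F \<Longrightarrow> ((\<lambda>n. c *\<^sub>C f n) \<longlongrightarrow> c *\<^sub>C l) F" by (rule bounded_linear.tendsto)
qed

section \<open>Closed subspaces and orthogonal series\<close>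

definition csubspace :: "'v::cvec set \<Rightarrow> bool" where
  "csubspace M \<longleftrightarrow> 0 \<in> M \<and> (\<forall>x\<in>M. \<forall>y\<in>M. x + y \<in> M) \<and> (\<forall>c. \<forall>x\<in>M. c *\<^sub>C x \<in> M)"

lemma csubspace_add: "csubspace M \<Longrightarrow> x \<in> M \<Longrightarrow> y \<in> M \<Longrightarrow> x + y \<in> M"
  and csubspace_scaleC: "csubspace M \<Longrightarrow> x \<in> M \<Longrightarrow> c *\<^sub>C x \<in> M"
  and csubspace_zero: "csubspace M \<Longrightarrow> 0 \<in> M"
  by (auto simp: csubspace_def)

lemma csubspace_sum: "csubspace M \<Longrightarrow> (\<And>a. a \<in> A \<Longrightarrow> f a \<in> M) \<Longrightarrow> sum f A \<in> M"
  by (induction A rule: infinite_finite_induct) (auto simp: csubspace_def)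

lemma csubspace_diff: "csubspace M \<Longrightarrow> x \<in> M \<Longrightarrow> y \<in> M \<Longrightarrow> x - y \<in> M"
  using csubspace_add[of M x "(-1) *\<^sub>C y"] csubspace_scaleC[of M y "-1"] by (simp add: scaleC_minus_one)

lemma csubspace_Inter: "(\<And>M. M \<in> F \<Longrightarrow> csubspace M) \<Longrightarrow> csubspace (\<Inter>F)"
  by (auto simp: csubspace_def)

definition closed_csubspace :: "'h::chilbert set \<Rightarrow> bool" where
  "closed_csubspace M \<longleftrightarrow> csubspace M \<and> closed M"

definition closed_span :: "'h::chilbert set \<Rightarrow> 'h set" where
  "closed_span S = \<Inter>{M. closed_csubspace M \<and> S \<subseteq> M}"

lemma closed_csubspace_closed_span: "closed_csubspace (closed_span S)"
  unfolding closed_span_def closed_csubspace_def by (auto intro!: csubspace_Inter closed_Inter)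

lemma closed_span_superset: "S \<subseteq> closed_span S"
  by (auto simp: closed_span_def)

lemma closed_span_minimal: "closed_csubspace M \<Longrightarrow> S \<subseteq> M \<Longrightarrow> closed_span S \<subseteq> M"
  by (auto simp: closed_span_def)

lemma closed_csubspace_lim:
  "closed_csubspace M \<Longrightarrow> (\<And>n. f n \<in> M) \<Longrightarrow> f \<longlonglongrightarrow> l \<Longrightarrow> l \<in> M"
  unfolding closed_csubspace_def using closed_sequentially by blast

lemma closed_csubspace_orth: "closed_csubspace {y. cinner x y = 0}"
proof -
  have "closed {y. cinner x y = 0}"
    by (intro closed_Collect_eq continuous_intros linear_continuous_on bounded_linear_cinner_right)
  then show ?thesis by (auto simp: closed_csubspace_def csubspace_def hil.add_right hil.scale_right)
qed

lemma orthsys_norm_sum: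
  fixes e :: "nat \<Rightarrow> 'h::chilbert"
  assumes "hil.orthsys e" "finite F"
  shows "(norm (\<Sum>j\<in>F. c j *\<^sub>C e j))\<^sup>2 \<le> (\<Sum>j\<in>F. (cmod (c j))\<^sup>2)"
  using assms(2)
proof (induction F rule: finite_induct)
  case (insert a F)
  have "cinner (c a *\<^sub>C e a) (\<Sum>j\<in>F. c j *\<^sub>C e j) = (\<Sum>j\<in>F. cnj (c a) * (c j * cinner (e a) (e j)))"
    by (simp add: hil.sum_right hil.scale_left hil.scale_right mult_ac)
  also have "\<dots> = 0"
  proof (intro sum.neutral ballI)
    fix j assume "j \<in> F"
    then have "cinner (e a) (e j) = 0" using assms(1) insert(2) unfolding hil.orthsys_def by metis
    then show "cnj (c a) * (c j * cinner (e a) (e j)) = 0" by simp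
  qed
  finally have "(norm (c a *\<^sub>C e a + (\<Sum>j\<in>F. c j *\<^sub>C e j)))\<^sup>2
      = (norm (c a *\<^sub>C e a))\<^sup>2 + (norm (\<Sum>j\<in>F. c j *\<^sub>C e j))\<^sup>2"
    using hil.q_add[of "c a *\<^sub>C e a" "\<Sum>j\<in>F. c j *\<^sub>C e j"] by (simp add: hil_q)
  moreover have "norm (e a) \<le> 1"
  proof (cases "e a = 0")
    case False
    then have "cinner (e a) (e a) = 1" using assms(1) by (auto simp: hil.orthsys_def)
    then have "complex_of_real ((norm (e a))\<^sup>2) = 1" by (simp only: cinner_self_norm)
    then show ?thesis by (metis of_real_eq_1_iff abs_norm_cancel power2_eq_1_iff abs_1 abs_minus_cancel order_refl)
  qed simp
  then have "norm (c a *\<^sub>C e a) \<le> cmod (c a)" by (simp add: chilbert_norm_scaleC mult_left_le)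
  then have "(norm (c a *\<^sub>C e a))\<^sup>2 \<le> (cmod (c a))\<^sup>2" by (rule power_mono) simp
  ultimately have "(norm (c a *\<^sub>C e a + (\<Sum>j\<in>F. c j *\<^sub>C e j)))\<^sup>2 \<le> (cmod (c a))\<^sup>2 + (\<Sum>j\<in>F. (cmod (c j))\<^sup>2)"
    using insert(3) by linarith
  then show ?case by (simp only: sum.insert[OF insert(1,2)])
qed simp

lemma orthsys_summable:
  fixes e :: "nat \<Rightarrow> 'h::chilbert"
  assumes o: "hil.orthsys e" and s: "summable (\<lambda>j. (cmod (c j))\<^sup>2)"
  shows "summable (\<lambda>j. c j *\<^sub>C e j)"
  unfolding summable_Cauchy
proof (intro allI impI)
  fix r :: real assume r: "r > 0"
  then obtain N where N: "\<And>m n. m \<ge> N \<Longrightarrow> norm (\<Sum>j=m..<n. (cmod (c j))\<^sup>2) < r\<^sup>2"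
    using s unfolding summable_Cauchy by (meson zero_less_power)
  have "norm (\<Sum>j=m..<n. c j *\<^sub>C e j) < r" if "m \<ge> N" for m n
  proof -
    have "(norm (\<Sum>j=m..<n. c j *\<^sub>C e j))\<^sup>2 < r\<^sup>2"
      using orthsys_norm_sum[OF o, of "{m..<n}" c] N[OF that, of n] by simp
    then show ?thesis by (rule power2_less_imp_less) (use r in simp)
  qed
  then show "\<exists>N. \<forall>m\<ge>N. \<forall>n. norm (\<Sum>j=m..<n. c j *\<^sub>C e j) < r" by blast
qed

lemma orthsys_cinner_suminf:
  fixes e :: "nat \<Rightarrow> 'h::chilbert"
  assumes o: "hil.orthsys e" and s: "summable (\<lambda>j. (cmod (c j))\<^sup>2)"
  shows "cinner (e i) (\<Sum>j. c j *\<^sub>C e j) = c i * cinner (e i) (e i)"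
proof -
  have "(\<lambda>j. cinner (e i) (c j *\<^sub>C e j)) sums cinner (e i) (\<Sum>j. c j *\<^sub>C e j)"
    by (rule bounded_linear.sums[OF bounded_linear_cinner_right]) (rule summable_sums[OF orthsys_summable[OF o s]])
  moreover have "(\<lambda>j. cinner (e i) (c j *\<^sub>C e j)) = (\<lambda>j. if j = i then c i * cinner (e i) (e i) else 0)"
    using o by (auto simp: hil.orthsys_def hil.scale_right)
  ultimately show ?thesis using sums_single[of i "\<lambda>_. c i * cinner (e i) (e i)"] sums_unique2 by simp blast
qed

text \<open>The projection is the Fourier series of \<open>d\<close> in the Gram--Schmidt system of
  \<open>v\<close>. Orthogonality to the system passes to \<open>v\<close> because the inner product
  is definite, so that each \<open>v k\<close> equals its finite expansion.\<close>

theorem orthogonal_projection: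
  fixes v :: "nat \<Rightarrow> 'h::chilbert"
  obtains p where "p \<in> closed_span (range v)" "\<And>k. cinner (v k) (d - p) = 0"
proof -
  let ?e = "hil.gram_schmidt v"
  have o: "hil.orthsys ?e" by (rule hil.orthsys_gram_schmidt)
  note cs = closed_csubspace_closed_span[of "range v"]
  then have css: "csubspace (closed_span (range v))" by (simp add: closed_csubspace_def)
  have "\<forall>j<N. ?e j \<in> closed_span (range v)" for N
  proof (induction N)
    case (Suc N)
    have "v N \<in> closed_span (range v)" using closed_span_superset[of "range v"] by auto
    moreover have "(\<Sum>j<N. cinner (?e j) (v N) *\<^sub>C ?e j) \<in> closed_span (range v)"
      using Suc by (intro csubspace_sum[OF css] csubspace_scaleC[OF css]) auto
    ultimately have "hil.resid ?e N (v N) \<in> closed_span (range v)"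
      unfolding hil.resid_def by (rule csubspace_diff[OF css])
    then have "?e N \<in> closed_span (range v)"
      by (subst hil.gram_schmidt_resid) (simp add: hil.normalize_vec_def csubspace_scaleC[OF css] csubspace_zero[OF css])
    then show ?case using Suc by (auto simp: less_Suc_eq)
  qed simp
  then have e: "?e j \<in> closed_span (range v)" for j by blast
  define p where "p = (\<Sum>j. cinner (?e j) d *\<^sub>C ?e j)"
  have s: "summable (\<lambda>j. (cmod (cinner (?e j) d))\<^sup>2)" by (rule hil.bessel_summable[OF o])
  have "(\<lambda>N. \<Sum>j<N. cinner (?e j) d *\<^sub>C ?e j) \<longlonglongrightarrow> p"
    using summable_sums[OF orthsys_summable[OF o s]] by (simp add: sums_def p_def)
  then have 1: "p \<in> closed_span (range v)"
    by (rule closed_csubspace_lim[OF cs, rotated]) (intro csubspace_sum[OF css] csubspace_scaleC[OF css] e)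
  have 2: "cinner (?e i) (d - p) = 0" for i
    using orthsys_cinner_suminf[OF o s, of i] o
    by (cases "?e i = 0") (auto simp: p_def hil.diff_right hil.orthsys_def)
  have "cinner (v k) (d - p) = 0" for k
  proof -
    have "hil.resid ?e (Suc k) (v k) = 0" using hil.gram_schmidt_resid_null[of v k] by (simp add: hil_q)
    then have "v k = (\<Sum>j<Suc k. cinner (?e j) (v k) *\<^sub>C ?e j)" by (simp only: hil.resid_def right_minus_eq)
    then have "cinner (v k) (d - p) = (\<Sum>j<Suc k. cnj (cinner (?e j) (v k)) * cinner (?e j) (d - p))"
      by (metis (no_types, lifting) hil.sum_left hil.scale_left sum.cong)
    then show ?thesis by (simp add: 2)
  qed
  then show ?thesis using that 1 by blast
qed

text \<open>Completeness is encoded as Parseval's identity, which is what Gram--Schmidt on a dense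
  sequence delivers.\<close>

definition onb :: "(nat \<Rightarrow> 'h::chilbert) \<Rightarrow> bool" where
  "onb e \<longleftrightarrow> (\<forall>i j. cinner (e i) (e j) = (if i = j then 1 else 0)) \<and>
     (\<forall>h. (\<lambda>j. (cmod (cinner (e j) h))\<^sup>2) sums (norm h)\<^sup>2)"

lemma onb_orthsys: "onb e \<Longrightarrow> hil.orthsys e"
  by (auto simp: onb_def hil.orthsys_def)

lemma onb_cinner: "onb e \<Longrightarrow> cinner (e i) (e j) = (if i = j then 1 else 0)"
  by (simp add: onb_def)

lemma onb_sums: "onb e \<Longrightarrow> (\<lambda>j. (cmod (cinner (e j) h))\<^sup>2) sums (norm h)\<^sup>2"
  by (simp add: onb_def)

lemma onb_zero: "onb e \<Longrightarrow> (\<And>j. cinner (e j) h = 0) \<Longrightarrow> h = 0"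
  using onb_sums[of e h] sums_unique2[OF _ sums_zero] by fastforce

lemma onb_eqI: "onb e \<Longrightarrow> (\<And>j. cinner (e j) x = cinner (e j) y) \<Longrightarrow> x = y"
  using onb_zero[of e "x - y"] by (simp add: hil.diff_right)

lemma onb_expand: "onb e \<Longrightarrow> (\<lambda>j. cinner (e j) h *\<^sub>C e j) sums h"
proof -
  assume e: "onb e"
  note o = onb_orthsys[OF e] and s = sums_summable[OF onb_sums[OF e, of h]]
  have "h - (\<Sum>j. cinner (e j) h *\<^sub>C e j) = 0"
    by (rule onb_zero[OF e]) (simp add: hil.diff_right orthsys_cinner_suminf[OF o s] onb_cinner[OF e])
  then show ?thesis using summable_sums[OF orthsys_summable[OF o s]] by simp
qed

lemma onb_cinner_sums:
  assumes "onb e"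
  shows "(\<lambda>p. cnj (cinner (e p) x) * cinner (e p) y) sums cinner x y"
proof -
  have "(\<lambda>p. cinner x (cinner (e p) y *\<^sub>C e p)) sums cinner x y"
    by (rule bounded_linear.sums[OF bounded_linear_cinner_right onb_expand[OF assms]])
  moreover have "cinner x (cinner (e p) y *\<^sub>C e p) = cnj (cinner (e p) x) * cinner (e p) y" for p
    by (metis cinner_commute hil.scale_right mult.commute)
  ultimately show ?thesis by simp
qed

lemma onb_closed_span: "onb e \<Longrightarrow> closed_csubspace M \<Longrightarrow> range e \<subseteq> M \<Longrightarrow> h \<in> M"
proof -
  assume a: "onb e" "closed_csubspace M" "range e \<subseteq> M"
  have "(\<lambda>N. \<Sum>j<N. cinner (e j) h *\<^sub>C e j) \<longlonglongrightarrow> h" using onb_expand[OF a(1)] by (simp add: sums_def)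
  then show "h \<in> M"
    by (rule closed_csubspace_lim[OF a(2), rotated])
       (use a in \<open>auto intro!: csubspace_sum csubspace_scaleC simp: closed_csubspace_def\<close>)
qed

text \<open>The Riesz--Fischer theorem: completeness of the space turns square summable coefficients
  into a vector.\<close>

lemma onb_synthesis:
  assumes e: "onb e" and s: "summable (\<lambda>j. (cmod (c j))\<^sup>2)"
  obtains h where "\<And>j. cinner (e j) h = c j" "(norm h)\<^sup>2 = (\<Sum>j. (cmod (c j))\<^sup>2)"
proof -
  define h where "h = (\<Sum>j. c j *\<^sub>C e j)"
  have h: "cinner (e j) h = c j" for j
    using orthsys_cinner_suminf[OF onb_orthsys[OF e] s, of j] onb_cinner[OF e] by (simp add: h_def)
  then show ?thesis using that[of h] onb_sums[OF e, of h] by (simp add: sums_iff)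
qed

text \<open>Deleting the zeros of a Gram--Schmidt system renumbers it; an initial block without
  zeros keeps its numbers.\<close>

lemma enumerate_initial_segment:
  assumes S: "infinite (S :: nat set)" and p: "{..<p} \<subseteq> S" and i: "i < p"
  shows "enumerate S i = i"
  using i
proof (induction i rule: less_induct)
  case (less i)
  then obtain n where n: "enumerate S n = i" using enumerate_Ex[OF S] p by (metis lessThan_iff subsetD)
  have "n \<le> i" using le_enumerate[OF S, of n] n by simp
  then show ?case using less n by (cases "n = i") auto
qed

text \<open>Gram--Schmidt is applied to the prescribed vectors followed by a dense sequence. The
  orthonormal initial block is left fixed, and zeros are discarded by enumerating the nonzero
  positions, of which there are infinitely many in infinite dimension.\<close>

theorem onb_extending:
  fixes e :: "nat \<Rightarrow> 'h::chilbert"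
  assumes sep: "hilbert_separable TYPE('h)" and inf: "infinite_dimensional TYPE('h)"
    and e: "\<And>i j. i < p \<Longrightarrow> j < p \<Longrightarrow> cinner (e i) (e j) = (if i = j then 1 else 0)"
  obtains f where "onb f" "\<And>i. i < p \<Longrightarrow> f i = e i"
proof -
  obtain D :: "'h set" where D: "countable D" "closure D = UNIV" using sep by (auto simp: hilbert_separable_def)
  then have "D \<noteq> {}" by auto
  define v where "v = (\<lambda>k. if k < p then e k else from_nat_into D (k - p))"
  let ?g = "hil.gram_schmidt v"
  have o: "hil.orthsys ?g" by (rule hil.orthsys_gram_schmidt)
  have "\<exists>k. hil.q (x - v k) < r" if r: "r > 0" for x r
  proof -
    have "x \<in> closure D" using D by simp
    then obtain d where d: "d \<in> D" "dist d x < sqrt r" unfolding closure_approachable using real_sqrt_gt_zero[OF r] by blast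
    obtain k where "from_nat_into D k = d" using from_nat_into_surj[OF D(1) d(1)] by blast
    then have "v (p + k) = d" by (simp add: v_def)
    moreover have "hil.q (x - d) < r"
    proof -
      have "norm (x - d) < sqrt r" using d(2) by (simp add: dist_norm norm_minus_commute)
      then have "(norm (x - d))\<^sup>2 < (sqrt r)\<^sup>2" by (rule power_strict_mono) auto
      then show ?thesis using r by (simp add: hil_q)
    qed
    ultimately show ?thesis by blast
  qed
  then have par: "(\<lambda>j. (cmod (cinner (?g j) h))\<^sup>2) sums (norm h)\<^sup>2" for h
    using hil.parseval[of v h] by (simp add: hil_q)
  have gi: "?g k = e k" if "k < p" for k
    using that
  proof (induction k rule: less_induct)
    case (less k)
    have "(\<Sum>j<k. cinner (?g j) (v k) *\<^sub>C ?g j) = 0"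
      using less e by (intro sum.neutral) (auto simp: v_def)
    then have "?g k = hil.normalize_vec (e k)" using less by (subst hil.gram_schmidt.simps) (simp add: v_def)
    then show ?case using e[OF less(2) less(2)] by (simp add: hil.normalize_vec_def hil.q_def scaleC_one)
  qed
  define S where "S = {k. ?g k \<noteq> 0}"
  have S: "infinite S"
  proof
    assume fin: "finite S"
    have "h = (\<Sum>s\<in>?g ` S. cinner s h *\<^sub>C s)" for h
    proof -
      have z: "h - (\<Sum>k\<in>S. cinner (?g k) h *\<^sub>C ?g k) = 0" (is "?z = 0")
      proof -
        have "cinner (?g i) (\<Sum>k\<in>S. cinner (?g k) h *\<^sub>C ?g k) = cinner (?g i) h" for i
        proof (cases "i \<in> S")
          case True
          have "cinner (?g i) (\<Sum>k\<in>S. cinner (?g k) h *\<^sub>C ?g k) = (\<Sum>k\<in>S. if k = i then cinner (?g i) h else 0)"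
            unfolding hil.sum_right hil.scale_right using o True
            by (intro sum.cong refl) (auto simp: hil.orthsys_def S_def)
          then show ?thesis using fin True by simp
        qed (simp add: S_def)
        then have "cinner (?g i) ?z = 0" for i by (simp add: hil.diff_right)
        then show ?thesis using par[of ?z] sums_unique2[OF _ sums_zero] by fastforce
      qed
      have "inj_on ?g S"
        using o by (intro inj_onI) (metis (mono_tags, lifting) S_def hil.orthsys_def mem_Collect_eq zero_neq_one)
      then show ?thesis using z by (simp add: sum.reindex)
    qed
    then have "\<forall>h. \<exists>c. h = (\<Sum>s\<in>?g ` S. c s *\<^sub>C s)" by (intro allI exI)
    moreover have "finite (?g ` S)" using fin by simp
    ultimately show False using inf unfolding infinite_dimensional_def by metis
  qed
  define f where "f = (\<lambda>i. ?g (enumerate S i))"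
  have pS: "{..<p} \<subseteq> S"
  proof
    fix i assume "i \<in> {..<p}"
    then have "i < p" by simp
    then have "cinner (?g i) (?g i) = 1" using gi e by simp
    then show "i \<in> S" unfolding S_def by force
  qed
  have "f i = e i" if "i < p" for i
    using enumerate_initial_segment[OF S pS that] gi that by (simp add: f_def)
  moreover have "onb f"
  proof -
    have sm: "strict_mono (enumerate S)" by (rule strict_mono_enumerate[OF S])
    have "cinner (f i) (f j) = (if i = j then 1 else 0)" for i j
    proof -
      have "enumerate S i \<in> S" by (rule enumerate_in_set[OF S])
      then have nz: "?g (enumerate S i) \<noteq> 0" by (simp add: S_def)
      show ?thesis
      proof (cases "i = j")
        case True
        then show ?thesis using o nz by (auto simp: f_def hil.orthsys_def)
      next
        case False
        then have "enumerate S i \<noteq> enumerate S j" using sm by (simp add: strict_mono_eq)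
        then show ?thesis using o False by (simp add: f_def hil.orthsys_def)
      qed
    qed
    moreover have "(\<lambda>j. (cmod (cinner (f j) h))\<^sup>2) sums (norm h)\<^sup>2" for h
    proof -
      have "(\<lambda>n. (cmod (cinner (?g (enumerate S n)) h))\<^sup>2) sums (norm h)\<^sup>2 \<longleftrightarrow>
          (\<lambda>j. (cmod (cinner (?g j) h))\<^sup>2) sums (norm h)\<^sup>2"
        by (rule sums_mono_reindex[OF sm]) (use range_enumerate[OF S] in \<open>auto simp: S_def\<close>)
      then show ?thesis using par by (simp add: f_def)
    qed
    ultimately show ?thesis by (simp add: onb_def)
  qed
  ultimately show ?thesis using that by blast
qed

corollary onb_exists:
  assumes "hilbert_separable TYPE('h::chilbert)" "infinite_dimensional TYPE('h::chilbert)"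
  obtains f :: "nat \<Rightarrow> 'h::chilbert" where "onb f"
  using onb_extending[OF assms, of 0 undefined] by (metis not_less_zero)

section \<open>Adjoints of bounded operators\<close>

lemma bounded_op_bounded_linear: "bounded_op T \<Longrightarrow> bounded_linear T"
proof -
  assume T: "bounded_op T"
  then obtain K where "\<And>h. norm (T h) \<le> K * norm h" by (auto simp: bounded_op_def)
  then show ?thesis using T unfolding bounded_op_def clinear_map_def
    by (intro bounded_linear_intro[of T K]) (auto simp: scaleR_scaleC mult.commute)
qed

text \<open>Since \<open>cadj\<close> is a definite description, existence has to be shown. The
  coordinates of \<open>y\<close> in a basis are forced to be \<open>cinner (T (e k)) u\<close>; the
  point is their square summability.\<close>

theorem adjoint_exists:
  fixes T :: "'h::chilbert \<Rightarrow> 'h"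
  assumes H: "hilbert_separable TYPE('h)" "infinite_dimensional TYPE('h)" and T: "bounded_op T"
  obtains y where "\<And>v. cinner y v = cinner u (T v)"
proof -
  obtain e :: "nat \<Rightarrow> 'h" where e: "onb e" using onb_exists[OF H] .
  have lin: "T (x + y) = T x + T y" "T (c *\<^sub>C x) = c *\<^sub>C T x" for x y c
    using T by (auto simp: bounded_op_def clinear_map_def)
  have T0: "T 0 = 0" using lin(2)[of 0 0] by simp
  have Tsum: "T (sum f A) = (\<Sum>a\<in>A. T (f a))" for f and A :: "nat set"
    by (induction A rule: infinite_finite_induct) (auto simp: lin T0)
  obtain K where K: "\<And>h. norm (T h) \<le> K * norm h" "K \<ge> 0"
  proof -
    obtain K where "\<And>h. norm (T h) \<le> K * norm h" using T by (auto simp: bounded_op_def)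
    then show ?thesis using that[of "\<bar>K\<bar>"] by (metis abs_ge_self abs_ge_zero mult_right_mono norm_ge_zero order_trans)
  qed
  define c where "c = (\<lambda>k. cinner (T (e k)) u)"
  have bd: "(\<Sum>j<N. (cmod (c j))\<^sup>2) \<le> (K * norm u)\<^sup>2" for N
  proof -
    \<comment> \<open>The partial sum is tested on itself:
      \<open>s = \<langle>T y, u\<rangle>\<close> is at most \<open>K * norm y * norm u\<close>,
      while \<open>norm y \<le> sqrt s\<close>, and therefore
      \<open>sqrt s \<le> K * norm u\<close>.\<close>
    define y where "y = (\<Sum>j<N. c j *\<^sub>C e j)"
    define s where "s = (\<Sum>j<N. (cmod (c j))\<^sup>2)"
    have s0: "s \<ge> 0" unfolding s_def by (intro sum_nonneg) simp
    have "cinner (T y) u = (\<Sum>j<N. cnj (c j) * c j)"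
      by (simp add: y_def Tsum lin hil.sum_left hil.scale_left c_def)
    also have "\<dots> = complex_of_real s"
      unfolding s_def of_real_sum by (intro sum.cong refl) (metis mult.commute mult_cnj_cmod)
    finally have "s = cmod (cinner (T y) u)" using s0 by simp
    also have "\<dots> \<le> (K * norm y) * norm u"
      by (rule order_trans[OF norm_cinner_le]) (intro mult_right_mono K norm_ge_zero)
    finally have "s \<le> (K * norm u) * norm y" by (simp add: mult_ac)
    moreover have "norm y \<le> sqrt s"
      using orthsys_norm_sum[OF onb_orthsys[OF e], of "{..<N}" c] by (simp add: y_def s_def real_le_rsqrt)
    ultimately have "s \<le> (K * norm u) * sqrt s" using K by (meson mult_left_mono mult_nonneg_nonneg norm_ge_zero order_trans)
    then have "sqrt s * sqrt s \<le> (K * norm u) * sqrt s" using s0 by simp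
    then have "sqrt s \<le> K * norm u"
      by (metis K(2) mult_right_le_imp_le mult_nonneg_nonneg norm_ge_zero not_less order_less_le real_sqrt_ge_zero s0)
    then show ?thesis using s0 by (metis s_def real_sqrt_le_iff real_sqrt_pow2 power_mono real_sqrt_ge_zero)
  qed
  have "summable (\<lambda>j. (cmod (c j))\<^sup>2)"
    by (rule summableI_nonneg_bounded[OF _ bd]) simp
  then obtain y where y: "\<And>j. cinner (e j) y = c j" using onb_synthesis[OF e] by metis
  let ?M = "{v. cinner y v = cinner u (T v)}"
  have "closed ?M"
    by (intro closed_Collect_eq linear_continuous_on bounded_linear_cinner_right
        bounded_linear_compose[OF bounded_linear_cinner_right] bounded_op_bounded_linear T)
  then have "closed_csubspace ?M"
    by (auto simp: closed_csubspace_def csubspace_def lin T0 hil.add_right hil.scale_right)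
  moreover have "cinner y (e j) = cinner u (T (e j))" for j
    using y[of j] unfolding c_def by (metis cinner_commute)
  ultimately have "v \<in> ?M" for v by (intro onb_closed_span[OF e]) auto
  then show ?thesis using that by blast
qed

lemma cadj_eqI:
  assumes "\<And>u v. cinner (S u) v = cinner u (T v)"
  shows "cadj T = S"
  unfolding cadj_def
proof (rule the_equality)
  fix S' assume a: "\<forall>u v. cinner (S' u) v = cinner u (T v)"
  show "S' = S"
  proof
    fix u
    have "cinner (S' u - S u) (S' u - S u) = 0" using a assms by (simp add: hil.diff_left)
    then show "S' u = S u" by (simp add: cinner_eq_0)
  qed
qed (use assms in blast)

lemma cinner_cadj:
  fixes T :: "'h::chilbert \<Rightarrow> 'h"
  assumes "hilbert_separable TYPE('h)" "infinite_dimensional TYPE('h)" "bounded_op T"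
  shows "cinner (cadj T u) v = cinner u (T v)"
proof -
  have "\<forall>u. \<exists>y. \<forall>v. cinner y v = cinner u (T v)" using adjoint_exists[OF assms] by metis
  then obtain S where "\<And>u v. cinner (S u) v = cinner u (T v)" by metis
  then show ?thesis using cadj_eqI by metis
qed

section \<open>Faithful representations of separable C*-algebras\<close>

text \<open>Real functionals are used because the Hahn--Banach argument is real; the values at
  self-adjoint elements determine the complex functional below. Positivity follows from
  contractivity and \<open>g 1 = 1\<close>.\<close>

definition alg_state :: "('a::unital_cstar_algebra \<Rightarrow> real) \<Rightarrow> bool" where
  "alg_state g \<longleftrightarrow> linear g \<and> (\<forall>x. \<bar>g x\<bar> \<le> norm x) \<and> g 1 = 1"

text \<open>A state is given by its restriction \<open>g\<close> to the self-adjoint part; \<open>state_ext g\<close> is its complex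
  linear extension, recovered from the real part as \<open>F(c) = Re F(c) - \<i> Re F(\<i>c)\<close>.\<close>

definition state_re :: "('a::unital_cstar_algebra \<Rightarrow> real) \<Rightarrow> 'a \<Rightarrow> real" where
  "state_re g c = g ((1/2) *\<^sub>R (c + cstar c))"

definition state_ext :: "('a::unital_cstar_algebra \<Rightarrow> real) \<Rightarrow> 'a \<Rightarrow> complex" where
  "state_ext g c = Complex (state_re g c) (- state_re g (\<i> *\<^sub>C c))"

definition state_form :: "('a::unital_cstar_algebra \<Rightarrow> real) \<Rightarrow> 'a \<Rightarrow> 'a \<Rightarrow> complex" where
  "state_form g a b = state_ext g (cstar a * b)"

lemma alg_state_linear:
  assumes "alg_state g"
  shows "g (x + y) = g x + g y" "g (r *\<^sub>R x) = r * g x" "g 0 = 0" "g (- x) = - g x" "g (x - y) = g x - g y"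
proof -
  have l: "linear g" using assms by (simp add: alg_state_def)
  show "g (x + y) = g x + g y" "g (r *\<^sub>R x) = r * g x" "g 0 = 0" "g (- x) = - g x" "g (x - y) = g x - g y"
    using linear_add[OF l] linear_scale[OF l] linear_0[OF l] linear_neg[OF l] linear_diff[OF l] by auto
qed

lemma alg_state_cpos: "alg_state g \<Longrightarrow> cpos a \<Longrightarrow> 0 \<le> g a"
proof -
  assume g: "alg_state g" and "cpos a"
  then obtain t where t: "norm (t *\<^sub>R 1 - a) \<le> t" by (auto simp: cpos_def)
  have "\<bar>g (t *\<^sub>R 1 - a)\<bar> \<le> t" using g t unfolding alg_state_def by (metis order_trans)
  then have "\<bar>t - g a\<bar> \<le> t" using alg_state_linear[OF g] g by (simp add: alg_state_def)
  then show ?thesis by linarith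
qed

lemma state_ext_add: "alg_state g \<Longrightarrow> state_ext g (x + y) = state_ext g x + state_ext g y"
  by (simp add: state_ext_def state_re_def complex_eq_iff cstar_add scaleC_add_right alg_state_linear algebra_simps)

lemma state_ext_scaleC: "alg_state g \<Longrightarrow> state_ext g (c *\<^sub>C x) = c * state_ext g x"
proof -
  assume g: "alg_state g"
  have re: "state_re g (x + y) = state_re g x + state_re g y" "state_re g (r *\<^sub>R x) = r * state_re g x" for x y r
    by (simp_all add: state_re_def cstar_add cstar_scaleR alg_state_linear[OF g] algebra_simps)
  have c: "c *\<^sub>C x = Re c *\<^sub>R x + Im c *\<^sub>R (\<i> *\<^sub>C x)"
    using scaleC_add_left[of "of_real (Re c)" "of_real (Im c) * \<i>" x]
    by (simp add: scaleR_scaleC scaleC_scaleC) (metis complex_eq mult.commute)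
  have ic: "\<i> *\<^sub>C c *\<^sub>C x = Re c *\<^sub>R (\<i> *\<^sub>C x) + (- Im c) *\<^sub>R x"
    unfolding c by (simp add: scaleC_add_right scaleC_scaleR scaleC_scaleC scaleC_minus_one)
  show ?thesis unfolding state_ext_def ic unfolding c re by (simp add: complex_eq_iff)
qed

lemma state_ext_cstar: "alg_state g \<Longrightarrow> state_ext g (cstar x) = cnj (state_ext g x)"
proof -
  assume g: "alg_state g"
  have "state_re g (cstar x) = state_re g x" by (simp add: state_re_def cstar_cstar add.commute)
  moreover have "state_re g (\<i> *\<^sub>C cstar x) = - state_re g (\<i> *\<^sub>C x)"
    by (simp add: state_re_def cstar_scaleC cstar_cstar scaleC_minus_left alg_state_linear[OF g] algebra_simps
        flip: alg_state_linear(4)[OF g])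
  ultimately show ?thesis by (simp add: state_ext_def complex_eq_iff)
qed

lemma state_ext_selfadj: "alg_state g \<Longrightarrow> cstar x = x \<Longrightarrow> state_ext g x = complex_of_real (g x)"
  using state_ext_cstar[of g x]
  by (simp add: complex_eq_iff) (simp add: state_ext_def state_re_def alg_state_linear)

lemma semi_inner_state_form:
  assumes g: "alg_state g"
  shows "semi_inner (state_form g)"
proof
  fix x y z :: 'a and c
  show "state_form g x (y + z) = state_form g x y + state_form g x z"
    by (simp add: state_form_def distrib_left state_ext_add[OF g])
  show "state_form g x (c *\<^sub>C y) = c * state_form g x y"
    by (simp add: state_form_def scaleC_mult_right state_ext_scaleC[OF g])
  show "state_form g y x = cnj (state_form g x y)"
    by (simp add: state_form_def cstar_mult cstar_cstar flip: state_ext_cstar[OF g])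
  show "0 \<le> Re (state_form g x x)"
    using alg_state_cpos[OF g cpos_cstar_mult[of x]]
    by (simp add: state_form_def state_ext_selfadj[OF g] cstar_mult cstar_cstar)
qed

lemma state_form_q:
  assumes g: "alg_state g"
  shows "semi_inner.q (state_form g) a = g (cstar a * a)"
proof -
  interpret semi_inner "state_form g" by (rule semi_inner_state_form[OF g])
  show ?thesis by (simp add: q_def state_form_def state_ext_selfadj[OF g] cstar_mult cstar_cstar)
qed

lemma state_sq_le_norm: "alg_state g \<Longrightarrow> g (cstar a * a) \<le> (norm a)\<^sup>2"
  unfolding cstar_identity[symmetric] alg_state_def using abs_le_D1 by blast

text \<open>This makes left multiplication by \<open>a\<close> bounded on the space of the state. If
  \<open>h * h = \<parallel>a\<parallel>^2 - a*a\<close>, the difference of the two sides is the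
  state of \<open>cstar (h * b) * (h * b)\<close>.\<close>

lemma state_cstar_mult_le:
  assumes g: "alg_state g"
  shows "g (cstar (a * b) * (a * b)) \<le> (norm a)\<^sup>2 * g (cstar b * b)"
proof -
  have sa: "cstar (cstar a * a) = cstar a * a" by (simp add: cstar_mult cstar_cstar)
  have "cpos ((norm a)\<^sup>2 *\<^sub>R 1 - cstar a * a)" by (rule cpos_norm_diff[OF sa]) (simp add: cstar_identity)
  then obtain h where h: "cpos h" "h * h = (norm a)\<^sup>2 *\<^sub>R 1 - cstar a * a" using cpos_sqrt_exists by metis
  have "cstar (h * b) * (h * b) = cstar b * (h * h) * b" using cpos_selfadj[OF h(1)] by (simp add: cstar_mult mult.assoc)
  also have "\<dots> = (norm a)\<^sup>2 *\<^sub>R (cstar b * b) - cstar (a * b) * (a * b)" unfolding h(2)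
    by (simp add: cstar_mult algebra_simps)
  finally have "0 \<le> g ((norm a)\<^sup>2 *\<^sub>R (cstar b * b) - cstar (a * b) * (a * b))"
    using alg_state_cpos[OF g cpos_cstar_mult[of "h * b"]] by simp
  then show ?thesis using alg_state_linear[OF g] by simp
qed

text \<open>Norming \<open>1 + b\<close> in place of \<open>b\<close> yields \<open>g 1 = 1\<close>:
  the equality \<open>norm (1 + b) = 1 + norm b\<close> leaves no slack in either term.\<close>

lemma state_norming_cpos:
  fixes b :: "'a::unital_cstar_algebra"
  assumes "cpos b"
  obtains g where "alg_state g" "g b = norm b"
proof -
  obtain g where g: "linear g" "\<And>x. \<bar>g x\<bar> \<le> norm x" "g (1 + b) = norm (1 + b)" using norming_functional by blast
  have "g 1 + g b = 1 + norm b" using g(3) linear_add[OF g(1)] norm_one_plus_cpos[OF assms] by simp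
  moreover have "g 1 \<le> 1" "g b \<le> norm b" using g(2)[of 1] g(2)[of b] by simp_all
  ultimately have "g 1 = 1" "g b = norm b" by simp_all
  then show ?thesis using that g by (auto simp: alg_state_def)
qed

text \<open>A convex series of states \<open>f k\<close>, where \<open>f k\<close> attains its norm
  at \<open>cstar (v k) * v k\<close>. If the sum vanishes at \<open>cstar a * a\<close>, so does
  every \<open>f k\<close>, and the triangle inequality for its seminorm gives
  \<open>norm (v k) \<le> norm (v k - a)\<close>. A \<open>v k\<close> close to \<open>a\<close>
  then forces \<open>a = 0\<close>.\<close>

theorem faithful_state_exists:
  fixes v :: "nat \<Rightarrow> 'a::unital_cstar_algebra"
  assumes dense: "\<And>x r. r > 0 \<Longrightarrow> \<exists>k. norm (x - v k) < r"
  obtains g :: "'a \<Rightarrow> real" where "alg_state g" "\<And>a. g (cstar a * a) = 0 \<Longrightarrow> a = 0"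
proof -
  have "\<exists>g. alg_state g \<and> g (cstar (v k) * v k) = norm (cstar (v k) * v k)" for k
    using state_norming_cpos[OF cpos_cstar_mult] by metis
  then obtain f where f: "\<And>k. alg_state (f k)" "\<And>k. f k (cstar (v k) * v k) = (norm (v k))\<^sup>2"
    unfolding cstar_identity by metis
  define c where "c = (\<lambda>k. (1/2::real) ^ Suc k)"
  have c: "c sums 1" "\<And>k. c k > 0" using power_half_series by (auto simp: c_def)
  have bd: "\<bar>c k * f k x\<bar> \<le> c k * norm x" for k x
    using f(1)[of k] c(2)[of k] by (simp add: alg_state_def abs_mult)
  have s1: "(\<lambda>k. c k * norm x) sums norm x" for x :: 'a using sums_mult2[OF c(1), of "norm x"] by simp
  have sm: "summable (\<lambda>k. c k * f k x)" for x
    by (rule summable_comparison_test'[OF sums_summable[OF s1[of x]], of 0]) (use bd in auto)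
  define g where "g = (\<lambda>x. \<Sum>k. c k * f k x)"
  have "linear g"
  proof (rule linearI)
    show "g (x + y) = g x + g y" for x y
      using suminf_add[OF sm[of x] sm[of y]] by (simp add: g_def alg_state_linear[OF f(1)] algebra_simps)
    show "g (r *\<^sub>R x) = r *\<^sub>R g x" for r x
      using suminf_mult[OF sm[of x], of r] by (simp add: g_def alg_state_linear[OF f(1)] mult_ac)
  qed
  moreover have "\<bar>g x\<bar> \<le> norm x" for x
  proof -
    have s: "summable (\<lambda>k. \<bar>c k * f k x\<bar>)"
      by (rule summable_comparison_test'[OF sums_summable[OF s1[of x]], of 0]) (use bd in auto)
    have "\<bar>g x\<bar> \<le> (\<Sum>k. \<bar>c k * f k x\<bar>)" unfolding g_def by (rule summable_rabs[OF s])
    also have "\<dots> \<le> norm x" using suminf_le[OF bd s sums_summable[OF s1]] s1[of x] by (simp add: sums_iff)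
    finally show ?thesis .
  qed
  moreover have "g 1 = 1" using f(1) c(1) by (simp add: g_def alg_state_def sums_iff)
  ultimately have gs: "alg_state g" by (simp add: alg_state_def)
  have "a = 0" if a: "g (cstar a * a) = 0" for a
  proof -
    have fa: "f k (cstar a * a) = 0" for k
    proof -
      have nn: "0 \<le> c k * f k (cstar a * a)" for k
        using alg_state_cpos[OF f(1) cpos_cstar_mult] c(2)[of k] by simp
      have "\<forall>k. c k * f k (cstar a * a) = 0" using suminf_eq_zero_iff[OF sm nn] a unfolding g_def by blast
      then show ?thesis using c(2)[of k] by (metis mult_eq_0_iff less_irrefl)
    qed
    have "norm (v k) \<le> norm (v k - a)" for k
    proof -
      interpret semi_inner "state_form (f k)" by (rule semi_inner_state_form[OF f(1)])
      note q = state_form_q[OF f(1)[of k]]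
      have "sqrt (q (v k - a + a)) \<le> sqrt (q (v k - a)) + sqrt (q a)" by (rule sqrt_q_triangle)
      then have "norm (v k) \<le> sqrt (q (v k - a))" using fa f(2)[of k] by (simp add: q)
      also have "\<dots> \<le> norm (v k - a)" unfolding q by (rule real_le_lsqrt) (use state_sq_le_norm[OF f(1)] in auto)
      finally show ?thesis .
    qed
    then have le: "norm a \<le> 2 * norm (a - v k)" for k
      using norm_triangle_ineq[of "a - v k" "v k"] norm_minus_commute[of a "v k"] by (smt (verit) diff_add_cancel)
    show "a = 0"
    proof (rule ccontr)
      assume "a \<noteq> 0"
      then obtain k where "norm (a - v k) < norm a / 2" using dense[of "norm a / 2" a] by auto
      then show False using le[of k] by simp
    qed
  qed
  then show ?thesis using that gs by blast
qed

text \<open>Split an orthonormal basis of \<open>'h\<close> along \<open>J \<times> \<nat>\<close>, where \<open>J\<close> indexes an orthonormal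
  basis of the given space.\<close>

lemma isometric_copies:
  fixes B :: "'v::cvec \<Rightarrow> 'v \<Rightarrow> complex" and v :: "nat \<Rightarrow> 'v"
  assumes H: "hilbert_separable TYPE('h::chilbert)" "infinite_dimensional TYPE('h::chilbert)"
    and B: "semi_inner B"
    and dense: "\<And>x r. r > 0 \<Longrightarrow> \<exists>k. semi_inner.q B (x - v k) < r"
    and nz: "semi_inner.q B x0 \<noteq> 0"
  obtains W :: "nat \<Rightarrow> 'v \<Rightarrow> 'h::chilbert" where
    "\<And>l. clinear_map (W l)" "\<And>l k a b. cinner (W l a) (W k b) = (if l = k then B a b else 0)"
    "closed_span (\<Union>l. range (W l)) = UNIV"
proof -
  interpret semi_inner B by (rule B)
  obtain \<epsilon> :: "nat \<Rightarrow> 'h" where \<epsilon>: "onb \<epsilon>" using onb_exists[OF H] by blast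
  let ?e = "gram_schmidt v"
  have o: "orthsys ?e" by (rule orthsys_gram_schmidt)
  have par: "(\<lambda>j. (cmod (B (?e j) x))\<^sup>2) sums q x" for x by (rule parseval[OF dense])
  define J where "J = {j. ?e j \<noteq> 0}"
  \<comment> \<open>\<open>J\<close> may be finite, but as soon as it is nonempty
    \<open>J \<times> \<nat>\<close> is countably infinite and can number the basis of the target
    space.\<close>
  have "J \<noteq> {}"
  proof
    assume "J = {}"
    then have "(\<lambda>j. (cmod (B (?e j) x0))\<^sup>2) = (\<lambda>_. 0)" by (auto simp: J_def)
    then show False using par[of x0] nz sums_unique2[OF _ sums_zero] by metis
  qed
  then have "infinite (J \<times> (UNIV :: nat set))" by (simp add: finite_cartesian_product_iff)
  then obtain \<beta> where \<beta>: "bij_betw \<beta> (UNIV :: nat set) (J \<times> (UNIV :: nat set))"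
    using countableE_infinite[of "J \<times> (UNIV :: nat set)"] bij_betw_inv_into by (metis countableI_type)
  \<comment> \<open>\<open>co l a\<close> lists the coordinates of \<open>W l a\<close>: the
    position numbered \<open>(j, l)\<close> receives the \<open>j\<close>-th Fourier coefficient of
    \<open>a\<close>, and positions of the other copies receive zero.\<close>
  define co where "co = (\<lambda>l a p. if snd (\<beta> p) = l then B (?e (fst (\<beta> p))) a else 0)"
  have co_sums: "(\<lambda>p. (cmod (co l a p))\<^sup>2) sums q a" for l a
  proof -
    let ?P = "{p. snd (\<beta> p) = l}"
    have bij: "bij_betw (\<lambda>p. fst (\<beta> p)) ?P J"
    proof (rule bij_betw_imageI)
      show "inj_on (\<lambda>p. fst (\<beta> p)) ?P"
        using \<beta> by (intro inj_onI) (metis (mono_tags, lifting) bij_betw_imp_inj_on injD mem_Collect_eq prod_eqI)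
      show "(\<lambda>p. fst (\<beta> p)) ` ?P = J"
      proof
        show "(\<lambda>p. fst (\<beta> p)) ` ?P \<subseteq> J" using bij_betwE[OF \<beta>] by (auto simp: mem_Times_iff)
        show "J \<subseteq> (\<lambda>p. fst (\<beta> p)) ` ?P"
        proof
          fix j assume "j \<in> J"
          then have "(j, l) \<in> \<beta> ` UNIV" using \<beta> by (simp add: bij_betw_def)
          then obtain p where "\<beta> p = (j, l)" by auto
          then show "j \<in> (\<lambda>p. fst (\<beta> p)) ` ?P" by (intro image_eqI[of _ _ p]) auto
        qed
      qed
    qed
    have "((\<lambda>j. (cmod (B (?e j) a))\<^sup>2) has_sum q a) UNIV" by (rule sums_nonneg_imp_has_sum[OF par]) simp
    then have "((\<lambda>j. (cmod (B (?e j) a))\<^sup>2) has_sum q a) J"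
      by (subst has_sum_cong_neutral[where S = J and T = UNIV and g = "\<lambda>j. (cmod (B (?e j) a))\<^sup>2"]) (auto simp: J_def)
    then have "((\<lambda>p. (cmod (B (?e (fst (\<beta> p))) a))\<^sup>2) has_sum q a) ?P"
      by (subst has_sum_reindex_bij_betw[OF bij, of "\<lambda>j. (cmod (B (?e j) a))\<^sup>2"])
    then have "((\<lambda>p. (cmod (co l a p))\<^sup>2) has_sum q a) UNIV"
      by (subst has_sum_cong_neutral[where S = UNIV and T = ?P and g = "\<lambda>p. (cmod (B (?e (fst (\<beta> p))) a))\<^sup>2"]) (auto simp: co_def)
    then show ?thesis by (rule has_sum_imp_sums)
  qed
  have "\<exists>h. (\<forall>p. cinner (\<epsilon> p) h = co l a p) \<and> (norm h)\<^sup>2 = q a" for l a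
    using onb_synthesis[OF \<epsilon> sums_summable[OF co_sums[of l a]]] co_sums[of l a] by (metis sums_unique)
  then obtain W where W: "\<And>l a p. cinner (\<epsilon> p) (W l a) = co l a p" "\<And>l a. (norm (W l a))\<^sup>2 = q a" by metis
  note eqI = onb_eqI[OF \<epsilon>]
  have lin: "W l (a + b) = W l a + W l b" "W l (c *\<^sub>C a) = c *\<^sub>C W l a" for l a b c
    by (rule eqI, simp add: W hil.add_right hil.scale_right co_def add_right scale_right)+
  have neg: "W l (a - b) = W l a - W l b" for l a b
    by (rule eqI) (simp add: W hil.diff_right co_def diff_right)
  have "cinner (W l a) (W k b) = (if l = k then B a b else 0)" for l k a b
  proof (cases "l = k")
    case True
    have "4 * cinner (W l a) (W l b) = 4 * B a b"
      unfolding hil.polarization polarization hil_q lin(1)[symmetric] lin(2)[symmetric] neg[symmetric] W(2) ..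
    then show ?thesis using True by simp
  next
    case False
    have "cnj (co l a p) * co k b p = 0" for p using False by (auto simp: co_def)
    then have "(\<lambda>p. 0) sums cinner (W l a) (W k b)"
      using onb_cinner_sums[OF \<epsilon>, of "W l a" "W k b"] unfolding W by (simp only:)
    then show ?thesis using False sums_unique2[OF _ sums_zero] by fastforce
  qed
  moreover have "closed_span (\<Union>l. range (W l)) = UNIV"
  proof -
    have "\<epsilon> p \<in> (\<Union>l. range (W l))" for p
    proof -
      obtain j l where jl: "\<beta> p = (j, l)" by fastforce
      then have jJ: "j \<in> J" using bij_betwE[OF \<beta>] by (metis UNIV_I mem_Sigma_iff)
      have "W l (?e j) = \<epsilon> p"
      proof (rule eqI)
        fix r
        obtain i k where ik: "\<beta> r = (i, k)" by fastforce
        have "r = p \<longleftrightarrow> i = j \<and> k = l" using jl ik \<beta> by (metis Pair_inject bij_betw_imp_inj_on injD)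
        moreover have "B (?e i) (?e j) = (if i = j then 1 else 0)" using o jJ by (auto simp: orthsys_def J_def)
        ultimately show "cinner (\<epsilon> r) (W l (?e j)) = cinner (\<epsilon> r) (\<epsilon> p)"
          by (auto simp: W co_def ik onb_cinner[OF \<epsilon>])
      qed
      then show ?thesis by (intro UN_I[of l]) (auto intro: range_eqI[OF sym])
    qed
    then have "range \<epsilon> \<subseteq> closed_span (\<Union>l. range (W l))"
      by (intro image_subsetI subsetD[OF closed_span_superset])
    then have "h \<in> closed_span (\<Union>l. range (W l))" for h
      by (rule onb_closed_span[OF \<epsilon> closed_csubspace_closed_span])
    then show ?thesis by (rule UNIV_eq_I[symmetric])
  qed
  ultimately show ?thesis using that lin by (metis clinear_map_def)
qed

text \<open>Both maps depend on a parameter, so the single estimate shows at once that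
  \<open>G x\<close> depends only on \<open>F x\<close> and that the resulting map is Lipschitz on a
  dense set.\<close>

lemma lipschitz_extension:
  fixes F G :: "'i \<Rightarrow> 'h::chilbert"
  assumes dense: "closure (F ` X) = UNIV" and K: "K \<ge> 0"
    and le: "\<And>x y. x \<in> X \<Longrightarrow> y \<in> X \<Longrightarrow> norm (G x - G y) \<le> K * norm (F x - F y)"
  obtains T where "\<And>x. x \<in> X \<Longrightarrow> T (F x) = G x" "\<And>h. isCont T h"
proof -
  define T0 where "T0 = (\<lambda>h. G (inv_into X F h))"
  have T0: "T0 (F x) = G x" if "x \<in> X" for x
  proof -
    have "F (inv_into X F (F x)) = F x" "inv_into X F (F x) \<in> X"
      using that by (auto intro: f_inv_into_f inv_into_into)
    then have "norm (G (inv_into X F (F x)) - G x) \<le> K * 0" using le[of "inv_into X F (F x)" x] that by simp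
    then show ?thesis by (simp add: T0_def)
  qed
  have "K-lipschitz_on (F ` X) T0"
    by (rule lipschitz_onI) (use T0 le K in \<open>auto simp: dist_norm\<close>)
  then obtain T where T: "K-lipschitz_on UNIV T" "\<And>h. h \<in> F ` X \<Longrightarrow> T h = T0 h"
    using lipschitz_extend_closure dense by metis
  have "continuous_on UNIV T" by (rule lipschitz_on_continuous_on[OF T(1)])
  then show ?thesis using that[of T] T(2) T0 by (auto simp: continuous_on_eq_continuous_at)
qed

text \<open>The GNS space of a faithful state may have finite dimension, whereas \<open>'h\<close>
  is a given infinite-dimensional space. Infinitely many copies of the GNS space fill
  \<open>'h\<close>, and the algebra acts on all of them by left multiplication.\<close>

theorem faithful_rep_exists:
  fixes v :: "nat \<Rightarrow> 'a::unital_cstar_algebra"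
  assumes H: "hilbert_separable TYPE('h::chilbert)" "infinite_dimensional TYPE('h::chilbert)"
    and dense: "\<And>x r. r > 0 \<Longrightarrow> \<exists>k. norm (x - v k) < r"
  obtains \<pi> :: "'a \<Rightarrow> 'h::chilbert \<Rightarrow> 'h" where "faithful_rep \<pi>"
proof -
  obtain g :: "'a \<Rightarrow> real" where g: "alg_state g" "\<And>a. g (cstar a * a) = 0 \<Longrightarrow> a = 0"
    using faithful_state_exists[OF dense] by blast
  let ?B = "state_form g"
  interpret semi_inner ?B by (rule semi_inner_state_form[OF g(1)])
  note q = state_form_q[OF g(1)]
  have "\<exists>k. q (x - v k) < r" if r: "r > 0" for x r
  proof -
    obtain k where "norm (x - v k) < sqrt r" using dense[of "sqrt r" x] r by auto
    then have "(norm (x - v k))\<^sup>2 < (sqrt r)\<^sup>2" by (rule power_strict_mono) auto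
    then show ?thesis using r state_sq_le_norm[OF g(1), of "x - v k"] by (intro exI[of _ k]) (simp add: q)
  qed
  moreover have "q 1 \<noteq> 0" using g by (simp add: q alg_state_def)
  ultimately obtain W :: "nat \<Rightarrow> 'a \<Rightarrow> 'h" where W: "\<And>l. clinear_map (W l)"
    "\<And>l k a b. cinner (W l a) (W k b) = (if l = k then ?B a b else 0)"
    "closed_span (\<Union>l. range (W l)) = UNIV"
    using isometric_copies[OF H semi_inner_state_form[OF g(1)], of v 1] by blast
  have Wlin: "W l (a + b) = W l a + W l b" "W l (c *\<^sub>C a) = c *\<^sub>C W l a" for l a b c
    using W(1) by (auto simp: clinear_map_def)
  have W0: "W l 0 = 0" for l using Wlin(2)[of l 0 0] by simp
  \<comment> \<open>On the dense image of the finitely supported families the action is given by a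
    formula. All identities are checked there and carried to \<open>'h\<close> by limits.\<close>
  define X :: "(nat \<Rightarrow> 'a) set" where "X = {b. finite {l. b l \<noteq> 0}}"
  define F where "F = (\<lambda>b. \<Sum>l | b l \<noteq> 0. W l (b l))"
  have Feq: "F b = (\<Sum>l\<in>S. W l (b l))" if "finite S" "{l. b l \<noteq> 0} \<subseteq> S" for b S
    unfolding F_def by (rule sum.mono_neutral_left[OF that]) (auto simp: W0)
  have Xadd: "(\<lambda>l. b l + b' l) \<in> X" if "b \<in> X" "b' \<in> X" for b b'
  proof -
    have "{l. b l + b' l \<noteq> 0} \<subseteq> {l. b l \<noteq> 0} \<union> {l. b' l \<noteq> 0}" by auto
    then show ?thesis using that finite_subset unfolding X_def by blast
  qed
  have Xsc: "(\<lambda>l. c *\<^sub>C b l) \<in> X" and Xmul: "(\<lambda>l. a * b l) \<in> X" if "b \<in> X" for b c a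
  proof -
    have "{l. c *\<^sub>C b l \<noteq> 0} \<subseteq> {l. b l \<noteq> 0}" "{l. a * b l \<noteq> 0} \<subseteq> {l. b l \<noteq> 0}" by auto
    then show "(\<lambda>l. c *\<^sub>C b l) \<in> X" "(\<lambda>l. a * b l) \<in> X" using that finite_subset unfolding X_def by blast+
  qed
  have Fadd: "F (\<lambda>l. b l + b' l) = F b + F b'" if "b \<in> X" "b' \<in> X" for b b'
  proof -
    let ?S = "{l. b l \<noteq> 0} \<union> {l. b' l \<noteq> 0}"
    have S: "finite ?S" using that by (simp add: X_def)
    have "{l. b l \<noteq> 0} \<subseteq> ?S" "{l. b' l \<noteq> 0} \<subseteq> ?S" "{l. b l + b' l \<noteq> 0} \<subseteq> ?S" by auto
    from this[THEN Feq[OF S]] show ?thesis by (simp add: Wlin sum.distrib)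
  qed
  have Fsc: "F (\<lambda>l. c *\<^sub>C b l) = c *\<^sub>C F b" if "b \<in> X" for b c
  proof -
    let ?S = "{l. b l \<noteq> 0}"
    have S: "finite ?S" using that by (simp add: X_def)
    have sc: "c *\<^sub>C sum f A = (\<Sum>l\<in>A. c *\<^sub>C f l)" for f :: "nat \<Rightarrow> 'h" and A
      by (induction A rule: infinite_finite_induct) (auto simp: scaleC_add_right)
    have "{l. c *\<^sub>C b l \<noteq> 0} \<subseteq> ?S" by auto
    from Feq[OF S this] Feq[OF S order_refl] show ?thesis by (simp add: Wlin sc)
  qed
  have Finner: "cinner (F b) (F b') = (\<Sum>l\<in>S. ?B (b l) (b' l))"
    if "finite S" "{l. b l \<noteq> 0} \<subseteq> S" "{l. b' l \<noteq> 0} \<subseteq> S" for b b' S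
    unfolding Feq[OF that(1,2)] Feq[OF that(1,3)] hil.sum_left hil.sum_right
    by (intro sum.cong refl) (use that(1) in \<open>simp add: W(2)\<close>)
  have Fdense: "closure (F ` X) = UNIV"
  proof -
    have 0: "(\<lambda>l. 0) \<in> X" "F (\<lambda>l. 0) = 0" by (auto simp: X_def F_def)
    have cs: "csubspace (F ` X)"
      unfolding csubspace_def
    proof (intro conjI ballI allI)
      show "0 \<in> F ` X" using 0 by (metis image_eqI)
      show "x + y \<in> F ` X" if xy: "x \<in> F ` X" "y \<in> F ` X" for x y
      proof -
        obtain b b' where b: "x = F b" "b \<in> X" "y = F b'" "b' \<in> X" using xy by blast
        show ?thesis unfolding b(1,3) Fadd[OF b(2,4), symmetric] by (rule imageI[OF Xadd[OF b(2,4)]])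
      qed
      show "c *\<^sub>C x \<in> F ` X" if xy: "x \<in> F ` X" for c x
      proof -
        obtain b where b: "x = F b" "b \<in> X" using xy by blast
        show ?thesis unfolding b(1) Fsc[OF b(2), symmetric] by (rule imageI[OF Xsc[OF b(2)]])
      qed
    qed
    have "csubspace (closure (F ` X))"
      unfolding csubspace_def
    proof (intro conjI ballI allI)
      show "0 \<in> closure (F ` X)" by (rule subsetD[OF closure_subset csubspace_zero[OF cs]])
      show "x + y \<in> closure (F ` X)" if "x \<in> closure (F ` X)" "y \<in> closure (F ` X)" for x y
      proof -
        obtain f f' where "\<forall>n. f n \<in> F ` X" "f \<longlonglongrightarrow> x" "\<forall>n. f' n \<in> F ` X" "f' \<longlonglongrightarrow> y"
          using \<open>x \<in> _\<close> \<open>y \<in> _\<close> unfolding closure_sequential by blast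
        then show ?thesis unfolding closure_sequential
          by (intro exI[of _ "\<lambda>n. f n + f' n"]) (auto intro: csubspace_add[OF cs] tendsto_add)
      qed
      show "c *\<^sub>C x \<in> closure (F ` X)" if "x \<in> closure (F ` X)" for c x
      proof -
        obtain f where "\<forall>n. f n \<in> F ` X" "f \<longlonglongrightarrow> x"
          using \<open>x \<in> _\<close> unfolding closure_sequential by blast
        then show ?thesis unfolding closure_sequential
          by (intro exI[of _ "\<lambda>n. c *\<^sub>C f n"]) (auto intro: csubspace_scaleC[OF cs] tendsto_scaleC)
      qed
    qed
    then have "closed_csubspace (closure (F ` X))" by (simp add: closed_csubspace_def)
    moreover have "(\<Union>l. range (W l)) \<subseteq> closure (F ` X)"
    proof
      fix x assume "x \<in> (\<Union>l. range (W l))"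
      then obtain l a where x: "x = W l a" by auto
      define b where "b = (\<lambda>k. if k = l then a else 0)"
      have sub: "{k. b k \<noteq> 0} \<subseteq> {l}" by (auto simp: b_def)
      then have "b \<in> X" using finite_subset unfolding X_def by blast
      moreover have "F b = x" using Feq[OF _ sub] by (simp add: x b_def)
      ultimately have "x \<in> F ` X" by (metis imageI)
      then show "x \<in> closure (F ` X)" by (rule subsetD[OF closure_subset])
    qed
    ultimately have "closed_span (\<Union>l. range (W l)) \<subseteq> closure (F ` X)" by (rule closed_span_minimal)
    then show ?thesis by (simp only: W(3) top.extremum_unique)
  qed
  have Fdiff: "F b - F b' = F (\<lambda>l. b l - b' l)" "(\<lambda>l. b l - b' l) \<in> X" if "b \<in> X" "b' \<in> X" for b b'
    using Fadd[OF that(1) Xsc[OF that(2), of "-1"]] Fsc[OF that(2), of "-1"] Xadd[OF that(1) Xsc[OF that(2), of "-1"]]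
    by (simp_all add: scaleC_minus_one)
  have Fmul: "norm (F (\<lambda>l. a * b l)) \<le> norm a * norm (F b)" if "b \<in> X" for a b
  proof -
    let ?S = "{l. b l \<noteq> 0}"
    have S: "finite ?S" using that by (simp add: X_def)
    have n: "(norm (F b))\<^sup>2 = (\<Sum>l\<in>?S. g (cstar (b l) * b l))" if "{l. b l \<noteq> 0} \<subseteq> ?S" for b
      using arg_cong[OF Finner[OF S that that], of Re] by (simp add: hil_q[symmetric] hil.q_def q[symmetric] q_def)
    have sub: "{l. a * b l \<noteq> 0} \<subseteq> ?S" by auto
    have "(norm (F (\<lambda>l. a * b l)))\<^sup>2 \<le> (\<Sum>l\<in>?S. (norm a)\<^sup>2 * g (cstar (b l) * b l))"
      unfolding n[OF sub] by (intro sum_mono state_cstar_mult_le[OF g(1)])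
    also have "\<dots> = (norm a * norm (F b))\<^sup>2" unfolding power_mult_distrib n[OF order_refl] by (simp add: sum_distrib_left)
    finally show ?thesis by (rule power2_le_imp_le) simp
  qed
  have "\<exists>T. (\<forall>b\<in>X. T (F b) = F (\<lambda>l. a * b l)) \<and> (\<forall>h. isCont T h)" for a
  proof -
    have "norm (F (\<lambda>l. a * b l) - F (\<lambda>l. a * b' l)) \<le> norm a * norm (F b - F b')" if "b \<in> X" "b' \<in> X" for b b'
      using Fmul[OF Fdiff(2)[OF that], of a] Fdiff(1)[OF that] Fdiff(1)[OF Xmul[OF that(1), of a] Xmul[OF that(2), of a]]
      by (simp add: right_diff_distrib)
    then obtain T where "\<And>b. b \<in> X \<Longrightarrow> T (F b) = F (\<lambda>l. a * b l)" "\<And>h. isCont T h"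
      using lipschitz_extension[OF Fdense norm_ge_zero[of a], of "\<lambda>b. F (\<lambda>l. a * b l)"] by blast
    then show ?thesis by blast
  qed
  then obtain \<pi> where \<pi>: "\<And>a b. b \<in> X \<Longrightarrow> \<pi> a (F b) = F (\<lambda>l. a * b l)" "\<And>a h. isCont (\<pi> a) h" by metis
  have appr: "\<exists>b. (\<forall>n. b n \<in> X) \<and> (\<lambda>n. F (b n)) \<longlonglongrightarrow> h" for h
  proof -
    have "h \<in> closure (F ` X)" using Fdense by simp
    then obtain f where f: "\<forall>n. f n \<in> F ` X" "f \<longlonglongrightarrow> h" unfolding closure_sequential by blast
    then have "\<forall>n. \<exists>b. b \<in> X \<and> f n = F b" by blast
    then obtain b where b: "\<And>n. b n \<in> X" "\<And>n. f n = F (b n)" by metis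
    from b(2) have "f = (\<lambda>n. F (b n))" by (rule ext)
    then show ?thesis using f(2) b(1) by (intro exI[of _ b]) simp
  qed
  have lim: "(\<lambda>n. F (\<lambda>l. a * b n l)) \<longlonglongrightarrow> \<pi> a h" if "\<And>n. b n \<in> X" "(\<lambda>n. F (b n)) \<longlonglongrightarrow> h" for a b h
    using isCont_tendsto_compose[OF \<pi>(2) that(2), of a] \<pi>(1)[OF that(1)] by simp
  have add_h: "\<pi> a (h + h') = \<pi> a h + \<pi> a h'" for a h h'
  proof -
    obtain b b' where b: "\<And>n. b n \<in> X" "(\<lambda>n. F (b n)) \<longlonglongrightarrow> h" and b': "\<And>n. b' n \<in> X" "(\<lambda>n. F (b' n)) \<longlonglongrightarrow> h'"
      using appr by metis
    have "(\<lambda>n. F (\<lambda>l. b n l + b' n l)) \<longlonglongrightarrow> h + h'" using tendsto_add[OF b(2) b'(2)] by (simp add: Fadd b b')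
    then have "(\<lambda>n. F (\<lambda>l. a * (b n l + b' n l))) \<longlonglongrightarrow> \<pi> a (h + h')" by (rule lim[rotated]) (intro Xadd b b')
    moreover have "(\<lambda>n. F (\<lambda>l. a * (b n l + b' n l))) \<longlonglongrightarrow> \<pi> a h + \<pi> a h'"
      using tendsto_add[OF lim[OF b, of a] lim[OF b', of a]] by (simp add: Fadd Xmul b b' distrib_left)
    ultimately show ?thesis using LIMSEQ_unique by blast
  qed
  have sc_h: "\<pi> a (c *\<^sub>C h) = c *\<^sub>C \<pi> a h" for a c h
  proof -
    obtain b where b: "\<And>n. b n \<in> X" "(\<lambda>n. F (b n)) \<longlonglongrightarrow> h" using appr by metis
    have "(\<lambda>n. F (\<lambda>l. c *\<^sub>C b n l)) \<longlonglongrightarrow> c *\<^sub>C h" using tendsto_scaleC[OF b(2)] by (simp add: Fsc b)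
    then have "(\<lambda>n. F (\<lambda>l. a * (c *\<^sub>C b n l))) \<longlonglongrightarrow> \<pi> a (c *\<^sub>C h)" by (rule lim[rotated]) (intro Xsc b)
    moreover have "(\<lambda>n. F (\<lambda>l. a * (c *\<^sub>C b n l))) \<longlonglongrightarrow> c *\<^sub>C \<pi> a h"
      using tendsto_scaleC[OF lim[OF b, of a], of c] by (simp add: Fsc Xmul b scaleC_mult_right)
    ultimately show ?thesis using LIMSEQ_unique by blast
  qed
  have bd: "norm (\<pi> a h) \<le> norm a * norm h" for a h
  proof -
    obtain b where b: "\<And>n. b n \<in> X" "(\<lambda>n. F (b n)) \<longlonglongrightarrow> h" using appr by metis
    show ?thesis
      by (rule LIMSEQ_le[OF tendsto_norm[OF lim[OF b]] tendsto_mult[OF tendsto_const tendsto_norm[OF b(2)]]])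
         (use Fmul b in auto)
  qed
  have add_a: "\<pi> (a + a') h = \<pi> a h + \<pi> a' h" for a a' h
  proof -
    obtain b where b: "\<And>n. b n \<in> X" "(\<lambda>n. F (b n)) \<longlonglongrightarrow> h" using appr by metis
    have "(\<lambda>n. F (\<lambda>l. (a + a') * b n l)) \<longlonglongrightarrow> \<pi> a h + \<pi> a' h"
      using tendsto_add[OF lim[OF b, of a] lim[OF b, of a']] by (simp add: Fadd[symmetric] Xmul b distrib_right)
    then show ?thesis using LIMSEQ_unique lim[OF b] by blast
  qed
  have sc_a: "\<pi> (c *\<^sub>C a) h = c *\<^sub>C \<pi> a h" for c a h
  proof -
    obtain b where b: "\<And>n. b n \<in> X" "(\<lambda>n. F (b n)) \<longlonglongrightarrow> h" using appr by metis
    have "(\<lambda>n. F (\<lambda>l. (c *\<^sub>C a) * b n l)) \<longlonglongrightarrow> c *\<^sub>C \<pi> a h"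
      using tendsto_scaleC[OF lim[OF b, of a], of c] by (simp add: Fsc[symmetric] Xmul b scaleC_mult_left)
    then show ?thesis using LIMSEQ_unique lim[OF b] by blast
  qed
  have mult_a: "\<pi> (a * a') h = \<pi> a (\<pi> a' h)" for a a' h
  proof -
    obtain b where b: "\<And>n. b n \<in> X" "(\<lambda>n. F (b n)) \<longlonglongrightarrow> h" using appr by metis
    have "(\<lambda>n. F (\<lambda>l. a * (a' * b n l))) \<longlonglongrightarrow> \<pi> a (\<pi> a' h)"
      by (rule lim[OF _ lim[OF b, of a']]) (intro Xmul b)
    then show ?thesis using LIMSEQ_unique lim[OF b, of "a * a'"] by (simp add: mult.assoc)
  qed
  have one: "\<pi> 1 h = h" for h
  proof -
    obtain b where b: "\<And>n. b n \<in> X" "(\<lambda>n. F (b n)) \<longlonglongrightarrow> h" using appr by metis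
    then show ?thesis using LIMSEQ_unique lim[OF b, of 1] by simp
  qed
  have star: "cinner (\<pi> (cstar a) u) h = cinner u (\<pi> a h)" for a u h
  proof -
    obtain b c where b: "\<And>n. b n \<in> X" "(\<lambda>n. F (b n)) \<longlonglongrightarrow> u" and c: "\<And>n. c n \<in> X" "(\<lambda>n. F (c n)) \<longlonglongrightarrow> h"
      using appr by metis
    have "cinner (F (\<lambda>l. cstar a * b n l)) (F (c n)) = cinner (F (b n)) (F (\<lambda>l. a * c n l))" for n
    proof -
      let ?S = "{l. b n l \<noteq> 0} \<union> {l. c n l \<noteq> 0}"
      have S: "finite ?S" using b(1)[of n] c(1)[of n] by (simp add: X_def)
      have sub: "{l. cstar a * b n l \<noteq> 0} \<subseteq> ?S" "{l. c n l \<noteq> 0} \<subseteq> ?S" "{l. b n l \<noteq> 0} \<subseteq> ?S" "{l. a * c n l \<noteq> 0} \<subseteq> ?S"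
        by auto
      show ?thesis unfolding Finner[OF S sub(1,2)] Finner[OF S sub(3,4)]
        by (simp add: state_form_def cstar_mult cstar_cstar mult.assoc)
    qed
    then show ?thesis
      using tendsto_cinner[OF lim[OF b, of "cstar a"] c(2)] tendsto_cinner[OF b(2) lim[OF c, of a]] LIMSEQ_unique by simp
  qed
  have "inj \<pi>"
  proof (rule injI)
    fix a a' assume eq: "\<pi> a = \<pi> a'"
    \<comment> \<open>This is the cyclic vector of copy \<open>0\<close>. Applying
      \<open>\<pi> c\<close> to it gives \<open>W 0 c\<close>, which by faithfulness of the state
      vanishes only for \<open>c = 0\<close>.\<close>
    define b where "b = (\<lambda>k::nat. if k = 0 then (1::'a) else 0)"
    have sub: "{k. c * b k \<noteq> 0} \<subseteq> {0}" for c by (auto simp: b_def)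
    have "{k. b k \<noteq> 0} \<subseteq> {0}" by (auto simp: b_def)
    then have bX: "b \<in> X" using finite_subset unfolding X_def by blast
    have "F (\<lambda>k. c * b k) = W 0 c" for c using Feq[OF _ sub] by (simp add: b_def)
    then have "W 0 a = W 0 a'" using \<pi>(1)[OF bX] eq by metis
    then have "W 0 (a - a') = 0" using Wlin(1)[of 0 "a - a'" a'] by simp
    then have "?B (a - a') (a - a') = 0" using W(2)[of 0 "a - a'" 0 "a - a'"] by simp
    then have "q (a - a') = 0" by (simp add: q_def)
    then show "a = a'" using g(2)[of "a - a'"] by (simp add: q)
  qed
  moreover have "bounded_op (\<pi> a)" for a using add_h sc_h bd unfolding bounded_op_def clinear_map_def by blast
  moreover have "\<pi> (cstar a) = cadj (\<pi> a)" for a using cadj_eqI[of "\<pi> (cstar a)" "\<pi> a"] star by simp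
  ultimately have "faithful_rep \<pi>"
    unfolding faithful_rep_def using add_a sc_a mult_a one by (auto simp: fun_eq_iff)
  then show ?thesis using that by blast
qed

section \<open>Operator norm of matrices\<close>

definition vip :: "complex vec \<Rightarrow> complex vec \<Rightarrow> complex" where
  "vip u v = (\<Sum>i<dim_vec u. cnj (u $ i) * v $ i)"

lemma vnorm_L2: "vnorm v = L2_set (\<lambda>i. cmod (v $ i)) {..<dim_vec v}"
  by (simp add: vnorm_def L2_set_def)

lemma vnorm_ge_0 [simp]: "0 \<le> vnorm v" by (simp add: vnorm_L2)

lemma vnorm_sq: "(vnorm v)\<^sup>2 = (\<Sum>i<dim_vec v. (cmod (v $ i))\<^sup>2)"
  by (simp add: vnorm_def sum_nonneg)

lemma vip_self: "vip v v = complex_of_real ((vnorm v)\<^sup>2)"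
  unfolding vip_def vnorm_sq of_real_sum
  by (intro sum.cong refl) (metis mult.commute mult_cnj_cmod)

lemma vip_cnj: "dim_vec u = dim_vec v \<Longrightarrow> vip v u = cnj (vip u v)"
  by (simp add: vip_def mult.commute)

lemma vip_add_right: "v \<in> carrier_vec m \<Longrightarrow> w \<in> carrier_vec m \<Longrightarrow> u \<in> carrier_vec m \<Longrightarrow> vip u (v + w) = vip u v + vip u w"
  by (simp add: vip_def algebra_simps sum.distrib)

lemma vip_add_left: "v \<in> carrier_vec m \<Longrightarrow> w \<in> carrier_vec m \<Longrightarrow> u \<in> carrier_vec m \<Longrightarrow> vip (v + w) u = vip v u + vip w u"
  by (simp add: vip_def algebra_simps sum.distrib)

lemma vip_smult_right: "v \<in> carrier_vec m \<Longrightarrow> u \<in> carrier_vec m \<Longrightarrow> vip u (c \<cdot>\<^sub>v v) = c * vip u v"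
  by (simp add: vip_def sum_distrib_left algebra_simps)

lemma vip_smult_left: "vip (c \<cdot>\<^sub>v v) u = cnj c * vip v u"
  by (simp add: vip_def sum_distrib_left algebra_simps)

lemma vip_zero_left [simp]: "vip (0\<^sub>v m) u = 0"
  by (simp add: vip_def)

lemma vip_zero_right [simp]: "u \<in> carrier_vec m \<Longrightarrow> vip u (0\<^sub>v m) = 0"
  by (simp add: vip_def)

lemma vip_cauchy_schwarz:
  assumes "u \<in> carrier_vec m" "v \<in> carrier_vec m"
  shows "cmod (vip u v) \<le> vnorm u * vnorm v"
proof -
  have "cmod (vip u v) \<le> (\<Sum>i<m. \<bar>cmod (u $ i)\<bar> * \<bar>cmod (v $ i)\<bar>)"
    using assms unfolding vip_def by (auto intro!: order_trans[OF norm_sum] simp: norm_mult)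
  also have "\<dots> \<le> L2_set (\<lambda>i. cmod (u $ i)) {..<m} * L2_set (\<lambda>i. cmod (v $ i)) {..<m}" by (rule L2_set_mult_ineq)
  also have "\<dots> = vnorm u * vnorm v" using assms unfolding vnorm_L2 by simp
  finally show ?thesis .
qed

lemma vnorm_triangle:
  assumes "u \<in> carrier_vec m" "v \<in> carrier_vec m"
  shows "vnorm (u + v) \<le> vnorm u + vnorm v"
proof -
  have "vnorm (u + v) = L2_set (\<lambda>i. cmod (u $ i + v $ i)) {..<m}"
    using assms by (auto simp: vnorm_L2 intro!: L2_set_cong)
  also have "\<dots> \<le> L2_set (\<lambda>i. cmod (u $ i) + cmod (v $ i)) {..<m}"
    by (intro L2_set_mono) (auto simp: norm_triangle_ineq)
  also have "\<dots> \<le> vnorm u + vnorm v" using assms by (auto simp: vnorm_L2 intro: order_trans[OF L2_set_triangle_ineq])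
  finally show ?thesis .
qed

lemma vnorm_smult: "vnorm (c \<cdot>\<^sub>v v) = cmod c * vnorm v"
proof -
  have "vnorm (c \<cdot>\<^sub>v v) = L2_set (\<lambda>i. cmod c * cmod (v $ i)) {..<dim_vec v}"
    by (auto simp: vnorm_L2 norm_mult intro!: L2_set_cong)
  then show ?thesis by (simp add: vnorm_L2 L2_set_right_distrib)
qed

lemma vnorm_zero [simp]: "vnorm (0\<^sub>v m) = 0"
  by (simp add: vnorm_def)

lemma vnorm_eq_0: "v \<in> carrier_vec m \<Longrightarrow> vnorm v = 0 \<Longrightarrow> v = 0\<^sub>v m"
  by (auto simp: vnorm_def sum_nonneg_eq_0_iff sum_nonneg)

lemma mat_adjoint_eq: "mat_adjoint A = mat (dim_col A) (dim_row A) (\<lambda>(i, j). cnj (A $$ (j, i)))"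
  unfolding mat_adjoint_def by (intro eq_matI) (auto simp: mat_of_rows_def)

lemma mat_adjoint_carrier [simp]: "A \<in> carrier_mat n m \<Longrightarrow> mat_adjoint (A :: complex mat) \<in> carrier_mat m n"
  by (auto simp: mat_adjoint_eq)

lemma mat_adjoint_adjoint [simp]: "mat_adjoint (mat_adjoint A) = (A :: complex mat)"
  by (rule eq_matI) (auto simp: mat_adjoint_eq)

lemma mat_adjoint_add:
  "A \<in> carrier_mat n m \<Longrightarrow> B \<in> carrier_mat n m \<Longrightarrow> mat_adjoint (A + B) = mat_adjoint A + mat_adjoint (B :: complex mat)"
  by (rule eq_matI) (auto simp: mat_adjoint_eq)

lemma mat_adjoint_smult: "mat_adjoint (c \<cdot>\<^sub>m A) = cnj c \<cdot>\<^sub>m mat_adjoint A"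
  by (rule eq_matI) (auto simp: mat_adjoint_eq)

lemma mat_adjoint_one [simp]: "mat_adjoint (1\<^sub>m m :: complex mat) = 1\<^sub>m m"
  by (rule eq_matI) (auto simp: mat_adjoint_eq)

lemma mat_adjoint_mult:
  "A \<in> carrier_mat n m \<Longrightarrow> B \<in> carrier_mat m k \<Longrightarrow> mat_adjoint (A * B) = mat_adjoint B * mat_adjoint (A :: complex mat)"
  by (rule eq_matI) (auto simp: mat_adjoint_eq scalar_prod_def mult.commute)

lemma vip_adjoint:
  assumes "A \<in> carrier_mat n m" "u \<in> carrier_vec n" "v \<in> carrier_vec m"
  shows "vip u (A *\<^sub>v v) = vip (mat_adjoint A *\<^sub>v u) v"
proof -
  have "vip u (A *\<^sub>v v) = (\<Sum>i<n. \<Sum>j<m. cnj (u $ i) * (A $$ (i, j) * v $ j))"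
    using assms by (auto simp: vip_def scalar_prod_def sum_distrib_left lessThan_atLeast0 intro!: sum.cong)
  also have "\<dots> = (\<Sum>j<m. \<Sum>i<n. cnj (u $ i) * (A $$ (i, j) * v $ j))" by (rule sum.swap)
  also have "\<dots> = vip (mat_adjoint A *\<^sub>v u) v"
    using assms by (auto simp: vip_def mat_adjoint_eq scalar_prod_def sum_distrib_right lessThan_atLeast0 sum_distrib_left mult_ac intro!: sum.cong)
  finally show ?thesis .
qed

text \<open>Cauchy--Schwarz in each row yields the Frobenius norm as a bound. Any finite bound
  serves to make \<open>mnorm\<close> the supremum of a bounded set.\<close>

lemma mult_vec_bounded:
  fixes A :: "complex mat"
  obtains C where "C \<ge> 0" "\<And>v. v \<in> carrier_vec (dim_col A) \<Longrightarrow> vnorm (A *\<^sub>v v) \<le> C * vnorm v"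
proof -
  define C where "C = sqrt (\<Sum>i<dim_row A. (vnorm (row A i))\<^sup>2)"
  have "vnorm (A *\<^sub>v v) \<le> C * vnorm v" if v: "v \<in> carrier_vec (dim_col A)" for v
  proof -
    have "cmod ((A *\<^sub>v v) $ i) \<le> vnorm (row A i) * vnorm v" if i: "i < dim_row A" for i
    proof -
      have "cmod ((A *\<^sub>v v) $ i) \<le> (\<Sum>j<dim_col A. \<bar>cmod (row A i $ j)\<bar> * \<bar>cmod (v $ j)\<bar>)"
        using v i by (auto simp: scalar_prod_def lessThan_atLeast0 norm_mult intro!: order_trans[OF norm_sum] sum_mono)
      also have "\<dots> \<le> L2_set (\<lambda>j. cmod (row A i $ j)) {..<dim_col A} * L2_set (\<lambda>j. cmod (v $ j)) {..<dim_col A}"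
        by (rule L2_set_mult_ineq)
      also have "\<dots> = vnorm (row A i) * vnorm v" using v unfolding vnorm_L2 by simp
      finally show ?thesis .
    qed
    then have "(vnorm (A *\<^sub>v v))\<^sup>2 \<le> (\<Sum>i<dim_row A. (vnorm (row A i) * vnorm v)\<^sup>2)"
      unfolding vnorm_sq by (auto intro!: sum_mono power_mono)
    also have "\<dots> = (C * vnorm v)\<^sup>2"
      unfolding power_mult_distrib C_def by (simp add: sum_nonneg sum_distrib_right)
    finally show ?thesis by (rule power2_le_imp_le) (simp add: C_def sum_nonneg)
  qed
  then show ?thesis using that[of C] by (simp add: C_def sum_nonneg)
qed

lemma mnorm_bdd: "bdd_above {vnorm (A *\<^sub>v v) | v. v \<in> carrier_vec (dim_col A) \<and> vnorm v \<le> 1}"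
proof -
  obtain C where C: "C \<ge> 0" "\<And>v. v \<in> carrier_vec (dim_col A) \<Longrightarrow> vnorm (A *\<^sub>v v) \<le> C * vnorm v"
    using mult_vec_bounded by blast
  have "vnorm (A *\<^sub>v v) \<le> C" if "v \<in> carrier_vec (dim_col A)" "vnorm v \<le> 1" for v
    using C(2)[OF that(1)] C(1) that(2) mult_left_le[of "vnorm v" C] by linarith
  then show ?thesis by (intro bdd_aboveI[of _ C]) auto
qed

lemma mnorm_ge_0 [simp]: "0 \<le> mnorm A"
proof -
  have "vnorm (A *\<^sub>v 0\<^sub>v (dim_col A)) \<le> mnorm A"
    unfolding mnorm_def by (rule cSup_upper[OF _ mnorm_bdd]) force
  then show ?thesis using vnorm_ge_0 order_trans by blast
qed

lemma vnorm_mult_le: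
  assumes A: "A \<in> carrier_mat n m" and v: "v \<in> carrier_vec m"
  shows "vnorm (A *\<^sub>v v) \<le> mnorm A * vnorm v"
proof (cases "vnorm v = 0")
  case True
  then have "v = 0\<^sub>v m" using vnorm_eq_0 v by blast
  then have "A *\<^sub>v v = 0\<^sub>v n" using A by auto
  then show ?thesis by simp
next
  case False
  let ?w = "complex_of_real (1 / vnorm v) \<cdot>\<^sub>v v"
  have "vnorm ?w = 1" using False unfolding vnorm_smult norm_of_real by simp
  moreover have w: "?w \<in> carrier_vec (dim_col A)" using A v by auto
  ultimately have "vnorm (A *\<^sub>v ?w) \<le> mnorm A"
    unfolding mnorm_def by (intro cSup_upper[OF _ mnorm_bdd]) (use w in force)
  moreover have "vnorm (A *\<^sub>v ?w) = (1 / vnorm v) * vnorm (A *\<^sub>v v)"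
    unfolding mult_mat_vec[OF A v] vnorm_smult norm_of_real by simp
  moreover have "vnorm v > 0" using False by (metis vnorm_ge_0 less_eq_real_def)
  ultimately have "(1 / vnorm v) * vnorm (A *\<^sub>v v) \<le> mnorm A" "vnorm v > 0" by (simp_all only:)
  then show ?thesis by (simp add: field_simps)
qed

lemma mnorm_leI:
  assumes A: "A \<in> carrier_mat n m" and c: "c \<ge> 0"
    and le: "\<And>v. v \<in> carrier_vec m \<Longrightarrow> vnorm (A *\<^sub>v v) \<le> c * vnorm v"
  shows "mnorm A \<le> c"
  unfolding mnorm_def
proof (rule cSup_least)
  show "{vnorm (A *\<^sub>v v) |v. v \<in> carrier_vec (dim_col A) \<and> vnorm v \<le> 1} \<noteq> {}"
    by (auto intro!: exI[of _ "0\<^sub>v (dim_col A)"])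
  fix x assume "x \<in> {vnorm (A *\<^sub>v v) |v. v \<in> carrier_vec (dim_col A) \<and> vnorm v \<le> 1}"
  then obtain v where v: "x = vnorm (A *\<^sub>v v)" "v \<in> carrier_vec m" "vnorm v \<le> 1" using A by auto
  then show "x \<le> c" using le[OF v(2)] mult_left_le[OF v(3) c] by linarith
qed

lemma mnorm_add:
  assumes "A \<in> carrier_mat n m" "B \<in> carrier_mat n m"
  shows "mnorm (A + B) \<le> mnorm A + mnorm B"
proof (rule mnorm_leI[of _ n m])
  fix v :: "complex vec" assume v: "v \<in> carrier_vec m"
  have "vnorm ((A + B) *\<^sub>v v) \<le> vnorm (A *\<^sub>v v) + vnorm (B *\<^sub>v v)"
    using assms v by (simp add: add_mult_distrib_mat_vec[OF assms v] vnorm_triangle[of _ n])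
  also have "\<dots> \<le> (mnorm A + mnorm B) * vnorm v"
    using vnorm_mult_le[OF assms(1) v] vnorm_mult_le[OF assms(2) v] by (simp add: distrib_right)
  finally show "vnorm ((A + B) *\<^sub>v v) \<le> (mnorm A + mnorm B) * vnorm v" .
qed (use assms in auto)

lemma mnorm_mult:
  assumes "A \<in> carrier_mat n m" "B \<in> carrier_mat m k"
  shows "mnorm (A * B) \<le> mnorm A * mnorm B"
proof (rule mnorm_leI[of _ n k])
  fix v :: "complex vec" assume v: "v \<in> carrier_vec k"
  have "vnorm ((A * B) *\<^sub>v v) = vnorm (A *\<^sub>v (B *\<^sub>v v))" using assms v by simp
  also have "\<dots> \<le> mnorm A * (mnorm B * vnorm v)"
    using vnorm_mult_le[OF assms(1), of "B *\<^sub>v v"] vnorm_mult_le[OF assms(2) v] assms v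
    by (meson mnorm_ge_0 mult_left_mono mult_mat_vec_carrier order_trans)
  finally show "vnorm ((A * B) *\<^sub>v v) \<le> mnorm A * mnorm B * vnorm v" by (simp add: mult_ac)
qed (use assms in auto)

lemma smult_mat_mult_vec: "A \<in> carrier_mat n m \<Longrightarrow> v \<in> carrier_vec m \<Longrightarrow> (c \<cdot>\<^sub>m A) *\<^sub>v v = c \<cdot>\<^sub>v ((A :: complex mat) *\<^sub>v v)"
  by (rule eq_vecI) (auto simp: scalar_prod_def sum_distrib_left mult_ac)

lemma mnorm_smult_le:
  assumes A: "A \<in> carrier_mat n m"
  shows "mnorm (c \<cdot>\<^sub>m A) \<le> cmod c * mnorm A"
proof (rule mnorm_leI[of _ n m])
  fix v :: "complex vec" assume v: "v \<in> carrier_vec m"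
  show "vnorm ((c \<cdot>\<^sub>m A) *\<^sub>v v) \<le> cmod c * mnorm A * vnorm v"
    unfolding smult_mat_mult_vec[OF A v] using vnorm_mult_le[OF A v] by (simp add: vnorm_smult mult.assoc mult_left_mono)
qed (use A in auto)

lemma mnorm_smult:
  assumes A: "A \<in> carrier_mat n m"
  shows "mnorm (c \<cdot>\<^sub>m A) = cmod c * mnorm A"
proof (cases "c = 0")
  case True
  then show ?thesis using mnorm_smult_le[OF A, of 0] mnorm_ge_0[of "0 \<cdot>\<^sub>m A"] by simp
next
  case False
  have "mnorm (inverse c \<cdot>\<^sub>m (c \<cdot>\<^sub>m A)) \<le> cmod (inverse c) * mnorm (c \<cdot>\<^sub>m A)"
    by (rule mnorm_smult_le) (use A in auto)
  moreover have "inverse c \<cdot>\<^sub>m (c \<cdot>\<^sub>m A) = A" by (rule eq_matI) (use False in auto)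
  ultimately have "mnorm A \<le> inverse (cmod c) * mnorm (c \<cdot>\<^sub>m A)" by (simp add: norm_inverse)
  then have "cmod c * mnorm A \<le> mnorm (c \<cdot>\<^sub>m A)" using False by (simp add: field_simps)
  then show ?thesis using mnorm_smult_le[OF A, of c] by simp
qed

lemma mnorm_one_le: "mnorm (1\<^sub>m m) \<le> 1"
  by (rule mnorm_leI[of _ m m]) auto

lemma mnorm_zero [simp]: "mnorm (0\<^sub>m n m) = 0"
proof (rule antisym)
  have "(0\<^sub>m n m :: complex mat) *\<^sub>v v = 0\<^sub>v n" if "v \<in> carrier_vec m" for v by (rule eq_vecI) (use that in auto)
  then show "mnorm (0\<^sub>m n m) \<le> 0" by (intro mnorm_leI[of _ n m]) auto
qed simp

lemma mnorm_adjoint_le: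
  assumes A: "A \<in> carrier_mat n m"
  shows "mnorm (mat_adjoint A) \<le> mnorm A"
proof (rule mnorm_leI[of _ m n])
  fix v :: "complex vec" assume v: "v \<in> carrier_vec n"
  let ?w = "mat_adjoint A *\<^sub>v v"
  have w: "?w \<in> carrier_vec m" using A v by (meson mat_adjoint_carrier mult_mat_vec_carrier)
  have "(vnorm ?w)\<^sup>2 = cmod (vip v (A *\<^sub>v ?w))"
    unfolding vip_adjoint[OF A v w] vip_self by (simp add: norm_power)
  also have "\<dots> \<le> vnorm v * (mnorm A * vnorm ?w)"
    using vip_cauchy_schwarz[of v n "A *\<^sub>v ?w"] vnorm_mult_le[OF A w] A v w
    by (meson mult_left_mono mult_mat_vec_carrier order_trans vnorm_ge_0)
  finally have "vnorm ?w * vnorm ?w \<le> (mnorm A * vnorm v) * vnorm ?w" by (simp add: power2_eq_square mult_ac)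
  then show "vnorm ?w \<le> mnorm A * vnorm v"
    by (cases "vnorm ?w = 0") (auto simp: mult_le_cancel_right less_le)
qed (use A in auto)

lemma mnorm_adjoint: "A \<in> carrier_mat n m \<Longrightarrow> mnorm (mat_adjoint A) = mnorm A"
  using mnorm_adjoint_le[of A n m] mnorm_adjoint_le[of "mat_adjoint A" m n] by simp

text \<open>Cauchy--Schwarz for the positive form \<open>\<langle>u, Tv\<rangle>\<close>, applied to \<open>v\<close> and \<open>Tv\<close>.\<close>

lemma mnorm_le_quadratic_form:
  assumes T: "T \<in> carrier_mat m m" "mat_adjoint T = T" and c: "c \<ge> 0"
    and pos: "\<And>v. v \<in> carrier_vec m \<Longrightarrow> 0 \<le> Re (vip v (T *\<^sub>v v))"
    and le: "\<And>v. v \<in> carrier_vec m \<Longrightarrow> Re (vip v (T *\<^sub>v v)) \<le> c * (vnorm v)\<^sup>2"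
  shows "mnorm T \<le> c"
proof (rule mnorm_leI[OF T(1) c])
  fix v :: "complex vec" assume v: "v \<in> carrier_vec m"
  define w where "w = T *\<^sub>v v"
  have w: "w \<in> carrier_vec m" "T *\<^sub>v w \<in> carrier_vec m" using T v by (auto simp: w_def)
  define a b d where "a = Re (vip v (T *\<^sub>v v))" and "b = (vnorm w)\<^sup>2" and "d = Re (vip w (T *\<^sub>v w))"
  have bnd: "a \<ge> 0" "a \<le> c * (vnorm v)\<^sup>2" "d \<ge> 0" "d \<le> c * b"
    unfolding a_def b_def d_def using pos le v w by auto
  have main: "0 \<le> a + 2 * t * b + t\<^sup>2 * d" for t
  proof -
    define u where "u = v + complex_of_real t \<cdot>\<^sub>v w"
    have u: "u \<in> carrier_vec m" using v w by (simp add: u_def)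
    have Tu: "T *\<^sub>v u = w + complex_of_real t \<cdot>\<^sub>v (T *\<^sub>v w)"
      unfolding u_def w_def[symmetric] using T v w by (simp add: mult_add_distrib_mat_vec[OF T(1)] w_def mult_mat_vec[OF T(1)])
    have "vip v (T *\<^sub>v w) = vip w w" using vip_adjoint[OF T(1) v w(1)] T(2) by (simp add: w_def)
    then have "Re (vip u (T *\<^sub>v u)) = a + 2 * t * b + t\<^sup>2 * d"
      unfolding Tu unfolding u_def using v w
      by (simp add: vip_add_left[of _ m] vip_add_right[of _ m] vip_smult_left vip_smult_right[of _ m] vip_self a_def d_def b_def
          power2_eq_square algebra_simps flip: w_def)
    then show ?thesis using pos[OF u] by simp
  qed
  have "b \<le> c * a"
  proof (cases "c = 0")
    case True
    then have "a = 0" "d = 0" using bnd by auto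
    then show ?thesis using main[of "-1"] True by (simp add: b_def)
  next
    case False
    then have "c > 0" using c by simp
    \<comment> \<open>The value \<open>- 1 / c\<close> minimizes the expression once
      \<open>d\<close> is replaced by its bound \<open>c * b\<close>; the outcome is
      \<open>\<parallel>T v\<parallel>^2 \<le> c \<langle>v, T v\<rangle>\<close>.\<close>
    have "0 \<le> a + 2 * (- 1 / c) * b + (- 1 / c)\<^sup>2 * d" by (rule main)
    also have "\<dots> \<le> a + 2 * (- 1 / c) * b + (- 1 / c)\<^sup>2 * (c * b)" using bnd by (intro add_left_mono mult_left_mono) auto
    also have "\<dots> = a - b / c" using \<open>c > 0\<close> by (simp add: field_simps power2_eq_square)
    finally show ?thesis using \<open>c > 0\<close> by (simp add: field_simps)
  qed
  also have "\<dots> \<le> (c * vnorm v)\<^sup>2" using mult_left_mono[OF bnd(2) c] by (simp add: power_mult_distrib power2_eq_square mult_ac)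
  finally show "vnorm (T *\<^sub>v v) \<le> c * vnorm v" unfolding b_def w_def by (rule power2_le_imp_le) (use c in simp)
qed

section \<open>Polynomials in matrices\<close>

lemma ev_mat_carrier:
  "(\<And>i. i \<in> ncvars P \<Longrightarrow> A i \<in> carrier_mat m m) \<Longrightarrow> ev_mat m A P \<in> carrier_mat m m"
  by (induction P) auto

text \<open>Variables are fixed because only self-adjoint tuples are substituted for them.\<close>

primrec ncstar :: "complex ncpoly \<Rightarrow> complex ncpoly" where
  "ncstar (NVar i) = NVar i"
| "ncstar (NConst c) = NConst (cnj c)"
| "ncstar (NAdd p q) = NAdd (ncstar p) (ncstar q)"
| "ncstar (NMul p q) = NMul (ncstar q) (ncstar p)"

lemma ncvars_ncstar [simp]: "ncvars (ncstar P) = ncvars P"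
  by (induction P) auto

lemma ncpolys_ncstar [simp]: "ncstar P \<in> ncpolys n \<longleftrightarrow> P \<in> ncpolys n"
  by (simp add: ncpolys_def)

lemma ncpolys_intros [simp]:
  "NVar i \<in> ncpolys n \<longleftrightarrow> i < n" "NConst c \<in> ncpolys n"
  "NAdd P Q \<in> ncpolys n \<longleftrightarrow> P \<in> ncpolys n \<and> Q \<in> ncpolys n"
  "NMul P Q \<in> ncpolys n \<longleftrightarrow> P \<in> ncpolys n \<and> Q \<in> ncpolys n"
  by (auto simp: ncpolys_def)

lemma ev_alg_ncstar:
  "(\<And>i. i \<in> ncvars P \<Longrightarrow> cstar (x i) = x i) \<Longrightarrow> ev_alg x (ncstar P) = cstar (ev_alg x P)"
  by (induction P) (auto simp: cstar_add cstar_mult cstar_scaleC)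

lemma ev_mat_ncstar:
  "(\<And>i. i \<in> ncvars P \<Longrightarrow> selfadjoint_mat m (A i)) \<Longrightarrow> ev_mat m A (ncstar P) = mat_adjoint (ev_mat m A P)"
proof (induction P)
  case (NAdd P Q)
  then have "ev_mat m A P \<in> carrier_mat m m" "ev_mat m A Q \<in> carrier_mat m m"
    by (auto intro!: ev_mat_carrier simp: selfadjoint_mat_def)
  then show ?case using NAdd by (simp add: mat_adjoint_add)
next
  case (NMul P Q)
  then have "ev_mat m A P \<in> carrier_mat m m" "ev_mat m A Q \<in> carrier_mat m m"
    by (auto intro!: ev_mat_carrier simp: selfadjoint_mat_def)
  then show ?case using NMul by (simp add: mat_adjoint_mult)
qed (auto simp: selfadjoint_mat_def mat_adjoint_smult)

section \<open>Direct sums of matrices\<close>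

definition dsum :: "complex mat \<Rightarrow> complex mat \<Rightarrow> complex mat" where
  "dsum A B = four_block_mat A (0\<^sub>m (dim_row A) (dim_col B)) (0\<^sub>m (dim_row B) (dim_col A)) B"

lemma dsum_carrier: "A \<in> carrier_mat m m \<Longrightarrow> B \<in> carrier_mat k k \<Longrightarrow> dsum A B \<in> carrier_mat (m + k) (m + k)"
  by (auto simp: dsum_def)

lemma dsum_add:
  assumes "A \<in> carrier_mat m m" "B \<in> carrier_mat k k" "C \<in> carrier_mat m m" "D \<in> carrier_mat k k"
  shows "dsum A B + dsum C D = dsum (A + C) (B + D)"
  by (rule eq_matI) (use assms in \<open>auto simp: dsum_def\<close>)

lemma dsum_mult:
  assumes "A \<in> carrier_mat m m" "B \<in> carrier_mat k k" "C \<in> carrier_mat m m" "D \<in> carrier_mat k k"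
  shows "dsum A B * dsum C D = dsum (A * C) (B * D)"
proof -
  have "dsum A B * dsum C D = four_block_mat (A * C + 0\<^sub>m m k * 0\<^sub>m k m) (A * 0\<^sub>m m k + 0\<^sub>m m k * D)
      (0\<^sub>m k m * C + B * 0\<^sub>m k m) (0\<^sub>m k m * 0\<^sub>m m k + B * D)"
    using assms unfolding dsum_def by (subst mult_four_block_mat[of _ m m _ k _ k _ _ m _ k]) auto
  also have "\<dots> = dsum (A * C) (B * D)" using assms by (simp add: dsum_def)
  finally show ?thesis .
qed

lemma dsum_smult_one: "dsum (c \<cdot>\<^sub>m 1\<^sub>m m) (c \<cdot>\<^sub>m 1\<^sub>m k) = c \<cdot>\<^sub>m 1\<^sub>m (m + k)"
  by (rule eq_matI) (auto simp: dsum_def)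

lemma dsum_adjoint:
  assumes "A \<in> carrier_mat m m" "B \<in> carrier_mat k k"
  shows "mat_adjoint (dsum A B) = dsum (mat_adjoint A) (mat_adjoint B)"
  by (rule eq_matI) (use assms in \<open>auto simp: dsum_def mat_adjoint_eq\<close>)

lemma ev_mat_dsum:
  assumes "\<And>i. i \<in> ncvars P \<Longrightarrow> A i \<in> carrier_mat m m \<and> B i \<in> carrier_mat k k"
  shows "ev_mat (m + k) (\<lambda>i. dsum (A i) (B i)) P = dsum (ev_mat m A P) (ev_mat k B P)"
  using assms
proof (induction P)
  case (NAdd P Q)
  then show ?case by (simp, intro dsum_add[of _ m _ k] ev_mat_carrier) auto
next
  case (NMul P Q)
  then show ?case by (simp, intro dsum_mult[of _ m _ k] ev_mat_carrier) auto
qed (auto simp: dsum_smult_one)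

lemma vnorm_append: "(vnorm (a @\<^sub>v b))\<^sup>2 = (vnorm a)\<^sup>2 + (vnorm b)\<^sup>2"
proof -
  let ?f = "\<lambda>i. (cmod ((a @\<^sub>v b) $ i))\<^sup>2"
  have "(vnorm (a @\<^sub>v b))\<^sup>2 = sum ?f {..<dim_vec a + dim_vec b}" by (simp add: vnorm_sq)
  also have "sum f {..<n + k} = sum f {..<n} + (\<Sum>i<k. f (n + i))" for f :: "nat \<Rightarrow> real" and n k
    by (induction k) (auto simp: add.assoc)
  finally show ?thesis by (simp add: vnorm_sq)
qed

text \<open>Vectors split into orthogonal blocks, and padding by zeros preserves their norm. The
  maximum matters later: an additional block can raise a norm to its target without violating an
  upper bound that both blocks satisfy.\<close>

lemma mnorm_dsum:
  assumes A: "A \<in> carrier_mat m m" and B: "B \<in> carrier_mat k k"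
  shows "mnorm (dsum A B) = max (mnorm A) (mnorm B)"
proof (rule antisym)
  have mv: "dsum A B *\<^sub>v (a @\<^sub>v b) = (A *\<^sub>v a) @\<^sub>v (B *\<^sub>v b)" if "a \<in> carrier_vec m" "b \<in> carrier_vec k" for a b
  proof -
    have "dsum A B *\<^sub>v (a @\<^sub>v b) = (A *\<^sub>v a + 0\<^sub>m m k *\<^sub>v b) @\<^sub>v (0\<^sub>m k m *\<^sub>v a + B *\<^sub>v b)"
      unfolding dsum_def using A B that by (subst four_block_mat_mult_vec[of _ m m _ k _ k]) auto
    moreover have "A *\<^sub>v a + 0\<^sub>m m k *\<^sub>v b = A *\<^sub>v a" "0\<^sub>m k m *\<^sub>v a + B *\<^sub>v b = B *\<^sub>v b"
      using A B that by auto
    ultimately show ?thesis by simp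
  qed
  let ?M = "max (mnorm A) (mnorm B)"
  have M: "?M \<ge> 0" by (simp add: le_max_iff_disj)
  show "mnorm (dsum A B) \<le> ?M"
  proof (rule mnorm_leI[OF dsum_carrier[OF A B] M])
    fix v :: "complex vec" assume v: "v \<in> carrier_vec (m + k)"
    define a b where "a = vec_first v m" and "b = vec_last v k"
    have ab: "a \<in> carrier_vec m" "b \<in> carrier_vec k" "v = a @\<^sub>v b" using v by (auto simp: a_def b_def)
    have "vnorm (A *\<^sub>v a) \<le> ?M * vnorm a" "vnorm (B *\<^sub>v b) \<le> ?M * vnorm b"
      using vnorm_mult_le[OF A ab(1)] vnorm_mult_le[OF B ab(2)]
      by (meson max.cobounded1 max.cobounded2 mult_right_mono order_trans vnorm_ge_0)+
    then have "(vnorm (A *\<^sub>v a))\<^sup>2 \<le> (?M * vnorm a)\<^sup>2" "(vnorm (B *\<^sub>v b))\<^sup>2 \<le> (?M * vnorm b)\<^sup>2"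
      by (simp_all add: power_mono)
    then have "(vnorm (dsum A B *\<^sub>v v))\<^sup>2 \<le> (?M * vnorm v)\<^sup>2"
      unfolding ab(3) mv[OF ab(1,2)] power_mult_distrib vnorm_append by (simp add: distrib_left)
    then show "vnorm (dsum A B *\<^sub>v v) \<le> ?M * vnorm v" by (rule power2_le_imp_le) (use M in simp)
  qed
  have "mnorm A \<le> mnorm (dsum A B)"
  proof (rule mnorm_leI[OF A])
    fix a :: "complex vec" assume a: "a \<in> carrier_vec m"
    have "vnorm (a @\<^sub>v 0\<^sub>v k) = vnorm a" using vnorm_append[of a "0\<^sub>v k"] by (simp add: power2_eq_iff_nonneg)
    moreover have "vnorm (A *\<^sub>v a @\<^sub>v B *\<^sub>v 0\<^sub>v k) = vnorm (A *\<^sub>v a)"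
    proof -
      have "B *\<^sub>v 0\<^sub>v k = 0\<^sub>v k" using B by auto
      then show ?thesis using vnorm_append[of "A *\<^sub>v a" "0\<^sub>v k"] by (simp add: power2_eq_iff_nonneg)
    qed
    ultimately show "vnorm (A *\<^sub>v a) \<le> mnorm (dsum A B) * vnorm a"
      using vnorm_mult_le[OF dsum_carrier[OF A B], of "a @\<^sub>v 0\<^sub>v k"] mv[OF a, of "0\<^sub>v k"] a by simp
  qed simp
  moreover have "mnorm B \<le> mnorm (dsum A B)"
  proof (rule mnorm_leI[OF B])
    fix b :: "complex vec" assume b: "b \<in> carrier_vec k"
    have "vnorm (0\<^sub>v m @\<^sub>v b) = vnorm b" using vnorm_append[of "0\<^sub>v m" b] by (simp add: power2_eq_iff_nonneg)
    moreover have "vnorm (A *\<^sub>v 0\<^sub>v m @\<^sub>v B *\<^sub>v b) = vnorm (B *\<^sub>v b)"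
    proof -
      have "A *\<^sub>v 0\<^sub>v m = 0\<^sub>v m" using A by auto
      then show ?thesis using vnorm_append[of "0\<^sub>v m" "B *\<^sub>v b"] by (simp add: power2_eq_iff_nonneg)
    qed
    ultimately show "vnorm (B *\<^sub>v b) \<le> mnorm (dsum A B) * vnorm b"
      using vnorm_mult_le[OF dsum_carrier[OF A B], of "0\<^sub>v m @\<^sub>v b"] mv[OF _ b, of "0\<^sub>v m"] b by simp
  qed simp
  ultimately show "?M \<le> mnorm (dsum A B)" by simp
qed

section \<open>Norms of differences of matrices\<close>

declare minus_carrier_mat [simp]

lemma mat_minus_eq: "A \<in> carrier_mat n m \<Longrightarrow> B \<in> carrier_mat n m \<Longrightarrow> A - B = A + (-1) \<cdot>\<^sub>m (B :: complex mat)"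
  by (rule eq_matI) auto

lemma mnorm_minus_commute: "A \<in> carrier_mat n m \<Longrightarrow> B \<in> carrier_mat n m \<Longrightarrow> mnorm (A - B) = mnorm (B - A)"
proof -
  assume a: "A \<in> carrier_mat n m" "B \<in> carrier_mat n m"
  have "B - A = (-1) \<cdot>\<^sub>m (A - B)" by (rule eq_matI) (use a in auto)
  then show ?thesis using mnorm_smult[of "A - B" n m "-1"] a by simp
qed

lemma mnorm_triangle_diff:
  assumes "A \<in> carrier_mat n m" "B \<in> carrier_mat n m" "C \<in> carrier_mat n m"
  shows "mnorm (A - C) \<le> mnorm (A - B) + mnorm (B - C)"
proof -
  have "A - C = (A - B) + (B - C)" by (rule eq_matI) (use assms in auto)
  then show ?thesis using mnorm_add[of "A - B" n m "B - C"] assms by simp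
qed

lemma mnorm_le_add_diff:
  assumes "A \<in> carrier_mat n m" "B \<in> carrier_mat n m"
  shows "mnorm A \<le> mnorm B + mnorm (A - B)"
proof -
  have "A = B + (A - B)" by (rule eq_matI) (use assms in auto)
  then show ?thesis using mnorm_add[of B n m "A - B"] assms by simp
qed

lemma mnorm_abs_diff:
  assumes "A \<in> carrier_mat n m" "B \<in> carrier_mat n m"
  shows "\<bar>mnorm A - mnorm B\<bar> \<le> mnorm (A - B)"
  using mnorm_le_add_diff[OF assms] mnorm_le_add_diff[OF assms(2,1)] mnorm_minus_commute[OF assms] by simp

lemma mnorm_add_diff:
  assumes "A \<in> carrier_mat n m" "B \<in> carrier_mat n m" "A' \<in> carrier_mat n m" "B' \<in> carrier_mat n m"
  shows "mnorm ((A + B) - (A' + B')) \<le> mnorm (A - A') + mnorm (B - B')"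
proof -
  have "(A + B) - (A' + B') = (A - A') + (B - B')" by (rule eq_matI) (use assms in auto)
  then show ?thesis using mnorm_add[of "A - A'" n m "B - B'"] assms by simp
qed

lemma mnorm_mult_diff:
  assumes "A \<in> carrier_mat m m" "B \<in> carrier_mat m m" "A' \<in> carrier_mat m m" "B' \<in> carrier_mat m m"
  shows "mnorm (A * B - A' * B') \<le> mnorm (A - A') * mnorm B + mnorm A' * mnorm (B - B')"
proof -
  have "A * B - A' * B' = (A - A') * B + A' * (B - B')"
  proof -
    have "(A - A') * B = A * B - A' * B" by (rule minus_mult_distrib_mat) (use assms in auto)
    moreover have "A' * (B - B') = A' * B - A' * B'" by (rule mult_minus_distrib_mat) (use assms in auto)
    moreover have "A * B - A' * B' = (A * B - A' * B) + (A' * B - A' * B')"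
      by (rule eq_matI) (use assms in auto)
    ultimately show ?thesis by simp
  qed
  also have "mnorm \<dots> \<le> mnorm ((A - A') * B) + mnorm (A' * (B - B'))" by (rule mnorm_add[of _ m m]) (use assms in auto)
  also have "\<dots> \<le> mnorm (A - A') * mnorm B + mnorm A' * mnorm (B - B')"
    by (intro add_mono mnorm_mult[of _ m m _ m]) (use assms in auto)
  finally show ?thesis .
qed

lemma mnorm_smult_diff:
  assumes "A \<in> carrier_mat n m" "B \<in> carrier_mat n m"
  shows "mnorm (c \<cdot>\<^sub>m A - c \<cdot>\<^sub>m B) = cmod c * mnorm (A - B)"
proof -
  have "c \<cdot>\<^sub>m A - c \<cdot>\<^sub>m B = c \<cdot>\<^sub>m (A - B)" by (rule eq_matI) (use assms in \<open>auto simp: algebra_simps\<close>)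
  then show ?thesis using mnorm_smult[of "A - B" n m c] assms by simp
qed

lemma mnorm_adjoint_diff:
  assumes "A \<in> carrier_mat n m" "B \<in> carrier_mat n m"
  shows "mnorm (mat_adjoint A - mat_adjoint B) = mnorm (A - B)"
proof -
  have "mat_adjoint A - mat_adjoint B = mat_adjoint (A - B)"
    by (rule eq_matI) (use assms in \<open>auto simp: mat_adjoint_eq\<close>)
  then show ?thesis using mnorm_adjoint[of "A - B" n m] assms by simp
qed

lemma mnorm_self_diff [simp]: "mnorm (A - A) = 0"
proof -
  have eq: "A - A = 0\<^sub>m (dim_row A) (dim_col A)" by (rule eq_matI) auto
  show ?thesis by (simp only: eq mnorm_zero)
qed

section \<open>Quadratic forms of matrices\<close>

definition qf :: "complex mat \<Rightarrow> complex vec \<Rightarrow> real" where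
  "qf A v = Re (vip v (A *\<^sub>v v))"

lemma qf_add: "A \<in> carrier_mat m m \<Longrightarrow> B \<in> carrier_mat m m \<Longrightarrow> v \<in> carrier_vec m \<Longrightarrow> qf (A + B) v = qf A v + qf B v"
  by (simp add: qf_def add_mult_distrib_mat_vec[of A m m B] vip_add_right[of _ m])

lemma qf_smult: "A \<in> carrier_mat m m \<Longrightarrow> v \<in> carrier_vec m \<Longrightarrow> qf (complex_of_real r \<cdot>\<^sub>m A) v = r * qf A v"
  by (simp add: qf_def smult_mat_mult_vec[of A m m] vip_smult_right[of _ m])

lemma qf_diff: "A \<in> carrier_mat m m \<Longrightarrow> B \<in> carrier_mat m m \<Longrightarrow> v \<in> carrier_vec m \<Longrightarrow> qf (A - B) v = qf A v - qf B v"
  using qf_smult[of B m v "-1"] qf_add[of A m "(-1) \<cdot>\<^sub>m B" v] by (simp add: mat_minus_eq[of A m m B])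

lemma qf_one: "v \<in> carrier_vec m \<Longrightarrow> qf (1\<^sub>m m) v = (vnorm v)\<^sup>2"
  by (simp add: qf_def vip_self)

text \<open>It converts a sum of products of the form \<open>mat_adjoint S * S\<close> into squared
  lengths, so that operator identities can be evaluated vector by vector.\<close>

lemma qf_gram: "S \<in> carrier_mat n m \<Longrightarrow> v \<in> carrier_vec m \<Longrightarrow> qf (mat_adjoint S * S) v = (vnorm (S *\<^sub>v v))\<^sup>2"
proof -
  assume S: "S \<in> carrier_mat n m" "v \<in> carrier_vec m"
  have "vip (S *\<^sub>v v) (S *\<^sub>v v) = vip (mat_adjoint S *\<^sub>v (S *\<^sub>v v)) v"
    by (rule vip_adjoint[OF S(1)]) (use S in auto)
  also have "mat_adjoint S *\<^sub>v (S *\<^sub>v v) = (mat_adjoint S * S) *\<^sub>v v"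
    using assoc_mult_mat_vec[OF mat_adjoint_carrier[OF S(1)] S] by simp
  finally have "vip ((mat_adjoint S * S) *\<^sub>v v) v = complex_of_real ((vnorm (S *\<^sub>v v))\<^sup>2)" by (simp only: vip_self)
  moreover have "vip v ((mat_adjoint S * S) *\<^sub>v v) = cnj (vip ((mat_adjoint S * S) *\<^sub>v v) v)"
    by (rule vip_cnj) (use S in \<open>simp add: mat_adjoint_eq\<close>)
  ultimately show ?thesis by (simp add: qf_def)
qed

lemma qf_bound: "A \<in> carrier_mat m m \<Longrightarrow> v \<in> carrier_vec m \<Longrightarrow> \<bar>qf A v\<bar> \<le> mnorm A * (vnorm v)\<^sup>2"
proof -
  assume A: "A \<in> carrier_mat m m" "v \<in> carrier_vec m"
  have "\<bar>qf A v\<bar> \<le> vnorm v * vnorm (A *\<^sub>v v)"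
    unfolding qf_def using vip_cauchy_schwarz[of v m "A *\<^sub>v v"] A abs_Re_le_cmod order_trans by (metis mult_mat_vec_carrier)
  also have "\<dots> \<le> vnorm v * (mnorm A * vnorm v)" by (intro mult_left_mono vnorm_mult_le[OF A]) simp
  finally show ?thesis by (simp add: power2_eq_square mult_ac)
qed

lemma ev_mat_cong: "(\<And>i. i \<in> ncvars P \<Longrightarrow> A i = B i) \<Longrightarrow> ev_mat m A P = ev_mat m B P"
  by (induction P) auto

lemma ncvars_ncpolys: "P \<in> ncpolys n \<Longrightarrow> i \<in> ncvars P \<Longrightarrow> i < n"
  by (auto simp: ncpolys_def)

section \<open>Rational approximation of polynomials\<close>

text \<open>One a priori bound for the algebra and for matrices of every size, used in the product
  step of rational approximation.\<close>

primrec ncbound :: "real \<Rightarrow> complex ncpoly \<Rightarrow> real" where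
  "ncbound R (NVar i) = R"
| "ncbound R (NConst c) = cmod c"
| "ncbound R (NAdd p q) = ncbound R p + ncbound R q"
| "ncbound R (NMul p q) = ncbound R p * ncbound R q"

lemma ncbound_ge_0: "R \<ge> 0 \<Longrightarrow> 0 \<le> ncbound R P"
  by (induction P) auto

lemma norm_ev_alg_le: "R \<ge> 0 \<Longrightarrow> P \<in> ncpolys n \<Longrightarrow> (\<And>i. i < n \<Longrightarrow> norm (x i) \<le> R) \<Longrightarrow> norm (ev_alg x P) \<le> ncbound R P"
proof (induction P)
  case (NAdd P Q)
  then show ?case using norm_triangle_ineq[of "ev_alg x P" "ev_alg x Q"] by simp
next
  case (NMul P Q)
  then have "norm (ev_alg x P) * norm (ev_alg x Q) \<le> ncbound R P * ncbound R Q"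
    by (intro mult_mono) (auto simp: ncbound_ge_0)
  then show ?case using norm_mult_ineq[of "ev_alg x P" "ev_alg x Q"] by simp
qed (auto simp: norm_scaleC)

lemma mnorm_ev_mat_le:
  "R \<ge> 0 \<Longrightarrow> P \<in> ncpolys n \<Longrightarrow> (\<And>i. i < n \<Longrightarrow> A i \<in> carrier_mat m m \<and> mnorm (A i) \<le> R) \<Longrightarrow> mnorm (ev_mat m A P) \<le> ncbound R P"
proof (induction P)
  case (NConst c)
  then show ?case using mnorm_smult[of "1\<^sub>m m" m m c] mnorm_one_le[of m] by (simp add: mult_left_le)
next
  case (NAdd P Q)
  then have "ev_mat m A P \<in> carrier_mat m m" "ev_mat m A Q \<in> carrier_mat m m"
    by (auto intro!: ev_mat_carrier dest: ncvars_ncpolys)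
  then show ?case using NAdd mnorm_add[of "ev_mat m A P" m m "ev_mat m A Q"] by simp
next
  case (NMul P Q)
  then have c: "ev_mat m A P \<in> carrier_mat m m" "ev_mat m A Q \<in> carrier_mat m m"
    by (auto intro!: ev_mat_carrier dest: ncvars_ncpolys)
  have "mnorm (ev_mat m A P) * mnorm (ev_mat m A Q) \<le> ncbound R P * ncbound R Q"
    using NMul by (intro mult_mono) (auto simp: ncbound_ge_0)
  then show ?case using mnorm_mult[OF c] by simp
qed simp

text \<open>The tolerance is uniform over all matrix sizes and all tuples bounded by
  \<open>R\<close>, and one replacement polynomial serves the algebra as well. This uniformity is
  essential because the matrices change their size along a sequence.\<close>

definition poly_close :: "'a::unital_cstar_algebra itself \<Rightarrow> nat \<Rightarrow> real \<Rightarrow> real \<Rightarrow> complex ncpoly \<Rightarrow> complex ncpoly \<Rightarrow> bool" where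
  "poly_close _ n R d P Q \<longleftrightarrow>
     (\<forall>x::nat \<Rightarrow> 'a. (\<forall>i<n. norm (x i) \<le> R) \<longrightarrow> norm (ev_alg x P - ev_alg x Q) \<le> d) \<and>
     (\<forall>m A. (\<forall>i<n. A i \<in> carrier_mat m m \<and> mnorm (A i) \<le> R) \<longrightarrow> mnorm (ev_mat m A P - ev_mat m A Q) \<le> d)"

lemma gauss_rat_dense:
  assumes "d > 0"
  obtains q where "cmod (c - gauss_rat q) \<le> d"
proof -
  obtain a where a: "Re c < of_rat a" "of_rat a < Re c + d / 2" using of_rat_dense[of "Re c" "Re c + d / 2"] assms by auto
  obtain b where b: "Im c < of_rat b" "of_rat b < Im c + d / 2" using of_rat_dense[of "Im c" "Im c + d / 2"] assms by auto
  have "cmod (c - gauss_rat (a, b)) \<le> \<bar>Re (c - gauss_rat (a, b))\<bar> + \<bar>Im (c - gauss_rat (a, b))\<bar>" by (rule cmod_le)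
  also have "\<dots> \<le> d" using a b by (simp add: gauss_rat_def)
  finally show ?thesis using that by blast
qed

lemma ncvars_map [simp]: "ncvars (map_ncpoly f P) = ncvars P"
  by (induction P) auto

lemma ratpolys_map: "Q \<in> ratpolys n \<Longrightarrow> map_ncpoly gauss_rat Q \<in> ncpolys n"
  by (simp add: ratpolys_def ncpolys_def)

lemma rational_approx:
  assumes R: "R \<ge> 0"
  shows "P \<in> ncpolys n \<Longrightarrow> d > 0 \<Longrightarrow> \<exists>Q\<in>ratpolys n. poly_close TYPE('a::unital_cstar_algebra) n R d P (map_ncpoly gauss_rat Q)"
proof (induction P arbitrary: d)
  case (NVar i)
  then have "poly_close TYPE('a) n R d (NVar i) (map_ncpoly gauss_rat (NVar i))"
    by (simp add: poly_close_def)
  then show ?case using NVar by (intro bexI[of _ "NVar i"]) (auto simp: ratpolys_def)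
next
  case (NConst c)
  obtain q where q: "cmod (c - gauss_rat q) \<le> d" using gauss_rat_dense NConst by blast
  have "norm (c *\<^sub>C (1::'a) - gauss_rat q *\<^sub>C 1) \<le> d"
    using q scaleC_add_left[of "c - gauss_rat q" "gauss_rat q" "1::'a"] norm_scaleC[of "c - gauss_rat q" "1::'a"] by simp
  moreover have "mnorm (c \<cdot>\<^sub>m 1\<^sub>m m - gauss_rat q \<cdot>\<^sub>m 1\<^sub>m m) \<le> d" for m
  proof -
    have "c \<cdot>\<^sub>m 1\<^sub>m m - gauss_rat q \<cdot>\<^sub>m 1\<^sub>m m = (c - gauss_rat q) \<cdot>\<^sub>m 1\<^sub>m m"
      by (rule eq_matI) (auto simp: algebra_simps)
    then have "mnorm (c \<cdot>\<^sub>m 1\<^sub>m m - gauss_rat q \<cdot>\<^sub>m 1\<^sub>m m) \<le> cmod (c - gauss_rat q) * 1"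
      using mnorm_smult[of "1\<^sub>m m" m m "c - gauss_rat q"] mnorm_one_le[of m] by (simp add: mult_left_le)
    then show ?thesis using q by simp
  qed
  ultimately have "poly_close TYPE('a) n R d (NConst c) (map_ncpoly gauss_rat (NConst q))"
    by (simp add: poly_close_def)
  then show ?case by (intro bexI[of _ "NConst q"]) (auto simp: ratpolys_def)
next
  case (NAdd P1 P2)
  then obtain Q1 Q2 where Q: "Q1 \<in> ratpolys n" "poly_close TYPE('a) n R (d/2) P1 (map_ncpoly gauss_rat Q1)"
    "Q2 \<in> ratpolys n" "poly_close TYPE('a) n R (d/2) P2 (map_ncpoly gauss_rat Q2)"
    by (metis half_gt_zero ncpolys_intros(3))
  let ?q1 = "map_ncpoly gauss_rat Q1" and ?q2 = "map_ncpoly gauss_rat Q2"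
  have "norm (ev_alg x (NAdd P1 P2) - ev_alg x (NAdd ?q1 ?q2)) \<le> d" if "\<forall>i<n. norm (x i) \<le> R" for x :: "nat \<Rightarrow> 'a"
  proof -
    have "norm (ev_alg x P1 - ev_alg x ?q1) \<le> d/2" "norm (ev_alg x P2 - ev_alg x ?q2) \<le> d/2"
      using Q that by (auto simp: poly_close_def)
    then show ?thesis
      using norm_diff_triangle_ineq[of "ev_alg x P1" "ev_alg x P2" "ev_alg x ?q1" "ev_alg x ?q2"] by simp
  qed
  moreover have "mnorm (ev_mat m A (NAdd P1 P2) - ev_mat m A (NAdd ?q1 ?q2)) \<le> d"
    if A: "\<forall>i<n. A i \<in> carrier_mat m m \<and> mnorm (A i) \<le> R" for m A
  proof -
    have "mnorm (ev_mat m A P1 - ev_mat m A ?q1) \<le> d/2" "mnorm (ev_mat m A P2 - ev_mat m A ?q2) \<le> d/2"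
      using Q A by (auto simp: poly_close_def)
    moreover have "ev_mat m A P \<in> carrier_mat m m" if "P \<in> ncpolys n" for P
      using that A by (auto intro!: ev_mat_carrier dest: ncvars_ncpolys)
    ultimately show ?thesis
      using mnorm_add_diff[of "ev_mat m A P1" m m "ev_mat m A P2" "ev_mat m A ?q1" "ev_mat m A ?q2"] Q NAdd.prems
      by (simp add: ratpolys_map)
  qed
  ultimately have "poly_close TYPE('a) n R d (NAdd P1 P2) (map_ncpoly gauss_rat (NAdd Q1 Q2))"
    by (simp add: poly_close_def)
  then show ?case using Q by (intro bexI[of _ "NAdd Q1 Q2"]) (auto simp: ratpolys_def)
next
  case (NMul P1 P2)
  define b1 b2 where "b1 = ncbound R P1" and "b2 = ncbound R P2"
  have b: "b1 \<ge> 0" "b2 \<ge> 0" by (simp_all add: b1_def b2_def ncbound_ge_0 R)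
  \<comment> \<open>In \<open>P1 P2 - Q1 Q2 = (P1 - Q1) P2 + Q1 (P2 - Q2)\<close> the factors are
    bounded by \<open>d1\<close>, \<open>b2\<close>, \<open>b1 + d1 \<le> b1 + 1\<close> and
    \<open>d2\<close>, so each product is at most \<open>d / 2\<close>. The added \<open>1\<close>
    keeps the denominators positive.\<close>
  define d1 d2 where "d1 = min 1 (d / (2 * (b2 + 1)))" and "d2 = d / 2 / (b1 + 1)"
  have d12: "d1 > 0" "d2 > 0" "d1 \<le> 1" using b NMul.prems by (auto simp: d1_def d2_def)
  have "d1 * b2 \<le> (d / (2 * (b2 + 1))) * b2" using b by (intro mult_right_mono) (auto simp: d1_def)
  also have "\<dots> \<le> d / 2" using b NMul.prems by (simp add: field_simps)
  finally have e1: "d1 * b2 \<le> d / 2" .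
  have gen: "c * (y / c) = y" if "c \<noteq> 0" for c y :: real using that by simp
  have nz: "b1 + 1 \<noteq> 0" using b by linarith
  have e2: "(b1 + 1) * d2 = d / 2" unfolding d2_def by (rule gen[OF nz])
  have comb: "u * v + w * z \<le> d" if "0 \<le> v" "v \<le> b2" "u \<le> d1" "0 \<le> u" "0 \<le> w" "w \<le> b1 + d1" "0 \<le> z" "z \<le> d2" for u v w z :: real
  proof -
    have "u * v \<le> d1 * b2" "w * z \<le> (b1 + 1) * d2" using that b d12 by (auto intro!: mult_mono)
    then show ?thesis using e1 e2 by simp
  qed
  obtain Q1 Q2 where Q: "Q1 \<in> ratpolys n" "poly_close TYPE('a) n R d1 P1 (map_ncpoly gauss_rat Q1)"
    "Q2 \<in> ratpolys n" "poly_close TYPE('a) n R d2 P2 (map_ncpoly gauss_rat Q2)"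
    using NMul d12 by (metis ncpolys_intros(4))
  let ?q1 = "map_ncpoly gauss_rat Q1" and ?q2 = "map_ncpoly gauss_rat Q2"
  have P: "P1 \<in> ncpolys n" "P2 \<in> ncpolys n" using NMul.prems by auto
  have "norm (ev_alg x (NMul P1 P2) - ev_alg x (NMul ?q1 ?q2)) \<le> d" if x: "\<forall>i<n. norm (x i) \<le> R" for x :: "nat \<Rightarrow> 'a"
  proof -
    have c: "norm (ev_alg x P1 - ev_alg x ?q1) \<le> d1" "norm (ev_alg x P2 - ev_alg x ?q2) \<le> d2"
      using Q x by (auto simp: poly_close_def)
    have n: "norm (ev_alg x P1) \<le> b1" "norm (ev_alg x P2) \<le> b2"
      unfolding b1_def b2_def using norm_ev_alg_le[OF R] P x by blast+
    have "norm (ev_alg x ?q1) \<le> b1 + d1"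
      using c(1) n(1) norm_triangle_sub[of "ev_alg x ?q1" "ev_alg x P1"] by (simp add: norm_minus_commute)
    then have "norm (ev_alg x P1 - ev_alg x ?q1) * norm (ev_alg x P2) + norm (ev_alg x ?q1) * norm (ev_alg x P2 - ev_alg x ?q2) \<le> d"
      using c n by (intro comb) auto
    moreover have "ev_alg x (NMul P1 P2) - ev_alg x (NMul ?q1 ?q2)
        = (ev_alg x P1 - ev_alg x ?q1) * ev_alg x P2 + ev_alg x ?q1 * (ev_alg x P2 - ev_alg x ?q2)"
      by (simp add: algebra_simps)
    ultimately show ?thesis
      by (smt (verit) norm_mult_ineq norm_triangle_ineq)
  qed
  moreover have "mnorm (ev_mat m A (NMul P1 P2) - ev_mat m A (NMul ?q1 ?q2)) \<le> d"
    if A: "\<forall>i<n. A i \<in> carrier_mat m m \<and> mnorm (A i) \<le> R" for m A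
  proof -
    have c: "mnorm (ev_mat m A P1 - ev_mat m A ?q1) \<le> d1" "mnorm (ev_mat m A P2 - ev_mat m A ?q2) \<le> d2"
      using Q A by (auto simp: poly_close_def)
    have car: "ev_mat m A P \<in> carrier_mat m m" if "P \<in> ncpolys n" for P
      using that A by (auto intro!: ev_mat_carrier dest: ncvars_ncpolys)
    note car4 = car[OF P(1)] car[OF P(2)] car[OF ratpolys_map[OF Q(1)]] car[OF ratpolys_map[OF Q(3)]]
    have n: "mnorm (ev_mat m A P1) \<le> b1" "mnorm (ev_mat m A P2) \<le> b2"
      unfolding b1_def b2_def using mnorm_ev_mat_le[OF R] P A by blast+
    have "mnorm (ev_mat m A ?q1) \<le> b1 + d1"
      using mnorm_le_add_diff[OF car4(3,1)] mnorm_minus_commute[OF car4(3,1)] c n by simp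
    then have "mnorm (ev_mat m A P1 - ev_mat m A ?q1) * mnorm (ev_mat m A P2) + mnorm (ev_mat m A ?q1) * mnorm (ev_mat m A P2 - ev_mat m A ?q2) \<le> d"
      using c n by (intro comb) auto
    then show ?thesis using mnorm_mult_diff[OF car4] by simp
  qed
  ultimately have "poly_close TYPE('a) n R d (NMul P1 P2) (map_ncpoly gauss_rat (NMul Q1 Q2))"
    by (simp add: poly_close_def)
  then show ?case using Q by (intro bexI[of _ "NMul Q1 Q2"]) (auto simp: ratpolys_def)
qed

lemma ratpolys_nonempty: "ratpolys n \<noteq> {}"
proof -
  have "NConst (0, 0) \<in> ratpolys n" by (simp add: ratpolys_def)
  then show ?thesis by blast
qed

lemma enum_poly_ncpolys: "enum_poly n j \<in> ncpolys n"
  unfolding enum_poly_def by (intro ratpolys_map from_nat_into ratpolys_nonempty)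

text \<open>The enumeration starts at index \<open>1\<close>, hence \<open>Suc j\<close>.\<close>

lemma enum_poly_surj:
  assumes "Q \<in> ratpolys n"
  obtains j where "enum_poly n (Suc j) = map_ncpoly gauss_rat Q"
proof -
  have "countable (ratpolys n)" by (rule countableI_type)
  then obtain j where "from_nat_into (ratpolys n) j = Q" using from_nat_into_surj assms by metis
  then show ?thesis using that[of j] by (simp add: enum_poly_def)
qed

lemma enum_poly_approx:
  assumes "R \<ge> 0" "P \<in> ncpolys n" "d > 0"
  obtains j where "poly_close TYPE('a::unital_cstar_algebra) n R d P (enum_poly n (Suc j))"
  using rational_approx[OF assms, where 'a='a] enum_poly_surj by metis

section \<open>Approximation property and norm convergence\<close>

definition norm_convergent ::
    "nat \<Rightarrow> (nat \<Rightarrow> 'a::unital_cstar_algebra) \<Rightarrow> (nat \<Rightarrow> nat) \<Rightarrow> (nat \<Rightarrow> nat \<Rightarrow> complex mat) \<Rightarrow> bool" where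
  "norm_convergent n x m A \<longleftrightarrow> (\<forall>k. 0 < m k) \<and> (\<forall>k. \<forall>i<n. selfadjoint_mat (m k) (A k i)) \<and>
     (\<forall>P\<in>ncpolys n. (\<lambda>k. mnorm (ev_mat (m k) (A k) P)) \<longlonglongrightarrow> norm (ev_alg x P))"

lemma approximation_property_imp_norm_convergent:
  fixes x :: "nat \<Rightarrow> 'a::unital_cstar_algebra"
  assumes ap: "approximation_property n x"
  obtains m A where "norm_convergent n x m A"
proof -
  \<comment> \<open>A single \<open>R\<close> strictly above every \<open>norm (x i)\<close> is
    admissible in the approximation property at every stage and also makes the rational
    approximation uniform in the stage.\<close>
  define R where "R = 1 + (\<Sum>i<n. norm (x i))"
  have R0: "R \<ge> 0" by (simp add: R_def sum_nonneg add_nonneg_nonneg)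
  have xR: "norm (x i) < R" if "i < n" for i
  proof -
    have "norm (x i) \<le> (\<Sum>i<n. norm (x i))" using that by (intro member_le_sum) auto
    then show ?thesis by (simp add: R_def)
  qed
  have "\<exists>k A. 0 < k \<and> A \<in> Gamma_top n x R k (1 / real (Suc N)) N" for N
  proof -
    \<comment> \<open>Infinitude of the admissible sizes supplies a positive one.\<close>
    have "infinite {k. Gamma_top n x R k (1 / real (Suc N)) N \<noteq> {}}"
      using ap xR unfolding approximation_property_def by simp
    then obtain k where "k > 0" "Gamma_top n x R k (1 / real (Suc N)) N \<noteq> {}"
      unfolding infinite_nat_iff_unbounded by blast
    then show ?thesis by blast
  qed
  then obtain m A where mA: "\<And>N. 0 < m N" "\<And>N. A N \<in> Gamma_top n x R (m N) (1 / real (Suc N)) N" by metis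
  have sa: "selfadjoint_mat (m N) (A N i)" and AR: "mnorm (A N i) \<le> R" if "i < n" for N i
    using mA(2)[of N] that by (auto simp: Gamma_top_def)
  have cl: "\<bar>mnorm (ev_mat (m N) (A N) (enum_poly n j)) - norm (ev_alg x (enum_poly n j))\<bar> \<le> 1 / real (Suc N)"
    if "j \<in> {1..N}" for j N using mA(2)[of N] that by (auto simp: Gamma_top_def)
  have "(\<lambda>k. mnorm (ev_mat (m k) (A k) P)) \<longlonglongrightarrow> norm (ev_alg x P)" if P: "P \<in> ncpolys n" for P
  proof (rule LIMSEQ_I)
    fix r :: real assume r: "r > 0"
    obtain j where j: "poly_close TYPE('a) n R (r / 4) P (enum_poly n (Suc j))"
      using enum_poly_approx[OF R0 P, of "r / 4", where 'a='a] r by auto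
    let ?Q = "enum_poly n (Suc j)"
    obtain N0 where N0: "1 / real (Suc N0) < r / 4" using r nat_approx_posE[of "r / 4"] by auto
    \<comment> \<open>\<open>Suc j \<le> k\<close> puts the chosen rational polynomial among the
      first \<open>k\<close>, so its norm is controlled up to \<open>1 / (k + 1)\<close>. Together
      with the two replacement errors this stays below three quarters of \<open>r\<close>.\<close>
    have "norm (mnorm (ev_mat (m k) (A k) P) - norm (ev_alg x P)) < r" if k: "k \<ge> max N0 (Suc j)" for k
    proof -
      have "mnorm (ev_mat (m k) (A k) P - ev_mat (m k) (A k) ?Q) \<le> r / 4"
        using j sa AR by (auto simp: poly_close_def selfadjoint_mat_def)
      moreover have "ev_mat (m k) (A k) P \<in> carrier_mat (m k) (m k)" if "P \<in> ncpolys n" for P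
        using that sa by (auto intro!: ev_mat_carrier dest: ncvars_ncpolys simp: selfadjoint_mat_def)
      ultimately have "\<bar>mnorm (ev_mat (m k) (A k) P) - mnorm (ev_mat (m k) (A k) ?Q)\<bar> \<le> r / 4"
        using mnorm_abs_diff P enum_poly_ncpolys order_trans by metis
      moreover have "norm (ev_alg x P - ev_alg x ?Q) \<le> r / 4"
      proof -
        have "\<forall>i<n. norm (x i) \<le> R" using xR by (simp add: less_imp_le)
        then show ?thesis using j unfolding poly_close_def by blast
      qed
      then have "\<bar>norm (ev_alg x P) - norm (ev_alg x ?Q)\<bar> \<le> r / 4" using norm_triangle_ineq3 order_trans by blast
      moreover have "\<bar>mnorm (ev_mat (m k) (A k) ?Q) - norm (ev_alg x ?Q)\<bar> \<le> 1 / real (Suc k)"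
        by (rule cl) (use k in auto)
      moreover have "1 / real (Suc k) \<le> 1 / real (Suc N0)" using k by (simp add: field_simps)
      ultimately show ?thesis using N0 r unfolding real_norm_def by linarith
    qed
    then show "\<exists>no. \<forall>k\<ge>no. norm (mnorm (ev_mat (m k) (A k) P) - norm (ev_alg x P)) < r" by blast
  qed
  then show ?thesis using that[of m A] mA(1) sa by (simp add: norm_convergent_def)
qed

section \<open>MF algebras and norm convergence\<close>

text \<open>For a norm convergent sequence of matrix tuples, \<open>represents n x m A s a\<close> says that the matrix
  sequence \<open>s\<close> is a lift of \<open>a\<close> under the induced embedding into the quotient algebra.\<close>

definition represents ::
    "nat \<Rightarrow> (nat \<Rightarrow> 'a::unital_cstar_algebra) \<Rightarrow> (nat \<Rightarrow> nat) \<Rightarrow> (nat \<Rightarrow> nat \<Rightarrow> complex mat) \<Rightarrow>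
      (nat \<Rightarrow> complex mat) \<Rightarrow> 'a \<Rightarrow> bool" where
  "represents n x m A s a \<longleftrightarrow> (\<forall>k. s k \<in> carrier_mat (m k) (m k)) \<and>
     (\<forall>d>0. \<exists>P\<in>ncpolys n. norm (a - ev_alg x P) < d \<and>
        eventually (\<lambda>k. mnorm (s k - ev_mat (m k) (A k) P) < d) sequentially)"

section \<open>From norm convergence to an embedding into the quotient\<close>

locale norm_conv =
  fixes n :: nat and x :: "nat \<Rightarrow> 'a::unital_cstar_algebra" and m :: "nat \<Rightarrow> nat" and A :: "nat \<Rightarrow> nat \<Rightarrow> complex mat"
  assumes sa: "\<forall>i<n. cstar (x i) = x i" and gen: "generates n x" and nc: "norm_convergent n x m A"
begin

abbreviation "ev k P \<equiv> ev_mat (m k) (A k) P"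
abbreviation "rp \<equiv> represents n x m A"

lemma ev_carrier [simp]: "P \<in> ncpolys n \<Longrightarrow> ev k P \<in> carrier_mat (m k) (m k)"
  using nc by (auto intro!: ev_mat_carrier dest: ncvars_ncpolys simp: norm_convergent_def selfadjoint_mat_def)

lemma ev_lim: "P \<in> ncpolys n \<Longrightarrow> (\<lambda>k. mnorm (ev k P)) \<longlonglongrightarrow> norm (ev_alg x P)"
  using nc by (simp add: norm_convergent_def)

lemma rp_carrier: "rp s a \<Longrightarrow> s k \<in> carrier_mat (m k) (m k)"
  by (simp add: represents_def)

lemma rpE:
  assumes "rp s a" "d > 0"
  obtains P where "P \<in> ncpolys n" "norm (a - ev_alg x P) < d" "eventually (\<lambda>k. mnorm (s k - ev k P) < d) sequentially"
  using assms by (auto simp: represents_def)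

lemma rpI:
  assumes "\<And>k. s k \<in> carrier_mat (m k) (m k)"
    "\<And>d. d > 0 \<Longrightarrow> \<exists>P\<in>ncpolys n. norm (a - ev_alg x P) < d \<and> eventually (\<lambda>k. mnorm (s k - ev k P) < d) sequentially"
  shows "rp s a"
  using assms by (auto simp: represents_def)

lemma rp_poly: "P \<in> ncpolys n \<Longrightarrow> rp (\<lambda>k. ev k P) (ev_alg x P)"
  by (rule rpI) (auto intro!: bexI[of _ P])

text \<open>Norms of lifts converge, which is stronger than control of the limes superior.
  Injectivity of the embedding follows, and so does the fact that two lifts of one element differ by
  a null sequence.\<close>

lemma rp_norm:
  assumes s: "rp s a"
  shows "(\<lambda>k. mnorm (s k)) \<longlonglongrightarrow> norm a"
proof (rule tendstoI)
  fix d :: real assume d: "d > 0"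
  then have d3: "d / 3 > 0" by simp
  obtain P where P: "P \<in> ncpolys n" "norm (a - ev_alg x P) < d / 3"
    "eventually (\<lambda>k. mnorm (s k - ev k P) < d / 3) sequentially" by (rule rpE[OF s d3])
  have "eventually (\<lambda>k. dist (mnorm (ev k P)) (norm (ev_alg x P)) < d / 3) sequentially"
    using tendstoD[OF ev_lim[OF P(1)], of "d / 3"] d by simp
  with P(3) show "eventually (\<lambda>k. dist (mnorm (s k)) (norm a) < d) sequentially"
  proof eventually_elim
    case (elim k)
    have "\<bar>mnorm (s k) - mnorm (ev k P)\<bar> < d / 3"
      using mnorm_abs_diff[OF rp_carrier[OF s] ev_carrier[OF P(1)], of k] elim by linarith
    moreover have "\<bar>norm a - norm (ev_alg x P)\<bar> < d / 3" using norm_triangle_ineq3[of a "ev_alg x P"] P(2) by linarith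
    ultimately show ?case using elim unfolding dist_real_def by linarith
  qed
qed

lemma rp_add:
  assumes "rp s a" "rp t b"
  shows "rp (\<lambda>k. s k + t k) (a + b)"
proof (rule rpI)
  fix d :: real assume d: "d > 0"
  then have d2: "d / 2 > 0" by simp
  obtain P where P: "P \<in> ncpolys n" "norm (a - ev_alg x P) < d / 2"
    "eventually (\<lambda>k. mnorm (s k - ev k P) < d / 2) sequentially" by (rule rpE[OF assms(1) d2])
  obtain Q where Q: "Q \<in> ncpolys n" "norm (b - ev_alg x Q) < d / 2"
    "eventually (\<lambda>k. mnorm (t k - ev k Q) < d / 2) sequentially" by (rule rpE[OF assms(2) d2])
  have "norm (a + b - ev_alg x (NAdd P Q)) < d"
    using norm_diff_triangle_ineq[of a b "ev_alg x P" "ev_alg x Q"] P Q by simp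
  moreover from P(3) Q(3) have "eventually (\<lambda>k. mnorm (s k + t k - ev k (NAdd P Q)) < d) sequentially"
  proof eventually_elim
    case (elim k)
    then show ?case
      using mnorm_add_diff[OF rp_carrier[OF assms(1)] rp_carrier[OF assms(2)] ev_carrier[OF P(1)] ev_carrier[OF Q(1)], of k] by simp
  qed
  ultimately show "\<exists>P\<in>ncpolys n. norm (a + b - ev_alg x P) < d \<and> eventually (\<lambda>k. mnorm (s k + t k - ev k P) < d) sequentially"
    using P Q by (intro bexI[of _ "NAdd P Q"]) auto
qed (use assms rp_carrier in auto)

lemma rp_smult:
  assumes "rp s a"
  shows "rp (\<lambda>k. c \<cdot>\<^sub>m s k) (c *\<^sub>C a)"
proof (rule rpI)
  fix d :: real assume d: "d > 0"
  have d2: "d / (cmod c + 1) > 0" using d by (simp add: add_nonneg_pos)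
  have cd: "cmod c * u < d" if "u < d / (cmod c + 1)" "u \<ge> 0" for u
  proof -
    have "cmod c * u \<le> (cmod c + 1) * u" using that by (simp add: mult_right_mono)
    also have "\<dots> < d"
    proof -
      have "cmod c + 1 > 0" by (simp add: add_nonneg_pos)
      then show ?thesis using that(1) by (simp only: pos_less_divide_eq mult.commute)
    qed
    finally show ?thesis .
  qed
  obtain P where P: "P \<in> ncpolys n" "norm (a - ev_alg x P) < d / (cmod c + 1)"
    "eventually (\<lambda>k. mnorm (s k - ev k P) < d / (cmod c + 1)) sequentially" by (rule rpE[OF assms d2])
  let ?Q = "NMul (NConst c) P"
  have "c *\<^sub>C a - ev_alg x ?Q = c *\<^sub>C (a - ev_alg x P)" by (simp add: scaleC_mult_left scaleC_diff_right)
  then have "norm (c *\<^sub>C a - ev_alg x ?Q) < d" using cd[OF P(2)] by (simp add: norm_scaleC)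
  moreover have "ev k ?Q = c \<cdot>\<^sub>m ev k P" for k
    using ev_carrier[OF P(1), of k] by (simp add: mult_smult_assoc_mat[of _ "m k" "m k"])
  from P(3) have "eventually (\<lambda>k. mnorm (c \<cdot>\<^sub>m s k - ev k ?Q) < d) sequentially"
  proof eventually_elim
    case (elim k)
    then show ?case unfolding \<open>ev k ?Q = c \<cdot>\<^sub>m ev k P\<close>
      using mnorm_smult_diff[OF rp_carrier[OF assms, of k] ev_carrier[OF P(1), of k], of c] cd by simp
  qed
  ultimately show "\<exists>P\<in>ncpolys n. norm (c *\<^sub>C a - ev_alg x P) < d \<and> eventually (\<lambda>k. mnorm (c \<cdot>\<^sub>m s k - ev k P) < d) sequentially"
    using P by (intro bexI[of _ ?Q]) auto
qed (use assms rp_carrier in auto)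

lemma rp_mult:
  assumes "rp s a" "rp t b"
  shows "rp (\<lambda>k. s k * t k) (a * b)"
proof (rule rpI)
  fix d :: real assume d: "d > 0"
  \<comment> \<open>\<open>norm b + 1\<close> bounds a late \<open>t k\<close>, and
    \<open>norm a + 2\<close> bounds a late \<open>ev k P\<close>: one unit accounts for
    \<open>s k\<close>, the other for the approximation error. \<open>M\<close> is the sum of both
    bounds.\<close>
  define M where "M = norm a + norm b + 3"
  have M: "M > 0" by (simp add: M_def add_nonneg_pos)
  define e where "e = min 1 (d / M)"
  have e: "e > 0" "e \<le> 1" "e * M \<le> d" using d M by (auto simp: e_def min_def field_simps)
  have comb: "u * v + w * z < d"
    if "0 \<le> v" "v \<le> norm b + 1" "u < e" "0 \<le> u" "0 \<le> w" "w \<le> norm a + 2" "0 \<le> z" "z < e" for u v w z :: real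
  proof -
    have "u * v \<le> u * (norm b + 1)" "w * z \<le> (norm a + 2) * z" using that by (auto intro: mult_left_mono mult_right_mono)
    moreover have "u * (norm b + 1) < e * (norm b + 1)" "(norm a + 2) * z \<le> (norm a + 2) * e"
      using that by (auto intro!: mult_strict_right_mono mult_left_mono add_nonneg_pos add_nonneg_nonneg)
    moreover have "e * (norm b + 1) + (norm a + 2) * e = e * M" by (simp add: M_def algebra_simps)
    ultimately show ?thesis using e by linarith
  qed
  obtain P where P: "P \<in> ncpolys n" "norm (a - ev_alg x P) < e"
    "eventually (\<lambda>k. mnorm (s k - ev k P) < e) sequentially" by (rule rpE[OF assms(1) e(1)])
  obtain Q where Q: "Q \<in> ncpolys n" "norm (b - ev_alg x Q) < e"
    "eventually (\<lambda>k. mnorm (t k - ev k Q) < e) sequentially" by (rule rpE[OF assms(2) e(1)])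
  have "norm (a * b - ev_alg x (NMul P Q)) < d"
  proof -
    have "norm (ev_alg x P) \<le> norm a + 2"
      using norm_triangle_sub[of "ev_alg x P" a] P(2) e(2) by (simp add: norm_minus_commute)
    then have "norm (a - ev_alg x P) * norm b + norm (ev_alg x P) * norm (b - ev_alg x Q) < d"
      using P Q by (intro comb) auto
    moreover have "a * b - ev_alg x (NMul P Q) = (a - ev_alg x P) * b + ev_alg x P * (b - ev_alg x Q)"
      by (simp add: algebra_simps)
    ultimately show ?thesis by (smt (verit) norm_mult_ineq norm_triangle_ineq)
  qed
  moreover have st: "eventually (\<lambda>k. mnorm (s k) < norm a + 1) sequentially" "eventually (\<lambda>k. mnorm (t k) < norm b + 1) sequentially"
    using order_tendstoD(2)[OF rp_norm[OF assms(1)]] order_tendstoD(2)[OF rp_norm[OF assms(2)]] by simp_all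
  from st P(3) Q(3) have "eventually (\<lambda>k. mnorm (s k * t k - ev k (NMul P Q)) < d) sequentially"
  proof eventually_elim
    case (elim k)
    note c = rp_carrier[OF assms(1), of k] rp_carrier[OF assms(2), of k] ev_carrier[OF P(1), of k] ev_carrier[OF Q(1), of k]
    have "mnorm (ev k P) \<le> norm a + 2"
      using mnorm_le_add_diff[OF c(3,1)] mnorm_minus_commute[OF c(3,1)] elim e(2) by simp
    then have "mnorm (s k - ev k P) * mnorm (t k) + mnorm (ev k P) * mnorm (t k - ev k Q) < d"
      using elim by (intro comb) auto
    then show ?case using mnorm_mult_diff[OF c] by simp
  qed
  ultimately show "\<exists>P\<in>ncpolys n. norm (a * b - ev_alg x P) < d \<and> eventually (\<lambda>k. mnorm (s k * t k - ev k P) < d) sequentially"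
    using P Q by (intro bexI[of _ "NMul P Q"]) auto
qed (use assms rp_carrier in \<open>meson mult_carrier_mat\<close>)

lemma rp_star:
  assumes "rp s a"
  shows "rp (\<lambda>k. mat_adjoint (s k)) (cstar a)"
proof (rule rpI)
  fix d :: real assume d: "d > 0"
  obtain P where P: "P \<in> ncpolys n" "norm (a - ev_alg x P) < d"
    "eventually (\<lambda>k. mnorm (s k - ev k P) < d) sequentially" by (rule rpE[OF assms d])
  have "ev_alg x (ncstar P) = cstar (ev_alg x P)" using sa P(1) by (intro ev_alg_ncstar) (auto dest: ncvars_ncpolys)
  then have "norm (cstar a - ev_alg x (ncstar P)) < d" using P(2) by (simp add: norm_cstar flip: cstar_diff)
  moreover have eq: "ev k (ncstar P) = mat_adjoint (ev k P)" for k
    using nc P(1) by (intro ev_mat_ncstar) (auto dest: ncvars_ncpolys simp: norm_convergent_def)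
  have "eventually (\<lambda>k. mnorm (mat_adjoint (s k) - ev k (ncstar P)) < d) sequentially"
    using P(3) unfolding eq mnorm_adjoint_diff[OF rp_carrier[OF assms] ev_carrier[OF P(1)]] .
  ultimately show "\<exists>P\<in>ncpolys n. norm (cstar a - ev_alg x P) < d \<and> eventually (\<lambda>k. mnorm (mat_adjoint (s k) - ev k P) < d) sequentially"
    using P by (intro bexI[of _ "ncstar P"]) auto
qed (use assms rp_carrier in auto)

lemma rp_diff: "rp s a \<Longrightarrow> rp t b \<Longrightarrow> rp (\<lambda>k. s k - t k) (a - b)"
  using rp_add[of s a "\<lambda>k. (-1) \<cdot>\<^sub>m t k" "(-1) *\<^sub>C b"] rp_smult[of t b "-1"]
  by (simp add: scaleC_minus_one mat_minus_eq[OF rp_carrier rp_carrier])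

lemma rp_perturb:
  assumes "rp s a" and t: "\<And>k. t k \<in> carrier_mat (m k) (m k)" and null: "(\<lambda>k. mnorm (s k - t k)) \<longlonglongrightarrow> 0"
  shows "rp t a"
proof (rule rpI)
  fix d :: real assume d: "d > 0"
  then have d2: "d / 2 > 0" by simp
  obtain P where P: "P \<in> ncpolys n" "norm (a - ev_alg x P) < d / 2"
    "eventually (\<lambda>k. mnorm (s k - ev k P) < d / 2) sequentially" by (rule rpE[OF assms(1) d2])
  have "eventually (\<lambda>k. mnorm (s k - t k) < d / 2) sequentially" using order_tendstoD(2)[OF null d2] .
  with P(3) have "eventually (\<lambda>k. mnorm (t k - ev k P) < d) sequentially"
  proof eventually_elim
    case (elim k)
    then show ?case
      using mnorm_triangle_diff[OF t rp_carrier[OF assms(1)] ev_carrier[OF P(1)], of k]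
        mnorm_minus_commute[OF t rp_carrier[OF assms(1)], of k] by simp
  qed
  then show "\<exists>P\<in>ncpolys n. norm (a - ev_alg x P) < d \<and> eventually (\<lambda>k. mnorm (t k - ev k P) < d) sequentially"
    using P d by (intro bexI[of _ P]) auto
qed (use t in auto)

text \<open>A diagonal lift: \<open>a\<close> is a limit of polynomials \<open>P j\<close>, and
  index \<open>k\<close> uses \<open>P (J k)\<close>, where \<open>J k\<close> grows so slowly that
  the matrix differences with all earlier polynomials are already comparable to the differences in
  the algebra.\<close>

lemma rp_exists: "\<exists>s. rp s a"
proof -
  define \<delta> where "\<delta> = (\<lambda>j::nat. 1 / real (Suc j))"
  have \<delta>: "\<delta> j > 0" "i \<le> j \<Longrightarrow> \<delta> j \<le> \<delta> i" for i j by (auto simp: \<delta>_def field_simps)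
  have "\<exists>P\<in>ncpolys n. norm (a - ev_alg x P) < \<delta> j" for j
  proof -
    have "a \<in> closure (ev_alg x ` ncpolys n)" using gen by (simp add: generates_def)
    then show ?thesis unfolding closure_approachable using \<delta>(1)[of j] by (fastforce simp: dist_norm norm_minus_commute)
  qed
  then obtain P where P: "\<And>j. P j \<in> ncpolys n" "\<And>j. norm (a - ev_alg x (P j)) < \<delta> j" by metis
  define good where "good = (\<lambda>j k. \<forall>i\<le>j. mnorm (ev k (P i) - ev k (P j)) < norm (ev_alg x (P i) - ev_alg x (P j)) + \<delta> j)"
  have ev_good: "eventually (good j) sequentially" for j
  proof -
    have *: "eventually (\<lambda>k. mnorm (ev k (P i) - ev k (P j)) < norm (ev_alg x (P i) - ev_alg x (P j)) + \<delta> j) sequentially" for i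
      using order_tendstoD(2)[OF rp_norm[OF rp_diff[OF rp_poly[OF P(1)] rp_poly[OF P(1)]]], of i j] \<delta>(1)[of j] by simp
    have "eventually (\<lambda>k. \<forall>i\<in>{..j}. mnorm (ev k (P i) - ev k (P j)) < norm (ev_alg x (P i) - ev_alg x (P j)) + \<delta> j) sequentially"
      by (rule eventually_ball_finite) (use * in auto)
    then show ?thesis by (simp add: good_def Ball_def)
  qed
  have good0: "good 0 k" for k using \<delta>(1)[of 0] by (auto simp: good_def)
  \<comment> \<open>The largest stage that is valid from \<open>k\<close> on. The restriction
    \<open>j \<le> k\<close> keeps the set finite; stage \<open>0\<close> is always good and keeps
    it nonempty.\<close>
  define J where "J = (\<lambda>k. Max {j. j \<le> k \<and> (\<forall>k'\<ge>k. good j k')})"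
  have fin: "finite {j. j \<le> k \<and> (\<forall>k'\<ge>k. good j k')}" for k by (rule finite_subset[of _ "{..k}"]) auto
  have J: "good (J k) k" for k
  proof -
    have "J k \<in> {j. j \<le> k \<and> (\<forall>k'\<ge>k. good j k')}" unfolding J_def by (rule Max_in[OF fin]) (use good0 in blast)
    then show ?thesis by auto
  qed
  have Jge: "eventually (\<lambda>k. i \<le> J k) sequentially" for i
  proof -
    obtain N where N: "\<And>k. k \<ge> N \<Longrightarrow> good i k" using ev_good[of i] unfolding eventually_sequentially by blast
    have "i \<le> J k" if "k \<ge> max i N" for k
      unfolding J_def by (rule Max_ge[OF fin]) (use that N in auto)
    then show ?thesis unfolding eventually_sequentially by blast
  qed
  have "rp (\<lambda>k. ev k (P (J k))) a"
  proof (rule rpI)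
    fix d :: real assume d: "d > 0"
    obtain i where i: "\<delta> i < d / 3" using nat_approx_posE[of "d / 3"] d unfolding \<delta>_def by auto
    from Jge[of i] have "eventually (\<lambda>k. mnorm (ev k (P (J k)) - ev k (P i)) < d) sequentially"
    proof eventually_elim
      case (elim k)
      have "mnorm (ev k (P i) - ev k (P (J k))) < norm (ev_alg x (P i) - ev_alg x (P (J k))) + \<delta> (J k)"
        using J[of k] elim by (auto simp: good_def)
      moreover have "norm (ev_alg x (P i) - ev_alg x (P (J k))) \<le> norm (a - ev_alg x (P i)) + norm (a - ev_alg x (P (J k)))"
        using norm_triangle_ineq4[of "ev_alg x (P i) - a" "ev_alg x (P (J k)) - a"] by (simp add: norm_minus_commute)
      moreover have "\<delta> (J k) \<le> \<delta> i" by (rule \<delta>(2)[OF elim])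
      ultimately have "mnorm (ev k (P i) - ev k (P (J k))) < d" using i P(2)[of i] P(2)[of "J k"] by linarith
      then show ?case using mnorm_minus_commute[OF ev_carrier[OF P(1)] ev_carrier[OF P(1)]] by simp
    qed
    moreover have "norm (a - ev_alg x (P i)) < d" using P(2)[of i] i d by linarith
    ultimately show "\<exists>Q\<in>ncpolys n. norm (a - ev_alg x Q) < d \<and> eventually (\<lambda>k. mnorm (ev k (P (J k)) - ev k Q) < d) sequentially"
      using P(1) by blast
  qed (use P in auto)
  then show ?thesis by blast
qed

lemma rp_bounded: "rp s a \<Longrightarrow> bounded_seq m s"
proof -
  assume s: "rp s a"
  have "Bseq (\<lambda>k. mnorm (s k))" using rp_norm[OF s] convergent_imp_Bseq convergentI by blast
  then obtain K where "\<And>k. norm (mnorm (s k)) \<le> K" unfolding Bseq_def by blast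
  then have "mnorm (s k) \<le> K" for k by (metis abs_of_nonneg mnorm_ge_0 real_norm_def)
  then have "bdd_above (range (\<lambda>k. mnorm (s k)))" by (rule bdd_aboveI2)
  then show ?thesis using rp_carrier[OF s] by (auto simp: bounded_seq_def)
qed

text \<open>All lifts of an element form a full class modulo null sequences, so
  \<open>\<phi> a\<close> can be defined as the set of lifts and no choice of representative
  enters.\<close>

lemma rp_qcls:
  assumes s: "rp s a"
  shows "{t. rp t a} = qcls m s"
proof
  show "{t. rp t a} \<subseteq> qcls m s"
  proof
    fix t assume "t \<in> {t. rp t a}"
    then have t: "rp t a" by simp
    have "(\<lambda>k. mnorm (s k - t k)) \<longlonglongrightarrow> 0" using rp_norm[OF rp_diff[OF s t]] by simp
    then show "t \<in> qcls m s"
      using rp_bounded[OF t] rp_carrier[OF s] rp_carrier[OF t] by (auto simp: qcls_def null_seq_def)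
  qed
  show "qcls m s \<subseteq> {t. rp t a}"
    using rp_perturb[OF s] by (auto simp: qcls_def null_seq_def bounded_seq_def)
qed

theorem MF: "MF_algebra TYPE('a)"
proof -
  define \<phi> where "\<phi> = (\<lambda>a. {t. rp t a})"
  have \<phi>q: "rp s a \<Longrightarrow> \<phi> a = qcls m s" for s a using rp_qcls by (simp add: \<phi>_def)
  obtain S where S: "\<And>a. rp (S a) a" using rp_exists by metis
  \<comment> \<open>\<open>qlift1\<close> and \<open>qlift2\<close> are unions over all
    representatives. Every representative produces the same class \<open>Z\<close>, and
    \<open>S\<close> shows that the union is not empty.\<close>
  have l1: "Z = qlift1 m f (\<phi> a)" if "\<And>s. rp s a \<Longrightarrow> Z = qcls m (\<lambda>k. f (s k))" for f a Z
    unfolding qlift1_def \<phi>_def using that S[of a] by blast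
  have l2: "Z = qlift2 m f (\<phi> a) (\<phi> b)"
    if "\<And>s t. rp s a \<Longrightarrow> rp t b \<Longrightarrow> Z = qcls m (\<lambda>k. f (s k) (t k))" for f a b Z
    unfolding qlift2_def \<phi>_def using that S[of a] S[of b] by blast
  have "unital_inj_star_hom_quot m \<phi>"
    unfolding unital_inj_star_hom_quot_def
  proof (intro conjI allI)
    show "\<phi> a \<in> quot_alg m" for a using \<phi>q[OF S] rp_bounded[OF S] by (auto simp: quot_alg_def)
    show "\<phi> (a + b) = qlift2 m (+) (\<phi> a) (\<phi> b)" for a b
      by (rule l2) (rule \<phi>q[OF rp_add])
    show "\<phi> (c *\<^sub>C a) = qlift1 m (\<lambda>M. c \<cdot>\<^sub>m M) (\<phi> a)" for c a
      by (rule l1) (rule \<phi>q[OF rp_smult])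
    show "\<phi> (a * b) = qlift2 m (*) (\<phi> a) (\<phi> b)" for a b
      by (rule l2) (rule \<phi>q[OF rp_mult])
    show "\<phi> (cstar a) = qlift1 m mat_adjoint (\<phi> a)" for a
      by (rule l1) (rule \<phi>q[OF rp_star])
    have "rp (\<lambda>k. 1\<^sub>m (m k)) 1"
    proof -
      have "1 \<cdot>\<^sub>m 1\<^sub>m k = (1\<^sub>m k :: complex mat)" for k by (rule eq_matI) auto
      then show ?thesis using rp_poly[of "NConst 1"] by (simp add: scaleC_one)
    qed
    then show "\<phi> 1 = qcls m (\<lambda>k. 1\<^sub>m (m k))" by (rule \<phi>q)
    show "inj \<phi>"
    proof (rule injI)
      fix a b assume "\<phi> a = \<phi> b"
      then have "rp (S a) b" using S[of a] by (auto simp: \<phi>_def)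
      then have "(\<lambda>k. mnorm (S a k - S a k)) \<longlonglongrightarrow> norm (a - b)" using rp_norm[OF rp_diff[OF S]] by blast
      then show "a = b" using LIMSEQ_unique[OF tendsto_const] by fastforce
    qed
  qed
  then show ?thesis using nc unfolding MF_algebra_def norm_convergent_def by blast
qed

end

section \<open>From an embedding into the quotient to matrix approximations\<close>

locale mf_hom =
  fixes nk :: "nat \<Rightarrow> nat" and \<phi> :: "'a::unital_cstar_algebra \<Rightarrow> (nat \<Rightarrow> complex mat) set"
  assumes pos: "\<And>k. 0 < nk k" and hom: "unital_inj_star_hom_quot nk \<phi>"
begin

lemma mem_bounded: "t \<in> \<phi> a \<Longrightarrow> bounded_seq nk t"
proof -
  assume t: "t \<in> \<phi> a"
  have "\<phi> a \<in> quot_alg nk" using hom by (simp add: unital_inj_star_hom_quot_def)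
  then show ?thesis using t by (auto simp: quot_alg_def qcls_def)
qed

lemma mem_carrier [simp]: "t \<in> \<phi> a \<Longrightarrow> t k \<in> carrier_mat (nk k) (nk k)"
  using mem_bounded by (auto simp: bounded_seq_def)

lemma mem_null: "s \<in> \<phi> a \<Longrightarrow> t \<in> \<phi> a \<Longrightarrow> (\<lambda>k. mnorm (s k - t k)) \<longlonglongrightarrow> 0"
proof -
  assume s: "s \<in> \<phi> a" and t: "t \<in> \<phi> a"
  have "\<phi> a \<in> quot_alg nk" using hom by (simp add: unital_inj_star_hom_quot_def)
  then obtain u where u: "bounded_seq nk u" "\<phi> a = qcls nk u" by (auto simp: quot_alg_def)
  have uc: "u k \<in> carrier_mat (nk k) (nk k)" for k using u(1) by (simp add: bounded_seq_def)
  have n: "(\<lambda>k. mnorm (u k - s k)) \<longlonglongrightarrow> 0" "(\<lambda>k. mnorm (u k - t k)) \<longlonglongrightarrow> 0"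
    using s t unfolding u(2) by (auto simp: qcls_def null_seq_def)
  show ?thesis
  proof (rule tendsto_sandwich[OF _ _ tendsto_const])
    show "eventually (\<lambda>k. 0 \<le> mnorm (s k - t k)) sequentially" by simp
    have "mnorm (s k - t k) \<le> mnorm (u k - s k) + mnorm (u k - t k)" for k
      using mnorm_triangle_diff[OF mem_carrier[OF s] uc mem_carrier[OF t], of k] mnorm_minus_commute[OF uc mem_carrier[OF s], of k] by simp
    then show "eventually (\<lambda>k. mnorm (s k - t k) \<le> mnorm (u k - s k) + mnorm (u k - t k)) sequentially" by simp
    show "(\<lambda>k. mnorm (u k - s k) + mnorm (u k - t k)) \<longlonglongrightarrow> 0" using tendsto_add[OF n] by simp
  qed
qed

lemma mem_perturb:
  assumes s: "s \<in> \<phi> a" and t: "bounded_seq nk t" and n: "(\<lambda>k. mnorm (s k - t k)) \<longlonglongrightarrow> 0"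
  shows "t \<in> \<phi> a"
proof -
  have "\<phi> a \<in> quot_alg nk" using hom by (simp add: unital_inj_star_hom_quot_def)
  then obtain u where u: "bounded_seq nk u" "\<phi> a = qcls nk u" by (auto simp: quot_alg_def)
  have uc: "u k \<in> carrier_mat (nk k) (nk k)" and tc: "t k \<in> carrier_mat (nk k) (nk k)" for k
    using u(1) t by (simp_all add: bounded_seq_def)
  have us: "(\<lambda>k. mnorm (u k - s k)) \<longlonglongrightarrow> 0" using s unfolding u(2) by (auto simp: qcls_def null_seq_def)
  have "(\<lambda>k. mnorm (u k - t k)) \<longlonglongrightarrow> 0"
  proof (rule tendsto_sandwich[OF _ _ tendsto_const])
    show "eventually (\<lambda>k. 0 \<le> mnorm (u k - t k)) sequentially" by simp
    show "eventually (\<lambda>k. mnorm (u k - t k) \<le> mnorm (u k - s k) + mnorm (s k - t k)) sequentially"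
      using mnorm_triangle_diff[OF uc mem_carrier[OF s] tc] by simp
    show "(\<lambda>k. mnorm (u k - s k) + mnorm (s k - t k)) \<longlonglongrightarrow> 0" using tendsto_add[OF us n] by simp
  qed
  then show ?thesis unfolding u(2) using uc tc t by (auto simp: qcls_def null_seq_def)
qed

lemma bounded_seqI:
  assumes "\<And>k. s k \<in> carrier_mat (nk k) (nk k)" "\<And>k. mnorm (s k) \<le> K"
  shows "bounded_seq nk s"
  using assms unfolding bounded_seq_def by (auto intro!: bdd_aboveI2[of _ _ K])

lemma bounded_seqE:
  assumes "bounded_seq nk s"
  obtains K where "\<And>k. mnorm (s k) \<le> K"
  using assms unfolding bounded_seq_def bdd_above_def by auto

lemma qcls_self: "bounded_seq nk s \<Longrightarrow> s \<in> qcls nk s"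
  by (auto simp: qcls_def null_seq_def bounded_seq_def)

text \<open>\<open>qlift2\<close> is a union over representatives, so it contains the class of every
  sum of lifts; boundedness puts the sum into its own class. Products, multiples and adjoints follow
  the same pattern.\<close>

lemma mem_add: "s \<in> \<phi> a \<Longrightarrow> t \<in> \<phi> b \<Longrightarrow> (\<lambda>k. s k + t k) \<in> \<phi> (a + b)"
proof -
  assume s: "s \<in> \<phi> a" and t: "t \<in> \<phi> b"
  obtain K L where K: "\<And>k. mnorm (s k) \<le> K" "\<And>k. mnorm (t k) \<le> L" using bounded_seqE mem_bounded s t by metis
  have "bounded_seq nk (\<lambda>k. s k + t k)"
  proof (rule bounded_seqI)
    show "mnorm (s k + t k) \<le> K + L" for k
      using mnorm_add[OF mem_carrier[OF s] mem_carrier[OF t], of k] add_mono[OF K(1) K(2), of k k] by linarith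
  qed (use s t in simp)
  moreover have "\<phi> (a + b) = qlift2 nk (+) (\<phi> a) (\<phi> b)" using hom by (simp add: unital_inj_star_hom_quot_def)
  ultimately show ?thesis unfolding qlift2_def using s t qcls_self by blast
qed

lemma mem_mult: "s \<in> \<phi> a \<Longrightarrow> t \<in> \<phi> b \<Longrightarrow> (\<lambda>k. s k * t k) \<in> \<phi> (a * b)"
proof -
  assume s: "s \<in> \<phi> a" and t: "t \<in> \<phi> b"
  obtain K L where K: "\<And>k. mnorm (s k) \<le> K" "\<And>k. mnorm (t k) \<le> L" using bounded_seqE mem_bounded s t by metis
  have "bounded_seq nk (\<lambda>k. s k * t k)"
  proof (rule bounded_seqI)
    show "s k * t k \<in> carrier_mat (nk k) (nk k)" for k using s t by (meson mem_carrier mult_carrier_mat)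
    have "K \<ge> 0" using K(1)[of 0] mnorm_ge_0 order_trans by blast
    then have "mnorm (s k) * mnorm (t k) \<le> K * L" for k by (intro mult_mono K) auto
    then show "mnorm (s k * t k) \<le> K * L" for k
      using mnorm_mult[OF mem_carrier[OF s] mem_carrier[OF t], of k] order_trans by blast
  qed
  moreover have "\<phi> (a * b) = qlift2 nk (*) (\<phi> a) (\<phi> b)" using hom by (simp add: unital_inj_star_hom_quot_def)
  ultimately show ?thesis unfolding qlift2_def using s t qcls_self by blast
qed

lemma mem_smult: "s \<in> \<phi> a \<Longrightarrow> (\<lambda>k. c \<cdot>\<^sub>m s k) \<in> \<phi> (c *\<^sub>C a)"
proof -
  assume s: "s \<in> \<phi> a"
  obtain K where K: "\<And>k. mnorm (s k) \<le> K" using bounded_seqE mem_bounded s by metis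
  have "bounded_seq nk (\<lambda>k. c \<cdot>\<^sub>m s k)"
  proof (rule bounded_seqI)
    show "mnorm (c \<cdot>\<^sub>m s k) \<le> cmod c * K" for k
      unfolding mnorm_smult[OF mem_carrier[OF s]] by (intro mult_left_mono K) simp
  qed (use s in simp)
  moreover have "\<phi> (c *\<^sub>C a) = qlift1 nk (\<lambda>M. c \<cdot>\<^sub>m M) (\<phi> a)" using hom by (simp add: unital_inj_star_hom_quot_def)
  ultimately show ?thesis unfolding qlift1_def using s qcls_self by blast
qed

lemma mem_star: "s \<in> \<phi> a \<Longrightarrow> (\<lambda>k. mat_adjoint (s k)) \<in> \<phi> (cstar a)"
proof -
  assume s: "s \<in> \<phi> a"
  obtain K where K: "\<And>k. mnorm (s k) \<le> K" using bounded_seqE mem_bounded s by metis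
  have "bounded_seq nk (\<lambda>k. mat_adjoint (s k))"
  proof (rule bounded_seqI)
    show "mnorm (mat_adjoint (s k)) \<le> K" for k unfolding mnorm_adjoint[OF mem_carrier[OF s]] by (rule K)
  qed (use s in simp)
  moreover have "\<phi> (cstar a) = qlift1 nk mat_adjoint (\<phi> a)" using hom by (simp add: unital_inj_star_hom_quot_def)
  ultimately show ?thesis unfolding qlift1_def using s qcls_self by blast
qed

lemma mem_one: "(\<lambda>k. 1\<^sub>m (nk k)) \<in> \<phi> 1"
proof -
  have "bounded_seq nk (\<lambda>k. 1\<^sub>m (nk k))" by (rule bounded_seqI[of _ 1]) (auto simp: mnorm_one_le)
  moreover have "\<phi> 1 = qcls nk (\<lambda>k. 1\<^sub>m (nk k))" using hom by (simp add: unital_inj_star_hom_quot_def)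
  ultimately show ?thesis using qcls_self by simp
qed

lemma mem_exists: "\<exists>s. s \<in> \<phi> a"
proof -
  have "\<phi> a \<in> quot_alg nk" using hom by (simp add: unital_inj_star_hom_quot_def)
  then show ?thesis using qcls_self by (auto simp: quot_alg_def)
qed

lemma mem_null_zero:
  assumes t: "t \<in> \<phi> a" and n: "(\<lambda>k. mnorm (t k)) \<longlonglongrightarrow> 0"
  shows "a = 0"
proof -
  \<comment> \<open>The zero sequence, written as a multiple of \<open>t\<close> so that homogeneity
    of \<open>\<phi>\<close> places it in \<open>\<phi> 0\<close>.\<close>
  let ?z = "\<lambda>k. 0 \<cdot>\<^sub>m t k"
  have z0: "?z \<in> \<phi> 0" using mem_smult[OF t, of 0] by simp
  have zeq: "t k - ?z k = t k" for k by (rule eq_matI) auto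
  have za: "?z \<in> \<phi> a" by (rule mem_perturb[OF t mem_bounded[OF z0]]) (simp add: zeq n)
  have "\<phi> a = \<phi> 0"
  proof
    show "\<phi> a \<subseteq> \<phi> 0" using mem_perturb[OF z0] mem_bounded mem_null[OF za] by blast
    show "\<phi> 0 \<subseteq> \<phi> a" using mem_perturb[OF za] mem_bounded mem_null[OF z0] by blast
  qed
  then show ?thesis using hom by (auto simp: unital_inj_star_hom_quot_def inj_def)
qed

text \<open>With \<open>\<rho> = \<parallel>a\<parallel>\<close>, the element \<open>\<rho>\<^sup>2 - a*a\<close> is a square \<open>b*b\<close>, so \<open>s*s\<close> plus a positive matrix
  sequence is a lift of \<open>\<rho>\<^sup>2\<close>.\<close>

lemma mem_upper:
  assumes s: "s \<in> \<phi> a" and r: "r > norm a"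
  shows "eventually (\<lambda>k. mnorm (s k) \<le> r) sequentially"
proof -
  define \<rho> where "\<rho> = norm a"
  have sab: "cstar (cstar a * a) = cstar a * a" by (simp add: cstar_mult cstar_cstar)
  have "cpos (\<rho>\<^sup>2 *\<^sub>R 1 - cstar a * a)" by (rule cpos_norm_diff[OF sab]) (simp add: cstar_identity \<rho>_def)
  then obtain b where b: "cpos b" "b * b = \<rho>\<^sup>2 *\<^sub>R 1 - cstar a * a" using cpos_sqrt_exists by metis
  obtain t where t: "t \<in> \<phi> b" using mem_exists by blast
  define u where "u = (\<lambda>k. mat_adjoint (s k) * s k + mat_adjoint (t k) * t k)"
  have "u \<in> \<phi> (cstar a * a + cstar b * b)" unfolding u_def by (intro mem_add mem_mult mem_star s t)
  also have "cstar a * a + cstar b * b = complex_of_real (\<rho>\<^sup>2) *\<^sub>C 1"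
    using b cpos_selfadj[OF b(1)] by (simp add: scaleR_scaleC)
  finally have u: "u \<in> \<phi> (complex_of_real (\<rho>\<^sup>2) *\<^sub>C 1)" .
  \<comment> \<open>The slack \<open>r^2 - \<rho>^2\<close> absorbs the null sequence by which
    \<open>u\<close> differs from scalar matrices.\<close>
  have d: "r\<^sup>2 - \<rho>\<^sup>2 > 0" using r by (simp add: \<rho>_def power_strict_mono)
  have "eventually (\<lambda>k. mnorm (u k - complex_of_real (\<rho>\<^sup>2) \<cdot>\<^sub>m 1\<^sub>m (nk k)) < r\<^sup>2 - \<rho>\<^sup>2) sequentially"
    using order_tendstoD(2)[OF mem_null[OF u mem_smult[OF mem_one]] d] .
  then show ?thesis
  proof eventually_elim
    case (elim k)
    have sc: "s k \<in> carrier_mat (nk k) (nk k)" "t k \<in> carrier_mat (nk k) (nk k)" using s t by auto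
    show ?case
    proof (rule mnorm_leI[OF sc(1)])
      show "0 \<le> r" using r norm_ge_zero[of a] by linarith
      fix v :: "complex vec" assume v: "v \<in> carrier_vec (nk k)"
      have c: "mat_adjoint (s k) * s k \<in> carrier_mat (nk k) (nk k)" "mat_adjoint (t k) * t k \<in> carrier_mat (nk k) (nk k)"
        using sc by (meson mat_adjoint_carrier mult_carrier_mat)+
      have "\<bar>qf (u k - complex_of_real (\<rho>\<^sup>2) \<cdot>\<^sub>m 1\<^sub>m (nk k)) v\<bar> \<le> (r\<^sup>2 - \<rho>\<^sup>2) * (vnorm v)\<^sup>2"
        by (rule order_trans[OF qf_bound[of _ "nk k"] mult_right_mono]) (use c v elim in \<open>auto simp: u_def\<close>)
      moreover have "qf (u k - complex_of_real (\<rho>\<^sup>2) \<cdot>\<^sub>m 1\<^sub>m (nk k)) v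
          = (vnorm (s k *\<^sub>v v))\<^sup>2 + (vnorm (t k *\<^sub>v v))\<^sup>2 - \<rho>\<^sup>2 * (vnorm v)\<^sup>2"
        unfolding u_def using c v sc
        by (simp only: qf_diff[of _ "nk k"] qf_add[of _ "nk k"] qf_gram[of _ "nk k" "nk k"] qf_smult[of _ "nk k"] qf_one
            add_carrier_mat smult_carrier_mat one_carrier_mat)
      ultimately have "(vnorm (s k *\<^sub>v v))\<^sup>2 + (vnorm (t k *\<^sub>v v))\<^sup>2 \<le> (r * vnorm v)\<^sup>2"
        by (simp add: power_mult_distrib algebra_simps abs_le_iff)
      then have "(vnorm (s k *\<^sub>v v))\<^sup>2 \<le> (r * vnorm v)\<^sup>2" using zero_le_power2[of "vnorm (t k *\<^sub>v v)"] by linarith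
      then show "vnorm (s k *\<^sub>v v) \<le> r * vnorm v"
        by (rule power2_le_imp_le) (use \<open>0 \<le> r\<close> in simp)
    qed
  qed
qed

text \<open>If the lifts of \<open>a\<close> were eventually bounded by \<open>r < \<rho> < \<parallel>a\<parallel>\<close>, the positive part of
  \<open>a*a - \<rho>\<^sup>2\<close> would be annihilated by \<open>\<phi>\<close>.\<close>

lemma mem_lower:
  assumes s: "s \<in> \<phi> a" and r: "0 \<le> r" "r < norm a"
  shows "frequently (\<lambda>k. mnorm (s k) > r) sequentially"
proof (rule ccontr)
  assume "\<not> frequently (\<lambda>k. mnorm (s k) > r) sequentially"
  then have le: "eventually (\<lambda>k. mnorm (s k) \<le> r) sequentially" by (simp add: frequently_def not_less)
  obtain \<rho> where \<rho>: "r < \<rho>" "\<rho> < norm a" using dense[OF r(2)] by blast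
  define d where "d = cstar a * a - \<rho>\<^sup>2 *\<^sub>R 1"
  have sd: "cstar d = d" by (simp add: d_def cstar_diff cstar_mult cstar_cstar cstar_scaleR)
  obtain c where c: "cpos c" "c * c = d * d" "d * c = c * d" using cabs_exists[OF sd] by blast
  obtain f where f: "cpos f" "f * f = c" "\<And>w. w * c = c * w \<Longrightarrow> w * f = f * w"
    using cpos_sqrt_exists[OF c(1) c(1)] by metis
  \<comment> \<open>Here \<open>c\<close> is \<open>|d|\<close> and \<open>e\<close> is the positive
    part of \<open>d\<close>. Since \<open>d * e = |d| * e\<close>, the compression
    \<open>e * (d * e)\<close> equals \<open>cstar (f * e) * (f * e)\<close> for the root
    \<open>f\<close> of \<open>|d|\<close>.\<close>
  define e where "e = (1/2) *\<^sub>R (c + d)"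
  have se: "cstar e = e" by (simp add: e_def cstar_scaleR cstar_add sd cpos_selfadj[OF c(1)])
  have ede: "d * e = c * e" by (simp add: e_def distrib_left c)
  have "e * c = c * e" by (simp add: e_def distrib_left distrib_right c)
  then have ef: "e * f = f * e" by (rule f(3))
  have fe: "cstar (f * e) = f * e" using ef se cpos_selfadj[OF f(1)] by (simp add: cstar_mult)
  have "(f * e) * (f * e) = e * (f * f) * e" using ef by (metis mult.assoc)
  then have eq: "e * (d * e) = cstar (f * e) * (f * e)" unfolding fe by (simp add: f ede mult.assoc)
  obtain t where t: "t \<in> \<phi> e" using mem_exists by blast
  obtain g where g: "g \<in> \<phi> (f * e)" using mem_exists by blast
  have st: "(\<lambda>k. s k * t k) \<in> \<phi> (a * e)" by (rule mem_mult[OF s t])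
  \<comment> \<open>\<open>p\<close> and \<open>q\<close> both lift
    \<open>cstar (a * e) * (a * e)\<close>. The form of \<open>p\<close> is at most
    \<open>r^2 \<parallel>t v\<parallel>^2\<close> at late indices, that of \<open>q\<close> at
    least \<open>\<rho>^2 \<parallel>t v\<parallel>^2\<close>. Since \<open>p - q\<close> is a null
    sequence, the gap \<open>\<rho>^2 - r^2\<close> makes \<open>t\<close> null as well.\<close>
  define p where "p = (\<lambda>k. mat_adjoint (s k * t k) * (s k * t k))"
  define q where "q = (\<lambda>k. complex_of_real (\<rho>\<^sup>2) \<cdot>\<^sub>m (mat_adjoint (t k) * t k) + mat_adjoint (g k) * g k)"
  have p: "p \<in> \<phi> (cstar (a * e) * (a * e))" unfolding p_def by (rule mem_mult[OF mem_star[OF st] st])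
  have "q \<in> \<phi> (complex_of_real (\<rho>\<^sup>2) *\<^sub>C (cstar e * e) + cstar (f * e) * (f * e))"
    unfolding q_def by (intro mem_add mem_smult mem_mult mem_star t g)
  also have "complex_of_real (\<rho>\<^sup>2) *\<^sub>C (cstar e * e) + cstar (f * e) * (f * e) = cstar (a * e) * (a * e)"
    unfolding eq[symmetric] by (simp add: d_def se cstar_mult algebra_simps scaleR_scaleC scaleC_mult_left scaleC_mult_right)
  finally have q: "q \<in> \<phi> (cstar (a * e) * (a * e))" .
  have pq: "(\<lambda>k. mnorm (p k - q k)) \<longlonglongrightarrow> 0" by (rule mem_null[OF p q])
  define \<kappa> where "\<kappa> = \<rho>\<^sup>2 - r\<^sup>2"
  have \<kappa>: "\<kappa> > 0" using \<rho> r by (simp add: \<kappa>_def power_strict_mono)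
  have bound: "eventually (\<lambda>k. mnorm (t k) \<le> sqrt (mnorm (p k - q k) / \<kappa>)) sequentially"
    using le
  proof eventually_elim
    case (elim k)
    have sc0: "s k \<in> carrier_mat (nk k) (nk k)" "t k \<in> carrier_mat (nk k) (nk k)" "g k \<in> carrier_mat (nk k) (nk k)"
      using s t g by auto
    note sc = sc0 mult_carrier_mat[OF sc0(1,2)]
    have cc: "mat_adjoint (s k * t k) * (s k * t k) \<in> carrier_mat (nk k) (nk k)"
      "mat_adjoint (t k) * t k \<in> carrier_mat (nk k) (nk k)" "mat_adjoint (g k) * g k \<in> carrier_mat (nk k) (nk k)"
      using sc by (meson mat_adjoint_carrier mult_carrier_mat)+
    show ?case
    proof (rule mnorm_leI[OF sc(2)])
      show "0 \<le> sqrt (mnorm (p k - q k) / \<kappa>)" using \<kappa> by simp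
      fix v :: "complex vec" assume v: "v \<in> carrier_vec (nk k)"
      have "\<bar>qf (p k - q k) v\<bar> \<le> mnorm (p k - q k) * (vnorm v)\<^sup>2"
        by (rule qf_bound[OF _ v]) (use cc in \<open>simp add: p_def q_def\<close>)
      moreover have "qf (p k - q k) v = (vnorm ((s k * t k) *\<^sub>v v))\<^sup>2 - (\<rho>\<^sup>2 * (vnorm (t k *\<^sub>v v))\<^sup>2 + (vnorm (g k *\<^sub>v v))\<^sup>2)"
        unfolding p_def q_def using cc v sc
        by (simp only: qf_diff[of _ "nk k"] qf_add[of _ "nk k"] qf_gram[of _ "nk k" "nk k"] qf_smult[of _ "nk k"]
            add_carrier_mat smult_carrier_mat)
      moreover have "(vnorm ((s k * t k) *\<^sub>v v))\<^sup>2 \<le> (r * vnorm (t k *\<^sub>v v))\<^sup>2"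
      proof (rule power_mono)
        have "vnorm ((s k * t k) *\<^sub>v v) = vnorm (s k *\<^sub>v (t k *\<^sub>v v))" using sc v by simp
        also have "\<dots> \<le> mnorm (s k) * vnorm (t k *\<^sub>v v)" by (rule vnorm_mult_le[OF sc(1)]) (use sc v in simp)
        also have "\<dots> \<le> r * vnorm (t k *\<^sub>v v)" by (intro mult_right_mono elim) simp
        finally show "vnorm ((s k * t k) *\<^sub>v v) \<le> r * vnorm (t k *\<^sub>v v)" .
      qed simp
      ultimately have "\<rho>\<^sup>2 * (vnorm (t k *\<^sub>v v))\<^sup>2 - r\<^sup>2 * (vnorm (t k *\<^sub>v v))\<^sup>2 \<le> mnorm (p k - q k) * (vnorm v)\<^sup>2"
        using zero_le_power2[of "vnorm (g k *\<^sub>v v)"] unfolding power_mult_distrib by linarith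
      then have "\<kappa> * (vnorm (t k *\<^sub>v v))\<^sup>2 \<le> mnorm (p k - q k) * (vnorm v)\<^sup>2" by (simp add: \<kappa>_def left_diff_distrib)
      then have "(vnorm (t k *\<^sub>v v))\<^sup>2 \<le> (sqrt (mnorm (p k - q k) / \<kappa>) * vnorm v)\<^sup>2"
        using \<kappa> by (simp add: power_mult_distrib field_simps)
      then show "vnorm (t k *\<^sub>v v) \<le> sqrt (mnorm (p k - q k) / \<kappa>) * vnorm v"
        by (rule power2_le_imp_le) (use \<kappa> in simp)
    qed
  qed
  have "(\<lambda>k. sqrt (mnorm (p k - q k) / \<kappa>)) \<longlonglongrightarrow> sqrt (0 / \<kappa>)" by (intro tendsto_intros pq) (use \<kappa> in simp)
  then have "(\<lambda>k. mnorm (t k)) \<longlonglongrightarrow> 0"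
    by (intro tendsto_sandwich[OF _ bound tendsto_const]) auto
  \<comment> \<open>Injectivity removes the positive part of \<open>d\<close>, so
    \<open>d = - |d|\<close> and \<open>cstar a * a\<close> is at most \<open>\<rho>^2\<close>,
    against \<open>\<rho> < norm a\<close>.\<close>
  then have "e = 0" by (rule mem_null_zero[OF t])
  moreover have "c + d = 2 *\<^sub>R e" by (simp add: e_def)
  ultimately have "c = - d" by (simp add: eq_neg_iff_add_eq_0)
  then have "c = \<rho>\<^sup>2 *\<^sub>R 1 - cstar a * a" by (simp add: d_def)
  then have "norm (cstar a * a) \<le> \<bar>\<rho>\<^sup>2\<bar>" using cpos_le_norm[OF cpos_cstar_mult[of a], of "\<rho>\<^sup>2"] c(1) by simp
  then have "(norm a)\<^sup>2 \<le> \<rho>\<^sup>2" by (simp add: cstar_identity)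
  moreover have "\<rho>\<^sup>2 < (norm a)\<^sup>2" using \<rho> r by (intro power_strict_mono) auto
  ultimately show False by simp
qed

lemma selfadj_lift:
  assumes "cstar a = a"
  obtains s where "s \<in> \<phi> a" "\<And>k. selfadjoint_mat (nk k) (s k)"
proof -
  obtain t where t: "t \<in> \<phi> a" using mem_exists by blast
  define s where "s = (\<lambda>k. (1/2) \<cdot>\<^sub>m (t k + mat_adjoint (t k)))"
  have "s \<in> \<phi> ((1/2) *\<^sub>C (a + cstar a))" unfolding s_def by (intro mem_smult mem_add mem_star t)
  also have "(1/2) *\<^sub>C (a + cstar a) = a"
    using scaleR_scaleC[of "1/2" "a + a"] assms by (simp flip: scaleR_2)
  finally have "s \<in> \<phi> a" .
  moreover have "selfadjoint_mat (nk k) (s k)" for k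
    using t mem_carrier[OF t, of k]
    by (auto simp: selfadjoint_mat_def s_def mat_adjoint_smult mat_adjoint_add[of _ "nk k" "nk k"] comm_add_mat[of _ "nk k" "nk k"])
  ultimately show ?thesis using that by blast
qed

lemma poly_lift:
  fixes x :: "nat \<Rightarrow> 'a"
  assumes "\<And>i. i < n \<Longrightarrow> S i \<in> \<phi> (x i)" "P \<in> ncpolys n"
  shows "(\<lambda>k. ev_mat (nk k) (\<lambda>i. S i k) P) \<in> \<phi> (ev_alg x P)"
  using assms(2)
proof (induction P)
  case (NConst c)
  show ?case using mem_smult[OF mem_one, of c] by simp
next
  case (NAdd P Q)
  then show ?case using mem_add[of "\<lambda>k. ev_mat (nk k) (\<lambda>i. S i k) P" _ "\<lambda>k. ev_mat (nk k) (\<lambda>i. S i k) Q"] by simp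
next
  case (NMul P Q)
  then show ?case using mem_mult[of "\<lambda>k. ev_mat (nk k) (\<lambda>i. S i k) P" _ "\<lambda>k. ev_mat (nk k) (\<lambda>i. S i k) Q"] by simp
qed (use assms in auto)

text \<open>Upper bounds hold at all late indices, lower bounds only at infinitely many, and
  different polynomials may attain their norms along disjoint sets of indices. A direct sum takes
  maxima of norms: it keeps the upper bounds (\<open>good\<close>) and accumulates the lower ones
  (\<open>hits\<close>), one polynomial at a time.\<close>

theorem approximation:
  fixes x :: "nat \<Rightarrow> 'a"
  assumes sa: "\<forall>i<n. cstar (x i) = x i"
  shows "approximation_property n x"
  unfolding approximation_property_def
proof (intro allI impI)
  fix R r and \<epsilon> :: real assume R: "\<forall>i<n. norm (x i) < R" and \<epsilon>: "\<epsilon> > 0"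
  let ?p = "\<lambda>j. enum_poly n j"
  have pn: "?p j \<in> ncpolys n" for j by (rule enum_poly_ncpolys)
  have "\<exists>s. s \<in> \<phi> (x i) \<and> (\<forall>k. selfadjoint_mat (nk k) (s k))" if "i < n" for i
    using selfadj_lift sa that by metis
  then obtain S where S: "\<And>i. i < n \<Longrightarrow> S i \<in> \<phi> (x i)" "\<And>i k. i < n \<Longrightarrow> selfadjoint_mat (nk k) (S i k)" by metis
  let ?e = "\<lambda>k P. ev_mat (nk k) (\<lambda>i. S i k) P"
  define good where "good = (\<lambda>m A. 0 < m \<and> (\<forall>i<n. selfadjoint_mat m (A i) \<and> mnorm (A i) \<le> R) \<and>
    (\<forall>j\<in>{1..r}. mnorm (ev_mat m A (?p j)) \<le> norm (ev_alg x (?p j)) + \<epsilon>))"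
  define hits where "hits = (\<lambda>q m A. \<forall>j\<in>{1..q}. mnorm (ev_mat m A (?p j)) \<ge> norm (ev_alg x (?p j)) - \<epsilon>)"
  have "eventually (\<lambda>k. \<forall>i\<in>{..<n}. mnorm (S i k) \<le> R) sequentially"
    by (rule eventually_ball_finite) (use mem_upper[OF S(1)] R in auto)
  moreover have "eventually (\<lambda>k. \<forall>j\<in>{1..r}. mnorm (?e k (?p j)) \<le> norm (ev_alg x (?p j)) + \<epsilon>) sequentially"
    by (rule eventually_ball_finite) (use mem_upper[OF poly_lift[OF S(1) pn]] \<epsilon> in auto)
  ultimately have ev_good: "eventually (\<lambda>k. good (nk k) (\<lambda>i. S i k)) sequentially"
    by eventually_elim (use pos S(2) in \<open>auto simp: good_def\<close>)
  have car: "A i \<in> carrier_mat m m" if "good m A" "i \<in> ncvars P" "P \<in> ncpolys n" for m A i P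
    using that by (auto simp: good_def selfadjoint_mat_def dest: ncvars_ncpolys)
  have norm_ds: "mnorm (ev_mat (m + l) (\<lambda>i. dsum (A i) (B i)) P) = max (mnorm (ev_mat m A P)) (mnorm (ev_mat l B P))"
    if "good m A" "good l B" "P \<in> ncpolys n" for m l A B P
  proof -
    have "ev_mat (m + l) (\<lambda>i. dsum (A i) (B i)) P = dsum (ev_mat m A P) (ev_mat l B P)"
      by (rule ev_mat_dsum) (use car that in blast)
    then show ?thesis using mnorm_dsum[OF ev_mat_carrier ev_mat_carrier] car that by metis
  qed
  have good_ds: "good (m + l) (\<lambda>i. dsum (A i) (B i))" if g: "good m A" "good l B" for m l A B
    unfolding good_def
  proof (intro conjI allI impI ballI)
    show "0 < m + l" using g by (simp add: good_def)
    fix i assume i: "i < n"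
    have c: "A i \<in> carrier_mat m m" "B i \<in> carrier_mat l l" "mat_adjoint (A i) = A i" "mat_adjoint (B i) = B i"
      "mnorm (A i) \<le> R" "mnorm (B i) \<le> R"
      using g i by (auto simp: good_def selfadjoint_mat_def)
    show "selfadjoint_mat (m + l) (dsum (A i) (B i))" "mnorm (dsum (A i) (B i)) \<le> R"
      using c by (simp_all add: selfadjoint_mat_def dsum_carrier dsum_adjoint[of _ m _ l] mnorm_dsum[of _ m _ l])
  next
    fix j assume "j \<in> {1..r}"
    then show "mnorm (ev_mat (m + l) (\<lambda>i. dsum (A i) (B i)) (?p j)) \<le> norm (ev_alg x (?p j)) + \<epsilon>"
      unfolding norm_ds[OF g pn] using g by (simp add: good_def)
  qed
  have hits: "\<exists>m A. good m A \<and> hits q m A" for q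
  proof (induction q)
    case 0
    obtain k where "good (nk k) (\<lambda>i. S i k)" using eventually_happens'[OF _ ev_good] by auto
    then show ?case by (auto simp: hits_def)
  next
    case (Suc q)
    then obtain m A where mA: "good m A" "hits q m A" by blast
    let ?c = "norm (ev_alg x (?p (Suc q)))"
    \<comment> \<open>\<open>mem_lower\<close> asks for a nonnegative radius; a negative target is
      met by any good block.\<close>
    have "\<exists>k. good (nk k) (\<lambda>i. S i k) \<and> mnorm (?e k (?p (Suc q))) \<ge> ?c - \<epsilon>"
    proof (cases "?c - \<epsilon> \<ge> 0")
      case True
      have "frequently (\<lambda>k. mnorm (?e k (?p (Suc q))) > ?c - \<epsilon>) sequentially"
        by (rule mem_lower[OF poly_lift[OF S(1) pn] True]) (use \<epsilon> in auto)
      from frequently_ex[OF frequently_eventually_conj[OF this ev_good]]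
      show ?thesis by (auto intro: less_imp_le)
    next
      case False
      obtain k where "good (nk k) (\<lambda>i. S i k)" using eventually_happens'[OF _ ev_good] by auto
      then show ?thesis using False mnorm_ge_0 by (intro exI[of _ k]) (meson le_cases order_trans)
    qed
    then obtain k where k: "good (nk k) (\<lambda>i. S i k)" "mnorm (?e k (?p (Suc q))) \<ge> ?c - \<epsilon>" by blast
    have "hits (Suc q) (m + nk k) (\<lambda>i. dsum (A i) (S i k))"
      unfolding hits_def norm_ds[OF mA(1) k(1) pn] using mA(2) k(2)
      by (auto simp: hits_def le_Suc_eq le_max_iff_disj)
    then show ?case using good_ds[OF mA(1) k(1)] by blast
  qed
  \<comment> \<open>Doubling a block preserves all norms and, sizes being positive, lets the size
    exceed any bound.\<close>
  have "\<exists>m A. K \<le> m \<and> good m A \<and> hits r m A" for K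
  proof (induction K)
    case 0
    then show ?case using hits by blast
  next
    case (Suc K)
    then obtain m A where mA: "K \<le> m" "good m A" "hits r m A" by blast
    have "hits r (m + m) (\<lambda>i. dsum (A i) (A i))"
      unfolding hits_def norm_ds[OF mA(2,2) pn] using mA(3) by (simp add: hits_def)
    moreover have "Suc K \<le> m + m" using mA by (simp add: good_def)
    ultimately show ?case using good_ds[OF mA(2,2)] by blast
  qed
  moreover have "Gamma_top n x R m \<epsilon> r \<noteq> {}" if g: "good m A" "hits r m A" for m A
  proof -
    \<comment> \<open>\<open>Gamma_top\<close> normalizes tuples to vanish from position
      \<open>n\<close> on; polynomials in the first \<open>n\<close> variables do not notice the
      change.\<close>
    define A' where "A' = (\<lambda>i. if i < n then A i else 0\<^sub>m m m)"
    have "ev_mat m A' P = ev_mat m A P" if "P \<in> ncpolys n" for P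
      by (rule ev_mat_cong) (use ncvars_ncpolys[OF that] in \<open>simp add: A'_def\<close>)
    then have "ev_mat m A' (?p j) = ev_mat m A (?p j)" for j using pn by blast
    then have "A' \<in> Gamma_top n x R m \<epsilon> r"
      using g by (auto simp: Gamma_top_def good_def hits_def A'_def abs_le_iff algebra_simps)
    then show ?thesis by blast
  qed
  ultimately have "\<forall>K. \<exists>m\<ge>K. m \<in> {k. Gamma_top n x R k \<epsilon> r \<noteq> {}}" by blast
  then show "infinite {k. Gamma_top n x R k \<epsilon> r \<noteq> {}}" unfolding infinite_nat_iff_unbounded_le .
qed

end

section \<open>Unitaries from convergent Gram matrices\<close>

definition unitary_op :: "('h::chilbert \<Rightarrow> 'h) \<Rightarrow> bool" where
  "unitary_op Z \<longleftrightarrow> bij Z \<and> clinear_map Z \<and> (\<forall>h. norm (Z h) = norm h)"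

lemma onb_unitary:
  fixes e f :: "nat \<Rightarrow> 'h::chilbert"
  assumes e: "onb e" and f: "onb f"
  obtains Z where "unitary_op Z" "\<And>j. Z (e j) = f j"
proof -
  have "\<exists>y. (\<forall>j. cinner (b j) y = cinner (a j) h) \<and> (norm y)\<^sup>2 = (norm h)\<^sup>2"
    if a: "onb a" and b: "onb b" for a b :: "nat \<Rightarrow> 'h" and h
    using onb_synthesis[OF b sums_summable[OF onb_sums[OF a, of h]]] onb_sums[OF a, of h] by (metis sums_unique)
  from this[OF e f] obtain Z where Z: "\<And>h j. cinner (f j) (Z h) = cinner (e j) h" "\<And>h. (norm (Z h))\<^sup>2 = (norm h)\<^sup>2"
    by metis
  have ex: "\<exists>y. \<forall>j. cinner (e j) y = cinner (f j) h" for h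
    using onb_synthesis[OF e sums_summable[OF onb_sums[OF f, of h]]] by metis
  have "inj Z" by (rule injI) (metis Z(1) onb_eqI[OF e])
  moreover have "surj Z"
    unfolding surj_def
  proof
    fix h
    obtain y where "\<And>j. cinner (e j) y = cinner (f j) h" using ex by blast
    then have "Z y = h" by (intro onb_eqI[OF f]) (simp add: Z(1))
    then show "\<exists>y. h = Z y" by blast
  qed
  moreover have "clinear_map Z" unfolding clinear_map_def
    by (intro conjI allI onb_eqI[OF f]) (simp_all add: Z(1) hil.add_right hil.scale_right)
  moreover have "norm (Z h) = norm h" for h using Z(2)[of h] by (simp add: power2_eq_iff_nonneg)
  ultimately have "unitary_op Z" by (simp add: unitary_op_def bij_def)
  moreover have "Z (e j) = f j" for j
    by (rule onb_eqI[OF f]) (simp add: Z(1) onb_cinner[OF e] onb_cinner[OF f])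
  ultimately show ?thesis using that by blast
qed

definition orthonormal_upto :: "nat \<Rightarrow> (nat \<Rightarrow> 'h::chilbert) \<Rightarrow> bool" where
  "orthonormal_upto p e \<longleftrightarrow> (\<forall>i<p. \<forall>j<p. cinner (e i) (e j) = (if i = j then 1 else 0))"

lemma orthonormal_resid: "orthonormal_upto p e \<Longrightarrow> i < p \<Longrightarrow> cinner (e i) (hil.resid e p x) = 0"
  by (rule hil.resid_orth) (auto simp: orthonormal_upto_def)

lemma orthonormal_resid_left: "orthonormal_upto p e \<Longrightarrow> i < p \<Longrightarrow> cinner (hil.resid e p x) (e i) = 0"
  using orthonormal_resid[of p e i x] cinner_commute[of "hil.resid e p x" "e i"] by simp

lemma cinner_resid_left:
  "cinner (hil.resid e p x) y = cinner x y - (\<Sum>j<p. cnj (cinner (e j) x) * cinner (e j) y)"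
  by (simp add: hil.resid_def hil.diff_left hil.sum_left hil.scale_left)

lemma orthonormal_resid_self:
  assumes "orthonormal_upto p e"
  shows "cinner (hil.resid e p x) x = cinner (hil.resid e p x) (hil.resid e p x)"
proof -
  have "cinner (hil.resid e p x) (hil.resid e p x)
      = cinner (hil.resid e p x) x - (\<Sum>j<p. cinner (e j) x * cinner (hil.resid e p x) (e j))"
    by (subst (2) hil.resid_def) (simp add: hil.diff_right hil.sum_right hil.scale_right)
  then show ?thesis using orthonormal_resid_left[OF assms] by simp
qed

lemma orthonormal_extend:
  assumes e: "orthonormal_upto p e" and nz: "hil.resid e p x \<noteq> 0"
  shows "orthonormal_upto (Suc p) (e(p := complex_of_real (1 / norm (hil.resid e p x)) *\<^sub>C hil.resid e p x))"
proof -
  let ?r = "hil.resid e p x" let ?u = "complex_of_real (1 / norm ?r) *\<^sub>C ?r"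
  have "cinner ?u ?u = complex_of_real (1 / norm ?r) * (complex_of_real (1 / norm ?r) * cinner ?r ?r)"
    by (simp only: hil.scale_left hil.scale_right complex_cnj_complex_of_real)
  then have "cinner ?u ?u = 1" using nz by (simp add: cinner_self_norm[of ?r] power2_eq_square)
  moreover have "cinner (e i) ?u = 0" "cinner ?u (e i) = 0" if "i < p" for i
    using orthonormal_resid[OF e that] orthonormal_resid_left[OF e that] by (simp_all add: hil.scale_left hil.scale_right)
  ultimately show ?thesis using e by (auto simp: orthonormal_upto_def less_Suc_eq)
qed

lemma resid_fun_upd: "hil.resid (e(p := u)) (Suc p) x = hil.resid e p x - cinner u x *\<^sub>C u"
  by (simp add: hil.resid_def)

text \<open>Gram--Schmidt run in parallel on \<open>w\<close> and on the approximating families \<open>w' t\<close>.\<close>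

lemma parallel_gram_schmidt:
  fixes w :: "nat \<Rightarrow> 'h::chilbert" and w' :: "nat \<Rightarrow> nat \<Rightarrow> 'h"
  assumes G: "\<And>i j. (\<lambda>t. cinner (w' t i) (w' t j)) \<longlonglongrightarrow> cinner (w i) (w j)"
  shows "\<exists>p e f. orthonormal_upto p e \<and> eventually (\<lambda>t. orthonormal_upto p (f t)) sequentially \<and>
     (\<forall>i<q. hil.resid e p (w i) = 0) \<and> (\<forall>j<p. \<forall>i. (\<lambda>t. cinner (f t j) (w' t i)) \<longlonglongrightarrow> cinner (e j) (w i))"
proof (induction q)
  case 0
  show ?case by (intro exI[of _ 0]) (auto simp: orthonormal_upto_def)
next
  case (Suc q)
  then obtain p e f where e: "orthonormal_upto p e" and f: "eventually (\<lambda>t. orthonormal_upto p (f t)) sequentially"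
    and I1: "\<And>i. i < q \<Longrightarrow> hil.resid e p (w i) = 0"
    and I2: "\<And>j i. j < p \<Longrightarrow> (\<lambda>t. cinner (f t j) (w' t i)) \<longlonglongrightarrow> cinner (e j) (w i)" by blast
  define r where "r = hil.resid e p (w q)"
  show ?case
  proof (cases "r = 0")
    case True
    then have "\<forall>i<Suc q. hil.resid e p (w i) = 0" using I1 by (auto simp: r_def less_Suc_eq)
    then show ?thesis using e f I2 by blast
  next
    case False
    define r' where "r' = (\<lambda>t. hil.resid (f t) p (w' t q))"
    have lim: "(\<lambda>t. cinner (r' t) (w' t i)) \<longlonglongrightarrow> cinner r (w i)" for i
      unfolding r'_def r_def cinner_resid_left by (intro tendsto_intros G I2) auto
    \<comment> \<open>A residual is orthogonal to what was subtracted, so its squared norm is its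
      inner product with \<open>w' t q\<close>, which is already known to converge.\<close>
    have ev: "eventually (\<lambda>t. Re (cinner (r' t) (w' t q)) = (norm (r' t))\<^sup>2) sequentially"
      using f by eventually_elim (simp add: r'_def orthonormal_resid_self cinner_self_norm)
    have li: "(\<lambda>t. Re (cinner (r' t) (w' t q))) \<longlonglongrightarrow> Re (cinner r (w q))" by (intro tendsto_Re lim)
    have req: "Re (cinner r (w q)) = (norm r)\<^sup>2"
      unfolding r_def orthonormal_resid_self[OF e] cinner_self_norm by simp
    have "(\<lambda>t. (norm (r' t))\<^sup>2) \<longlonglongrightarrow> (norm r)\<^sup>2" using Lim_transform_eventually[OF li ev] unfolding req .
    from tendsto_real_sqrt[OF this] have nr: "(\<lambda>t. norm (r' t)) \<longlonglongrightarrow> norm r" by simp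
    \<comment> \<open>As \<open>r\<close> is nonzero, the approximating residuals are nonzero from
      some index on. Before that index normalization may fail, which is why orthonormality of
      \<open>f t\<close> is carried only eventually through the induction.\<close>
    have nz: "eventually (\<lambda>t. r' t \<noteq> 0) sequentially"
      using order_tendstoD(1)[OF nr, of 0] False by (auto elim: eventually_mono)
    define u where "u = complex_of_real (1 / norm r) *\<^sub>C r"
    define u' where "u' = (\<lambda>t. complex_of_real (1 / norm (r' t)) *\<^sub>C r' t)"
    have "orthonormal_upto (Suc p) (e(p := u))" unfolding u_def using orthonormal_extend[OF e] False by (simp add: r_def)
    moreover have "eventually (\<lambda>t. orthonormal_upto (Suc p) ((f t)(p := u' t))) sequentially"
      using f nz by eventually_elim (simp add: u'_def r'_def orthonormal_extend del: of_real_divide)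
    moreover have "hil.resid (e(p := u)) (Suc p) (w i) = 0" if "i < Suc q" for i
    proof (cases "i = q")
      case True
      have "cinner u (w q) = complex_of_real (1 / norm r) * complex_of_real ((norm r)\<^sup>2)"
        unfolding u_def hil.scale_left r_def orthonormal_resid_self[OF e] cinner_self_norm by simp
      then have "cinner u (w q) *\<^sub>C u = r"
        using False by (simp add: u_def scaleC_scaleC scaleC_one power2_eq_square flip: of_real_mult)
      then show ?thesis unfolding resid_fun_upd True by (simp add: r_def)
    next
      case neq: False
      then have i: "i < q" using that by simp
      have "w i = (\<Sum>j<p. cinner (e j) (w i) *\<^sub>C e j)" using I1[OF i] by (simp add: hil.resid_def)
      then have "cinner r (w i) = (\<Sum>j<p. cinner (e j) (w i) * cinner r (e j))"
        by (metis (no_types, lifting) hil.sum_right hil.scale_right sum.cong)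
      also have "\<dots> = 0" by (intro sum.neutral) (simp add: r_def orthonormal_resid_left[OF e])
      finally have "cinner u (w i) = 0" by (simp add: u_def hil.scale_left)
      then show ?thesis unfolding resid_fun_upd I1[OF i] by simp
    qed
    moreover have "(\<lambda>t. cinner (((f t)(p := u' t)) j) (w' t i)) \<longlonglongrightarrow> cinner ((e(p := u)) j) (w i)" if "j < Suc p" for j i
    proof (cases "j = p")
      case True
      have "(\<lambda>t. complex_of_real (1 / norm (r' t)) * cinner (r' t) (w' t i)) \<longlonglongrightarrow> complex_of_real (1 / norm r) * cinner r (w i)"
        by (intro tendsto_intros nr lim) (use False in simp)
      then show ?thesis using True by (simp add: u_def u'_def hil.scale_left)
    next
      case False
      then show ?thesis using I2[of j i] that by simp
    qed
    ultimately show ?thesis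
      by (intro exI[of _ "Suc p"] exI[of _ "e(p := u)"] exI[of _ "\<lambda>t. (f t)(p := u' t)"]) blast
  qed
qed

text \<open>\<open>Z t\<close> sends the Gram--Schmidt vectors of \<open>w\<close> to those of
  \<open>w' t\<close> and is completed by extending both finite systems to bases. The squared norm
  of \<open>Z t (w i) - w' t i\<close> then expands into inner products that all converge.\<close>

theorem gram_unitaries:
  fixes w :: "nat \<Rightarrow> 'h::chilbert" and w' :: "nat \<Rightarrow> nat \<Rightarrow> 'h"
  assumes H: "hilbert_separable TYPE('h)" "infinite_dimensional TYPE('h)"
    and G: "\<And>i j. (\<lambda>t. cinner (w' t i) (w' t j)) \<longlonglongrightarrow> cinner (w i) (w j)"
  obtains Z :: "nat \<Rightarrow> 'h \<Rightarrow> 'h" where "\<And>t. unitary_op (Z t)" "\<And>i. i < q \<Longrightarrow> (\<lambda>t. Z t (w i) - w' t i) \<longlonglongrightarrow> 0"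
proof -
  obtain p e f where e: "orthonormal_upto p e" and f: "eventually (\<lambda>t. orthonormal_upto p (f t)) sequentially"
    and I1: "\<And>i. i < q \<Longrightarrow> hil.resid e p (w i) = 0"
    and I2: "\<And>j i. j < p \<Longrightarrow> (\<lambda>t. cinner (f t j) (w' t i)) \<longlonglongrightarrow> cinner (e j) (w i)"
    using parallel_gram_schmidt[where w = w and w' = w' and q = q] G by blast
  have ext: "\<exists>E. onb E \<and> (\<forall>i<p. E i = g i)" if "orthonormal_upto p g" for g :: "nat \<Rightarrow> 'h"
    using onb_extending[OF H, of p g] that unfolding orthonormal_upto_def by metis
  obtain E where E: "onb E" "\<And>i. i < p \<Longrightarrow> E i = e i" using ext[OF e] by blast
  have "\<exists>Z. unitary_op Z \<and> (orthonormal_upto p (f t) \<longrightarrow> (\<forall>j<p. Z (e j) = f t j))" for t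
  proof (cases "orthonormal_upto p (f t)")
    case True
    obtain F where F: "onb F" "\<And>i. i < p \<Longrightarrow> F i = f t i" using ext[OF True] by blast
    obtain Z where "unitary_op Z" "\<And>j. Z (E j) = F j" using onb_unitary[OF E(1) F(1)] by blast
    then show ?thesis using E(2) F(2) by metis
  next
    case False
    \<comment> \<open>At the finitely many indices where \<open>f t\<close> is not orthonormal any
      unitary will do.\<close>
    have "unitary_op (id :: 'h \<Rightarrow> 'h)" by (simp add: unitary_op_def clinear_map_def)
    then show ?thesis using False by blast
  qed
  then obtain Z where Z: "\<And>t. unitary_op (Z t)" "\<And>t j. orthonormal_upto p (f t) \<Longrightarrow> j < p \<Longrightarrow> Z t (e j) = f t j" by metis
  have "(\<lambda>t. Z t (w i) - w' t i) \<longlonglongrightarrow> 0" if i: "i < q" for i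
  proof -
    have wi: "w i = (\<Sum>j<p. cinner (e j) (w i) *\<^sub>C e j)" using I1[OF i] by (simp add: hil.resid_def)
    have "(\<lambda>t. \<Sum>j<p. cnj (cinner (e j) (w i)) * cinner (f t j) (w' t i)) \<longlonglongrightarrow> (\<Sum>j<p. cnj (cinner (e j) (w i)) * cinner (e j) (w i))"
      by (intro tendsto_intros I2) auto
    also have "(\<Sum>j<p. cnj (cinner (e j) (w i)) * cinner (e j) (w i)) = cinner (w i) (w i)"
      by (subst (3) wi) (simp add: hil.sum_left hil.scale_left)
    finally have l1: "(\<lambda>t. \<Sum>j<p. cnj (cinner (e j) (w i)) * cinner (f t j) (w' t i)) \<longlonglongrightarrow> cinner (w i) (w i)" .
    have "eventually (\<lambda>t. (\<Sum>j<p. cnj (cinner (e j) (w i)) * cinner (f t j) (w' t i)) = cinner (Z t (w i)) (w' t i)) sequentially"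
      using f
    proof eventually_elim
      case (elim t)
      have lin: "Z t (a + b) = Z t a + Z t b" "Z t (c *\<^sub>C a) = c *\<^sub>C Z t a" for a b c
        using Z(1)[of t] by (auto simp: unitary_op_def clinear_map_def)
      have Z0: "Z t 0 = 0" using lin(2)[of 0 0] by simp
      have "Z t (sum g S) = (\<Sum>a\<in>S. Z t (g a))" for g :: "nat \<Rightarrow> 'h" and S
        by (induction S rule: infinite_finite_induct) (auto simp: lin Z0)
      then have "Z t (w i) = (\<Sum>j<p. cinner (e j) (w i) *\<^sub>C Z t (e j))" by (subst wi) (simp add: lin)
      also have "\<dots> = (\<Sum>j<p. cinner (e j) (w i) *\<^sub>C f t j)" by (intro sum.cong refl) (simp add: Z(2)[OF elim])
      finally show ?case by (simp add: hil.sum_left hil.scale_left)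
    qed
    then have l2: "(\<lambda>t. cinner (Z t (w i)) (w' t i)) \<longlonglongrightarrow> cinner (w i) (w i)" by (rule Lim_transform_eventually[OF l1])
    have "(norm (Z t (w i) - w' t i))\<^sup>2 = (norm (w i))\<^sup>2 - 2 * Re (cinner (Z t (w i)) (w' t i)) + Re (cinner (w' t i) (w' t i))" for t
      using hil.q_diff[of "Z t (w i)" "w' t i"] Z(1)[of t] by (simp add: hil_q unitary_op_def cinner_self_norm)
    moreover have "(\<lambda>t. (norm (w i))\<^sup>2 - 2 * Re (cinner (Z t (w i)) (w' t i)) + Re (cinner (w' t i) (w' t i)))
        \<longlonglongrightarrow> (norm (w i))\<^sup>2 - 2 * Re (cinner (w i) (w i)) + Re (cinner (w i) (w i))"
      by (intro tendsto_intros l2 G)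
    ultimately have "(\<lambda>t. (norm (Z t (w i) - w' t i))\<^sup>2) \<longlonglongrightarrow> 0" by (simp add: cinner_self_norm)
    from tendsto_real_sqrt[OF this] have "(\<lambda>t. norm (Z t (w i) - w' t i)) \<longlonglongrightarrow> 0" by simp
    then show ?thesis by (rule tendsto_norm_zero_cancel)
  qed
  then show ?thesis using that Z(1) by blast
qed

section \<open>Vector states of a representation as limits of matrix states\<close>

text \<open>\<open>C\<close> need not be closed, so the point nearest to \<open>\<tau>\<close> is
  replaced by some \<open>u\<close> whose squared distance is minimal up to
  \<open>\<delta>^2\<close>; the functional is the direction from \<open>\<tau>\<close> to
  \<open>u\<close>. Convexity is applied on the segment from \<open>u\<close> to \<open>z\<close> at
  parameter \<open>\<delta>\<close>. The coefficient bound \<open>2 M\<close> will permit a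
  convergent subsequence of functionals.\<close>

lemma convex_separation:
  fixes C :: "(nat \<Rightarrow> complex) set" and \<tau> :: "nat \<Rightarrow> complex"
  assumes ne: "C \<noteq> {}"
    and conv: "\<And>z w \<theta>. z \<in> C \<Longrightarrow> w \<in> C \<Longrightarrow> 0 \<le> \<theta> \<Longrightarrow> \<theta> \<le> (1::real) \<Longrightarrow> (\<lambda>j. of_real (1 - \<theta>) * z j + of_real \<theta> * w j) \<in> C"
    and M: "\<And>z j. z \<in> C \<Longrightarrow> j < r \<Longrightarrow> cmod (z j) \<le> M" "\<And>j. j < r \<Longrightarrow> cmod (\<tau> j) \<le> M" "M \<ge> 0"
    and far: "\<And>z. z \<in> C \<Longrightarrow> \<exists>j<r. \<epsilon> \<le> cmod (z j - \<tau> j)" and \<epsilon>: "\<epsilon> > 0"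
  obtains c where "\<And>j. j < r \<Longrightarrow> cmod (c j) \<le> 2 * M" "\<And>z. z \<in> C \<Longrightarrow> \<epsilon>\<^sup>2 / 2 \<le> Re (\<Sum>j<r. c j * (z j - \<tau> j))"
proof -
  define N where "N = (\<lambda>z::nat \<Rightarrow> complex. \<Sum>j<r. (cmod (z j - \<tau> j))\<^sup>2)"
  have Nge: "\<epsilon>\<^sup>2 \<le> N z" if z: "z \<in> C" for z
  proof -
    obtain j where j: "j < r" "\<epsilon> \<le> cmod (z j - \<tau> j)" using far[OF z] by blast
    have "\<epsilon>\<^sup>2 \<le> (cmod (z j - \<tau> j))\<^sup>2" using j \<epsilon> by (intro power_mono) auto
    also have "\<dots> \<le> N z" unfolding N_def by (rule member_le_sum) (use j in auto)
    finally show ?thesis .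
  qed
  define D where "D = Inf (N ` C)"
  have bdd: "bdd_below (N ` C)" by (rule bdd_belowI2[OF Nge])
  have D: "D \<le> N z" if "z \<in> C" for z unfolding D_def by (rule cInf_lower[OF _ bdd]) (use that in auto)
  define K where "K = real r * (2 * M)\<^sup>2"
  have K: "K \<ge> 0" by (simp add: K_def)
  \<comment> \<open>Near-minimality costs \<open>\<delta> * (1 + K) / 2\<close> in the inner
    product, where \<open>K\<close> bounds squared distances within \<open>C\<close>. This has to
    stay below half of the gap \<open>\<epsilon>^2\<close>.\<close>
  define \<delta> where "\<delta> = min 1 (\<epsilon>\<^sup>2 / (1 + K))"
  have K1: "1 + K > 0" using K by simp
  have "\<delta> \<le> \<epsilon>\<^sup>2 / (1 + K)" by (simp add: \<delta>_def)
  then have "\<delta> * (1 + K) \<le> \<epsilon>\<^sup>2" by (simp only: pos_le_divide_eq[OF K1])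
  with \<epsilon> K1 have \<delta>: "\<delta> > 0" "\<delta> \<le> 1" "\<delta> * (1 + K) \<le> \<epsilon>\<^sup>2" by (auto simp: \<delta>_def)
  have "\<exists>u\<in>C. N u < D + \<delta>\<^sup>2"
  proof (rule ccontr)
    assume "\<not> ?thesis"
    then have "D + \<delta>\<^sup>2 \<le> D" unfolding D_def by (intro cInf_greatest) (use ne in \<open>auto simp: not_less D_def\<close>)
    then show False using \<delta> by simp
  qed
  then obtain u where u: "u \<in> C" "N u < D + \<delta>\<^sup>2" by blast
  define c where "c = (\<lambda>j. cnj (u j - \<tau> j))"
  have "cmod (c j) \<le> 2 * M" if "j < r" for j
    using norm_triangle_ineq4[of "u j" "\<tau> j"] M(1)[OF u(1) that] M(2)[OF that] by (simp add: c_def del: complex_cnj_diff)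
  moreover have "\<epsilon>\<^sup>2 / 2 \<le> Re (\<Sum>j<r. c j * (z j - \<tau> j))" if z: "z \<in> C" for z
  proof -
    define X where "X = (\<Sum>j<r. Re (c j * (z j - u j)))"
    have sq: "(cmod (a + of_real \<delta> * b))\<^sup>2 = (cmod a)\<^sup>2 + 2 * \<delta> * Re (cnj a * b) + \<delta>\<^sup>2 * (cmod b)\<^sup>2" for a b
      unfolding cmod_power2 by (simp add: power2_eq_square algebra_simps)
    let ?y = "\<lambda>j. of_real (1 - \<delta>) * u j + of_real \<delta> * z j"
    have "?y j - \<tau> j = (u j - \<tau> j) + of_real \<delta> * (z j - u j)" for j by (simp add: algebra_simps)
    then have "N ?y = N u + 2 * \<delta> * X + \<delta>\<^sup>2 * (\<Sum>j<r. (cmod (z j - u j))\<^sup>2)"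
      unfolding N_def X_def c_def by (simp only: sq sum.distrib sum_distrib_left)
    moreover have "(\<Sum>j<r. (cmod (z j - u j))\<^sup>2) \<le> K"
    proof -
      have "(cmod (z j - u j))\<^sup>2 \<le> (2 * M)\<^sup>2" if "j < r" for j
        using norm_triangle_ineq4[of "z j" "u j"] M(1)[OF z that] M(1)[OF u(1) that] by (intro power_mono) auto
      then have "(\<Sum>j<r. (cmod (z j - u j))\<^sup>2) \<le> (\<Sum>j<r. (2 * M)\<^sup>2)" by (intro sum_mono) auto
      then show ?thesis by (simp add: K_def)
    qed
    then have "\<delta>\<^sup>2 * (\<Sum>j<r. (cmod (z j - u j))\<^sup>2) \<le> \<delta>\<^sup>2 * K" by (intro mult_left_mono) auto
    moreover have "D \<le> N ?y" by (rule D[OF conv[OF u(1) z]]) (use \<delta> in auto)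
    ultimately have "0 \<le> \<delta>\<^sup>2 + 2 * \<delta> * X + \<delta>\<^sup>2 * K" using u(2) by linarith
    also have "\<dots> = \<delta> * (\<delta> * (1 + K) + 2 * X)" by (simp add: power2_eq_square algebra_simps)
    finally have "0 \<le> \<delta> * (1 + K) + 2 * X" using \<delta> by (simp add: zero_le_mult_iff)
    then have "- (\<epsilon>\<^sup>2 / 2) \<le> X" using \<delta>(3) by linarith
    moreover have "Re (\<Sum>j<r. c j * (z j - \<tau> j)) = X + N u"
    proof -
      have "Re (c j * (z j - \<tau> j)) = Re (c j * (z j - u j)) + (cmod (u j - \<tau> j))\<^sup>2" for j
      proof -
        have "c j * (z j - \<tau> j) = c j * (z j - u j) + c j * (u j - \<tau> j)" by (simp add: algebra_simps)
        moreover have "c j * (u j - \<tau> j) = complex_of_real ((cmod (u j - \<tau> j))\<^sup>2)"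
          unfolding c_def by (metis mult.commute mult_cnj_cmod)
        ultimately show ?thesis by simp
      qed
      then show ?thesis by (simp add: X_def N_def sum.distrib)
    qed
    ultimately show ?thesis using Nge[OF u(1)] by linarith
  qed
  ultimately show ?thesis using that by blast
qed

text \<open>Bolzano--Weierstrass, applied to one coordinate after the other.\<close>

lemma bounded_coordinates_subseq:
  fixes c :: "nat \<Rightarrow> nat \<Rightarrow> complex"
  assumes "\<And>i j. j < r \<Longrightarrow> cmod (c i j) \<le> M"
  shows "\<exists>s l. strict_mono s \<and> (\<forall>j<r. (\<lambda>i. c (s i) j) \<longlonglongrightarrow> l j)"
  using assms
proof (induction r)
  case 0
  show ?case by (intro exI[of _ id]) (auto simp: strict_mono_def)
next
  case (Suc r)
  then obtain s l where s: "strict_mono s" "\<And>j. j < r \<Longrightarrow> (\<lambda>i. c (s i) j) \<longlonglongrightarrow> l j" by (metis less_SucI)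
  have "bounded (range (\<lambda>i. c (s i) r))" by (rule boundedI[of _ M]) (use Suc.prems in auto)
  then obtain a \<sigma> where \<sigma>: "strict_mono \<sigma>" "(\<lambda>i. c (s (\<sigma> i)) r) \<longlonglongrightarrow> a"
    using bounded_imp_convergent_subsequence[of "\<lambda>i. c (s i) r"] by (auto simp: o_def)
  have "(\<lambda>i. c ((s \<circ> \<sigma>) i) j) \<longlonglongrightarrow> (l(r := a)) j" if "j < Suc r" for j
  proof (cases "j = r")
    case False
    then have "((\<lambda>i. c (s i) j) \<circ> \<sigma>) \<longlonglongrightarrow> l j" using s(2)[of j] that by (intro LIMSEQ_subseq_LIMSEQ[OF _ \<sigma>(1)]) auto
    then show ?thesis using False by (simp add: o_def)
  qed (use \<sigma> in simp)
  then show ?case using strict_mono_o[OF s(1) \<sigma>(1)] by blast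
qed

section \<open>Representations and their cyclic decomposition\<close>

locale hilbert_rep =
  fixes \<pi> :: "'a::unital_cstar_algebra \<Rightarrow> 'h::chilbert \<Rightarrow> 'h"
  assumes H: "hilbert_separable TYPE('h)" "infinite_dimensional TYPE('h)" and rep: "faithful_rep \<pi>"
begin

lemma rep_lin:
  "\<pi> a (u + v) = \<pi> a u + \<pi> a v" "\<pi> a (c *\<^sub>C u) = c *\<^sub>C \<pi> a u"
  "\<pi> (a + b) u = \<pi> a u + \<pi> b u" "\<pi> (c *\<^sub>C a) u = c *\<^sub>C \<pi> a u"
  "\<pi> (a * b) u = \<pi> a (\<pi> b u)" "\<pi> 1 u = u"
  using rep by (auto simp: faithful_rep_def bounded_op_def clinear_map_def)

lemma rep_star: "cinner (\<pi> (cstar a) u) v = cinner u (\<pi> a v)"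
  using rep cinner_cadj[OF H, of "\<pi> a" u v] by (auto simp: faithful_rep_def)

lemma rep_star': "cinner u (\<pi> (cstar a) v) = cinner (\<pi> a u) v"
  using rep_star[of "cstar a" u v] by (simp add: cstar_cstar)

lemma rep_scaleR: "\<pi> (r *\<^sub>R a) u = r *\<^sub>R \<pi> a u"
  by (simp add: scaleR_scaleC rep_lin)

lemma rep_diff: "\<pi> (a - b) u = \<pi> a u - \<pi> b u"
  using rep_lin(3)[of a "- b" u] rep_lin(4)[of "-1" b u] by (simp add: scaleC_minus_one)

lemma rep_zero [simp]: "\<pi> a 0 = 0" "\<pi> 0 u = 0"
  using rep_lin(2)[of a 0 0] rep_lin(4)[of 0 0 u] by simp_all

text \<open>With \<open>b * b = \<parallel>a\<parallel>^2 - a*a\<close>, the difference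
  \<open>\<parallel>a\<parallel>^2 \<parallel>u\<parallel>^2 - \<parallel>\<pi> a
  u\<parallel>^2\<close> equals \<open>\<parallel>\<pi> b u\<parallel>^2\<close>.\<close>

lemma rep_norm: "norm (\<pi> a u) \<le> norm a * norm u"
proof -
  have sa: "cstar (cstar a * a) = cstar a * a" by (simp add: cstar_mult cstar_cstar)
  have "cpos ((norm a)\<^sup>2 *\<^sub>R 1 - cstar a * a)" by (rule cpos_norm_diff[OF sa]) (simp add: cstar_identity)
  then obtain b where b: "cpos b" "b * b = (norm a)\<^sup>2 *\<^sub>R 1 - cstar a * a" using cpos_sqrt_exists by metis
  have "cinner (\<pi> b u) (\<pi> b u) = cinner (\<pi> (b * b) u) u"
    using rep_star[of b "\<pi> b u" u] cpos_selfadj[OF b(1)] by (simp add: rep_lin)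
  also have "\<dots> = (norm a)\<^sup>2 * cinner u u - cinner (\<pi> (cstar a) (\<pi> a u)) u"
    unfolding b(2) rep_diff rep_scaleR hil.diff_left by (simp add: rep_lin scaleR_scaleC hil.scale_left)
  also have "\<dots> = complex_of_real ((norm a)\<^sup>2 * (norm u)\<^sup>2 - (norm (\<pi> a u))\<^sup>2)"
    unfolding rep_star cinner_self_norm by simp
  finally have "(norm (\<pi> b u))\<^sup>2 = (norm a)\<^sup>2 * (norm u)\<^sup>2 - (norm (\<pi> a u))\<^sup>2"
    unfolding cinner_self_norm of_real_eq_iff .
  then have "(norm (\<pi> a u))\<^sup>2 \<le> (norm a * norm u)\<^sup>2"
    using zero_le_power2[of "norm (\<pi> b u)"] by (simp add: power_mult_distrib)
  then show ?thesis by (rule power2_le_imp_le) simp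
qed

lemma bounded_linear_rep: "bounded_linear (\<pi> a)"
  by (rule bounded_linear_intro[of _ "norm a"]) (auto simp: rep_lin scaleR_scaleC rep_norm mult.commute)

lemma bounded_linear_rep_left: "bounded_linear (\<lambda>a. \<pi> a u)"
  by (rule bounded_linear_intro[of _ "norm u"]) (auto simp: rep_lin rep_scaleR rep_norm)

lemma closed_csubspace_vimage_rep:
  assumes M: "closed_csubspace M"
  shows "closed_csubspace {y. \<pi> a y \<in> M}"
proof -
  have "closed (\<pi> a -` M)"
    using M by (intro continuous_closed_vimage) (auto simp: closed_csubspace_def bounded_linear_rep linear_continuous_at)
  moreover have "csubspace {y. \<pi> a y \<in> M}"
    using M by (auto simp: csubspace_def closed_csubspace_def rep_lin)
  ultimately show ?thesis by (simp add: closed_csubspace_def vimage_def)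
qed

text \<open>Decomposition into cyclic subspaces: \<open>\<xi> l\<close> is the component of \<open>d l\<close> orthogonal to the
  invariant subspace generated by \<open>d 0, \<dots>, d (l - 1)\<close>.\<close>

lemma cyclic_decomposition:
  fixes v :: "nat \<Rightarrow> 'a"
  assumes dense: "\<And>a r. r > 0 \<Longrightarrow> \<exists>k. norm (a - v k) < r"
  obtains \<xi> :: "nat \<Rightarrow> 'h" where
    "\<And>l k a b. l \<noteq> k \<Longrightarrow> cinner (\<pi> a (\<xi> l)) (\<pi> b (\<xi> k)) = 0"
    "closed_span {\<pi> (v k) (\<xi> l) | k l. True} = UNIV"
proof -
  \<comment> \<open>Membership in a closed subspace is tested on the dense sequence
    \<open>v\<close>, which keeps the generating families countable.\<close>
  have dense_in: "\<pi> a u \<in> M" if M: "closed_csubspace M" and vM: "\<And>k. \<pi> (v k) u \<in> M" for M a u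
  proof -
    have "\<exists>k. norm (a - v k) < 1 / real (Suc i)" for i by (rule dense) simp
    then obtain k where k: "\<And>i. norm (a - v (k i)) < 1 / real (Suc i)" by metis
    have "(\<lambda>i. v (k i) - a) \<longlonglongrightarrow> 0"
    proof (rule Lim_null_comparison[OF _ LIMSEQ_inverse_real_of_nat])
      show "eventually (\<lambda>i. norm (v (k i) - a) \<le> inverse (real (Suc i))) sequentially"
        using k by (intro always_eventually allI) (simp add: norm_minus_commute inverse_eq_divide less_imp_le)
    qed
    then have "(\<lambda>i. v (k i)) \<longlonglongrightarrow> a" by (rule LIM_zero_cancel)
    then have "(\<lambda>i. \<pi> (v (k i)) u) \<longlonglongrightarrow> \<pi> a u" by (rule bounded_linear.tendsto[OF bounded_linear_rep_left])
    then show ?thesis by (rule closed_csubspace_lim[OF M, rotated]) (rule vM)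
  qed
  obtain d :: "nat \<Rightarrow> 'h" where d: "onb d" using onb_exists[OF H] by blast
  define S where "S = (\<lambda>l. {\<pi> a (d j) | a j. j < l})"
  \<comment> \<open>An enumeration of all \<open>\<pi> (v k) (d j)\<close> with
    \<open>j < l\<close>; the remaining codes give \<open>0\<close>, which does not change the
    span.\<close>
  define w where "w = (\<lambda>l i. if snd (prod_decode i) < l then \<pi> (v (fst (prod_decode i))) (d (snd (prod_decode i))) else 0)"
  have wS: "range (w l) \<subseteq> closed_span (S l)" for l
  proof -
    have "csubspace (closed_span (S l))" using closed_csubspace_closed_span by (auto simp: closed_csubspace_def)
    then have "0 \<in> closed_span (S l)" by (rule csubspace_zero)
    moreover have "\<pi> a (d j) \<in> closed_span (S l)" if "j < l" for a j
      by (rule subsetD[OF closed_span_superset]) (use that in \<open>auto simp: S_def\<close>)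
    ultimately show ?thesis by (auto simp: w_def)
  qed
  have "\<exists>p. p \<in> closed_span (range (w l)) \<and> (\<forall>k. cinner (w l k) (d l - p) = 0)" for l
    using orthogonal_projection[of "w l" "d l"] by metis
  then obtain p where p: "\<And>l. p l \<in> closed_span (range (w l))" "\<And>l k. cinner (w l k) (d l - p l) = 0" by metis
  define \<xi> where "\<xi> = (\<lambda>l. d l - p l)"
  have pS: "p l \<in> closed_span (S l)" for l
    using p(1) closed_span_minimal[OF closed_csubspace_closed_span wS] by blast
  have orth: "cinner (\<xi> l) y = 0" if y: "y \<in> closed_span (S l)" for l y
  proof -
    have "S l \<subseteq> {y. cinner (\<xi> l) y = 0}"
    proof
      fix y assume "y \<in> S l"
      then obtain a j where y: "y = \<pi> a (d j)" "j < l" by (auto simp: S_def)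
      have "\<pi> (v k) (d j) \<in> {y. cinner (\<xi> l) y = 0}" for k
      proof -
        have "w l (prod_encode (k, j)) = \<pi> (v k) (d j)" using y by (simp add: w_def)
        then have "cinner (\<pi> (v k) (d j)) (\<xi> l) = 0" using p(2)[of l "prod_encode (k, j)"] by (simp add: \<xi>_def)
        then show ?thesis using cinner_commute[of "\<xi> l" "\<pi> (v k) (d j)"] by simp
      qed
      then show "y \<in> {y. cinner (\<xi> l) y = 0}" unfolding y by (rule dense_in[OF closed_csubspace_orth])
    qed
    then show ?thesis using closed_span_minimal[OF closed_csubspace_orth] y by blast
  qed
  have inv: "\<pi> b y \<in> closed_span (S l)" if y: "y \<in> closed_span (S l)" for b y l
  proof -
    have "S l \<subseteq> {y. \<pi> b y \<in> closed_span (S l)}"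
    proof
      fix y assume "y \<in> S l"
      then obtain a j where y: "y = \<pi> a (d j)" "j < l" by (auto simp: S_def)
      then have "\<pi> b y = \<pi> (b * a) (d j)" by (simp add: rep_lin)
      then have "\<pi> b y \<in> S l" using y by (auto simp: S_def)
      then show "y \<in> {y. \<pi> b y \<in> closed_span (S l)}" using subsetD[OF closed_span_superset] by blast
    qed
    then have "closed_span (S l) \<subseteq> {y. \<pi> b y \<in> closed_span (S l)}"
      by (rule closed_span_minimal[OF closed_csubspace_vimage_rep[OF closed_csubspace_closed_span]])
    then show ?thesis using y by blast
  qed
  have \<xi>S: "\<xi> k \<in> closed_span (S l)" if "k < l" for k l
  proof -
    have cs: "csubspace (closed_span (S l))" using closed_csubspace_closed_span by (auto simp: closed_csubspace_def)
    have "\<pi> 1 (d k) \<in> S l" unfolding S_def using that by blast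
    then have "d k \<in> closed_span (S l)" using subsetD[OF closed_span_superset] by (simp add: rep_lin)
    moreover have "S k \<subseteq> S l" unfolding S_def using that less_trans by blast
    then have "closed_span (S k) \<subseteq> closed_span (S l)"
      by (intro closed_span_minimal closed_csubspace_closed_span order_trans[OF _ closed_span_superset])
    ultimately show ?thesis unfolding \<xi>_def using pS[of k] by (intro csubspace_diff[OF cs]) auto
  qed
  have o1: "cinner (\<pi> a (\<xi> l)) (\<pi> b (\<xi> k)) = 0" if "k < l" for a b l k
  proof -
    have "cinner (\<pi> a (\<xi> l)) (\<pi> b (\<xi> k)) = cinner (\<xi> l) (\<pi> (cstar a * b) (\<xi> k))"
      using rep_star'[of "\<xi> l" a "\<pi> b (\<xi> k)"] by (simp add: rep_lin)
    then show ?thesis using orth[OF inv[OF \<xi>S[OF that]]] by simp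
  qed
  have o2: "cinner (\<pi> a (\<xi> l)) (\<pi> b (\<xi> k)) = 0" if "l \<noteq> k" for a b l k
    using o1[of k l a b] o1[of l k b a] that cinner_commute[of "\<pi> a (\<xi> l)" "\<pi> b (\<xi> k)"] by (cases "k < l") auto
  let ?N = "closed_span {\<pi> (v k) (\<xi> l) | k l. True}"
  have N: "closed_csubspace ?N" "csubspace ?N" using closed_csubspace_closed_span by (auto simp: closed_csubspace_def)
  have \<pi>N: "\<pi> a (\<xi> l) \<in> ?N" for a l
    by (rule dense_in[OF N(1)]) (rule subsetD[OF closed_span_superset], blast)
  have invN: "\<pi> b y \<in> ?N" if y: "y \<in> ?N" for b y
  proof -
    have "{\<pi> (v k) (\<xi> l) | k l. True} \<subseteq> {y. \<pi> b y \<in> ?N}"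
      using \<pi>N by (auto simp flip: rep_lin(5))
    then have "?N \<subseteq> {y. \<pi> b y \<in> ?N}" by (rule closed_span_minimal[OF closed_csubspace_vimage_rep[OF N(1)]])
    then show ?thesis using y by blast
  qed
  \<comment> \<open>\<open>d l = \<xi> l + p l\<close>, and \<open>p l\<close> lies in the invariant
    subspace generated by the earlier \<open>d j\<close>, so the cyclic vectors recover the whole
    basis by induction.\<close>
  have dN: "d l \<in> ?N" for l
  proof (induction l rule: less_induct)
    case (less l)
    have "S l \<subseteq> ?N" using less invN by (auto simp: S_def)
    then have "p l \<in> ?N" using pS[of l] closed_span_minimal[OF N(1)] by blast
    moreover have "\<pi> 1 (\<xi> l) \<in> ?N" by (rule \<pi>N)
    ultimately have "\<xi> l + p l \<in> ?N" by (intro csubspace_add[OF N(2)]) (simp_all add: rep_lin)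
    then show ?case by (simp add: \<xi>_def)
  qed
  have "h \<in> ?N" for h by (rule onb_closed_span[OF d N(1)]) (use dN in auto)
  then have "?N = UNIV" by (rule UNIV_eq_I[symmetric])
  then show ?thesis using that o2 by blast
qed

end

text \<open>A positive functional on the matrix algebra given by finitely many vectors.
  Concatenation of rescaled lists realizes convex combinations, and placing the entries in different
  copies of the amplification turns the list into one vector.\<close>

definition fam_state :: "complex mat \<Rightarrow> complex vec list \<Rightarrow> complex" where
  "fam_state M vs = (\<Sum>v\<leftarrow>vs. vip v (M *\<^sub>v v))"

definition fam_sqnorm :: "complex vec list \<Rightarrow> real" where
  "fam_sqnorm vs = (\<Sum>v\<leftarrow>vs. (vnorm v)\<^sup>2)"

lemma fam_state_bound:
  "M \<in> carrier_mat m m \<Longrightarrow> set vs \<subseteq> carrier_vec m \<Longrightarrow> cmod (fam_state M vs) \<le> mnorm M * fam_sqnorm vs"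
proof (induction vs)
  case (Cons v vs)
  have v: "v \<in> carrier_vec m" using Cons.prems by simp
  have "cmod (vip v (M *\<^sub>v v)) \<le> vnorm v * (mnorm M * vnorm v)"
    by (rule order_trans[OF vip_cauchy_schwarz[OF v] mult_left_mono[OF vnorm_mult_le[OF Cons.prems(1) v]]])
       (use Cons.prems v in auto)
  then have "cmod (vip v (M *\<^sub>v v)) \<le> mnorm M * (vnorm v)\<^sup>2" by (simp add: power2_eq_square mult_ac)
  then show ?case
    using Cons norm_triangle_ineq[of "vip v (M *\<^sub>v v)" "fam_state M vs"] by (simp add: fam_state_def fam_sqnorm_def distrib_left)
qed (simp add: fam_state_def fam_sqnorm_def)

lemma fam_state_scale:
  "M \<in> carrier_mat m m \<Longrightarrow> set vs \<subseteq> carrier_vec m \<Longrightarrow>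
    fam_state M (map (\<lambda>v. complex_of_real c \<cdot>\<^sub>v v) vs) = complex_of_real (c\<^sup>2) * fam_state M vs"
proof (induction vs)
  case (Cons v vs)
  then have "vip (complex_of_real c \<cdot>\<^sub>v v) (M *\<^sub>v (complex_of_real c \<cdot>\<^sub>v v)) = complex_of_real (c\<^sup>2) * vip v (M *\<^sub>v v)"
    by (simp add: mult_mat_vec[of M m m] vip_smult_left vip_smult_right[of _ m] power2_eq_square)
  then show ?case using Cons by (simp add: fam_state_def distrib_left)
qed (simp add: fam_state_def)

lemma fam_sqnorm_scale: "fam_sqnorm (map (\<lambda>v. complex_of_real c \<cdot>\<^sub>v v) vs) = c\<^sup>2 * fam_sqnorm vs"
  by (induction vs) (auto simp: fam_sqnorm_def vnorm_smult power_mult_distrib distrib_left)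

primrec poly_comb :: "(nat \<Rightarrow> complex) \<Rightarrow> (nat \<Rightarrow> complex ncpoly) \<Rightarrow> nat \<Rightarrow> complex ncpoly" where
  "poly_comb l P 0 = NConst 0"
| "poly_comb l P (Suc r) = NAdd (poly_comb l P r) (NMul (NConst (l r)) (P r))"

lemma vnorm_unit: "0 < m \<Longrightarrow> vnorm (unit_vec m 0) = 1"
proof -
  assume "0 < m"
  have "(\<Sum>i<m. (cmod (unit_vec m 0 $ i))\<^sup>2) = (\<Sum>i<m. if i = 0 then 1 else 0)"
    by (intro sum.cong refl) (auto simp: unit_vec_def)
  then show ?thesis using \<open>0 < m\<close> by (simp add: vnorm_def)
qed

locale norm_conv_rep = norm_conv n x m A + hilbert_rep \<pi>
  for n and x :: "nat \<Rightarrow> 'a::unital_cstar_algebra" and m A and \<pi> :: "'a \<Rightarrow> 'h::chilbert \<Rightarrow> 'h"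
begin

lemma ev_smult: "P \<in> ncpolys n \<Longrightarrow> ev k (NMul (NConst c) P) = c \<cdot>\<^sub>m ev k P"
  using mult_smult_assoc_mat[of "1\<^sub>m (m k)" "m k" "m k" "ev k P" "m k" c] ev_carrier[of P k]
    left_mult_one_mat[of "ev k P" "m k" "m k"] by simp

lemma poly_comb_ncpolys: "(\<And>j. P j \<in> ncpolys n) \<Longrightarrow> poly_comb l P r \<in> ncpolys n"
  by (induction r) auto

lemma vip_poly_comb:
  assumes P: "\<And>j. P j \<in> ncpolys n" and v: "v \<in> carrier_vec (m k)"
  shows "vip v (ev k (poly_comb l P r) *\<^sub>v v) = (\<Sum>j<r. l j * vip v (ev k (P j) *\<^sub>v v))"
proof (induction r)
  case 0
  have "(0 \<cdot>\<^sub>m 1\<^sub>m (m k)) *\<^sub>v v = 0 \<cdot>\<^sub>v v"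
    using smult_mat_mult_vec[of "1\<^sub>m (m k)" "m k" "m k" v 0] v by simp
  then show ?case using v by (simp add: vip_smult_right[of _ "m k"])
next
  case (Suc r)
  let ?Q = "ev k (poly_comb l P r)"
  have c: "?Q \<in> carrier_mat (m k) (m k)" "ev k (P r) \<in> carrier_mat (m k) (m k)" using P poly_comb_ncpolys by auto
  have "ev k (poly_comb l P (Suc r)) = ?Q + l r \<cdot>\<^sub>m ev k (P r)" using ev_smult[OF P, of k "l r" r] by simp
  then have "ev k (poly_comb l P (Suc r)) *\<^sub>v v = ?Q *\<^sub>v v + l r \<cdot>\<^sub>v (ev k (P r) *\<^sub>v v)"
    using c v by (simp add: add_mult_distrib_mat_vec[of _ "m k" "m k"] smult_mat_mult_vec[of _ "m k" "m k"])
  then show ?case using Suc c v by (simp add: vip_add_right[of _ "m k"] vip_smult_right[of _ "m k"])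
qed

lemma state_poly_comb:
  "cinner \<xi> (\<pi> (ev_alg x (poly_comb l P r)) \<xi>) = (\<Sum>j<r. l j * cinner \<xi> (\<pi> (ev_alg x (P j)) \<xi>))"
  by (induction r) (simp_all add: rep_lin hil.add_right hil.scale_right scaleC_mult_left)

text \<open>If a vector state were not approximable, a functional separating it from the convex set of
  states of \<open>M\<^sub>m\<close> would produce a self-adjoint polynomial \<open>T\<close> whose largest eigenvalue on the
  matrices stays below the state; this contradicts convergence of the norm of \<open>T + \<kappa>\<close>.\<close>

theorem vector_state_approx:
  fixes P :: "nat \<Rightarrow> complex ncpoly"
  assumes P: "\<And>j. P j \<in> ncpolys n" and \<epsilon>: "\<epsilon> > 0"
  shows "eventually (\<lambda>t. \<exists>vs. set vs \<subseteq> carrier_vec (m t) \<and>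
    (\<forall>j<r. cmod (fam_state (ev t (P j)) vs - cinner \<xi> (\<pi> (ev_alg x (P j)) \<xi>)) < \<epsilon>)) sequentially"
proof (cases "\<xi> = 0")
  case True
  have "\<exists>vs. set vs \<subseteq> carrier_vec (m t) \<and> (\<forall>j<r. cmod (fam_state (ev t (P j)) vs - cinner \<xi> (\<pi> (ev_alg x (P j)) \<xi>)) < \<epsilon>)" for t
    by (rule exI[of _ "[]"]) (use \<epsilon> True in \<open>simp add: fam_state_def\<close>)
  then show ?thesis by simp
next
  case False
  define s where "s = (norm \<xi>)\<^sup>2"
  have s: "s > 0" using False by (simp add: s_def)
  define \<omega> where "\<omega> = (\<lambda>P. cinner \<xi> (\<pi> (ev_alg x P) \<xi>))"
  have \<omega>_bound: "cmod (\<omega> Q) \<le> norm (ev_alg x Q) * s" for Q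
  proof -
    have "cmod (\<omega> Q) \<le> norm \<xi> * (norm (ev_alg x Q) * norm \<xi>)"
      unfolding \<omega>_def by (rule order_trans[OF norm_cinner_le mult_left_mono[OF rep_norm]]) simp
    then show ?thesis by (simp add: s_def power2_eq_square mult_ac)
  qed
  define bad where "bad = (\<lambda>t. \<forall>vs. set vs \<subseteq> carrier_vec (m t) \<longrightarrow> (\<exists>j<r. \<epsilon> \<le> cmod (fam_state (ev t (P j)) vs - \<omega> (P j))))"
  have mpos: "0 < m t" for t using nc by (simp add: norm_convergent_def)
  define v0 where "v0 = (\<lambda>t. complex_of_real (sqrt s) \<cdot>\<^sub>v unit_vec (m t) 0)"
  have v0: "v0 t \<in> carrier_vec (m t)" "(vnorm (v0 t))\<^sup>2 = s" for t
    using s mpos[of t] by (auto simp: v0_def vnorm_smult vnorm_unit power_mult_distrib)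
  have "\<exists>B. \<forall>t. mnorm (ev t (P j)) \<le> B" for j
  proof -
    have "Bseq (\<lambda>t. mnorm (ev t (P j)))" using ev_lim[OF P] convergentI convergent_imp_Bseq by blast
    then obtain B where B: "\<And>t. norm (mnorm (ev t (P j))) \<le> B" unfolding Bseq_def by blast
    show ?thesis by (rule exI[of _ B]) (use B in simp)
  qed
  then obtain B where B: "\<And>t j. mnorm (ev t (P j)) \<le> B j" by metis
  have B0: "0 \<le> B j" for j using B[of 0 j] mnorm_ge_0 order_trans by blast
  \<comment> \<open>A common bound for the coordinates of the matrix functionals of mass
    \<open>s\<close> and of the given state. It does not depend on \<open>t\<close>, so all
    separating coefficients stay in one bounded set.\<close>
  define M where "M = (\<Sum>j<r. B j + norm (ev_alg x (P j))) * s"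
  have M0: "M \<ge> 0" unfolding M_def using s B0 by (intro mult_nonneg_nonneg sum_nonneg add_nonneg_nonneg) auto
  have Mj: "(B j + norm (ev_alg x (P j))) * s \<le> M" if "j < r" for j
  proof -
    have "B j + norm (ev_alg x (P j)) \<le> (\<Sum>j<r. B j + norm (ev_alg x (P j)))"
      by (rule member_le_sum[of j "{..<r}" "\<lambda>j. B j + norm (ev_alg x (P j))"]) (use that B0 in \<open>auto intro: add_nonneg_nonneg\<close>)
    then show ?thesis unfolding M_def using s by (intro mult_right_mono) auto
  qed
  define separates where "separates = (\<lambda>t c. (\<forall>j<r. cmod (c j) \<le> 2 * M) \<and>
    (\<forall>v\<in>carrier_vec (m t). (vnorm v)\<^sup>2 = s \<longrightarrow>
      \<epsilon>\<^sup>2 / 2 \<le> Re (\<Sum>j<r. c j * (vip v (ev t (P j) *\<^sub>v v) - \<omega> (P j)))))"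
  have "\<exists>c. separates t c" if bad: "bad t" for t
  proof -
    \<comment> \<open>All members have the mass \<open>s = \<parallel>\<xi>\<parallel>^2\<close> of
      the given state, a condition preserved by convex combinations.\<close>
    define C where "C = {\<lambda>j. fam_state (ev t (P j)) vs | vs. set vs \<subseteq> carrier_vec (m t) \<and> fam_sqnorm vs = s}"
    have C1: "(\<lambda>j. fam_state (ev t (P j)) [v]) \<in> C" if "v \<in> carrier_vec (m t)" "(vnorm v)\<^sup>2 = s" for v
      unfolding C_def using that by (intro CollectI exI[of _ "[v]"]) (auto simp: fam_sqnorm_def)
    obtain c where c: "\<And>j. j < r \<Longrightarrow> cmod (c j) \<le> 2 * M"
      "\<And>z. z \<in> C \<Longrightarrow> \<epsilon>\<^sup>2 / 2 \<le> Re (\<Sum>j<r. c j * (z j - \<omega> (P j)))"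
    proof (rule convex_separation[of C r M "\<lambda>j. \<omega> (P j)" \<epsilon>])
      show "C \<noteq> {}" using C1[OF v0] by blast
      show "(\<lambda>j. of_real (1 - \<theta>) * z j + of_real \<theta> * w j) \<in> C"
        if "z \<in> C" "w \<in> C" and \<theta>: "0 \<le> \<theta>" "\<theta> \<le> 1" for z w and \<theta> :: real
      proof -
        obtain vs ws where vs: "z = (\<lambda>j. fam_state (ev t (P j)) vs)" "set vs \<subseteq> carrier_vec (m t)" "fam_sqnorm vs = s"
          and ws: "w = (\<lambda>j. fam_state (ev t (P j)) ws)" "set ws \<subseteq> carrier_vec (m t)" "fam_sqnorm ws = s"
          using \<open>z \<in> C\<close> \<open>w \<in> C\<close> by (auto simp: C_def)
        let ?us = "map (\<lambda>v. complex_of_real (sqrt (1 - \<theta>)) \<cdot>\<^sub>v v) vs @ map (\<lambda>v. complex_of_real (sqrt \<theta>) \<cdot>\<^sub>v v) ws"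
        have app: "fam_state N (a @ b) = fam_state N a + fam_state N b" "fam_sqnorm (a @ b) = fam_sqnorm a + fam_sqnorm b" for N a b
          by (simp_all add: fam_state_def fam_sqnorm_def)
        have "fam_state (ev t (P j)) ?us = of_real (1 - \<theta>) * z j + of_real \<theta> * w j" for j
          unfolding app fam_state_scale[OF ev_carrier[OF P] vs(2)] fam_state_scale[OF ev_carrier[OF P] ws(2)]
          using \<theta> by (simp add: vs ws)
        moreover have "fam_sqnorm ?us = s"
          unfolding app fam_sqnorm_scale using \<theta> by (simp add: vs ws algebra_simps)
        moreover have "set ?us \<subseteq> carrier_vec (m t)" using vs ws by auto
        ultimately show ?thesis unfolding C_def by (intro CollectI exI[of _ ?us]) auto
      qed
      show "cmod (z j) \<le> M" if "z \<in> C" "j < r" for z j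
      proof -
        obtain vs where vs: "z = (\<lambda>j. fam_state (ev t (P j)) vs)" "set vs \<subseteq> carrier_vec (m t)" "fam_sqnorm vs = s"
          using \<open>z \<in> C\<close> by (auto simp: C_def)
        have "cmod (z j) \<le> mnorm (ev t (P j)) * s" using fam_state_bound[OF ev_carrier[OF P] vs(2)] vs by simp
        also have "\<dots> \<le> (B j + norm (ev_alg x (P j))) * s" using B[of t j] s by (intro mult_right_mono) (auto intro: add_increasing2)
        also have "\<dots> \<le> M" by (rule Mj[OF \<open>j < r\<close>])
        finally show ?thesis .
      qed
      show "cmod (\<omega> (P j)) \<le> M" if "j < r" for j
      proof -
        have "norm (ev_alg x (P j)) * s \<le> (B j + norm (ev_alg x (P j))) * s" using B0[of j] s by (intro mult_right_mono) auto
        then show ?thesis using \<omega>_bound[of "P j"] Mj[OF that] by linarith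
      qed
      show "\<exists>j<r. \<epsilon> \<le> cmod (z j - \<omega> (P j))" if "z \<in> C" for z using that bad by (auto simp: C_def bad_def)
    qed (use M0 \<epsilon> in auto)
    have "\<epsilon>\<^sup>2 / 2 \<le> Re (\<Sum>j<r. c j * (vip v (ev t (P j) *\<^sub>v v) - \<omega> (P j)))"
      if "v \<in> carrier_vec (m t)" "(vnorm v)\<^sup>2 = s" for v
      using c(2)[OF C1[OF that]] by (simp add: fam_state_def)
    then show ?thesis using c(1) unfolding separates_def by blast
  qed
  then obtain c where c0: "\<And>t. bad t \<Longrightarrow> separates t (c t)" by metis
  have c: "\<And>t j. bad t \<Longrightarrow> j < r \<Longrightarrow> cmod (c t j) \<le> 2 * M"
    "\<And>t v. bad t \<Longrightarrow> v \<in> carrier_vec (m t) \<Longrightarrow> (vnorm v)\<^sup>2 = s \<Longrightarrow>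
      \<epsilon>\<^sup>2 / 2 \<le> Re (\<Sum>j<r. c t j * (vip v (ev t (P j) *\<^sub>v v) - \<omega> (P j)))"
    for t j v using c0 unfolding separates_def by blast+
  have "finite {t. bad t}"
  proof (rule ccontr)
    assume inf: "infinite {t. bad t}"
    define s1 where "s1 = enumerate {t. bad t}"
    have s1: "strict_mono s1" "\<And>i. bad (s1 i)"
      using strict_mono_enumerate[OF inf] enumerate_in_set[OF inf] by (auto simp: s1_def)
    \<comment> \<open>The separating coefficients vary with \<open>t\<close>, but norm convergence
      is available for fixed polynomials. Their limits \<open>l\<close> along a subsequence define
      one polynomial \<open>Q\<close> for infinitely many bad indices.\<close>
    have "\<exists>s2 l. strict_mono s2 \<and> (\<forall>j<r. (\<lambda>i. c (s1 (s2 i)) j) \<longlonglongrightarrow> l j)"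
      by (rule bounded_coordinates_subseq[where c = "\<lambda>i. c (s1 i)" and M = "2 * M"]) (rule c(1)[OF s1(2)])
    then obtain s2 l where s2: "strict_mono s2" "\<And>j. j < r \<Longrightarrow> (\<lambda>i. c (s1 (s2 i)) j) \<longlonglongrightarrow> l j" by blast
    define t where "t = s1 \<circ> s2"
    have tm: "filterlim t sequentially sequentially"
      unfolding t_def by (rule filterlim_subseq[OF strict_mono_o[OF s1(1) s2(1)]])
    define Q where "Q = poly_comb l P r"
    \<comment> \<open>Separation bounds the real part of \<open>Q\<close> from below on matrix
      states, so its negative \<open>T\<close> is bounded from above. Adding \<open>\<kappa>\<close>
      makes the quadratic form nonnegative at late indices, where \<open>mnorm\<close> of
      \<open>T\<close> is below \<open>\<kappa>\<close>; the norm of \<open>T'\<close> is then the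
      top of its form.\<close>
    define T where "T = NMul (NConst (complex_of_real (-1/2))) (NAdd Q (ncstar Q))"
    define \<kappa> where "\<kappa> = norm (ev_alg x T) + 1"
    define T' where "T' = NAdd T (NMul (NConst (complex_of_real \<kappa>)) (NConst 1))"
    \<comment> \<open>Half of the separation \<open>\<epsilon>^2 / 2\<close> is reserved for
      replacing \<open>c (t i)\<close> by the limit \<open>l\<close>.\<close>
    define \<eta> where "\<eta> = \<epsilon>\<^sup>2 / 4"
    have \<eta>: "\<eta> > 0" using \<epsilon> by (simp add: \<eta>_def)
    have Qn: "Q \<in> ncpolys n" "T \<in> ncpolys n" "T' \<in> ncpolys n" unfolding T'_def T_def Q_def using poly_comb_ncpolys[of P l r] P by simp_all
    have adjQ: "ev k (ncstar Q) = mat_adjoint (ev k Q)" for k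
      using nc Qn(1) by (intro ev_mat_ncstar) (auto dest: ncvars_ncpolys simp: norm_convergent_def)
    have evT: "ev k T = complex_of_real (-1/2) \<cdot>\<^sub>m (ev k Q + mat_adjoint (ev k Q))" for k
      using ev_smult[of "NAdd Q (ncstar Q)" k "complex_of_real (-1/2)"] Qn(1) by (simp add: T_def adjQ)
    have one: "1 \<cdot>\<^sub>m 1\<^sub>m k = (1\<^sub>m k :: complex mat)" for k by (rule eq_matI) auto
    have evT': "ev k T' = ev k T + complex_of_real \<kappa> \<cdot>\<^sub>m 1\<^sub>m (m k)" for k
      using ev_smult[of "NConst 1" k "complex_of_real \<kappa>"] by (simp add: T'_def one)
    have Qc: "ev k Q \<in> carrier_mat (m k) (m k)" "ev k T \<in> carrier_mat (m k) (m k)" for k using Qn by auto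
    have qfQ: "qf (mat_adjoint (ev k Q)) v = qf (ev k Q) v" if "v \<in> carrier_vec (m k)" for k v
    proof -
      have "vip v (ev k Q *\<^sub>v v) = vip (mat_adjoint (ev k Q) *\<^sub>v v) v" by (rule vip_adjoint[OF Qc(1) that that])
      also have "\<dots> = cnj (vip v (mat_adjoint (ev k Q) *\<^sub>v v))"
        by (rule vip_cnj) (use Qc(1)[of k] that in \<open>simp add: mat_adjoint_eq\<close>)
      finally show ?thesis by (simp add: qf_def)
    qed
    have qfT: "qf (ev k T) v = - qf (ev k Q) v" if "v \<in> carrier_vec (m k)" for k v
      unfolding evT using that Qc(1)[of k] qfQ[OF that] by (simp only: qf_smult[of _ "m k"] qf_add[of _ "m k"] add_carrier_mat mat_adjoint_carrier) simp
    have qfT': "qf (ev k T') v = - qf (ev k Q) v + \<kappa> * (vnorm v)\<^sup>2" if "v \<in> carrier_vec (m k)" for k v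
      unfolding evT' using that Qc(2)[of k] by (simp only: qf_smult[of _ "m k"] qf_add[of _ "m k"] qf_one qfT smult_carrier_mat one_carrier_mat)
    have adjT: "mat_adjoint (ev k T) = ev k T" for k
      unfolding evT mat_adjoint_smult using Qc(1)[of k]
      by (simp add: mat_adjoint_add[of _ "m k" "m k"] comm_add_mat[of _ "m k" "m k"])
    have adjT': "mat_adjoint (ev k T') = ev k T'" for k
      unfolding evT' using Qc(2)[of k] by (simp add: mat_adjoint_add[of _ "m k" "m k"] mat_adjoint_smult adjT)
    have \<omega>star: "\<omega> (ncstar Q) = cnj (\<omega> Q)"
    proof -
      have "ev_alg x (ncstar Q) = cstar (ev_alg x Q)" using sa Qn(1) by (intro ev_alg_ncstar) (auto dest: ncvars_ncpolys)
      then show ?thesis unfolding \<omega>_def by (simp add: rep_star') (rule cinner_commute)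
    qed
    define \<tau> where "\<tau> = - Re (\<omega> Q)"
    have \<omega>T': "Re (\<omega> T') = \<tau> + \<kappa> * s"
    proof -
      have "\<omega> T' = complex_of_real (-1/2) * (\<omega> Q + \<omega> (ncstar Q)) + complex_of_real \<kappa> * cinner \<xi> \<xi>"
        unfolding \<omega>_def T'_def T_def by (simp add: rep_lin hil.add_right hil.scale_right scaleC_mult_left scaleC_one)
      then show ?thesis by (simp add: \<omega>star \<tau>_def cinner_self_norm s_def)
    qed
    have lower: "\<tau> / s + \<kappa> \<le> norm (ev_alg x T')"
    proof -
      have "\<tau> + \<kappa> * s \<le> norm (ev_alg x T') * s" using \<omega>_bound[of T'] complex_Re_le_cmod[of "\<omega> T'"] \<omega>T' by linarith
      then show ?thesis using s by (simp add: field_simps)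
    qed
    have "(\<lambda>i. \<Sum>j<r. cmod (c (t i) j - l j) * (2 * M)) \<longlonglongrightarrow> (\<Sum>j<r. cmod (l j - l j) * (2 * M))"
      unfolding t_def o_def by (intro tendsto_intros s2(2)) auto
    then have e1: "eventually (\<lambda>i. (\<Sum>j<r. cmod (c (t i) j - l j) * (2 * M)) < \<eta>) sequentially"
      using order_tendstoD(2)[of _ 0 _ \<eta>] \<eta> by simp
    have e2: "eventually (\<lambda>i. mnorm (ev (t i) T) < \<kappa>) sequentially"
      by (rule eventually_compose_filterlim[OF order_tendstoD(2)[OF ev_lim[OF Qn(2)]] tm]) (simp add: \<kappa>_def)
    have e3: "eventually (\<lambda>i. mnorm (ev (t i) T') > norm (ev_alg x T') - \<eta> / (2 * s)) sequentially"
      by (rule eventually_compose_filterlim[OF order_tendstoD(1)[OF ev_lim[OF Qn(3)]] tm]) (use \<eta> s in simp)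
    from eventually_happens'[OF _ eventually_conj[OF e1 eventually_conj[OF e2 e3]]]
    obtain i where i: "(\<Sum>j<r. cmod (c (t i) j - l j) * (2 * M)) < \<eta>" "mnorm (ev (t i) T) < \<kappa>"
      "mnorm (ev (t i) T') > norm (ev_alg x T') - \<eta> / (2 * s)" by auto
    define k where "k = t i"
    have bk: "bad k" using s1(2) by (simp add: k_def t_def)
    have sep: "\<eta> \<le> qf (ev k Q) v + \<tau>" if v: "v \<in> carrier_vec (m k)" "(vnorm v)\<^sup>2 = s" for v
    proof -
      define z where "z = (\<lambda>j. vip v (ev k (P j) *\<^sub>v v) - \<omega> (P j))"
      have zb: "cmod (z j) \<le> 2 * M" if "j < r" for j
      proof -
        have "cmod (vip v (ev k (P j) *\<^sub>v v)) \<le> mnorm (ev k (P j)) * s"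
          using fam_state_bound[OF ev_carrier[OF P], of "[v]" k j] v by (simp add: fam_state_def fam_sqnorm_def)
        also have "\<dots> \<le> B j * s" using B[of k j] s by (intro mult_right_mono) auto
        finally have "cmod (z j) \<le> B j * s + norm (ev_alg x (P j)) * s"
          unfolding z_def using norm_triangle_ineq4[of "vip v (ev k (P j) *\<^sub>v v)" "\<omega> (P j)"] \<omega>_bound[of "P j"] by linarith
        then show ?thesis using Mj[OF that] M0 by (simp add: distrib_right)
      qed
      have "\<epsilon>\<^sup>2 / 2 \<le> Re (\<Sum>j<r. c k j * z j)" unfolding z_def by (rule c(2)[OF bk v])
      also have "(\<Sum>j<r. c k j * z j) = (\<Sum>j<r. l j * z j) + (\<Sum>j<r. (c k j - l j) * z j)"
        by (simp add: sum.distrib[symmetric] algebra_simps)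
      also have "Re \<dots> \<le> Re (\<Sum>j<r. l j * z j) + (\<Sum>j<r. cmod (c k j - l j) * (2 * M))"
      proof -
        have "Re (\<Sum>j<r. (c k j - l j) * z j) \<le> cmod (\<Sum>j<r. (c k j - l j) * z j)" by (rule complex_Re_le_cmod)
        also have "\<dots> \<le> (\<Sum>j<r. cmod ((c k j - l j) * z j))" by (rule norm_sum)
        also have "\<dots> \<le> (\<Sum>j<r. cmod (c k j - l j) * (2 * M))"
          unfolding norm_mult by (intro sum_mono mult_left_mono zb) auto
        finally show ?thesis by simp
      qed
      finally have "\<eta> \<le> Re (\<Sum>j<r. l j * z j)" using i(1) by (simp add: \<eta>_def k_def)
      also have "(\<Sum>j<r. l j * z j) = vip v (ev k Q *\<^sub>v v) - \<omega> Q"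
        unfolding z_def Q_def vip_poly_comb[OF P v(1)] \<omega>_def state_poly_comb by (simp add: right_diff_distrib sum_subtractf)
      finally show ?thesis by (simp add: qf_def \<tau>_def)
    qed
    \<comment> \<open>On unit vectors the form of \<open>T\<close> is at most
      \<open>(\<tau> - \<eta>) / s\<close>, while the normalized vector state takes the value
      \<open>\<tau> / s\<close> at \<open>T\<close>. The deficit \<open>\<eta> / s\<close> exceeds
      the norm error \<open>\<eta> / (2 * s)\<close>, which gives the contradiction.\<close>
    define \<gamma> where "\<gamma> = (\<tau> - \<eta>) / s + \<kappa>"
    have up: "qf (ev k T') v \<le> \<gamma> * (vnorm v)\<^sup>2" if v: "v \<in> carrier_vec (m k)" for v
    proof (cases "vnorm v = 0")
      case True
      then have "v = 0\<^sub>v (m k)" using vnorm_eq_0 v by blast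
      then show ?thesis by (simp add: qf_def True)
    next
      case False
      define b where "b = sqrt s / vnorm v"
      have b: "b\<^sup>2 * (vnorm v)\<^sup>2 = s" using False s by (simp add: b_def power_divide)
      have b2: "b\<^sup>2 > 0" using False s by (simp add: b_def)
      let ?u = "complex_of_real b \<cdot>\<^sub>v v"
      have u: "?u \<in> carrier_vec (m k)" "(vnorm ?u)\<^sup>2 = s" using v b by (simp_all add: vnorm_smult power_mult_distrib)
      have "qf (ev k Q) ?u = b\<^sup>2 * qf (ev k Q) v"
        using fam_state_scale[OF Qc(1)[of k], of "[v]" b] v by (simp add: fam_state_def qf_def)
      then have "\<eta> - \<tau> \<le> b\<^sup>2 * qf (ev k Q) v" using sep[OF u] by linarith
      then have "- qf (ev k Q) v \<le> (\<tau> - \<eta>) / b\<^sup>2" using b2 by (simp add: field_simps)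
      also have "\<dots> = (\<tau> - \<eta>) / s * (vnorm v)\<^sup>2" using b b2 s False by (simp add: field_simps)
      finally show ?thesis unfolding qfT'[OF v] by (simp add: \<gamma>_def algebra_simps)
    qed
    have dn: "0 \<le> qf (ev k T') v" if v: "v \<in> carrier_vec (m k)" for v
    proof -
      have "\<bar>qf (ev k T) v\<bar> \<le> mnorm (ev k T) * (vnorm v)\<^sup>2" by (rule qf_bound[OF Qc(2) v])
      also have "\<dots> \<le> \<kappa> * (vnorm v)\<^sup>2" using i(2) by (intro mult_right_mono) (auto simp: k_def)
      finally show ?thesis unfolding qfT'[OF v] using qfT[OF v] by linarith
    qed
    have "0 \<le> \<gamma> * s" using order_trans[OF dn up, OF v0(1) v0(1)] v0(2) by simp
    then have \<gamma>0: "\<gamma> \<ge> 0" using s by (simp add: zero_le_mult_iff)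
    have "mnorm (ev k T') \<le> \<gamma>"
      by (rule mnorm_le_quadratic_form[OF ev_carrier[OF Qn(3)] adjT' \<gamma>0]) (use up dn in \<open>auto simp: qf_def\<close>)
    then have "\<tau> / s + \<kappa> - \<eta> / (2 * s) < (\<tau> - \<eta>) / s + \<kappa>" using i(3) lower by (simp add: k_def \<gamma>_def)
    then have "\<eta> / s < \<eta> / (2 * s)" by (simp add: diff_divide_distrib)
    then show False using \<eta> s by (simp add: field_simps)
  qed
  then have "eventually (\<lambda>t. \<not> bad t) sequentially"
    by (simp add: cofinite_eq_sequentially[symmetric] eventually_cofinite)
  then show ?thesis
    by eventually_elim (auto simp: bad_def \<omega>_def not_le)
qed

end

section \<open>Unitaries onto the amplified matrix space\<close>

text \<open>The basis is cut into consecutive blocks of length \<open>m\<close>; block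
  \<open>j\<close> supplies the coordinates of the \<open>j\<close>-th copy.\<close>

lemma ell2_unitary_exists:
  fixes e :: "nat \<Rightarrow> 'h::chilbert"
  assumes m: "0 < m" and e: "onb e"
  obtains U :: "'h \<Rightarrow> nat \<Rightarrow> complex vec" where "unitary_to_ell2 m U"
proof -
  define U where "U = (\<lambda>h j. vec m (\<lambda>i. cinner (e (j * m + i)) h))"
  have blk: "(\<Sum>p\<in>{j * m..<j * m + m}. f p) = (\<Sum>i<m. f (j * m + i))" for f :: "nat \<Rightarrow> real" and j
    using sum.shift_bounds_nat_ivl[of f 0 "j * m" m] by (simp add: lessThan_atLeast0 add.commute)
  have Usq: "(vnorm (U h j))\<^sup>2 = (\<Sum>p\<in>{j * m..<j * m + m}. (cmod (cinner (e p) h))\<^sup>2)" for h j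
    unfolding blk by (simp add: vnorm_sq U_def)
  have Usums: "(\<lambda>j. (vnorm (U h j))\<^sup>2) sums (norm h)\<^sup>2" for h
    unfolding Usq by (rule sums_group[OF onb_sums[OF e] m])
  have mem: "U h \<in> ell2_m m" for h
    using sums_summable[OF Usums[of h]] by (auto simp: ell2_m_def U_def)
  have coord: "U h (p div m) $ (p mod m) = cinner (e p) h" for h p
    using m by (simp add: U_def)
  have "inj U" by (rule injI) (metis coord onb_eqI[OF e])
  moreover have "range U = ell2_m m"
  proof
    show "range U \<subseteq> ell2_m m" using mem by blast
    show "ell2_m m \<subseteq> range U"
    proof
      fix f assume f: "f \<in> ell2_m m"
      then have fc: "f j \<in> carrier_vec m" and fs: "summable (\<lambda>j. (vnorm (f j))\<^sup>2)" for j by (auto simp: ell2_m_def)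
      define c where "c = (\<lambda>p. f (p div m) $ (p mod m))"
      have fj: "(\<Sum>p\<in>{j * m..<j * m + m}. (cmod (c p))\<^sup>2) = (vnorm (f j))\<^sup>2" for j
      proof -
        have "(\<Sum>i<m. (cmod (c (j * m + i)))\<^sup>2) = (\<Sum>i<m. (cmod (f j $ i))\<^sup>2)"
          by (intro sum.cong refl) (simp add: c_def)
        then show ?thesis unfolding blk using fc[of j] by (simp add: vnorm_sq)
      qed
      have "summable (\<lambda>p. (cmod (c p))\<^sup>2)"
      proof (rule summableI_nonneg_bounded)
        fix N
        have "N \<le> N * m" using m by simp
        then have "(\<Sum>p<N. (cmod (c p))\<^sup>2) \<le> (\<Sum>p<N * m. (cmod (c p))\<^sup>2)" by (intro sum_mono2) auto
        also have "\<dots> = (\<Sum>j<N. (vnorm (f j))\<^sup>2)" unfolding sum.nat_group[symmetric] fj ..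
        also have "\<dots> \<le> (\<Sum>j. (vnorm (f j))\<^sup>2)" by (rule sum_le_suminf[OF fs]) auto
        finally show "(\<Sum>p<N. (cmod (c p))\<^sup>2) \<le> (\<Sum>j. (vnorm (f j))\<^sup>2)" .
      qed simp
      then obtain h where h: "\<And>p. cinner (e p) h = c p" using onb_synthesis[OF e] by metis
      have "U h = f"
      proof
        fix j
        show "U h j = f j"
          by (rule eq_vecI) (use fc[of j] m in \<open>auto simp: U_def h c_def\<close>)
      qed
      then show "f \<in> range U" by blast
    qed
  qed
  ultimately have "bij_betw U UNIV (ell2_m m)" by (simp add: bij_betw_def)
  moreover have "U (a + b) = (\<lambda>j. U a j + U b j)" for a b
    by (intro ext eq_vecI) (auto simp: U_def hil.add_right)
  moreover have "U (c *\<^sub>C a) = (\<lambda>j. c \<cdot>\<^sub>v U a j)" for c a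
    by (intro ext eq_vecI) (auto simp: U_def hil.scale_right)
  ultimately have "unitary_to_ell2 m U" using Usums by (auto simp: unitary_to_ell2_def sums_iff)
  then show ?thesis using that by blast
qed

lemma vip_polarization:
  assumes "u \<in> carrier_vec m" "v \<in> carrier_vec m"
  shows "4 * vip u v = of_real ((vnorm (u + v))\<^sup>2) - of_real ((vnorm (u + (-1) \<cdot>\<^sub>v v))\<^sup>2)
     - \<i> * (of_real ((vnorm (u + \<i> \<cdot>\<^sub>v v))\<^sup>2) - of_real ((vnorm (u + (- \<i>) \<cdot>\<^sub>v v))\<^sup>2))"
  unfolding vip_self[symmetric] using assms
  by (simp add: vip_add_left[of _ m] vip_add_right[of _ m] vip_smult_left vip_smult_right[of _ m] algebra_simps)

section \<open>Amplified matrices as operators\<close>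

locale ell2_unitary =
  fixes m :: nat and U :: "'h::chilbert \<Rightarrow> nat \<Rightarrow> complex vec"
  assumes U: "unitary_to_ell2 m U"
begin

lemma U_lin: "U (a + b) j = U a j + U b j" "U (c *\<^sub>C a) j = c \<cdot>\<^sub>v U a j"
  using U by (auto simp: unitary_to_ell2_def)

lemma U_mem: "U h \<in> ell2_m m"
  using U by (auto simp: unitary_to_ell2_def bij_betw_def)

lemma U_carrier [simp]: "U h j \<in> carrier_vec m"
  using U_mem[of h] by (simp add: ell2_m_def)

lemma U_inj: "U a = U b \<Longrightarrow> a = b"
  using U by (auto simp: unitary_to_ell2_def bij_betw_def dest: injD)

lemma U_inv: "f \<in> ell2_m m \<Longrightarrow> U (inv_into UNIV U f) = f"
  using U by (auto simp: unitary_to_ell2_def bij_betw_def intro!: f_inv_into_f)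

lemma U_sums: "(\<lambda>j. (vnorm (U h j))\<^sup>2) sums (norm h)\<^sup>2"
proof -
  have "summable (\<lambda>j. (vnorm (U h j))\<^sup>2)" using U_mem[of h] by (simp add: ell2_m_def)
  then show ?thesis using U by (simp add: unitary_to_ell2_def sums_iff)
qed

text \<open>Unitaries are defined by preservation of norms; polarization in every copy gives the
  inner products.\<close>

lemma U_vip_sums: "(\<lambda>j. vip (U a j) (U b j)) sums cinner a b"
proof -
  have s: "(\<lambda>j. complex_of_real ((vnorm (U a j + c \<cdot>\<^sub>v U b j))\<^sup>2)) sums complex_of_real ((norm (a + c *\<^sub>C b))\<^sup>2)" for c
    using sums_of_real[OF U_sums[of "a + c *\<^sub>C b"]] by (simp only: U_lin)
  have s1: "(\<lambda>j. complex_of_real ((vnorm (U a j + U b j))\<^sup>2)) sums complex_of_real ((norm (a + b))\<^sup>2)"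
    using sums_of_real[OF U_sums[of "a + b"]] by (simp only: U_lin)
  have "(\<lambda>j. 4 * vip (U a j) (U b j)) sums (of_real ((norm (a + b))\<^sup>2) - of_real ((norm (a + (-1) *\<^sub>C b))\<^sup>2)
     - \<i> * (of_real ((norm (a + \<i> *\<^sub>C b))\<^sup>2) - of_real ((norm (a + (- \<i>) *\<^sub>C b))\<^sup>2)))"
    unfolding vip_polarization[OF U_carrier U_carrier] by (intro sums_diff sums_mult s s1)
  also have "\<dots> = 4 * cinner a b"
    unfolding hil.polarization hil_q by (simp add: scaleC_minus_left scaleC_one)
  finally have "(\<lambda>j. 4 * vip (U a j) (U b j)) sums (4 * cinner a b)" .
  from sums_mult[OF this, of "1/4"] show ?thesis by simp
qed

lemma amp_mem:
  assumes A: "A \<in> carrier_mat m m"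
  shows "(\<lambda>j. A *\<^sub>v U h j) \<in> ell2_m m" "(\<Sum>j. (vnorm (A *\<^sub>v U h j))\<^sup>2) \<le> (mnorm A * norm h)\<^sup>2"
proof -
  have le: "(vnorm (A *\<^sub>v U h j))\<^sup>2 \<le> (mnorm A)\<^sup>2 * (vnorm (U h j))\<^sup>2" for j
    using power_mono[OF vnorm_mult_le[OF A U_carrier[of h j]] vnorm_ge_0, of 2] by (simp add: power_mult_distrib)
  have s: "(\<lambda>j. (mnorm A)\<^sup>2 * (vnorm (U h j))\<^sup>2) sums ((mnorm A)\<^sup>2 * (norm h)\<^sup>2)" by (rule sums_mult[OF U_sums])
  have sm: "summable (\<lambda>j. (vnorm (A *\<^sub>v U h j))\<^sup>2)"
    by (rule summable_comparison_test'[OF sums_summable[OF s], of 0]) (use le in simp)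
  then show "(\<lambda>j. A *\<^sub>v U h j) \<in> ell2_m m"
    using A U_carrier[of h] by (auto simp: ell2_m_def)
  show "(\<Sum>j. (vnorm (A *\<^sub>v U h j))\<^sup>2) \<le> (mnorm A * norm h)\<^sup>2"
    using suminf_le[OF le sm sums_summable[OF s]] s by (simp add: sums_iff power_mult_distrib)
qed

lemma conj_amp_apply: "A \<in> carrier_mat m m \<Longrightarrow> U (conj_amp U A h) = (\<lambda>j. A *\<^sub>v U h j)"
  unfolding conj_amp_def by (rule U_inv[OF amp_mem(1)])

lemma norm_conj_amp: "A \<in> carrier_mat m m \<Longrightarrow> norm (conj_amp U A h) \<le> mnorm A * norm h"
proof -
  assume A: "A \<in> carrier_mat m m"
  have "(norm (conj_amp U A h))\<^sup>2 = (\<Sum>j. (vnorm (A *\<^sub>v U h j))\<^sup>2)"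
    using U_sums[of "conj_amp U A h"] unfolding conj_amp_apply[OF A] by (simp add: sums_iff)
  then have "(norm (conj_amp U A h))\<^sup>2 \<le> (mnorm A * norm h)\<^sup>2" using amp_mem(2)[OF A] by simp
  then show ?thesis by (rule power2_le_imp_le) simp
qed

lemma conj_amp_linear:
  assumes A: "A \<in> carrier_mat m m"
  shows "conj_amp U A (a + b) = conj_amp U A a + conj_amp U A b" "conj_amp U A (c *\<^sub>C a) = c *\<^sub>C conj_amp U A a"
proof -
  show "conj_amp U A (a + b) = conj_amp U A a + conj_amp U A b"
    by (rule U_inj, rule ext) (simp add: conj_amp_apply[OF A] U_lin mult_add_distrib_mat_vec[OF A])
  show "conj_amp U A (c *\<^sub>C a) = c *\<^sub>C conj_amp U A a"
    by (rule U_inj, rule ext) (simp add: conj_amp_apply[OF A] U_lin mult_mat_vec[OF A])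
qed

lemma conj_amp_symmetric:
  assumes A: "selfadjoint_mat m A"
  shows "cinner (conj_amp U A a) b = cinner a (conj_amp U A b)"
proof -
  have c: "A \<in> carrier_mat m m" "mat_adjoint A = A" using A by (auto simp: selfadjoint_mat_def)
  have "vip (U a j) (A *\<^sub>v U b j) = vip (A *\<^sub>v U a j) (U b j)" for j
    using vip_adjoint[OF c(1) U_carrier U_carrier, of a j b j] c(2) by simp
  then show ?thesis
    using U_vip_sums[of "conj_amp U A a" b] U_vip_sums[of a "conj_amp U A b"] sums_unique2
    unfolding conj_amp_apply[OF c(1)] by fastforce
qed

lemma comp_unitary: "unitary_op Z \<Longrightarrow> unitary_to_ell2 m (U \<circ> Z)"
  using U unfolding unitary_to_ell2_def unitary_op_def clinear_map_def
  by (auto intro: bij_betw_trans)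

end

text \<open>The uniform bound \<open>K\<close> lets strong convergence pass to limits of vectors, so
  it has to be checked on a total family only.\<close>

lemma strong_limit_closed:
  fixes T :: "nat \<Rightarrow> 'h::chilbert \<Rightarrow> 'h"
  assumes T: "\<And>q a b. T q (a + b) = T q a + T q b" "\<And>q c a. T q (c *\<^sub>C a) = c *\<^sub>C T q a"
    and K: "\<And>q a. norm (T q a) \<le> K * norm a"
    and S: "\<And>a b. S (a + b) = S a + S b" "\<And>c a. S (c *\<^sub>C a) = c *\<^sub>C S a" and L: "\<And>a. norm (S a) \<le> L * norm a"
  shows "closed_csubspace {h. (\<lambda>q. T q h) \<longlonglongrightarrow> S h}"
proof -
  have z: "T q 0 = 0" "S 0 = 0" for q using T(2)[of q 0 0] S(2)[of 0 0] by simp_all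
  have d: "T q (a - b) = T q a - T q b" "S (a - b) = S a - S b" for q a b
    using T(1)[of q a "(-1) *\<^sub>C b"] T(2)[of q "-1" b] S(1)[of a "(-1) *\<^sub>C b"] S(2)[of "-1" b] by (simp_all add: scaleC_minus_one)
  have "closed {h. (\<lambda>q. T q h) \<longlonglongrightarrow> S h}"
    unfolding closed_sequential_limits
  proof (intro allI impI)
    fix f l assume a: "(\<forall>n. f n \<in> {h. (\<lambda>q. T q h) \<longlonglongrightarrow> S h}) \<and> f \<longlonglongrightarrow> l"
    have "(\<lambda>q. T q l) \<longlonglongrightarrow> S l"
    proof (rule LIMSEQ_I)
      fix r :: real assume r: "r > 0"
      define M where "M = \<bar>K\<bar> + \<bar>L\<bar> + 1"
      have M: "M > 0" by (simp add: M_def)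
      then obtain i where i: "norm (f i - l) < r / (2 * M)"
        using a r LIMSEQ_D[of f l "r / (2 * M)"] by auto
      have "(\<lambda>q. T q (f i)) \<longlonglongrightarrow> S (f i)" using a by blast
      then obtain N where N: "\<And>q. q \<ge> N \<Longrightarrow> norm (T q (f i) - S (f i)) < r / 2"
        using r LIMSEQ_D[of _ "S (f i)" "r / 2"] by auto
      have "norm (T q l - S l) < r" if "q \<ge> N" for q
      proof -
        have "T q l - S l = (T q (f i) - S (f i)) - (T q (f i - l) - S (f i - l))" by (simp add: d)
        then have "norm (T q l - S l) \<le> norm (T q (f i) - S (f i)) + norm (T q (f i - l) - S (f i - l))"
          by (simp only: norm_triangle_ineq4)
        then have "norm (T q l - S l) \<le> norm (T q (f i) - S (f i)) + (norm (T q (f i - l)) + norm (S (f i - l)))"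
          using norm_triangle_ineq4[of "T q (f i - l)" "S (f i - l)"] by linarith
        also have "norm (T q (f i - l)) + norm (S (f i - l)) \<le> M * norm (f i - l)"
        proof -
          have "K * norm (f i - l) \<le> \<bar>K\<bar> * norm (f i - l)" "L * norm (f i - l) \<le> \<bar>L\<bar> * norm (f i - l)"
            by (intro mult_right_mono; simp)+
          then show ?thesis using K[of q "f i - l"] L[of "f i - l"] norm_ge_zero[of "f i - l"]
            unfolding M_def distrib_right by linarith
        qed
        also have "M * norm (f i - l) < r / 2" using i M by (simp add: field_simps)
        finally show ?thesis using N[OF that] by linarith
      qed
      then show "\<exists>no. \<forall>q\<ge>no. norm (T q l - S l) < r" by blast
    qed
    then show "l \<in> {h. (\<lambda>q. T q h) \<longlonglongrightarrow> S h}" by simp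
  qed
  moreover have "csubspace {h. (\<lambda>q. T q h) \<longlonglongrightarrow> S h}"
    unfolding csubspace_def by (auto simp: z T S intro: tendsto_add tendsto_scaleC)
  ultimately show ?thesis by (simp add: closed_csubspace_def)
qed

lemma enum_poly_dense:
  fixes x :: "nat \<Rightarrow> 'a::unital_cstar_algebra"
  assumes gen: "generates n x" and r: "r > 0"
  shows "\<exists>k. norm (a - ev_alg x (enum_poly n (Suc k))) < r"
proof -
  define R where "R = (\<Sum>i<n. norm (x i))"
  have R0: "R \<ge> 0" by (simp add: R_def sum_nonneg)
  have xR: "\<forall>i<n. norm (x i) \<le> R" unfolding R_def by (auto intro: member_le_sum)
  have "a \<in> closure (ev_alg x ` ncpolys n)" using gen by (simp add: generates_def)
  moreover have "r / 2 > 0" using r by simp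
  ultimately obtain P where P: "P \<in> ncpolys n" "dist (ev_alg x P) a < r / 2" unfolding closure_approachable by blast
  obtain k where "poly_close TYPE('a) n R (r / 2) P (enum_poly n (Suc k))"
    using enum_poly_approx[OF R0 P(1) \<open>r / 2 > 0\<close>, where 'a='a] by blast
  then have "norm (ev_alg x P - ev_alg x (enum_poly n (Suc k))) \<le> r / 2" using xR unfolding poly_close_def by blast
  then have "norm (a - ev_alg x (enum_poly n (Suc k))) < r"
    using P(2) norm_triangle_ineq[of "a - ev_alg x P" "ev_alg x P - ev_alg x (enum_poly n (Suc k))"]
    by (simp add: dist_norm norm_minus_commute)
  then show ?thesis by blast
qed

section \<open>From matrix states to operators on the representation space\<close>

context norm_conv_rep
begin

text \<open>Stage \<open>N\<close> treats the first \<open>N\<close> polynomials and the first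
  \<open>N\<close> vectors with error \<open>1 / (N + 1)\<close> at one common index
  \<open>t N \<ge> N\<close>. Lists with \<open>l \<ge> N\<close> need only lie in the right space;
  for fixed \<open>l\<close> they concern finitely many stages.\<close>

lemma vector_states_diagonal:
  fixes P :: "nat \<Rightarrow> complex ncpoly" and \<xi> :: "nat \<Rightarrow> 'h"
  assumes P: "\<And>j. P j \<in> ncpolys n"
  obtains t vs where "\<And>N. N \<le> t N" "\<And>N l. set (vs N l) \<subseteq> carrier_vec (m (t N))"
    "\<And>l j. (\<lambda>N. fam_state (ev (t N) (P j)) (vs N l)) \<longlonglongrightarrow> cinner (\<xi> l) (\<pi> (ev_alg x (P j)) (\<xi> l))"
proof -
  define close where "close = (\<lambda>N t l ws. set ws \<subseteq> carrier_vec (m t) \<and>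
    (\<forall>j<N. cmod (fam_state (ev t (P j)) ws - cinner (\<xi> l) (\<pi> (ev_alg x (P j)) (\<xi> l))) < 1 / real (Suc N)))"
  have "\<exists>t\<ge>N. \<forall>l<N. \<exists>ws. close N t l ws" for N
  proof -
    have "eventually (\<lambda>t. \<forall>l\<in>{..<N}. \<exists>ws. close N t l ws) sequentially"
      unfolding close_def by (rule eventually_ball_finite) (auto intro!: vector_state_approx P)
    from eventually_happens'[OF _ eventually_conj[OF this eventually_ge_at_top[of N]]] show ?thesis by auto
  qed
  then obtain t where t: "\<And>N. N \<le> t N" "\<And>N l. l < N \<Longrightarrow> \<exists>ws. close N (t N) l ws" by metis
  have "\<exists>ws. set ws \<subseteq> carrier_vec (m (t N)) \<and> (l < N \<longrightarrow> close N (t N) l ws)" for N l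
  proof (cases "l < N")
    case True
    then obtain ws where "close N (t N) l ws" using t(2) by blast
    then show ?thesis by (auto simp: close_def)
  next
    case False
    then show ?thesis by (intro exI[of _ "[]"]) auto
  qed
  then obtain vs where vs: "\<And>N l. set (vs N l) \<subseteq> carrier_vec (m (t N))" "\<And>N l. l < N \<Longrightarrow> close N (t N) l (vs N l)" by metis
  have "(\<lambda>N. fam_state (ev (t N) (P j)) (vs N l)) \<longlonglongrightarrow> cinner (\<xi> l) (\<pi> (ev_alg x (P j)) (\<xi> l))" for l j
  proof (rule LIM_zero_cancel, rule Lim_null_comparison[OF _ LIMSEQ_inverse_real_of_nat])
    have "eventually (\<lambda>N. l < N \<and> j < N) sequentially" using eventually_gt_at_top by (intro eventually_conj) auto
    then show "eventually (\<lambda>N. cmod (fam_state (ev (t N) (P j)) (vs N l) - cinner (\<xi> l) (\<pi> (ev_alg x (P j)) (\<xi> l)))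
        \<le> inverse (real (Suc N))) sequentially"
    proof eventually_elim
      case (elim N)
      then have "close N (t N) l (vs N l)" using vs(2) by blast
      then have "cmod (fam_state (ev (t N) (P j)) (vs N l) - cinner (\<xi> l) (\<pi> (ev_alg x (P j)) (\<xi> l))) < 1 / real (Suc N)"
        using elim unfolding close_def by blast
      then show ?case by (simp add: inverse_eq_divide)
    qed
  qed
  then show ?thesis using that t(1) vs(1) by blast
qed

text \<open>The family \<open>vs l\<close> is placed in the coordinates \<open>prod_encode (l, a)\<close>, so that different \<open>l\<close>
  occupy orthogonal copies of the matrix space.\<close>

definition placed :: "nat \<Rightarrow> (nat \<Rightarrow> complex vec list) \<Rightarrow> nat \<Rightarrow> complex mat \<Rightarrow> nat \<Rightarrow> complex vec" where
  "placed k vs l M p = (if fst (prod_decode p) = l \<and> snd (prod_decode p) < length (vs l)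
     then M *\<^sub>v (vs l ! snd (prod_decode p)) else 0\<^sub>v (m k))"

lemma placed_carrier:
  "M \<in> carrier_mat (m k) (m k) \<Longrightarrow> set (vs l) \<subseteq> carrier_vec (m k) \<Longrightarrow> placed k vs l M p \<in> carrier_vec (m k)"
  unfolding placed_def by (auto intro!: mult_mat_vec_carrier)

lemma placed_zero: "p \<notin> (\<lambda>a. prod_encode (l, a)) ` {..<length (vs l)} \<Longrightarrow> placed k vs l M p = 0\<^sub>v (m k)"
proof (rule ccontr)
  assume a: "p \<notin> (\<lambda>a. prod_encode (l, a)) ` {..<length (vs l)}" "placed k vs l M p \<noteq> 0\<^sub>v (m k)"
  then have "fst (prod_decode p) = l" "snd (prod_decode p) < length (vs l)" by (auto simp: placed_def split: if_splits)
  then have "p = prod_encode (l, snd (prod_decode p))" by (metis prod.collapse prod_decode_inverse)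
  then show False using a(1) \<open>snd (prod_decode p) < length (vs l)\<close> by blast
qed

lemma placed_ell2:
  assumes "M \<in> carrier_mat (m k) (m k)" "set (vs l) \<subseteq> carrier_vec (m k)"
  shows "placed k vs l M \<in> ell2_m (m k)"
proof -
  have "summable (\<lambda>p. (vnorm (placed k vs l M p))\<^sup>2)"
    by (rule summable_finite[of "(\<lambda>a. prod_encode (l, a)) ` {..<length (vs l)}"]) (auto simp: placed_zero)
  then show ?thesis using placed_carrier[of M k vs l] assms by (simp add: ell2_m_def)
qed

text \<open>The sum over a list of vectors becomes an inner product in the amplification, which is
  how arbitrary matrix states become vector states. Families with different \<open>l\<close> have no
  common nonzero coordinate.\<close>

lemma placed_vip:
  assumes M: "M \<in> carrier_mat (m k) (m k)" "M' \<in> carrier_mat (m k) (m k)"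
    and vs: "\<And>l. set (vs l) \<subseteq> carrier_vec (m k)"
  shows "(\<lambda>p. vip (placed k vs l M p) (placed k vs l' M' p)) sums
    (if l = l' then fam_state (mat_adjoint M * M') (vs l) else 0)"
proof -
  let ?S = "(\<lambda>a. prod_encode (l, a)) ` {..<length (vs l)}"
  have "(\<lambda>p. vip (placed k vs l M p) (placed k vs l' M' p)) sums (\<Sum>p\<in>?S. vip (placed k vs l M p) (placed k vs l' M' p))"
    by (rule sums_finite) (auto simp: placed_zero)
  moreover have "(\<Sum>p\<in>?S. vip (placed k vs l M p) (placed k vs l' M' p)) = (if l = l' then fam_state (mat_adjoint M * M') (vs l) else 0)"
  proof (cases "l = l'")
    case True
    have "inj_on (\<lambda>a. prod_encode (l, a)) {..<length (vs l)}" by (auto simp: inj_on_def)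
    then have "(\<Sum>p\<in>?S. vip (placed k vs l M p) (placed k vs l' M' p)) = (\<Sum>a<length (vs l). vip (M *\<^sub>v (vs l ! a)) (M' *\<^sub>v (vs l ! a)))"
      using True by (simp add: sum.reindex placed_def)
    also have "\<dots> = (\<Sum>a<length (vs l). vip (vs l ! a) ((mat_adjoint M * M') *\<^sub>v (vs l ! a)))"
    proof (rule sum.cong[OF refl])
      fix a assume "a \<in> {..<length (vs l)}"
      then have v: "vs l ! a \<in> carrier_vec (m k)" using vs[of l] by auto
      have M'v: "M' *\<^sub>v (vs l ! a) \<in> carrier_vec (m k)" using M v by auto
      have "vip (vs l ! a) (mat_adjoint M *\<^sub>v (M' *\<^sub>v (vs l ! a))) = vip (M *\<^sub>v (vs l ! a)) (M' *\<^sub>v (vs l ! a))"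
        using vip_adjoint[OF mat_adjoint_carrier[OF M(1)] v M'v] by simp
      then show "vip (M *\<^sub>v (vs l ! a)) (M' *\<^sub>v (vs l ! a)) = vip (vs l ! a) ((mat_adjoint M * M') *\<^sub>v (vs l ! a))"
        using assoc_mult_mat_vec[OF mat_adjoint_carrier[OF M(1)] M(2) v] by simp
    qed
    also have "\<dots> = fam_state (mat_adjoint M * M') (vs l)"
      by (simp add: fam_state_def sum_list_sum_nth lessThan_atLeast0)
    finally show ?thesis using True by simp
  next
    case False
    have "vip (placed k vs l M p) (placed k vs l' M' p) = 0" for p
    proof (cases "fst (prod_decode p) = l")
      case True
      then have "placed k vs l' M' p = 0\<^sub>v (m k)" using False by (simp add: placed_def)
      then show ?thesis using placed_carrier[OF M(1) vs] by simp
    next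
      case False
      then have "placed k vs l M p = 0\<^sub>v (m k)" by (simp add: placed_def)
      then show ?thesis by simp
    qed
    then show ?thesis using False by simp
  qed
  ultimately show ?thesis by simp
qed

text \<open>The vectors \<open>w' N i\<close> copy the family \<open>w i\<close> in the amplified
  matrix space: the same polynomials produce them and their Gram matrix is almost the same.
  Multiplication by a variable permits an exact change of index in the enumerated polynomials, so
  \<open>\<pi> (x i)\<close> and the amplified matrix act on the two families in the same way.
  Strong convergence on the total family follows, and self-adjointness yields convergence of the
  adjoints.\<close>

theorem star_strong_approximation:
  "\<exists>m' A' U. norm_convergent n x m' A' \<and> (\<forall>k. unitary_to_ell2 (m' k) (U k)) \<and>
     (\<forall>i<n. star_strong_conv (\<lambda>k. conj_amp (U k) (A' k i)) (\<pi> (x i)))"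
proof -
  define Q where "Q = (\<lambda>j. enum_poly n (Suc j))"
  have Q: "Q j \<in> ncpolys n" for j by (simp add: Q_def enum_poly_ncpolys)
  have "\<exists>k. norm (a - ev_alg x (Q k)) < r" if "r > 0" for a r
    unfolding Q_def by (rule enum_poly_dense[OF gen that])
  then obtain \<xi> :: "nat \<Rightarrow> 'h" where \<xi>: "\<And>l k a b. l \<noteq> k \<Longrightarrow> cinner (\<pi> a (\<xi> l)) (\<pi> b (\<xi> k)) = 0"
    "closed_span {\<pi> (ev_alg x (Q k)) (\<xi> l) | k l. True} = UNIV"
    using cyclic_decomposition[of "\<lambda>k. ev_alg x (Q k)"] by blast
  \<comment> \<open>The Gram entries of \<open>w\<close> are values of the states of
    \<open>\<xi> l\<close> at products of an enumerated polynomial with the adjoint of another;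
    \<open>P\<close> lists these products.\<close>
  define P where "P = (\<lambda>p. NMul (ncstar (Q (fst (prod_decode p)))) (Q (snd (prod_decode p))))"
  have P: "P p \<in> ncpolys n" for p by (simp add: P_def Q)
  obtain t vs where t: "\<And>N. N \<le> t N" and vs: "\<And>N l. set (vs N l) \<subseteq> carrier_vec (m (t N))"
    and lim: "\<And>l j. (\<lambda>N. fam_state (ev (t N) (P j)) (vs N l)) \<longlonglongrightarrow> cinner (\<xi> l) (\<pi> (ev_alg x (P j)) (\<xi> l))"
    by (rule vector_states_diagonal[OF P, where \<xi> = \<xi>]) (rule that; assumption)
  obtain e :: "nat \<Rightarrow> 'h" where e: "onb e" using onb_exists[OF H] by blast
  have mpos: "0 < m k" for k using nc by (simp add: norm_convergent_def)
  have "\<exists>U :: 'h \<Rightarrow> nat \<Rightarrow> complex vec. unitary_to_ell2 (m (t N)) U" for N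
    using ell2_unitary_exists[OF mpos e] by metis
  then obtain U0 :: "nat \<Rightarrow> 'h \<Rightarrow> nat \<Rightarrow> complex vec" where U0: "\<And>N. ell2_unitary (m (t N)) (U0 N)"
    unfolding ell2_unitary_def by metis
  define w where "w = (\<lambda>i. \<pi> (ev_alg x (Q (fst (prod_decode i)))) (\<xi> (snd (prod_decode i))))"
  define pl where "pl = (\<lambda>N i. placed (t N) (vs N) (snd (prod_decode i)) (ev (t N) (Q (fst (prod_decode i)))))"
  define w' where "w' = (\<lambda>N i. inv_into UNIV (U0 N) (pl N i))"
  have U0w': "U0 N (w' N i) = pl N i" for N i
    unfolding w'_def pl_def by (rule ell2_unitary.U_inv[OF U0 placed_ell2[OF ev_carrier[OF Q] vs]])
  have adj: "ev k (ncstar (Q j)) = mat_adjoint (ev k (Q j))" for k j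
    using nc Q[of j] by (intro ev_mat_ncstar) (auto dest: ncvars_ncpolys simp: norm_convergent_def)
  have adja: "ev_alg x (ncstar (Q j)) = cstar (ev_alg x (Q j))" for j
    using sa Q[of j] by (intro ev_alg_ncstar) (auto dest: ncvars_ncpolys)
  have gram: "(\<lambda>N. cinner (w' N i) (w' N j)) \<longlonglongrightarrow> cinner (w i) (w j)" for i j
  proof -
    obtain a l where al: "prod_decode i = (a, l)" by fastforce
    obtain b k where bk: "prod_decode j = (b, k)" by fastforce
    have "cinner (w' N i) (w' N j) = (if l = k then fam_state (ev (t N) (P (prod_encode (a, b)))) (vs N l) else 0)" for N
    proof -
      have "(\<lambda>p. vip (U0 N (w' N i) p) (U0 N (w' N j) p)) sums (if l = k then fam_state (mat_adjoint (ev (t N) (Q a)) * ev (t N) (Q b)) (vs N l) else 0)"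
        unfolding U0w' pl_def using placed_vip[where vs = "vs N" and k = "t N" and l = l and l' = k, OF ev_carrier[OF Q] ev_carrier[OF Q] vs, of a b]
        by (simp add: al bk)
      then show ?thesis using sums_unique2[OF ell2_unitary.U_vip_sums[OF U0]] by (simp add: P_def adj)
    qed
    moreover have "cinner (w i) (w j) = (if l = k then cinner (\<xi> l) (\<pi> (ev_alg x (P (prod_encode (a, b)))) (\<xi> l)) else 0)"
      using \<xi>(1)[of l k] by (auto simp: w_def al bk P_def adja rep_lin rep_star')
    ultimately show ?thesis using lim[of "prod_encode (a, b)" l] by (cases "l = k") simp_all
  qed
  \<comment> \<open>One index and one unitary serve the first \<open>q\<close> vectors with error
    \<open>1 / (q + 1)\<close>; letting \<open>q\<close> grow reaches every vector.\<close>
  have "\<exists>N V. q \<le> N \<and> unitary_op V \<and> (\<forall>i<q. norm (V (w i) - w' N i) < 1 / real (Suc q))" for q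
  proof -
    obtain Z where Z: "\<And>N. unitary_op (Z N)" "\<And>i. i < q \<Longrightarrow> (\<lambda>N. Z N (w i) - w' N i) \<longlonglongrightarrow> 0"
      by (rule gram_unitaries[OF H gram, where q = q]) (rule that; assumption)
    have "eventually (\<lambda>N. \<forall>i\<in>{..<q}. norm (Z N (w i) - w' N i) < 1 / real (Suc q)) sequentially"
    proof (rule eventually_ball_finite)
      show "\<forall>i\<in>{..<q}. eventually (\<lambda>N. norm (Z N (w i) - w' N i) < 1 / real (Suc q)) sequentially"
        using order_tendstoD(2)[OF tendsto_norm_zero[OF Z(2)]] by simp
    qed simp
    from eventually_happens'[OF _ eventually_conj[OF this eventually_ge_at_top[of q]]]
    obtain N where "\<forall>i<q. norm (Z N (w i) - w' N i) < 1 / real (Suc q)" "q \<le> N" by auto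
    then show ?thesis using Z(1) by blast
  qed
  then obtain N V where N: "\<And>q. q \<le> N q" and V: "\<And>q. unitary_op (V q)"
    and VN: "\<And>q i. i < q \<Longrightarrow> norm (V q (w i) - w' (N q) i) < 1 / real (Suc q)" by metis
  have Vlim: "(\<lambda>q. norm (V q (w i) - w' (N q) i)) \<longlonglongrightarrow> 0" for i
  proof (rule Lim_null_comparison[OF _ LIMSEQ_inverse_real_of_nat])
    show "eventually (\<lambda>q. norm (norm (V q (w i) - w' (N q) i)) \<le> inverse (real (Suc q))) sequentially"
      using eventually_gt_at_top[of i]
    proof eventually_elim
      case (elim q)
      then show ?case using VN[of i q] by (simp add: inverse_eq_divide)
    qed
  qed
  define T where "T = (\<lambda>q. t (N q))"
  have Tlim: "filterlim T sequentially sequentially"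
  proof (rule filterlim_at_top_mono[OF filterlim_ident])
    show "eventually (\<lambda>q. q \<le> T q) sequentially" using t N order_trans unfolding T_def by (intro always_eventually) blast
  qed
  define m' where "m' = (\<lambda>q. m (T q))"
  define A' where "A' = (\<lambda>q. A (T q))"
  define U where "U = (\<lambda>q. U0 (N q) \<circ> V q)"
  have nc': "norm_convergent n x m' A'"
    using nc unfolding norm_convergent_def m'_def A'_def
    by (auto intro: filterlim_compose[OF _ Tlim])
  have U: "ell2_unitary (m' q) (U q)" for q
    using ell2_unitary.comp_unitary[OF U0 V, of "N q" q] by (simp add: ell2_unitary_def m'_def T_def U_def)
  have U0': "ell2_unitary (m' q) (U0 (N q))" for q using U0[of "N q"] by (simp add: m'_def T_def)
  have A': "selfadjoint_mat (m' q) (A' q i)" "A' q i \<in> carrier_mat (m' q) (m' q)" if "i < n" for q i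
    using nc' that by (auto simp: norm_convergent_def selfadjoint_mat_def)
  have strong: "(\<lambda>q. conj_amp (U q) (A' q i) h) \<longlonglongrightarrow> \<pi> (x i) h" if i: "i < n" for i h
  proof -
    define C where "C = (\<lambda>q. conj_amp (U q) (A' q i))"
    define B where "B = (\<lambda>q. conj_amp (U0 (N q)) (A' q i))"
    have "(\<lambda>q. mnorm (ev_mat (m' q) (A' q) (NVar i))) \<longlonglongrightarrow> norm (ev_alg x (NVar i))"
      using nc' i by (auto simp: norm_convergent_def simp del: ev_mat.simps ev_alg.simps)
    then have nlim: "(\<lambda>q. mnorm (A' q i)) \<longlonglongrightarrow> norm (x i)" by simp
    then have "Bseq (\<lambda>q. mnorm (A' q i))" using convergentI convergent_imp_Bseq by blast
    then obtain K where K: "\<And>q. norm (mnorm (A' q i)) \<le> K" unfolding Bseq_def by blast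
    have CK: "norm (C q a) \<le> K * norm a" for q a
      using ell2_unitary.norm_conj_amp[OF U A'(2)[OF i], of q a] mult_right_mono[OF K[of q], of "norm a"]
      by (simp add: C_def)
    have Clin: "C q (a + b) = C q a + C q b" "C q (c *\<^sub>C a) = c *\<^sub>C C q a" for q a b c
      unfolding C_def using ell2_unitary.conj_amp_linear[OF U A'(2)[OF i]] by auto
    have cl: "closed_csubspace {h. (\<lambda>q. C q h) \<longlonglongrightarrow> \<pi> (x i) h}"
      by (rule strong_limit_closed[OF Clin CK rep_lin(1) rep_lin(2) rep_norm])
    \<comment> \<open>\<open>U q\<close> factors through \<open>V q\<close>, so \<open>V q\<close>
      carries the operator built from \<open>U q\<close> to the one built from
      \<open>U0 (N q)\<close>, for which the action on the vectors \<open>w'\<close> is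
      explicit.\<close>
    have VC: "V q (C q h) = B q (V q h)" for q h
    proof (rule ell2_unitary.U_inj[OF U0'[of q]])
      have "U0 (N q) (V q (C q h)) = U q (C q h)" by (simp add: U_def)
      also have "\<dots> = (\<lambda>j. A' q i *\<^sub>v U q h j)" unfolding C_def by (rule ell2_unitary.conj_amp_apply[OF U A'(2)[OF i]])
      also have "\<dots> = U0 (N q) (B q (V q h))"
        unfolding B_def ell2_unitary.conj_amp_apply[OF U0' A'(2)[OF i]] by (simp add: U_def)
      finally show "U0 (N q) (V q (C q h)) = U0 (N q) (B q (V q h))" .
    qed
    have lim_w: "(\<lambda>q. C q (w j)) \<longlonglongrightarrow> \<pi> (x i) (w j)" for j
    proof -
      obtain b l where bl: "prod_decode j = (b, l)" by fastforce
      \<comment> \<open>Returning to rational coefficients shows that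
        \<open>NMul (NVar i) (Q b)\<close> is itself one of the enumerated polynomials, exactly and
        not only up to approximation.\<close>
      obtain R where R: "R \<in> ratpolys n" "Q b = map_ncpoly gauss_rat R"
        unfolding Q_def enum_poly_def using from_nat_into[OF ratpolys_nonempty] by blast
      have "NMul (NVar i) R \<in> ratpolys n" using R(1) i by (simp add: ratpolys_def)
      then obtain b' where b': "Q b' = NMul (NVar i) (Q b)"
        using enum_poly_surj unfolding Q_def by (metis R(2) Q_def ncpoly.map(1) ncpoly.map(4))
      define j' where "j' = prod_encode (b', l)"
      have wj': "\<pi> (x i) (w j) = w j'" by (simp add: w_def bl j'_def b' rep_lin)
      have Bw': "B q (w' (N q) j) = w' (N q) j'" for q
      proof (rule ell2_unitary.U_inj[OF U0'[of q]])
        have "A' q i *\<^sub>v pl (N q) j p = pl (N q) j' p" for p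
        proof -
          have Ai: "A (T q) i \<in> carrier_mat (m (T q)) (m (T q))" using A'(2)[OF i, of q] by (simp add: A'_def m'_def)
          have "A (T q) i *\<^sub>v 0\<^sub>v (m (T q)) = 0\<^sub>v (m (T q))" using Ai by auto
          moreover have "A (T q) i *\<^sub>v (ev (T q) (Q b) *\<^sub>v v) = (A (T q) i * ev (T q) (Q b)) *\<^sub>v v" if "v \<in> carrier_vec (m (T q))" for v
            using assoc_mult_mat_vec[OF Ai ev_carrier[OF Q] that] by simp
          moreover have "vs (N q) l ! a \<in> carrier_vec (m (T q))" if "a < length (vs (N q) l)" for a
            using vs[of "N q" l] that by (auto simp: T_def)
          ultimately show ?thesis unfolding pl_def placed_def bl j'_def A'_def T_def by (simp add: b')
        qed
        then show "U0 (N q) (B q (w' (N q) j)) = U0 (N q) (w' (N q) j')"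
          unfolding B_def ell2_unitary.conj_amp_apply[OF U0' A'(2)[OF i]] U0w' by (intro ext) simp
      qed
      \<comment> \<open>\<open>V q\<close> is isometric, so the comparison can be made after
        applying it. The first term is the defect at \<open>w j\<close>, enlarged by the operator
        bound \<open>K\<close>; the second is the defect at the image vector
        \<open>w j'\<close>.\<close>
      have le: "norm (C q (w j) - \<pi> (x i) (w j)) \<le> K * norm (V q (w j) - w' (N q) j) + norm (V q (w j') - w' (N q) j')" for q
      proof -
        have Vlin: "V q (a + b) = V q a + V q b" "V q (c *\<^sub>C a) = c *\<^sub>C V q a" "norm (V q a) = norm a" for a b c
          using V[of q] by (auto simp: unitary_op_def clinear_map_def)
        have Blin: "B q (a + b) = B q a + B q b" "B q (c *\<^sub>C a) = c *\<^sub>C B q a" for a b c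
          unfolding B_def using ell2_unitary.conj_amp_linear[OF U0' A'(2)[OF i]] by auto
        have Vd: "V q (a - b) = V q a - V q b" and Bd: "B q (a - b) = B q a - B q b" for a b
          using Vlin(1)[of a "- b"] Vlin(2)[of "-1" b] Blin(1)[of a "- b"] Blin(2)[of "-1" b] by (simp_all add: scaleC_minus_one)
        have BK: "norm (B q a) \<le> K * norm a" for a
          using ell2_unitary.norm_conj_amp[OF U0' A'(2)[OF i], of q a] mult_right_mono[OF K[of q], of "norm a"] by (simp add: B_def)
        have "norm (C q (w j) - \<pi> (x i) (w j)) = norm (V q (C q (w j) - w j'))" by (simp add: Vlin(3) wj')
        also have "V q (C q (w j) - w j') = B q (V q (w j) - w' (N q) j) - (V q (w j') - w' (N q) j')"
          by (simp add: Vd VC Bd Bw')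
        also have "norm \<dots> \<le> norm (B q (V q (w j) - w' (N q) j)) + norm (V q (w j') - w' (N q) j')"
          by (rule norm_triangle_ineq4)
        finally show ?thesis using BK[of "V q (w j) - w' (N q) j"] by linarith
      qed
      have z: "(\<lambda>q. K * norm (V q (w j) - w' (N q) j) + norm (V q (w j') - w' (N q) j')) \<longlonglongrightarrow> 0"
        using tendsto_add[OF tendsto_mult_right_zero[OF Vlim[of j], of K] Vlim[of j']] by simp
      have "(\<lambda>q. C q (w j) - \<pi> (x i) (w j)) \<longlonglongrightarrow> 0"
        by (rule Lim_null_comparison[OF _ z]) (use le in simp)
      then show ?thesis by (rule LIM_zero_cancel)
    qed
    have "{\<pi> (ev_alg x (Q k)) (\<xi> l) | k l. True} \<subseteq> {h. (\<lambda>q. C q h) \<longlonglongrightarrow> \<pi> (x i) h}"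
    proof
      fix y assume "y \<in> {\<pi> (ev_alg x (Q k)) (\<xi> l) | k l. True}"
      then obtain k l where "y = \<pi> (ev_alg x (Q k)) (\<xi> l)" by blast
      then have "y = w (prod_encode (k, l))" by (simp add: w_def)
      then show "y \<in> {h. (\<lambda>q. C q h) \<longlonglongrightarrow> \<pi> (x i) h}" using lim_w by simp
    qed
    then have "closed_span {\<pi> (ev_alg x (Q k)) (\<xi> l) | k l. True} \<subseteq> {h. (\<lambda>q. C q h) \<longlonglongrightarrow> \<pi> (x i) h}"
      by (rule closed_span_minimal[OF cl])
    then show ?thesis unfolding \<xi>(2) C_def by blast
  qed
  have "star_strong_conv (\<lambda>q. conj_amp (U q) (A' q i)) (\<pi> (x i))" if i: "i < n" for i
  proof -
    have "cadj (conj_amp (U q) (A' q i)) = conj_amp (U q) (A' q i)" for q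
      by (rule cadj_eqI) (rule ell2_unitary.conj_amp_symmetric[OF U A'(1)[OF i]])
    moreover have "cadj (\<pi> (x i)) = \<pi> (x i)"
      by (rule cadj_eqI) (metis rep_star sa i)
    ultimately show ?thesis using strong[OF i] by (simp add: star_strong_conv_def)
  qed
  then show ?thesis using nc' U by (intro exI[of _ m'] exI[of _ A'] exI[of _ U]) (simp add: ell2_unitary_def)
qed

end

section \<open>Characterizations of MF algebras\<close>

theorem theorem5p2:
  fixes n :: nat and x :: "nat \<Rightarrow> 'a::unital_cstar_algebra"
  assumes sa: "\<forall>i<n. cstar (x i) = x i"
    and gen: "generates n x"
    and H: "hilbert_separable TYPE('h::chilbert)" "infinite_dimensional TYPE('h)"
  shows
    "(MF_algebra TYPE('a) \<longleftrightarrow> approximation_property n x)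
   \<and> (approximation_property n x \<longleftrightarrow>
        (\<exists>m::nat \<Rightarrow> nat. \<exists>A::nat \<Rightarrow> nat \<Rightarrow> complex mat.
           (\<forall>k. 0 < m k) \<and> (\<forall>k. \<forall>i<n. selfadjoint_mat (m k) (A k i)) \<and>
           (\<forall>P\<in>ncpolys n. (\<lambda>k. mnorm (ev_mat (m k) (A k) P)) \<longlonglongrightarrow> norm (ev_alg x P))))
   \<and> (approximation_property n x \<longleftrightarrow>
        (\<forall>\<pi>::'a \<Rightarrow> 'h \<Rightarrow> 'h. faithful_rep \<pi> \<longrightarrow>
           (\<exists>m::nat \<Rightarrow> nat. \<exists>A::nat \<Rightarrow> nat \<Rightarrow> complex mat. \<exists>U::nat \<Rightarrow> 'h \<Rightarrow> (nat \<Rightarrow> complex vec).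
              (\<forall>k. 0 < m k) \<and> (\<forall>k. \<forall>i<n. selfadjoint_mat (m k) (A k i)) \<and>
              (\<forall>k. unitary_to_ell2 (m k) (U k)) \<and>
              (\<forall>P\<in>ncpolys n. (\<lambda>k. mnorm (ev_mat (m k) (A k) P)) \<longlonglongrightarrow> norm (ev_alg x P)) \<and>
              (\<forall>i<n. star_strong_conv (\<lambda>k. conj_amp (U k) (A k i)) (\<pi> (x i))))))"
proof -
  have c12: "approximation_property n x" if mf: "MF_algebra TYPE('a)"
  proof -
    obtain nk and \<phi> :: "'a \<Rightarrow> (nat \<Rightarrow> complex mat) set" where "\<forall>k. 0 < nk k" "unital_inj_star_hom_quot nk \<phi>"
      using mf unfolding MF_algebra_def by blast
    then have "mf_hom nk \<phi>" by (simp add: mf_hom_def)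
    then show ?thesis using sa by (rule mf_hom.approximation)
  qed
  have c23: "\<exists>m A. norm_convergent n x m A" if "approximation_property n x"
    using approximation_property_imp_norm_convergent[OF that] by blast
  have c31: "MF_algebra TYPE('a)" if "norm_convergent n x m A" for m A
    by (rule norm_conv.MF[of n x m A]) (simp add: norm_conv_def sa gen that)
  have c34: "\<exists>m A U. norm_convergent n x m A \<and> (\<forall>k. unitary_to_ell2 (m k) (U k)) \<and>
      (\<forall>i<n. star_strong_conv (\<lambda>k. conj_amp (U k) (A k i)) (\<pi> (x i)))"
    if "norm_convergent n x m A" "faithful_rep \<pi>" for m A and \<pi> :: "'a \<Rightarrow> 'h \<Rightarrow> 'h"
    by (rule norm_conv_rep.star_strong_approximation[of n x m A \<pi>])
       (simp add: norm_conv_rep_def norm_conv_def hilbert_rep_def sa gen H that)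
  \<comment> \<open>Without some faithful representation on \<open>'h\<close> the universally
    quantified condition would hold vacuously and could not imply norm convergence.\<close>
  obtain \<pi>0 :: "'a \<Rightarrow> 'h \<Rightarrow> 'h" where \<pi>0: "faithful_rep \<pi>0"
    using faithful_rep_exists[OF H enum_poly_dense[OF gen]] by blast
  have e1: "MF_algebra TYPE('a) \<longleftrightarrow> approximation_property n x"
    and e2: "approximation_property n x \<longleftrightarrow> (\<exists>m A. norm_convergent n x m A)"
    using c12 c23 c31 by blast+
  have e3: "approximation_property n x \<longleftrightarrow> (\<forall>\<pi>::'a \<Rightarrow> 'h \<Rightarrow> 'h. faithful_rep \<pi> \<longrightarrow>
      (\<exists>m A U. norm_convergent n x m A \<and> (\<forall>k. unitary_to_ell2 (m k) (U k)) \<and>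
        (\<forall>i<n. star_strong_conv (\<lambda>k. conj_amp (U k) (A k i)) (\<pi> (x i)))))" (is "_ \<longleftrightarrow> ?R")
  proof
    assume "approximation_property n x"
    then obtain m A where mA: "norm_convergent n x m A" using e2 by blast
    show ?R by (intro allI impI) (rule c34[OF mA])
  next
    assume ?R
    then have "\<exists>m A. norm_convergent n x m A" using \<pi>0 by blast
    then show "approximation_property n x" using e2 by blast
  qed
  show ?thesis
    using e1 e2 e3 unfolding norm_convergent_def by (simp only: conj_assoc conj_left_commute conj_commute)
qed

end
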